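(* Let $A$ be a noetherian (locally finite) $\mathbb{N}$-graded algebra over a field $k$. Then for every $0\neq X\in\mathbf{D}^-(\mathrm{gr}\,A)$, $$-\mathrm{inf.deg}(X)\leqslant \mathrm{extreg}(X).$$ If, further, $A_0$ is semisimple, then $-\mathrm{inf.deg}(X)=\mathrm{extreg}(X)$ for every $0\neq X\in\mathbf{D}^-(\mathrm{gr}\,A)$.
   Context: $k$ is a field. An $\mathbb{N}$-graded algebra $A=\bigoplus_{i\geqslant 0}A_i$ is always a $k$-algebra that is locally finite: $\dim_k A_i<\infty$ for all $i$. Noetherian means left and right noetherian. Modules are graded left modules. $\mathrm{Gr}\,A$ is the category of graded $A$-modules with degree-zero morphisms, $\mathrm{gr}\,A$ its full subcategory of finitely generated modules; $\mathbf{D}^-$ denotes the derived category of right bounded (bounded above) cochain complexes. For noetherian $A$, $\mathbf{D}^-(\mathrm{gr}\,A)$ is identified with the full subcategory of $\mathbf{D}^-(\mathrm{Gr}\,A)$ of complexes with finitely generated cohomologies. $J$ is the graded Jacobson radical of $A$ and $S=A/J$ (so $S=A_0$ when $A_0$ is semisimple). Shift: $M(j)_m=M_{m+j}$. $\underline{\mathrm{Hom}}_A(M,N)=\bigoplus_j\mathrm{Hom}_{\mathrm{Gr}\,A}(M,N(j))$, with derived functor $R\underline{\mathrm{Hom}}_A$. For a complex $X$ of graded modules (or graded vector spaces), $\mathrm{sup.deg}(X)=\sup\{i+j\mid H^i(X)_j\neq 0,\ i,j\in\mathbb{Z}\}$ and $\mathrm{inf.deg}(X)=\inf\{i+j\mid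 H^i(X)_j\neq 0,\ i,j\in\mathbb{Z}\}$, with values in $\mathbb{Z}\cup\{\pm\infty\}$, $\sup\emptyset=-\infty$, $\inf\emptyset=+\infty$. For $X\in\mathbf{D}^-(\mathrm{Gr}\,A)$, $\mathrm{extreg}(X)=\mathrm{sup.deg}(R\underline{\mathrm{Hom}}_A(X,S))$. *)

theory Defs
  imports "HOL-Library.Extended_Real" "HOL-Algebra.Module" "HOL-Algebra.AbelCoset"
begin

text \<open>The locale \<open>module\<close> of HOL-Algebra requires a commutative base ring.\<close>

locale left_module = R?: ring R + M?: abelian_group M
  for R :: "('r, 'x) ring_scheme" (structure) and M :: "('r, 'm, 'y) module_scheme" (structure) +
  assumes smult_closed: "\<lbrakk>a \<in> carrier R; x \<in> carrier M\<rbrakk> \<Longrightarrow> a \<odot>\<^bsub>M\<^esub> x \<in> carrier M"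
    and smult_l_distr: "\<lbrakk>a \<in> carrier R; b \<in> carrier R; x \<in> carrier M\<rbrakk> \<Longrightarrow>
      (a \<oplus>\<^bsub>R\<^esub> b) \<odot>\<^bsub>M\<^esub> x = a \<odot>\<^bsub>M\<^esub> x \<oplus>\<^bsub>M\<^esub> b \<odot>\<^bsub>M\<^esub> x"
    and smult_r_distr: "\<lbrakk>a \<in> carrier R; x \<in> carrier M; y \<in> carrier M\<rbrakk> \<Longrightarrow>
      a \<odot>\<^bsub>M\<^esub> (x \<oplus>\<^bsub>M\<^esub> y) = a \<odot>\<^bsub>M\<^esub> x \<oplus>\<^bsub>M\<^esub> a \<odot>\<^bsub>M\<^esub> y"
    and smult_assoc: "\<lbrakk>a \<in> carrier R; b \<in> carrier R; x \<in> carrier M\<rbrakk> \<Longrightarrow>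
      (a \<otimes>\<^bsub>R\<^esub> b) \<odot>\<^bsub>M\<^esub> x = a \<odot>\<^bsub>M\<^esub> (b \<odot>\<^bsub>M\<^esub> x)"
    and smult_one: "x \<in> carrier M \<Longrightarrow> \<one>\<^bsub>R\<^esub> \<odot>\<^bsub>M\<^esub> x = x"

definition finitely_generated :: "('r, 'x) ring_scheme \<Rightarrow> ('r, 'm, 'y) module_scheme \<Rightarrow> bool" where
  "finitely_generated R M \<longleftrightarrow>
     (\<exists>F. finite F \<and> F \<subseteq> carrier M \<and>
        (\<forall>x\<in>carrier M. \<exists>c\<in>F \<rightarrow> carrier R. x = (\<Oplus>\<^bsub>M\<^esub>b\<in>F. c b \<odot>\<^bsub>M\<^esub> b)))"

definition regular_module :: "('r, 'x) ring_scheme \<Rightarrow> ('r, 'r) module" where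
  "regular_module R = \<lparr>carrier = carrier R, mult = mult R, one = one R,
     zero = zero R, add = add R, smult = mult R\<rparr>"

definition opposite_ring :: "('r, 'x) ring_scheme \<Rightarrow> ('r, 'x) ring_scheme" where
  "opposite_ring R = R\<lparr>mult := \<lambda>x y. mult R y x\<rparr>"

definition left_noetherian :: "('r, 'x) ring_scheme \<Rightarrow> bool" where
  "left_noetherian R \<longleftrightarrow>
     (\<forall>I. submodule I R (regular_module R) \<longrightarrow>
        finitely_generated R ((regular_module R)\<lparr>carrier := I\<rparr>))"

definition noetherian :: "('r, 'x) ring_scheme \<Rightarrow> bool" where
  "noetherian R \<longleftrightarrow> left_noetherian R \<and> left_noetherian (opposite_ring R)"

definition semisimple_ring :: "('r, 'x) ring_scheme \<Rightarrow> bool" where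
  "semisimple_ring R \<longleftrightarrow>
     (\<forall>I. submodule I R (regular_module R) \<longrightarrow>
        (\<exists>L. submodule L R (regular_module R) \<and>
             I \<inter> L = {\<zero>\<^bsub>R\<^esub>} \<and> I <+>\<^bsub>R\<^esub> L = carrier R))"

text \<open>A graded object is a module together with its homogeneous components.  As for modules in
  HOL-Algebra, the fields \<open>mult\<close> and \<open>one\<close> are irrelevant unless the object is an algebra.\<close>

record ('r, 'm, 'i) graded = "('r, 'm) module" +
  homog :: "'i \<Rightarrow> 'm set"

text \<open>Internal direct sum decomposition: every element is, in a unique way, a sum of a finitely
  supported family of elements of the given subgroups.\<close>

definition internal_direct_sum :: "('m, 'x) ring_scheme \<Rightarrow> ('i \<Rightarrow> 'm set) \<Rightarrow> bool" where
  "internal_direct_sum G D \<longleftrightarrow>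
     (\<forall>i. additive_subgroup (D i) G) \<and>
     (\<forall>x\<in>carrier G. \<exists>!c. (\<forall>i. c i \<in> D i) \<and> finite {i. c i \<noteq> \<zero>\<^bsub>G\<^esub>} \<and>
        x = (\<Oplus>\<^bsub>G\<^esub>i\<in>{i. c i \<noteq> \<zero>\<^bsub>G\<^esub>}. c i))"

locale graded_algebra = K?: field K + A?: ring A + KA?: Module.module K A
  for K :: "('k, 'x) ring_scheme" and A :: "('k, 'a, nat) graded" +
  assumes smult_mult_left: "\<lbrakk>c \<in> carrier K; x \<in> carrier A; y \<in> carrier A\<rbrakk> \<Longrightarrow>
      c \<odot>\<^bsub>A\<^esub> (x \<otimes>\<^bsub>A\<^esub> y) = (c \<odot>\<^bsub>A\<^esub> x) \<otimes>\<^bsub>A\<^esub> y"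
    and smult_mult_right: "\<lbrakk>c \<in> carrier K; x \<in> carrier A; y \<in> carrier A\<rbrakk> \<Longrightarrow>
      c \<odot>\<^bsub>A\<^esub> (x \<otimes>\<^bsub>A\<^esub> y) = x \<otimes>\<^bsub>A\<^esub> (c \<odot>\<^bsub>A\<^esub> y)"
    and homog_submodule: "submodule (homog A i) K A"
    and homog_sum: "internal_direct_sum A (homog A)"
    and homog_one: "\<one>\<^bsub>A\<^esub> \<in> homog A 0"
    and homog_mult: "\<lbrakk>x \<in> homog A i; y \<in> homog A j\<rbrakk> \<Longrightarrow> x \<otimes>\<^bsub>A\<^esub> y \<in> homog A (i + j)"
    and locally_finite: "finitely_generated K (A\<lparr>carrier := homog A i\<rparr>)"

locale noetherian_graded_algebra = graded_algebra +
  assumes noetherian: "noetherian A"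

definition degree_zero_part :: "('k, 'a, nat) graded \<Rightarrow> ('k, 'a, nat) graded" where
  "degree_zero_part A = A\<lparr>carrier := homog A 0\<rparr>"

locale graded_module = left_module A M
  for A :: "('k, 'a, nat) graded" and M :: "('a, 'm, int) graded" +
  assumes homog_sum: "internal_direct_sum M (homog M)"
    and homog_smult: "\<lbrakk>a \<in> homog A i; x \<in> homog M j\<rbrakk> \<Longrightarrow> a \<odot>\<^bsub>M\<^esub> x \<in> homog M (int i + j)"

definition graded_regular :: "('k, 'a, nat) graded \<Rightarrow> ('a, 'a, int) graded" where
  "graded_regular A = \<lparr>carrier = carrier A, mult = mult A, one = one A,
     zero = zero A, add = add A, smult = mult A,
     homog = (\<lambda>j. if 0 \<le> j then homog A (nat j) else {\<zero>\<^bsub>A\<^esub>})\<rparr>"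

definition shift :: "('a, 'm, int) graded \<Rightarrow> int \<Rightarrow> ('a, 'm, int) graded" where
  "shift M j = M\<lparr>homog := \<lambda>m. homog M (m + j)\<rparr>"

definition graded_sub :: "('a, 'm, int) graded \<Rightarrow> 'm set \<Rightarrow> ('a, 'm, int) graded" where
  "graded_sub M N = M\<lparr>carrier := N, homog := \<lambda>j. homog M j \<inter> N\<rparr>"

definition graded_quot :: "('a, 'm, int) graded \<Rightarrow> 'm set \<Rightarrow> ('a, 'm set, int) graded" where
  "graded_quot M N = \<lparr>carrier = a_rcosets\<^bsub>M\<^esub> N, mult = undefined, one = undefined,
     zero = N, add = set_add M,
     smult = (\<lambda>a C. \<Union>x\<in>C. N +>\<^bsub>M\<^esub> (a \<odot>\<^bsub>M\<^esub> x)),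
     homog = (\<lambda>j. (\<lambda>x. N +>\<^bsub>M\<^esub> x) ` homog M j)\<rparr>"

definition graded_submodule :: "('k, 'a, nat) graded \<Rightarrow> ('a, 'm, int) graded \<Rightarrow> 'm set \<Rightarrow> bool" where
  "graded_submodule A M N \<longleftrightarrow>
     submodule N A M \<and> internal_direct_sum (graded_sub M N) (homog (graded_sub M N))"

definition max_graded_left_ideal :: "('k, 'a, nat) graded \<Rightarrow> 'a set \<Rightarrow> bool" where
  "max_graded_left_ideal A I \<longleftrightarrow>
     graded_submodule A (graded_regular A) I \<and> I \<noteq> carrier A \<and>
     (\<forall>L. graded_submodule A (graded_regular A) L \<and> I \<subseteq> L \<longrightarrow> L = I \<or> L = carrier A)"

definition graded_jacobson_radical :: "('k, 'a, nat) graded \<Rightarrow> 'a set" where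
  "graded_jacobson_radical A = carrier A \<inter> \<Inter>{I. max_graded_left_ideal A I}"

definition graded_top :: "('k, 'a, nat) graded \<Rightarrow> ('a, 'a set, int) graded" where
  "graded_top A = graded_quot (graded_regular A) (graded_jacobson_radical A)"

text \<open>Morphisms of the category of graded modules.  Values outside the carrier are irrelevant.\<close>

definition gr_hom ::
  "('k, 'a, nat) graded \<Rightarrow> ('a, 'm, int) graded \<Rightarrow> ('a, 'n, int) graded \<Rightarrow> ('m \<Rightarrow> 'n) set" where
  "gr_hom A M N = {f \<in> carrier M \<rightarrow> carrier N.
     (\<forall>x\<in>carrier M. \<forall>y\<in>carrier M. f (x \<oplus>\<^bsub>M\<^esub> y) = f x \<oplus>\<^bsub>N\<^esub> f y) \<and>
     (\<forall>a\<in>carrier A. \<forall>x\<in>carrier M. f (a \<odot>\<^bsub>M\<^esub> x) = a \<odot>\<^bsub>N\<^esub> f x) \<and>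
     (\<forall>j. \<forall>x\<in>homog M j. f x \<in> homog N j)}"

text \<open>The graded vector space \<open>\<Oplus>\<^sub>j Hom(M, N(j))\<close> over \<open>K\<close>, realised inside the functions from
  \<open>carrier M\<close> to \<open>carrier N\<close>; they are made extensional so that they are determined by their values
  on \<open>carrier M\<close>.\<close>

definition graded_Hom ::
  "('k, 'a, nat) graded \<Rightarrow> ('a, 'm, int) graded \<Rightarrow> ('a, 'n, int) graded \<Rightarrow> ('k, 'm \<Rightarrow> 'n, int) graded"
  where
  "graded_Hom A M N = \<lparr>
     carrier = {(\<lambda>x\<in>carrier M. \<Oplus>\<^bsub>N\<^esub>j\<in>F. g j x) | F g. finite F \<and> (\<forall>j\<in>F. g j \<in> gr_hom A M (shift N j))},
     mult = undefined, one = undefined,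
     zero = (\<lambda>x\<in>carrier M. \<zero>\<^bsub>N\<^esub>),
     add = (\<lambda>f g. \<lambda>x\<in>carrier M. f x \<oplus>\<^bsub>N\<^esub> g x),
     smult = (\<lambda>c f. \<lambda>x\<in>carrier M. (c \<odot>\<^bsub>A\<^esub> \<one>\<^bsub>A\<^esub>) \<odot>\<^bsub>N\<^esub> f x),
     homog = (\<lambda>j. gr_hom A M (shift N j) \<inter> extensional (carrier M))\<rparr>"

definition graded_free :: "('k, 'a, nat) graded \<Rightarrow> ('a, 'm, int) graded \<Rightarrow> bool" where
  "graded_free A P \<longleftrightarrow> graded_module A P \<and>
     (\<exists>B. B \<subseteq> (\<Union>j. homog P j) \<and>
        (\<forall>x\<in>carrier P. \<exists>!c. (\<forall>b\<in>B. c b \<in> carrier A) \<and> (\<forall>b. b \<notin> B \<longrightarrow> c b = \<zero>\<^bsub>A\<^esub>) \<and>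
           finite {b. c b \<noteq> \<zero>\<^bsub>A\<^esub>} \<and>
           x = (\<Oplus>\<^bsub>P\<^esub>b\<in>{b. c b \<noteq> \<zero>\<^bsub>A\<^esub>}. c b \<odot>\<^bsub>P\<^esub> b)))"

text \<open>The terms of a complex live in a common type but are otherwise unrelated, each having its
  own carrier and operations.  The same record is used for complexes of graded vector spaces.\<close>

record ('a, 'm) cochain =
  obj :: "int \<Rightarrow> ('a, 'm, int) graded"
  diff :: "int \<Rightarrow> 'm \<Rightarrow> 'm"

definition cochain_complex :: "('k, 'a, nat) graded \<Rightarrow> ('a, 'm) cochain \<Rightarrow> bool" where
  "cochain_complex A X \<longleftrightarrow>
     (\<forall>i. graded_module A (obj X i)) \<and>
     (\<forall>i. diff X i \<in> gr_hom A (obj X i) (obj X (i + 1))) \<and>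
     (\<forall>i. \<forall>x\<in>carrier (obj X i). diff X (i + 1) (diff X i x) = \<zero>\<^bsub>obj X (i + 2)\<^esub>)"

definition right_bounded :: "('a, 'm) cochain \<Rightarrow> bool" where
  "right_bounded X \<longleftrightarrow> (\<exists>n. \<forall>i>n. carrier (obj X i) = {\<zero>\<^bsub>obj X i\<^esub>})"

definition cocycles :: "('a, 'm) cochain \<Rightarrow> int \<Rightarrow> 'm set" where
  "cocycles X i = {x \<in> carrier (obj X i). diff X i x = \<zero>\<^bsub>obj X (i + 1)\<^esub>}"

definition coboundaries :: "('a, 'm) cochain \<Rightarrow> int \<Rightarrow> 'm set" where
  "coboundaries X i = diff X (i - 1) ` carrier (obj X (i - 1))"

definition cohomology :: "('a, 'm) cochain \<Rightarrow> int \<Rightarrow> ('a, 'm set, int) graded" where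
  "cohomology X i = graded_quot (graded_sub (obj X i) (cocycles X i)) (coboundaries X i)"

definition sup_deg :: "('a, 'm) cochain \<Rightarrow> ereal" where
  "sup_deg X = Sup {ereal (of_int (i + j)) | i j.
     homog (cohomology X i) j \<noteq> {\<zero>\<^bsub>cohomology X i\<^esub>}}"

definition inf_deg :: "('a, 'm) cochain \<Rightarrow> ereal" where
  "inf_deg X = Inf {ereal (of_int (i + j)) | i j.
     homog (cohomology X i) j \<noteq> {\<zero>\<^bsub>cohomology X i\<^esub>}}"

definition cochain_map ::
  "('k, 'a, nat) graded \<Rightarrow> ('a, 'm) cochain \<Rightarrow> ('a, 'n) cochain \<Rightarrow> (int \<Rightarrow> 'm \<Rightarrow> 'n) \<Rightarrow> bool" where
  "cochain_map A X Y f \<longleftrightarrow>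
     (\<forall>i. f i \<in> gr_hom A (obj X i) (obj Y i)) \<and>
     (\<forall>i. \<forall>x\<in>carrier (obj X i). f (i + 1) (diff X i x) = diff Y i (f i x))"

definition cohomology_map ::
  "('a, 'm) cochain \<Rightarrow> ('a, 'n) cochain \<Rightarrow> (int \<Rightarrow> 'm \<Rightarrow> 'n) \<Rightarrow> int \<Rightarrow> 'm set \<Rightarrow> 'n set" where
  "cohomology_map X Y f i C = (\<Union>x\<in>C. coboundaries Y i +>\<^bsub>obj Y i\<^esub> f i x)"

definition quasi_iso ::
  "('k, 'a, nat) graded \<Rightarrow> ('a, 'm) cochain \<Rightarrow> ('a, 'n) cochain \<Rightarrow> (int \<Rightarrow> 'm \<Rightarrow> 'n) \<Rightarrow> bool" where
  "quasi_iso A X Y f \<longleftrightarrow> cochain_map A X Y f \<and>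
     (\<forall>i. bij_betw (cohomology_map X Y f i) (carrier (cohomology X i)) (carrier (cohomology Y i)))"

definition Dminus_Gr :: "('k, 'a, nat) graded \<Rightarrow> ('a, 'm) cochain set" where
  "Dminus_Gr A = {X. cochain_complex A X \<and> right_bounded X}"

text \<open>For noetherian \<open>A\<close>, the bounded above derived category of finitely generated graded modules
  is identified with the full subcategory of complexes with finitely generated cohomologies.\<close>

definition Dminus_gr :: "('k, 'a, nat) graded \<Rightarrow> ('a, 'm) cochain set" where
  "Dminus_gr A = {X \<in> Dminus_Gr A. \<forall>i. finitely_generated A (cohomology X i)}"

text \<open>
  The type \<open>('a \<times> 'm) list\<close> is infinite and at least as large as \<open>'a\<close> and \<open>'m\<close>, hence every object
  of \<open>Dminus_Gr A\<close> with elements in \<open>'m\<close> has a right bounded resolution by graded free modules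
  whose elements lie in this type.  Consequently it is no restriction to require
  that the middle term of the roof below, and the resolution in the definition of \<open>RHom\<close>, live there.

  Two objects are isomorphic in the derived category iff they are linked by a roof of
  quasi-isomorphisms.
\<close>

definition D_iso :: "('k, 'a, nat) graded \<Rightarrow> ('a, 'm) cochain \<Rightarrow> ('a, 'n) cochain \<Rightarrow> bool" where
  "D_iso A X Y \<longleftrightarrow>
     (\<exists>(Z :: ('a, ('a \<times> 'm) list) cochain) s t. Z \<in> Dminus_Gr A \<and> quasi_iso A Z X s \<and> quasi_iso A Z Y t)"

definition zero_complex :: "('a, unit) cochain" where
  "zero_complex = \<lparr>obj = (\<lambda>i. \<lparr>carrier = UNIV, mult = (\<lambda>x y. ()), one = (), zero = (),
     add = (\<lambda>x y. ()), smult = (\<lambda>a x. ()), homog = (\<lambda>j. UNIV)\<rparr>), diff = (\<lambda>i x. ())\<rparr>"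

definition free_resolution ::
  "('k, 'a, nat) graded \<Rightarrow> ('a, 'm) cochain \<Rightarrow> ('a, 'p) cochain \<Rightarrow> bool" where
  "free_resolution A X P \<longleftrightarrow>
     P \<in> Dminus_Gr A \<and> (\<forall>i. graded_free A (obj P i)) \<and> (\<exists>q. quasi_iso A P X q)"

definition chosen_resolution ::
  "('k, 'a, nat) graded \<Rightarrow> ('a, 'm) cochain \<Rightarrow> ('a, ('a \<times> 'm) list) cochain" where
  "chosen_resolution A X = (SOME P. free_resolution A X P)"

text \<open>The complex of graded homomorphisms from a complex \<open>P\<close> to a graded module \<open>N\<close>, the latter
  placed in cohomological degree 0; the differential is \<open>f \<mapsto> d\<^sub>N \<circ> f - (-1)\<^sup>n f \<circ> d\<^sub>P\<close> for \<open>f\<close> of degree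
  \<open>n\<close>, where here \<open>d\<^sub>N = 0\<close>.\<close>

definition Hom_complex ::
  "('k, 'a, nat) graded \<Rightarrow> ('a, 'p) cochain \<Rightarrow> ('a, 'n, int) graded \<Rightarrow> ('k, 'p \<Rightarrow> 'n) cochain" where
  "Hom_complex A P N = \<lparr>
     obj = (\<lambda>n. graded_Hom A (obj P (- n)) N),
     diff = (\<lambda>n f. \<lambda>x\<in>carrier (obj P (- (n + 1))).
       let y = f (diff P (- (n + 1)) x) in if even n then \<ominus>\<^bsub>N\<^esub> y else y)\<rparr>"

text \<open>The derived functor is computed by a chosen resolution; up to quasi-isomorphism the
  result does not depend on the choice.\<close>

definition RHom ::
  "('k, 'a, nat) graded \<Rightarrow> ('a, 'm) cochain \<Rightarrow> ('a, 'n, int) graded \<Rightarrow>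
   ('k, ('a \<times> 'm) list \<Rightarrow> 'n) cochain" where
  "RHom A X N = Hom_complex A (chosen_resolution A X) N"

definition extreg :: "('k, 'a, nat) graded \<Rightarrow> ('a, 'm) cochain \<Rightarrow> ereal" where
  "extreg A X = sup_deg (RHom A X (graded_top A))"

end

theory Submission
  imports Defs "HOL-Library.Nat_Bijection"
begin

text \<open>Let \<open>P\<close> be a bounded above free resolution of \<open>X\<close>, let \<open>J\<close> be the graded Jacobson radical, which
  consists of the elements whose degree zero component lies in the nilpotent ideal \<open>J\<^sub>0\<close> of \<open>A\<^sub>0\<close>, and let
  \<open>S = A/J\<close>.  Maps from \<open>P\<close> to \<open>S\<close> factor through \<open>P/JP\<close>, and \<open>A\<^sub>0/J\<^sub>0\<close> is semisimple; hence the cohomology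
  of \<open>Hom(P, S)\<close> in bidegree \<open>(-i, -j)\<close> vanishes iff that of \<open>P/JP\<close> vanishes in bidegree \<open>(i, j)\<close>.

  Suppose that this holds whenever \<open>i + j < D\<close>.  In this range a homotopy \<open>s\<close>, built by descending
  induction on \<open>i\<close>, makes \<open>1 - ds - sd\<close> map the generators of highest degree into \<open>JP\<close>.  As \<open>J\<^sub>0\<close> is nilpotent,
  its iterates move a cocycle into the part of \<open>P\<close> generated in lower degrees, and finitely many such
  steps suffice because the cohomology of \<open>X\<close>, being finitely generated, vanishes in low degrees.  So
  \<open>H\<^sup>i(X)\<^sub>j = 0\<close> for \<open>i + j < D\<close>, which is the inequality.

  If \<open>A\<^sub>0\<close> is semisimple, the argument runs with \<open>J\<^sub>0 = 0\<close>, where \<open>JP\<close> in degree \<open>j\<close> is just the part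
  generated in degrees below \<open>j\<close>, and it can be reversed: acyclicity of \<open>P\<close> in the range \<open>i + j < D\<close>
  gives that of \<open>P/JP\<close> by descending induction on \<open>i\<close>.\<close>

text \<open>The resolution is an arbitrary free one. It need not be minimal, a term may have
  infinitely many generators, and their degrees may be unbounded below. So neither a minimal
  resolution nor the graded Nakayama lemma is at hand: homotopies take the place of splitting off a
  contractible summand, and the vanishing of the cohomology in low degrees takes the place of a
  lowest generator as the start of the induction on degrees. The region i + j < D is a staircase:
  the bound D - 1 - i for j drops by one when i grows by one. The boundary of an element of highest
  admissible degree in P^(i-1) therefore lies one degree above the range in which the homotopy at i
  is controlled. This is why an \<open>almost_contraction\<close> carries a separate condition on
  boundaries, and why \<open>boundary_splitting\<close>, the point where semisimplicity modulo the
  radical enters, is needed. The degree zero part of the radical is a parameter \<open>J0\<close>.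
  It is \<open>rad0\<close> for the inequality and zero for its converse; in the latter case the
  link with S is the inclusion of zero in \<open>rad0\<close>.\<close>

section \<open>Finite sums and subgroups in abelian groups\<close>

lemma (in abelian_monoid) finsum_in_subset:
  assumes "H \<subseteq> carrier G" "\<zero> \<in> H" "\<And>x y. x \<in> H \<Longrightarrow> y \<in> H \<Longrightarrow> x \<oplus> y \<in> H" "\<And>i. i \<in> F \<Longrightarrow> f i \<in> H"
  shows "finsum G f F \<in> H"
  using assms(4)
proof (induction F rule: infinite_finite_induct)
  case (insert i F)
  then have "f \<in> F \<rightarrow> carrier G" "f i \<in> carrier G" using assms(1) by auto
  then show ?case using insert assms(3) by simp
qed (auto simp: assms(2))

lemma finsum_additive_map:
  assumes "abelian_monoid M" "abelian_monoid N" "f \<in> carrier M \<rightarrow> carrier N" "f \<zero>\<^bsub>M\<^esub> = \<zero>\<^bsub>N\<^esub>"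
    "\<And>x y. x \<in> carrier M \<Longrightarrow> y \<in> carrier M \<Longrightarrow> f (x \<oplus>\<^bsub>M\<^esub> y) = f x \<oplus>\<^bsub>N\<^esub> f y"
    "g \<in> F \<rightarrow> carrier M"
  shows "f (finsum M g F) = finsum N (\<lambda>i. f (g i)) F"
proof -
  interpret M: abelian_monoid M by fact
  interpret N: abelian_monoid N by fact
  show ?thesis using assms(6)
  proof (induction F rule: infinite_finite_induct)
    case (insert i F)
    then have "g \<in> F \<rightarrow> carrier M" "g i \<in> carrier M" by auto
    moreover from this have "(\<lambda>i. f (g i)) \<in> F \<rightarrow> carrier N" "f (g i) \<in> carrier N" using assms(3) by auto
    ultimately show ?case using insert assms(5) by (simp add: M.finsum_closed)
  qed (auto simp: assms(4))
qed

lemma (in abelian_monoid) finsum_supp: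
  assumes "finite F" "{i. f i \<noteq> \<zero>} \<subseteq> F" "\<And>i. f i \<in> carrier G"
  shows "finsum G f {i. f i \<noteq> \<zero>} = finsum G f F"
  by (rule add.finprod_mono_neutral_cong_left) (use assms in auto)

lemma additive_subgroup_iff:
  assumes "abelian_group G"
  shows "additive_subgroup H G \<longleftrightarrow> H \<subseteq> carrier G \<and> \<zero>\<^bsub>G\<^esub> \<in> H \<and>
    (\<forall>x\<in>H. \<forall>y\<in>H. x \<oplus>\<^bsub>G\<^esub> y \<in> H) \<and> (\<forall>x\<in>H. \<ominus>\<^bsub>G\<^esub> x \<in> H)"
  by (auto simp: additive_subgroup_def subgroup_def a_inv_def)

subsection \<open>Components in internal direct sums\<close>

definition components :: "('m, 'x) ring_scheme \<Rightarrow> ('i \<Rightarrow> 'm set) \<Rightarrow> 'm \<Rightarrow> 'i \<Rightarrow> 'm" where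
  "components G D x = (THE c. (\<forall>i. c i \<in> D i) \<and> finite {i. c i \<noteq> \<zero>\<^bsub>G\<^esub>} \<and>
     x = (\<Oplus>\<^bsub>G\<^esub>i\<in>{i. c i \<noteq> \<zero>\<^bsub>G\<^esub>}. c i))"

locale direct_sum = abelian_group G for G (structure) +
  fixes D :: "'i \<Rightarrow> 'a set"
  assumes direct_sum: "internal_direct_sum G D"
begin

lemma D_sub: "additive_subgroup (D i) G"
  using direct_sum by (simp add: internal_direct_sum_def)

lemma D_carrier: "x \<in> D i \<Longrightarrow> x \<in> carrier G"
  using additive_subgroup.a_subset[OF D_sub] by auto
lemma D_zero: "\<zero> \<in> D i"
  using additive_subgroup.zero_closed[OF D_sub] by auto
lemma D_add: "x \<in> D i \<Longrightarrow> y \<in> D i \<Longrightarrow> x \<oplus> y \<in> D i"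
  using additive_subgroup.a_closed[OF D_sub] by auto
lemma D_neg: "x \<in> D i \<Longrightarrow> \<ominus> x \<in> D i"
  using D_sub[of i] additive_subgroup_iff[OF abelian_group_axioms] by auto

lemma components_spec:
  assumes "x \<in> carrier G"
  shows "components G D x i \<in> D i" "finite {i. components G D x i \<noteq> \<zero>}"
    "x = (\<Oplus>i\<in>{i. components G D x i \<noteq> \<zero>}. components G D x i)"
proof -
  have "\<exists>!c. (\<forall>i. c i \<in> D i) \<and> finite {i. c i \<noteq> \<zero>} \<and> x = (\<Oplus>i\<in>{i. c i \<noteq> \<zero>}. c i)"
    using direct_sum assms by (auto simp: internal_direct_sum_def)
  from theI'[OF this] show "components G D x i \<in> D i" "finite {i. components G D x i \<noteq> \<zero>}"
    "x = (\<Oplus>i\<in>{i. components G D x i \<noteq> \<zero>}. components G D x i)"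
    unfolding components_def by auto
qed

lemma components_closed [simp]: "x \<in> carrier G \<Longrightarrow> components G D x i \<in> carrier G"
  using components_spec(1) D_carrier by blast

lemma components_sum:
  assumes "x \<in> carrier G" "finite F" "{i. components G D x i \<noteq> \<zero>} \<subseteq> F"
  shows "(\<Oplus>i\<in>F. components G D x i) = x"
  using components_spec(3)[OF assms(1)] finsum_supp[OF assms(2,3)] assms(1) by simp

text \<open>\<open>F\<close> may be larger than the support of \<open>c\<close>, so components can
  be read off from a sum over any convenient finite set.\<close>

lemma components_unique:
  assumes "finite F" "\<And>i. i \<in> F \<Longrightarrow> c i \<in> D i" "x = finsum G c F"
  shows "components G D x i = (if i \<in> F then c i else \<zero>)"
proof -
  let ?c = "\<lambda>i. if i \<in> F then c i else \<zero>"
  have c: "?c i \<in> D i" for i using assms D_zero by auto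
  have F: "{i. ?c i \<noteq> \<zero>} \<subseteq> F" by auto
  have "c \<in> F \<rightarrow> carrier G" using assms D_carrier by auto
  then have 1: "x = finsum G ?c F" "x \<in> carrier G" using assms by (auto intro!: finsum_cong)
  have 2: "x = finsum G ?c {i. ?c i \<noteq> \<zero>}"
    using 1(1) finsum_supp[OF assms(1) F] c D_carrier by metis
  have ex1: "\<exists>!c. (\<forall>i. c i \<in> D i) \<and> finite {i. c i \<noteq> \<zero>} \<and> x = (\<Oplus>i\<in>{i. c i \<noteq> \<zero>}. c i)"
    using direct_sum 1 by (auto simp: internal_direct_sum_def)
  have "components G D x = ?c" unfolding components_def
    by (rule the1_equality[OF ex1]) (use c 2 F assms(1) finite_subset in blast)
  then show ?thesis by simp
qed

lemma components_zero [simp]: "components G D \<zero> i = \<zero>"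
  using components_unique[of "{}" "\<lambda>_. \<zero>" \<zero> i] by simp

lemma components_same: "x \<in> D j \<Longrightarrow> components G D x i = (if i = j then x else \<zero>)"
  using components_unique[of "{j}" "\<lambda>_. x" x i] by (simp add: D_carrier)

lemma components_add:
  assumes "x \<in> carrier G" "y \<in> carrier G"
  shows "components G D (x \<oplus> y) i = components G D x i \<oplus> components G D y i"
proof -
  let ?F = "{i. components G D x i \<noteq> \<zero>} \<union> {i. components G D y i \<noteq> \<zero>}"
  have F: "finite ?F" using assms components_spec by auto
  have "x \<oplus> y = (\<Oplus>i\<in>?F. components G D x i) \<oplus> (\<Oplus>i\<in>?F. components G D y i)"
    using components_sum[OF assms(1) F] components_sum[OF assms(2) F] by auto
  also have "\<dots> = (\<Oplus>i\<in>?F. components G D x i \<oplus> components G D y i)"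
    by (rule finsum_addf[symmetric]) (use assms in auto)
  finally have "components G D (x \<oplus> y) i = (if i \<in> ?F then components G D x i \<oplus> components G D y i else \<zero>)"
    by (intro components_unique[OF F]) (use assms components_spec D_add in auto)
  then show ?thesis using assms by auto
qed

lemma components_neg:
  assumes "x \<in> carrier G"
  shows "components G D (\<ominus> x) i = \<ominus> components G D x i"
proof -
  have "components G D (\<ominus> x) i \<oplus> components G D x i = \<zero>"
    using components_add[of "\<ominus> x" x i] assms by (simp add: l_neg)
  then show ?thesis using assms by (simp add: minus_equality)
qed

lemma direct_sum_induct:
  assumes "x \<in> carrier G" "\<And>i x. x \<in> D i \<Longrightarrow> Q x" "\<And>x y. x \<in> carrier G \<Longrightarrow> y \<in> carrier G \<Longrightarrow> Q x \<Longrightarrow> Q y \<Longrightarrow> Q (x \<oplus> y)"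
  shows "Q x"
proof -
  have "(\<Oplus>i\<in>{i. components G D x i \<noteq> \<zero>}. components G D x i) \<in> {x\<in>carrier G. Q x}"
    by (rule finsum_in_subset) (use assms(1,3) assms(2)[OF D_zero] assms(2)[OF components_spec(1)[OF assms(1)]] in auto)
  then show ?thesis using components_spec(3)[OF assms(1)] by simp
qed

end

text \<open>Uniqueness is the point: applying the additive projection \<open>p i\<close> to a
  decomposition of x leaves only its entry at i. In this form a grading is obtained from a formula
  for the components; the criterion serves homogeneous submodules, the regular module and the free
  modules constructed later.\<close>

lemma direct_sumI:
  fixes G (structure)
  assumes "abelian_group G" "\<And>i. additive_subgroup (D i) G"
    and closed: "\<And>i x. x \<in> carrier G \<Longrightarrow> p i x \<in> D i"
    and fin: "\<And>x. x \<in> carrier G \<Longrightarrow> finite {i. p i x \<noteq> \<zero>}"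
    and sum: "\<And>x. x \<in> carrier G \<Longrightarrow> x = (\<Oplus>i\<in>{i. p i x \<noteq> \<zero>}. p i x)"
    and add: "\<And>i x y. x \<in> carrier G \<Longrightarrow> y \<in> carrier G \<Longrightarrow> p i (x \<oplus> y) = p i x \<oplus> p i y"
    and same: "\<And>i j x. x \<in> D j \<Longrightarrow> p i x = (if i = j then x else \<zero>)"
  shows "direct_sum G D" "x \<in> carrier G \<Longrightarrow> components G D x i = p i x"
proof -
  interpret abelian_group G by fact
  have DC: "x \<in> D i \<Longrightarrow> x \<in> carrier G" for x i
    using additive_subgroup.a_subset[OF assms(2)] by auto
  have uniq: "c = (\<lambda>i. p i x)"
    if c: "\<forall>i. c i \<in> D i" "finite {i. c i \<noteq> \<zero>}" "x = (\<Oplus>i\<in>{i. c i \<noteq> \<zero>}. c i)" for x c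
  proof
    fix i
    let ?F = "{i. c i \<noteq> \<zero>}"
    have cc: "c i \<in> carrier G" for i using c(1) DC by blast
    have "p i x = (\<Oplus>j\<in>?F. p i (c j))" unfolding c(3)
    proof (rule finsum_additive_map)
      show "p i \<in> carrier G \<rightarrow> carrier G" using closed DC by auto
      show "p i \<zero> = \<zero>" using same[of \<zero> i i] additive_subgroup.zero_closed[OF assms(2)] by auto
      show "c \<in> {j. c j \<noteq> \<zero>} \<rightarrow> carrier G" using c DC by auto
    qed (use add in auto, unfold_locales)
    also have "\<dots> = (\<Oplus>j\<in>?F. if i = j then c j else \<zero>)"
      by (intro finsum_cong') (use cc c(1) same in auto)
    also have "\<dots> = c i"
    proof (cases "i \<in> ?F")
      case True
      then show ?thesis using finsum_singleton[of i ?F c] c(2) cc by auto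
    next
      case False
      have "(\<Oplus>j\<in>?F. if i = j then c j else \<zero>) = (\<Oplus>j\<in>?F. \<zero>)"
        by (intro finsum_cong') (use False in auto)
      then show ?thesis using False by simp
    qed
    finally show "c i = p i x" by simp
  qed
  show D: "direct_sum G D"
  proof
    show "internal_direct_sum G D" unfolding internal_direct_sum_def
    proof (intro conjI allI ballI assms(2))
      fix x assume x: "x \<in> carrier G"
      show "\<exists>!c. (\<forall>i. c i \<in> D i) \<and> finite {i. c i \<noteq> \<zero>} \<and> x = (\<Oplus>i\<in>{i. c i \<noteq> \<zero>}. c i)"
      proof (rule ex1I[of _ "\<lambda>i. p i x"])
        show "(\<forall>i. p i x \<in> D i) \<and> finite {i. p i x \<noteq> \<zero>} \<and> x = (\<Oplus>i\<in>{i. p i x \<noteq> \<zero>}. p i x)"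
          using closed fin sum x by metis
      qed (use uniq in blast)
    qed
  qed
  show "components G D x i = p i x" if "x \<in> carrier G"
    using uniq[of "components G D x" x] direct_sum.components_spec[OF D that] by metis
qed

text \<open>By additivity it suffices to look at homogeneous elements. The reindexing
  \<open>h\<close> is the identity for morphisms of degree zero, and a translation for
  multiplication by a homogeneous scalar or for evaluation of scalars at a homogeneous
  element.\<close>

lemma components_hom:
  assumes "direct_sum G D" "direct_sum H E" "f \<in> carrier G \<rightarrow> carrier H"
    "\<And>x y. x \<in> carrier G \<Longrightarrow> y \<in> carrier G \<Longrightarrow> f (x \<oplus>\<^bsub>G\<^esub> y) = f x \<oplus>\<^bsub>H\<^esub> f y"
    "\<And>i x. x \<in> D i \<Longrightarrow> f x \<in> E (h i)" "inj h" "x \<in> carrier G"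
  shows "components H E (f x) (h i) = f (components G D x i)"
  using assms(7)
proof (rule direct_sum.direct_sum_induct[OF assms(1)])
  interpret G: direct_sum G D by fact
  interpret H: direct_sum H E by fact
  have f0: "f \<zero>\<^bsub>G\<^esub> = \<zero>\<^bsub>H\<^esub>"
    using assms(4)[of "\<zero>\<^bsub>G\<^esub>" "\<zero>\<^bsub>G\<^esub>"] assms(3) H.add.l_cancel_one'[of "f \<zero>\<^bsub>G\<^esub>" "f \<zero>\<^bsub>G\<^esub>"] by (auto simp: Pi_iff)
  show "components H E (f x) (h i) = f (components G D x i)" if "x \<in> D j" for x j
    using that G.components_same[OF that] H.components_same[OF assms(5)[OF that]] assms(6) f0 by (auto simp: inj_def)
  show "components H E (f (x \<oplus>\<^bsub>G\<^esub> y)) (h i) = f (components G D (x \<oplus>\<^bsub>G\<^esub> y) i)"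
    if "x \<in> carrier G" "y \<in> carrier G" "components H E (f x) (h i) = f (components G D x i)"
      "components H E (f y) (h i) = f (components G D y i)" for x y
    using that assms(3,4) G.components_add H.components_add by (simp add: Pi_iff)
qed

subsection \<open>Modules and linear maps\<close>

context left_module
begin

lemma smult_l_null: "x \<in> carrier M \<Longrightarrow> \<zero>\<^bsub>R\<^esub> \<odot>\<^bsub>M\<^esub> x = \<zero>\<^bsub>M\<^esub>"
  using smult_l_distr[of "\<zero>\<^bsub>R\<^esub>" "\<zero>\<^bsub>R\<^esub>" x] smult_closed[of "\<zero>\<^bsub>R\<^esub>" x]
  by (simp add: M.add.r_cancel_one')

lemma smult_r_null: "a \<in> carrier R \<Longrightarrow> a \<odot>\<^bsub>M\<^esub> \<zero>\<^bsub>M\<^esub> = \<zero>\<^bsub>M\<^esub>"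
  using smult_r_distr[of a "\<zero>\<^bsub>M\<^esub>" "\<zero>\<^bsub>M\<^esub>"] smult_closed[of a "\<zero>\<^bsub>M\<^esub>"]
  by (simp add: M.add.r_cancel_one')

lemma smult_r_minus: "a \<in> carrier R \<Longrightarrow> x \<in> carrier M \<Longrightarrow> a \<odot>\<^bsub>M\<^esub> (\<ominus>\<^bsub>M\<^esub> x) = \<ominus>\<^bsub>M\<^esub> (a \<odot>\<^bsub>M\<^esub> x)"
  using smult_r_distr[of a "\<ominus>\<^bsub>M\<^esub> x" x] smult_closed
  by (simp add: M.l_neg smult_r_null M.minus_equality)

lemma smult_l_minus: "a \<in> carrier R \<Longrightarrow> x \<in> carrier M \<Longrightarrow> (\<ominus>\<^bsub>R\<^esub> a) \<odot>\<^bsub>M\<^esub> x = \<ominus>\<^bsub>M\<^esub> (a \<odot>\<^bsub>M\<^esub> x)"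
  using smult_l_distr[of "\<ominus>\<^bsub>R\<^esub> a" a x] smult_closed
  by (simp add: R.l_neg smult_l_null M.minus_equality)

lemma smult_finsum:
  "a \<in> carrier R \<Longrightarrow> f \<in> F \<rightarrow> carrier M \<Longrightarrow> a \<odot>\<^bsub>M\<^esub> finsum M f F = (\<Oplus>\<^bsub>M\<^esub>i\<in>F. a \<odot>\<^bsub>M\<^esub> f i)"
  by (rule finsum_additive_map[where f="\<lambda>x. a \<odot>\<^bsub>M\<^esub> x"])
     (auto simp: smult_closed smult_r_null smult_r_distr M.abelian_monoid_axioms)

text \<open>Closure under negation is multiplication by -1 and so is absorbed in the last
  condition.\<close>

lemma submodule_iff:
  "submodule N R M \<longleftrightarrow> N \<subseteq> carrier M \<and> \<zero>\<^bsub>M\<^esub> \<in> N \<and> (\<forall>x\<in>N. \<forall>y\<in>N. x \<oplus>\<^bsub>M\<^esub> y \<in> N) \<and>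
     (\<forall>a\<in>carrier R. \<forall>x\<in>N. a \<odot>\<^bsub>M\<^esub> x \<in> N)"
proof -
  have "\<ominus>\<^bsub>M\<^esub> x \<in> N" if "N \<subseteq> carrier M" "\<forall>a\<in>carrier R. \<forall>x\<in>N. a \<odot>\<^bsub>M\<^esub> x \<in> N" "x \<in> N" for x
    using that smult_l_minus[of "\<one>\<^bsub>R\<^esub>" x] smult_one[of x] by (metis R.add.inv_closed R.one_closed subsetD)
  then show ?thesis
    by (auto simp: submodule_def subgroup_def submodule_axioms_def a_inv_def subset_iff)
qed

lemma submodule_neg: "submodule N R M \<Longrightarrow> x \<in> N \<Longrightarrow> \<ominus>\<^bsub>M\<^esub> x \<in> N"
  using smult_l_minus[of "\<one>\<^bsub>R\<^esub>" x] smult_one[of x] unfolding submodule_iff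
  by (metis R.add.inv_closed R.one_closed subsetD)

lemma submodule_additive: "submodule N R M \<Longrightarrow> additive_subgroup N M"
  using submodule.axioms(1) additive_subgroup.intro by blast

lemma submodule_finsum: "submodule N R M \<Longrightarrow> (\<And>i. i \<in> F \<Longrightarrow> f i \<in> N) \<Longrightarrow> finsum M f F \<in> N"
  by (rule M.finsum_in_subset) (auto simp: submodule_iff)

lemma submodule_minus: "submodule N R M \<Longrightarrow> x \<in> N \<Longrightarrow> y \<in> N \<Longrightarrow> x \<ominus>\<^bsub>M\<^esub> y \<in> N"
  using submodule_neg[of N y] by (auto simp: a_minus_def submodule_iff)

end

definition lin_maps :: "('r, 'x) ring_scheme \<Rightarrow> ('r, 'm, 'y) module_scheme \<Rightarrow> ('r, 'n, 'z) module_scheme \<Rightarrow> ('m \<Rightarrow> 'n) set" where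
  "lin_maps R M N = {f \<in> carrier M \<rightarrow> carrier N.
     (\<forall>x\<in>carrier M. \<forall>y\<in>carrier M. f (x \<oplus>\<^bsub>M\<^esub> y) = f x \<oplus>\<^bsub>N\<^esub> f y) \<and>
     (\<forall>a\<in>carrier R. \<forall>x\<in>carrier M. f (a \<odot>\<^bsub>M\<^esub> x) = a \<odot>\<^bsub>N\<^esub> f x)}"

lemma gr_hom_iff: "f \<in> gr_hom A M N \<longleftrightarrow> f \<in> lin_maps A M N \<and> (\<forall>j. \<forall>x\<in>homog M j. f x \<in> homog N j)"
  by (auto simp: gr_hom_def lin_maps_def)

locale linear_map = M?: left_module R M + N?: left_module R N for R (structure) and M (structure) and N (structure) +
  fixes f
  assumes lin: "f \<in> lin_maps R M N"
begin

lemma closed: "x \<in> carrier M \<Longrightarrow> f x \<in> carrier N"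
  using lin by (auto simp: lin_maps_def)
lemma add: "x \<in> carrier M \<Longrightarrow> y \<in> carrier M \<Longrightarrow> f (x \<oplus>\<^bsub>M\<^esub> y) = f x \<oplus>\<^bsub>N\<^esub> f y"
  using lin by (auto simp: lin_maps_def)
lemma smult: "a \<in> carrier R \<Longrightarrow> x \<in> carrier M \<Longrightarrow> f (a \<odot>\<^bsub>M\<^esub> x) = a \<odot>\<^bsub>N\<^esub> f x"
  using lin by (auto simp: lin_maps_def)
lemma zero: "f \<zero>\<^bsub>M\<^esub> = \<zero>\<^bsub>N\<^esub>"
  using smult[of "\<zero>\<^bsub>R\<^esub>" "\<zero>\<^bsub>M\<^esub>"] closed by (simp add: M.smult_l_null N.smult_l_null)
lemma neg: "x \<in> carrier M \<Longrightarrow> f (\<ominus>\<^bsub>M\<^esub> x) = \<ominus>\<^bsub>N\<^esub> f x"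
  using add[of "\<ominus>\<^bsub>M\<^esub> x" x] closed by (simp add: M.M.l_neg zero N.M.minus_equality)
lemma minus: "x \<in> carrier M \<Longrightarrow> y \<in> carrier M \<Longrightarrow> f (x \<ominus>\<^bsub>M\<^esub> y) = f x \<ominus>\<^bsub>N\<^esub> f y"
  by (simp add: a_minus_def add neg)
lemma vimage_submodule:
  assumes "submodule L R N" shows "submodule {x \<in> carrier M. f x \<in> L} R M"
  using assms by (auto simp: M.submodule_iff N.submodule_iff add smult zero M.smult_closed)

end

lemma finsum_restrict_carrier:
  assumes "abelian_monoid G" "abelian_monoid H" "carrier H \<subseteq> carrier G" "add H = add G" "zero H = zero G"
    "f \<in> F \<rightarrow> carrier H"
  shows "finsum H f F = finsum G f F"
  using finsum_additive_map[of H G "\<lambda>x. x" f F] assms by auto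

lemma abelian_group_restrict:
  assumes "abelian_group G" "additive_subgroup (carrier H) G" "add H = add G" "zero H = zero G"
  shows "abelian_group H"
proof -
  interpret G: abelian_group G by fact
  have H: "carrier H \<subseteq> carrier G" "\<zero>\<^bsub>G\<^esub> \<in> carrier H"
    "\<And>x y. x \<in> carrier H \<Longrightarrow> y \<in> carrier H \<Longrightarrow> x \<oplus>\<^bsub>G\<^esub> y \<in> carrier H"
    "\<And>x. x \<in> carrier H \<Longrightarrow> \<ominus>\<^bsub>G\<^esub> x \<in> carrier H"
    using assms(2) additive_subgroup_iff[OF assms(1)] by auto
  show ?thesis
  proof (rule abelian_groupI; (unfold assms(3,4))?)
    fix x assume x: "x \<in> carrier H"
    then have "\<ominus>\<^bsub>G\<^esub> x \<oplus>\<^bsub>G\<^esub> x = \<zero>\<^bsub>G\<^esub>" using H G.l_neg by auto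
    with x H(4) show "\<exists>y\<in>carrier H. y \<oplus>\<^bsub>G\<^esub> x = \<zero>\<^bsub>G\<^esub>" by blast
  qed (use H in \<open>auto simp: G.a_ac subset_iff\<close>)
qed

lemma finsum_struct_cong:
  assumes "carrier H = carrier G" "add H = add G" "zero H = zero G"
  shows "finsum H f F = finsum G f F"
  using assms by (simp add: finsum_def finprod_def)

lemma a_inv_struct_cong:
  assumes "carrier H = carrier G" "add H = add G" "zero H = zero G"
  shows "a_inv H = a_inv G"
  using assms by (simp add: a_inv_def m_inv_def fun_eq_iff)

abbreviation component :: "('a, 'm, int) graded \<Rightarrow> int \<Rightarrow> 'm \<Rightarrow> 'm" where
  "component M j x \<equiv> components M (homog M) x j"

sublocale graded_module \<subseteq> direct_sum M "homog M"
  by (unfold_locales) (rule homog_sum)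

text \<open>A decomposition inside N is also one inside M, so by uniqueness the components taken in
  N and in M agree. This turns the definition by a direct sum into a closure condition that can be
  checked on elements.\<close>

lemma (in graded_module) graded_submodule_iff:
  "graded_submodule A M N \<longleftrightarrow> submodule N A M \<and> (\<forall>x\<in>N. \<forall>j. component M j x \<in> N)"
proof (cases "submodule N A M")
  case True
  let ?N = "graded_sub M N"
  have N: "carrier ?N = N" "add ?N = add M" "zero ?N = zero M" "homog ?N = (\<lambda>j. homog M j \<inter> N)"
    by (auto simp: graded_sub_def)
  have NM: "N \<subseteq> carrier M" using True submodule_iff by auto
  interpret S: abelian_group ?N
    by (rule abelian_group_restrict[OF M.abelian_group_axioms]) (use N submodule_additive[OF True] in auto)
  have fs: "f \<in> F \<rightarrow> N \<Longrightarrow> finsum ?N f F = finsum M f F" for f and F :: "int set"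
    by (rule finsum_restrict_carrier) (use NM N in auto, unfold_locales)
  have "internal_direct_sum ?N (homog ?N)" if "\<forall>x\<in>N. \<forall>j. component M j x \<in> N"
  proof -
    have ai: "a_inv ?N x = a_inv M x" if "x \<in> N" for x
    proof -
      have "\<ominus>\<^bsub>M\<^esub> x \<in> N" using submodule_neg[OF True] that by auto
      moreover have "\<ominus>\<^bsub>M\<^esub> x \<oplus>\<^bsub>M\<^esub> x = \<zero>\<^bsub>M\<^esub>" using that NM M.l_neg by auto
      ultimately show ?thesis using that S.minus_equality[of "\<ominus>\<^bsub>M\<^esub> x" x] N by auto
    qed
    have "direct_sum ?N (homog ?N)"
    proof (rule direct_sumI(1)[where p="\<lambda>j x. component M j x"])
      show "additive_subgroup (homog ?N i) ?N" for i
        using D_sub[of i] True D_neg ai submodule_neg[OF True]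
        by (auto simp: additive_subgroup_iff S.abelian_group_axioms M.abelian_group_axioms N submodule_iff)
      show "x = (\<Oplus>\<^bsub>?N\<^esub>i\<in>{i. component M i x \<noteq> \<zero>\<^bsub>?N\<^esub>}. component M i x)" if x: "x \<in> carrier ?N" for x
      proof -
        have "(\<Oplus>\<^bsub>?N\<^esub>i\<in>{i. component M i x \<noteq> \<zero>\<^bsub>?N\<^esub>}. component M i x) =
          (\<Oplus>\<^bsub>M\<^esub>i\<in>{i. component M i x \<noteq> \<zero>\<^bsub>M\<^esub>}. component M i x)"
          using x \<open>\<forall>x\<in>N. \<forall>j. component M j x \<in> N\<close> by (subst fs) (auto simp: N)
        then show ?thesis using components_spec(3)[of x] x NM N by auto
      qed
    qed (use that NM N components_spec components_add components_same in \<open>auto simp: S.abelian_group_axioms subset_iff\<close>)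
    then show ?thesis by (rule direct_sum.direct_sum)
  qed
  moreover have "component M j x \<in> N" if ids: "internal_direct_sum ?N (homog ?N)" and x: "x \<in> N" for x j
  proof -
    interpret D: direct_sum ?N "homog ?N" by unfold_locales (fact ids)
    let ?c = "components ?N (homog ?N) x"
    have c: "\<And>i. ?c i \<in> homog M i \<inter> N" using D.components_spec(1)[of x] x N by auto
    have "x = finsum ?N ?c {i. ?c i \<noteq> \<zero>\<^bsub>M\<^esub>}" using D.components_spec(3)[of x] x N by auto
    also have "\<dots> = finsum M ?c {i. ?c i \<noteq> \<zero>\<^bsub>M\<^esub>}" by (rule fs) (use c in auto)
    finally have "component M j x = (if j \<in> {i. ?c i \<noteq> \<zero>\<^bsub>M\<^esub>} then ?c j else \<zero>\<^bsub>M\<^esub>)"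
      by (intro components_unique) (use c D.components_spec(2)[of x] x N in auto)
    then show ?thesis using c True by (auto simp: submodule_iff)
  qed
  ultimately show ?thesis using True by (auto simp: graded_submodule_def)
qed (auto simp: graded_submodule_def)

subsection \<open>Degree-preserving linear maps\<close>

lemma lin_maps_comp: "f \<in> lin_maps R L M \<Longrightarrow> g \<in> lin_maps R M N \<Longrightarrow> (\<lambda>x. g (f x)) \<in> lin_maps R L N"
  by (auto simp: lin_maps_def Pi_iff)

lemma gr_hom_comp: "f \<in> gr_hom A L M \<Longrightarrow> g \<in> gr_hom A M N \<Longrightarrow> (\<lambda>x. g (f x)) \<in> gr_hom A L N"
  by (auto simp: gr_hom_iff lin_maps_comp)

lemma gr_hom_ident: "(\<lambda>x. x) \<in> gr_hom A M M"
  by (auto simp: gr_hom_def)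

lemma (in left_module) lin_maps_add:
  assumes "f \<in> lin_maps R L M" "g \<in> lin_maps R L M"
  shows "(\<lambda>x. f x \<oplus>\<^bsub>M\<^esub> g x) \<in> lin_maps R L M"
  using assms by (auto simp: lin_maps_def Pi_iff smult_r_distr M.a_ac)

lemma (in left_module) lin_maps_neg:
  assumes "f \<in> lin_maps R L M"
  shows "(\<lambda>x. \<ominus>\<^bsub>M\<^esub> f x) \<in> lin_maps R L M"
  using assms by (auto simp: lin_maps_def Pi_iff smult_r_minus M.minus_add)

lemma (in graded_module) gr_hom_minus:
  assumes "f \<in> gr_hom A L M" "g \<in> gr_hom A L M"
  shows "(\<lambda>x. f x \<ominus>\<^bsub>M\<^esub> g x) \<in> gr_hom A L M"
  using lin_maps_add[OF _ lin_maps_neg, of f L g] assms D_add D_neg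
  by (auto simp: gr_hom_iff a_minus_def)

locale graded_map = linear_map A M N f + M?: graded_module A M + N?: graded_module A N
  for A and M and N and f +
  assumes homog: "x \<in> homog M j \<Longrightarrow> f x \<in> homog N j"
begin

lemma component: "x \<in> carrier M \<Longrightarrow> component N j (f x) = f (component M j x)"
  by (rule components_hom[where h="\<lambda>i. i"]) (auto simp: closed add homog M.direct_sum_axioms N.direct_sum_axioms)

end

lemma graded_mapI: "graded_module A M \<Longrightarrow> graded_module A N \<Longrightarrow> f \<in> gr_hom A M N \<Longrightarrow> graded_map A M N f"
  by (simp add: graded_map_def linear_map_def graded_module_def graded_map_axioms_def linear_map_axioms_def gr_hom_iff)

subsection \<open>The regular graded module\<close>

lemma graded_regular_simps [simp]:
  "carrier (graded_regular A) = carrier A" "zero (graded_regular A) = zero A"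
  "add (graded_regular A) = add A" "smult (graded_regular A) = mult A"
  by (auto simp: graded_regular_def)

lemma graded_regular_ops [simp]:
  "finsum (graded_regular A) f F = finsum A f F" "a_inv (graded_regular A) = a_inv A"
  "a_minus (graded_regular A) x y = a_minus A x y"
  by (auto simp: a_minus_def intro!: finsum_struct_cong a_inv_struct_cong)
     (metis a_inv_struct_cong graded_regular_simps(1-3))

context graded_algebra
begin

lemma homog_direct_sum: "direct_sum A (homog A)"
  by unfold_locales (rule homog_sum)

text \<open>The grading of A by all integers, zero in negative degrees. Coefficients of a
  homogeneous element of degree j at a generator g lie in \<open>H (j - deg g)\<close> whatever the
  sign of the difference.\<close>

abbreviation H :: "int \<Rightarrow> 'a set" where "H \<equiv> homog (graded_regular A)"

lemma H_nat: "H (int n) = homog A n" and H_neg: "j < 0 \<Longrightarrow> H j = {\<zero>\<^bsub>A\<^esub>}"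
  and H_0: "H 0 = homog A 0"
  by (auto simp: graded_regular_def)

lemma left_module_regular: "left_module A (graded_regular A)"
proof -
  have "abelian_group (graded_regular A)"
    by (rule abelian_group_restrict[OF A.abelian_group_axioms])
       (auto simp: additive_subgroup_iff A.abelian_group_axioms)
  then show ?thesis
    by (auto simp: left_module_def left_module_axioms_def A.ring_axioms A.l_distr A.r_distr A.m_assoc)
qed

lemma graded_module_regular: "graded_module A (graded_regular A)"
proof -
  interpret L: left_module A "graded_regular A" by (rule left_module_regular)
  interpret D: direct_sum A "homog A" by (rule homog_direct_sum)
  let ?p = "\<lambda>j x. if 0 \<le> j then components A (homog A) x (nat j) else \<zero>\<^bsub>A\<^esub>"
  have "direct_sum (graded_regular A) H"
  proof (rule direct_sumI(1)[where p="?p"])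
    show "additive_subgroup (H i) (graded_regular A)" for i
    proof -
      have "H i = (if 0 \<le> i then homog A (nat i) else {\<zero>\<^bsub>A\<^esub>})" by (simp add: graded_regular_def)
      then show ?thesis using D.D_carrier D.D_zero D.D_add D.D_neg
        unfolding additive_subgroup_iff[OF L.M.abelian_group_axioms] by auto
    qed
    fix x assume x: "x \<in> carrier (graded_regular A)"
    have supp: "{i. ?p i x \<noteq> \<zero>\<^bsub>graded_regular A\<^esub>} = int ` {n. components A (homog A) x n \<noteq> \<zero>\<^bsub>A\<^esub>}"
      by (auto split: if_splits simp: image_iff) (metis int_nat_eq)
    show "finite {i. ?p i x \<noteq> \<zero>\<^bsub>graded_regular A\<^esub>}"
      unfolding supp using D.components_spec(2) x by auto
    show "x = (\<Oplus>\<^bsub>graded_regular A\<^esub>i\<in>{i. ?p i x \<noteq> \<zero>\<^bsub>graded_regular A\<^esub>}. ?p i x)"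
      unfolding supp using D.components_spec(3)[of x] x
      by (simp, subst A.add.finprod_reindex) (auto simp: Pi_iff)
    show "?p i x \<in> H i" for i using x D.components_spec(1)[of x] by (auto simp: graded_regular_def)
    show "?p i (x \<oplus>\<^bsub>graded_regular A\<^esub> y) = ?p i x \<oplus>\<^bsub>graded_regular A\<^esub> ?p i y" 
      if "y \<in> carrier (graded_regular A)" for i y using x that D.components_add by auto
  next
    show "?p i x = (if i = j then x else \<zero>\<^bsub>graded_regular A\<^esub>)" if "x \<in> H j" for i j x
      using that D.components_same by (auto simp: graded_regular_def split: if_splits)
  qed (rule L.M.abelian_group_axioms)
  moreover have "a \<otimes>\<^bsub>A\<^esub> x \<in> H (int i + j)" if "a \<in> homog A i" "x \<in> H j" for a x i j
    using that homog_mult[of a i x "nat j"] D.D_carrier D.D_zero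
    by (auto simp: graded_regular_def nat_add_distrib split: if_splits)
  ultimately show ?thesis
    by (auto simp: graded_module_def graded_module_axioms_def L.left_module_axioms direct_sum.direct_sum)
qed

sublocale reg: graded_module A "graded_regular A"
  by (rule graded_module_regular)

abbreviation cA :: "int \<Rightarrow> 'a \<Rightarrow> 'a" where "cA \<equiv> component (graded_regular A)"

lemmas H_carrier = reg.D_carrier[simplified] and H_zero = reg.D_zero[simplified]
  and cA_in = reg.components_spec(1)[simplified] and cA_closed [simp] = reg.components_closed[simplified]
  and cA_add = reg.components_add[simplified] and cA_same = reg.components_same[simplified]
  and cA_zero = reg.components_zero[simplified] and cA_neg = reg.components_neg[simplified]
  and H_add = reg.D_add[simplified] and H_minus = reg.D_neg[simplified]

lemma one_H: "\<one>\<^bsub>A\<^esub> \<in> H 0" by (simp add: H_0 homog_one)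

lemma cA_one: "cA 0 \<one>\<^bsub>A\<^esub> = \<one>\<^bsub>A\<^esub>" using cA_same[OF one_H, of 0] by simp

lemma cA_neg_degree: "a \<in> carrier A \<Longrightarrow> j < 0 \<Longrightarrow> cA j a = \<zero>\<^bsub>A\<^esub>"
  using cA_in[of a j] H_neg by auto

lemma H_smult:
  assumes "graded_module A M" "a \<in> H i" "x \<in> homog M j"
  shows "a \<odot>\<^bsub>M\<^esub> x \<in> homog M (i + j)"
proof -
  interpret M: graded_module A M by fact
  show ?thesis
  proof (cases "i < 0")
    case True
    then show ?thesis using assms H_neg[of i] M.D_carrier M.D_zero by (auto simp: M.smult_l_null)
  next
    case False
    then show ?thesis using M.homog_smult[of a "nat i" x j] assms H_nat[of "nat i"] by auto
  qed
qed

lemmas H_mult = H_smult[OF graded_module_regular, simplified]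

lemma component_smult:
  assumes "graded_module A M" "a \<in> carrier A" "x \<in> homog M d"
  shows "component M j (a \<odot>\<^bsub>M\<^esub> x) = cA (j - d) a \<odot>\<^bsub>M\<^esub> x"
proof -
  interpret M: graded_module A M by fact
  have "component M ((j - d) + d) (a \<odot>\<^bsub>M\<^esub> x) = cA (j - d) a \<odot>\<^bsub>M\<^esub> x"
    by (rule components_hom[where h="\<lambda>i. i + d" and f="\<lambda>a. a \<odot>\<^bsub>M\<^esub> x"])
       (use assms M.D_carrier M.smult_l_distr M.smult_closed H_smult[OF assms(1)] in
         \<open>auto simp: reg.direct_sum_axioms M.direct_sum_axioms\<close>)
  then show ?thesis by simp
qed

text \<open>The projection to A0 is multiplicative because A has no elements of negative degree: for
  b of positive degree, the degree zero part of a b would require a component of a in negative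
  degree. So A0 is also a quotient of A, by the ideal of elements of positive degree.\<close>

lemma cA_mult_0:
  assumes "a \<in> carrier A" "b \<in> carrier A"
  shows "cA 0 (a \<otimes>\<^bsub>A\<^esub> b) = cA 0 a \<otimes>\<^bsub>A\<^esub> cA 0 b"
proof -
  have hom: "cA 0 (a \<otimes>\<^bsub>A\<^esub> b) = cA 0 a \<otimes>\<^bsub>A\<^esub> cA 0 b" if a: "a \<in> carrier A" and b: "b \<in> H j" for a b j
  proof -
    have bA: "b \<in> carrier A" using b H_carrier by auto
    have 1: "cA 0 (a \<otimes>\<^bsub>A\<^esub> b) = cA (- j) a \<otimes>\<^bsub>A\<^esub> b"
      using component_smult[OF graded_module_regular a b, of 0] by simp
    consider "j = 0" | "j < 0" | "j > 0" by linarith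
    then show ?thesis
    proof cases
      case 1
      then show ?thesis using b \<open>cA 0 (a \<otimes>\<^bsub>A\<^esub> b) = cA (- j) a \<otimes>\<^bsub>A\<^esub> b\<close> cA_same[OF b] by simp
    next
      case 2
      then have "b = \<zero>\<^bsub>A\<^esub>" using b H_neg by auto
      then show ?thesis using a by (simp add: cA_zero)
    next
      case 3
      then show ?thesis using 1 a bA cA_neg_degree[OF a, of "- j"] cA_same[OF b, of 0] by simp
    qed
  qed
  have "cA 0 (a \<otimes>\<^bsub>A\<^esub> b) = cA 0 a \<otimes>\<^bsub>A\<^esub> cA 0 b"
    using assms(2)[folded graded_regular_simps(1)]
  proof (rule reg.direct_sum_induct)
    show "cA 0 (a \<otimes>\<^bsub>A\<^esub> (x \<oplus>\<^bsub>graded_regular A\<^esub> y)) = cA 0 a \<otimes>\<^bsub>A\<^esub> cA 0 (x \<oplus>\<^bsub>graded_regular A\<^esub> y)"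
      if "x \<in> carrier (graded_regular A)" "y \<in> carrier (graded_regular A)"
        "cA 0 (a \<otimes>\<^bsub>A\<^esub> x) = cA 0 a \<otimes>\<^bsub>A\<^esub> cA 0 x" "cA 0 (a \<otimes>\<^bsub>A\<^esub> y) = cA 0 a \<otimes>\<^bsub>A\<^esub> cA 0 y" for x y
      using that assms(1) by (simp add: A.r_distr cA_add)
  qed (use hom assms in auto)
  then show ?thesis .
qed

end

subsection \<open>Submodules over the degree zero part\<close>

definition deg0_submodule :: "('k, 'a, nat) graded \<Rightarrow> ('a, 'm, int) graded \<Rightarrow> int \<Rightarrow> 'm set \<Rightarrow> bool" where
  "deg0_submodule A M j U \<longleftrightarrow> U \<subseteq> homog M j \<and> \<zero>\<^bsub>M\<^esub> \<in> U \<and> (\<forall>x\<in>U. \<forall>y\<in>U. x \<oplus>\<^bsub>M\<^esub> y \<in> U) \<and>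
     (\<forall>a\<in>homog A 0. \<forall>x\<in>U. a \<odot>\<^bsub>M\<^esub> x \<in> U)"

text \<open>The n-th power of an ideal vanishes exactly when these n-fold products of its elements
  do; sums of products are not formed.\<close>

fun products :: "('a, 'x) ring_scheme \<Rightarrow> 'a set \<Rightarrow> nat \<Rightarrow> 'a set" where
  "products R E 0 = {\<one>\<^bsub>R\<^esub>}"
| "products R E (Suc n) = {p \<otimes>\<^bsub>R\<^esub> e | p e. p \<in> products R E n \<and> e \<in> E}"

context graded_algebra
begin

lemma deg0_neg:
  assumes "graded_module A M" "deg0_submodule A M j U" "x \<in> U"
  shows "\<ominus>\<^bsub>M\<^esub> x \<in> U"
proof -
  interpret M: graded_module A M by fact
  have x: "x \<in> carrier M" using assms M.D_carrier by (auto simp: deg0_submodule_def)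
  have "\<ominus>\<^bsub>A\<^esub> \<one>\<^bsub>A\<^esub> \<in> homog A 0" using H_minus[OF one_H] H_0 by simp
  then have "(\<ominus>\<^bsub>A\<^esub> \<one>\<^bsub>A\<^esub>) \<odot>\<^bsub>M\<^esub> x \<in> U" using assms by (auto simp: deg0_submodule_def)
  then show ?thesis using x by (simp add: M.smult_l_minus M.smult_one)
qed

abbreviation deg0_ideal :: "'a set \<Rightarrow> bool" where
  "deg0_ideal U \<equiv> deg0_submodule A (graded_regular A) 0 U"

lemma deg0_ideal_iff:
  "deg0_ideal U \<longleftrightarrow> U \<subseteq> H 0 \<and> \<zero>\<^bsub>A\<^esub> \<in> U \<and> (\<forall>x\<in>U. \<forall>y\<in>U. x \<oplus>\<^bsub>A\<^esub> y \<in> U) \<and>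
     (\<forall>a\<in>H 0. \<forall>x\<in>U. a \<otimes>\<^bsub>A\<^esub> x \<in> U)"
  by (simp add: deg0_submodule_def H_0)

lemma deg0_ideal_minus: "deg0_ideal U \<Longrightarrow> x \<in> U \<Longrightarrow> y \<in> U \<Longrightarrow> x \<ominus>\<^bsub>A\<^esub> y \<in> U"
  using deg0_neg[OF graded_module_regular, of 0 U y] by (auto simp: deg0_ideal_iff a_minus_def)

lemma deg0_ideal_one: "deg0_ideal U \<Longrightarrow> \<one>\<^bsub>A\<^esub> \<in> U \<Longrightarrow> U = H 0"
  unfolding deg0_ideal_iff using H_carrier by (metis A.r_one subsetI subset_antisym)

lemma H0_carrier: "a \<in> H 0 \<Longrightarrow> a \<in> carrier A" by (rule H_carrier)
lemma H0_mult: "a \<in> H 0 \<Longrightarrow> b \<in> H 0 \<Longrightarrow> a \<otimes>\<^bsub>A\<^esub> b \<in> H 0" using H_mult[of a 0 b 0] by simp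
lemma cA0_same: "a \<in> H 0 \<Longrightarrow> cA 0 a = a" using cA_same[of a 0 0] by simp

lemma deg0_ideal_H0: "deg0_ideal (H 0)"
  by (auto simp: deg0_ideal_iff H_zero H_add H0_mult)

section \<open>Finite dimension of A0 and chain conditions on its left ideals\<close>

definition K_subspace :: "'a set \<Rightarrow> bool" where
  "K_subspace U \<longleftrightarrow> U \<subseteq> carrier A \<and> \<zero>\<^bsub>A\<^esub> \<in> U \<and> (\<forall>x\<in>U. \<forall>y\<in>U. x \<oplus>\<^bsub>A\<^esub> y \<in> U) \<and>
     (\<forall>c\<in>carrier K. \<forall>x\<in>U. c \<odot>\<^bsub>A\<^esub> x \<in> U)"

definition K_span :: "'a set \<Rightarrow> 'a set" where
  "K_span F = {(\<Oplus>\<^bsub>A\<^esub>b\<in>F. c b \<odot>\<^bsub>A\<^esub> b) | c. c \<in> F \<rightarrow> carrier K}"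

lemma K_span_insert:
  assumes "finite F" "b \<notin> F" "insert b F \<subseteq> carrier A" "x \<in> K_span (insert b F)"
  obtains c y where "c \<in> carrier K" "y \<in> K_span F" "x = c \<odot>\<^bsub>A\<^esub> b \<oplus>\<^bsub>A\<^esub> y"
proof -
  obtain c where c: "c \<in> insert b F \<rightarrow> carrier K" "x = (\<Oplus>\<^bsub>A\<^esub>b\<in>insert b F. c b \<odot>\<^bsub>A\<^esub> b)"
    using assms(4) by (auto simp: K_span_def)
  have "x = c b \<odot>\<^bsub>A\<^esub> b \<oplus>\<^bsub>A\<^esub> (\<Oplus>\<^bsub>A\<^esub>b\<in>F. c b \<odot>\<^bsub>A\<^esub> b)"
    unfolding c(2) by (rule A.finsum_insert) (use assms c(1) in auto)
  moreover have "(\<Oplus>\<^bsub>A\<^esub>b\<in>F. c b \<odot>\<^bsub>A\<^esub> b) \<in> K_span F" using c(1) by (auto simp: K_span_def)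
  ultimately show thesis using that[of "c b"] c(1) by auto
qed

lemma K_subspace_span:
  assumes "finite F" "F \<subseteq> carrier A" shows "K_subspace (K_span F)"
  unfolding K_subspace_def
proof (intro conjI ballI)
  show "K_span F \<subseteq> carrier A" using assms by (auto simp: K_span_def intro!: A.finsum_closed)
  have "(\<Oplus>\<^bsub>A\<^esub>b\<in>F. \<zero>\<^bsub>K\<^esub> \<odot>\<^bsub>A\<^esub> b) = (\<Oplus>\<^bsub>A\<^esub>b\<in>F. \<zero>\<^bsub>A\<^esub>)"
    by (rule A.finsum_cong') (use assms in auto)
  then have "(\<Oplus>\<^bsub>A\<^esub>b\<in>F. \<zero>\<^bsub>K\<^esub> \<odot>\<^bsub>A\<^esub> b) = \<zero>\<^bsub>A\<^esub>" by simp
  then show "\<zero>\<^bsub>A\<^esub> \<in> K_span F"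
    by (auto simp: K_span_def intro!: exI[of _ "\<lambda>_. \<zero>\<^bsub>K\<^esub>"])
  fix x assume "x \<in> K_span F"
  then obtain c where c: "c \<in> F \<rightarrow> carrier K" "x = (\<Oplus>\<^bsub>A\<^esub>b\<in>F. c b \<odot>\<^bsub>A\<^esub> b)" by (auto simp: K_span_def)
  { fix y assume "y \<in> K_span F"
    then obtain d where d: "d \<in> F \<rightarrow> carrier K" "y = (\<Oplus>\<^bsub>A\<^esub>b\<in>F. d b \<odot>\<^bsub>A\<^esub> b)" by (auto simp: K_span_def)
    have "x \<oplus>\<^bsub>A\<^esub> y = (\<Oplus>\<^bsub>A\<^esub>b\<in>F. c b \<odot>\<^bsub>A\<^esub> b \<oplus>\<^bsub>A\<^esub> d b \<odot>\<^bsub>A\<^esub> b)"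
      unfolding c d by (rule A.finsum_addf[symmetric]) (use c d assms in auto)
    also have "\<dots> = (\<Oplus>\<^bsub>A\<^esub>b\<in>F. (c b \<oplus>\<^bsub>K\<^esub> d b) \<odot>\<^bsub>A\<^esub> b)"
      by (rule A.finsum_cong') (use assms c d in \<open>auto simp: KA.smult_l_distr Pi_iff subset_iff\<close>)
    finally show "x \<oplus>\<^bsub>A\<^esub> y \<in> K_span F" using c d by (auto simp: K_span_def intro!: exI[of _ "\<lambda>b. c b \<oplus>\<^bsub>K\<^esub> d b"]) }
  fix k assume k: "k \<in> carrier K"
  have "k \<odot>\<^bsub>A\<^esub> x = (\<Oplus>\<^bsub>A\<^esub>b\<in>F. k \<odot>\<^bsub>A\<^esub> (c b \<odot>\<^bsub>A\<^esub> b))"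
    unfolding c(2) by (rule KA.finsum_smult_ldistr) (use assms c k in auto)
  also have "\<dots> = (\<Oplus>\<^bsub>A\<^esub>b\<in>F. (k \<otimes>\<^bsub>K\<^esub> c b) \<odot>\<^bsub>A\<^esub> b)"
    by (rule A.finsum_cong') (use assms c k in \<open>auto simp: KA.smult_assoc1 Pi_iff subset_iff\<close>)
  finally show "k \<odot>\<^bsub>A\<^esub> x \<in> K_span F" using c k by (auto simp: K_span_def intro!: exI[of _ "\<lambda>b. k \<otimes>\<^bsub>K\<^esub> c b"])
qed

lemma K_subspace_neg: "K_subspace U \<Longrightarrow> x \<in> U \<Longrightarrow> \<ominus>\<^bsub>A\<^esub> x \<in> U"
  using KA.smult_l_minus[of "\<one>\<^bsub>K\<^esub>" x] unfolding K_subspace_def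
  by (metis K.add.inv_closed K.one_closed KA.smult_one subsetD)

text \<open>The function stands in for the dimension: what is wanted is a bounded integer that
  increases strictly along proper inclusions. When a vector b is added to the spanning set, the
  value is that of the intersection with the old span V, plus one if the subspace is not contained
  in V.\<close>

lemma K_span_rank:
  assumes "finite F" "F \<subseteq> carrier A"
  shows "\<exists>\<mu> :: 'a set \<Rightarrow> nat. \<forall>U. K_subspace U \<and> U \<subseteq> K_span F \<longrightarrow>
    \<mu> U \<le> card F \<and> (\<forall>U'. K_subspace U' \<and> U' \<subset> U \<longrightarrow> \<mu> U' < \<mu> U)"
  using assms
proof (induction F)
  case empty
  have "K_span {} = {\<zero>\<^bsub>A\<^esub>}" by (auto simp: K_span_def)
  then show ?case by (intro exI[of _ "\<lambda>_. 0"]) (auto simp: K_subspace_def)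
next
  case (insert b F)
  define V where "V = K_span F"
  have V: "K_subspace V" unfolding V_def using K_subspace_span insert by auto
  obtain \<mu> where \<mu>: "\<And>U. K_subspace U \<Longrightarrow> U \<subseteq> V \<Longrightarrow> \<mu> U \<le> card F"
    "\<And>U U'. K_subspace U \<Longrightarrow> U \<subseteq> V \<Longrightarrow> K_subspace U' \<Longrightarrow> U' \<subset> U \<Longrightarrow> \<mu> U' < \<mu> U"
    using insert.IH insert.prems unfolding V_def by (metis insert_subset)
  define \<nu> where "\<nu> U = \<mu> (U \<inter> V) + (if U \<subseteq> V then 0 else 1)" for U
  have int: "K_subspace (U \<inter> V)" if "K_subspace U" for U using that V by (auto simp: K_subspace_def)
  show ?case
  proof (intro exI[of _ \<nu>] allI impI conjI; elim conjE)
    fix U assume U: "K_subspace U" "U \<subseteq> K_span (insert b F)"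
    show "\<nu> U \<le> card (insert b F)" using \<mu>(1)[OF int[OF U(1)]] insert by (auto simp: \<nu>_def)
    fix U' assume U': "K_subspace U'" "U' \<subset> U"
    have le: "\<mu> (U' \<inter> V) \<le> \<mu> (U \<inter> V)"
    proof (cases "U' \<inter> V = U \<inter> V")
      case False
      then have "U' \<inter> V \<subset> U \<inter> V" using U' by auto
      then show ?thesis using \<mu>(2)[OF int[OF U(1)] _ int[OF U'(1)]] by fastforce
    qed simp
    show "\<nu> U' < \<nu> U"
    proof (cases "U' \<inter> V = U \<inter> V")
      case False
      then have "U' \<inter> V \<subset> U \<inter> V" using U' by auto
      then have "\<mu> (U' \<inter> V) < \<mu> (U \<inter> V)" using \<mu>(2)[OF int[OF U(1)] _ int[OF U'(1)]] by auto
      moreover have "\<not> U \<subseteq> V" if "\<not> U' \<subseteq> V" using that U' by auto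
      ultimately show ?thesis by (auto simp: \<nu>_def)
    next
      case True
      then have nU: "\<not> U \<subseteq> V" using U' by blast
      \<comment> \<open>Otherwise some u in U' has a nonzero, hence invertible, b-coefficient c. For
        w in U outside U' with b-coefficient d, the difference w - (d/c) u lies in the intersection
        of U with V, which equals that of U' with V, so w would lie in U'.\<close>
      have "U' \<subseteq> V"
      proof (rule ccontr)
        assume "\<not> U' \<subseteq> V"
        then obtain u where u: "u \<in> U'" "u \<notin> V" by auto
        obtain w where w: "w \<in> U" "w \<notin> U'" using U' by auto
        obtain c y where c: "c \<in> carrier K" "y \<in> V" "u = c \<odot>\<^bsub>A\<^esub> b \<oplus>\<^bsub>A\<^esub> y"
          using K_span_insert[of F b u] insert u U U' V_def by (metis psubsetD subsetD)
        obtain d z where d: "d \<in> carrier K" "z \<in> V" "w = d \<odot>\<^bsub>A\<^esub> b \<oplus>\<^bsub>A\<^esub> z"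
          using K_span_insert[of F b w] insert w U U' V_def by (metis subsetD)
        have bA: "b \<in> carrier A" using insert by auto
        have yz: "y \<in> carrier A" "z \<in> carrier A" using c d V by (auto simp: K_subspace_def)
        have "c \<noteq> \<zero>\<^bsub>K\<^esub>" using c u yz bA by auto
        then have inv: "inv\<^bsub>K\<^esub> c \<in> carrier K" "inv\<^bsub>K\<^esub> c \<otimes>\<^bsub>K\<^esub> c = \<one>\<^bsub>K\<^esub>"
          using c K.field_Units by auto
        define r where "r = d \<otimes>\<^bsub>K\<^esub> inv\<^bsub>K\<^esub> c"
        have r: "r \<in> carrier K" "r \<otimes>\<^bsub>K\<^esub> c = d" using inv c d by (auto simp: r_def K.m_assoc)
        have ru: "r \<odot>\<^bsub>A\<^esub> u \<in> U'" using U' u r by (auto simp: K_subspace_def)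
        have "r \<odot>\<^bsub>A\<^esub> u = d \<odot>\<^bsub>A\<^esub> b \<oplus>\<^bsub>A\<^esub> r \<odot>\<^bsub>A\<^esub> y"
          using c r bA yz by (simp add: KA.smult_r_distr KA.smult_assoc1[symmetric])
        then have "w \<ominus>\<^bsub>A\<^esub> r \<odot>\<^bsub>A\<^esub> u = z \<ominus>\<^bsub>A\<^esub> r \<odot>\<^bsub>A\<^esub> y"
          using d r bA yz by (simp add: a_minus_def A.minus_add A.a_ac A.r_neg1 A.r_neg2)
        moreover have "z \<ominus>\<^bsub>A\<^esub> r \<odot>\<^bsub>A\<^esub> y \<in> V"
          using V c d r K_subspace_neg[OF V] by (auto simp: K_subspace_def a_minus_def)
        moreover have "w \<ominus>\<^bsub>A\<^esub> r \<odot>\<^bsub>A\<^esub> u \<in> U"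
          using U U' w ru K_subspace_neg[OF U(1)] by (auto simp: K_subspace_def a_minus_def)
        ultimately have "w \<ominus>\<^bsub>A\<^esub> r \<odot>\<^bsub>A\<^esub> u \<in> U'" using True by auto
        then have "(w \<ominus>\<^bsub>A\<^esub> r \<odot>\<^bsub>A\<^esub> u) \<oplus>\<^bsub>A\<^esub> r \<odot>\<^bsub>A\<^esub> u \<in> U'" using ru U' by (auto simp: K_subspace_def)
        moreover have "w \<in> carrier A" "r \<odot>\<^bsub>A\<^esub> u \<in> carrier A" using U U' w ru by (auto simp: K_subspace_def)
        ultimately have "w \<in> U'" by (simp add: a_minus_def A.a_assoc A.l_neg)
        then show False using w by simp
      qed
      then show ?thesis using nU True by (simp add: \<nu>_def)
    qed
  qed
qed

text \<open>A scalar c acts as multiplication by c 1, an element of A0.\<close>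

lemma deg0_ideal_K_subspace: "deg0_ideal U \<Longrightarrow> K_subspace U"
proof -
  assume U: "deg0_ideal U"
  have "c \<odot>\<^bsub>A\<^esub> x \<in> U" if c: "c \<in> carrier K" and x: "x \<in> U" for c x
  proof -
    have "c \<odot>\<^bsub>A\<^esub> \<one>\<^bsub>A\<^esub> \<in> H 0" using submodule.smult_closed[OF homog_submodule c homog_one] H_0 by simp
    then have "(c \<odot>\<^bsub>A\<^esub> \<one>\<^bsub>A\<^esub>) \<otimes>\<^bsub>A\<^esub> x \<in> U" using U x by (auto simp: deg0_ideal_iff)
    moreover have "x \<in> carrier A" using U x H0_carrier by (auto simp: deg0_ideal_iff)
    ultimately show ?thesis using smult_mult_left[OF c A.one_closed, of x] by simp
  qed
  then show ?thesis using U H0_carrier by (auto simp: deg0_ideal_iff K_subspace_def)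
qed

text \<open>Here the finite dimension of A0 enters. Strict monotonicity together with the bound
  yields minimal and maximal left ideals with a given property as well as the stabilization of
  ascending chains.\<close>

lemma deg0_ideal_rank:
  obtains \<mu> :: "'a set \<Rightarrow> nat" and n where "\<And>U. deg0_ideal U \<Longrightarrow> \<mu> U \<le> n"
    "\<And>U U'. deg0_ideal U \<Longrightarrow> deg0_ideal U' \<Longrightarrow> U' \<subset> U \<Longrightarrow> \<mu> U' < \<mu> U"
proof -
  let ?A = "A\<lparr>carrier := homog A 0\<rparr>"
  interpret B: abelian_group ?A
    by (rule abelian_group_restrict[OF A.abelian_group_axioms])
       (use submodule.axioms(1)[OF homog_submodule] in \<open>auto simp: additive_subgroup_def\<close>)
  obtain F where F: "finite F" "F \<subseteq> homog A 0"
    "\<And>x. x \<in> homog A 0 \<Longrightarrow> \<exists>c\<in>F \<rightarrow> carrier K. x = (\<Oplus>\<^bsub>?A\<^esub>b\<in>F. c b \<odot>\<^bsub>A\<^esub> b)"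
    using locally_finite[of 0] unfolding finitely_generated_def by auto
  have FA: "F \<subseteq> carrier A" using F(2) H0_carrier H_0 by auto
  have sm: "c \<in> carrier K \<Longrightarrow> b \<in> homog A 0 \<Longrightarrow> c \<odot>\<^bsub>A\<^esub> b \<in> homog A 0" for c b
    using submodule.smult_closed[OF homog_submodule] by blast
  have "x \<in> K_span F" if "x \<in> H 0" for x
  proof -
    obtain c where c: "c\<in>F \<rightarrow> carrier K" "x = (\<Oplus>\<^bsub>?A\<^esub>b\<in>F. c b \<odot>\<^bsub>A\<^esub> b)" using F(3) \<open>x \<in> H 0\<close> H_0 by auto
    have "(\<Oplus>\<^bsub>?A\<^esub>b\<in>F. c b \<odot>\<^bsub>A\<^esub> b) = (\<Oplus>\<^bsub>A\<^esub>b\<in>F. c b \<odot>\<^bsub>A\<^esub> b)"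
      by (rule finsum_restrict_carrier)
         (use c F sm H0_carrier H_0 in \<open>auto simp: B.abelian_monoid_axioms A.abelian_monoid_axioms Pi_iff subset_iff\<close>)
    then show ?thesis using c by (auto simp: K_span_def)
  qed
  then have sub: "U \<subseteq> K_span F" if "deg0_ideal U" for U using that by (auto simp: deg0_ideal_iff)
  obtain \<mu> :: "'a set \<Rightarrow> nat" where "\<forall>U. K_subspace U \<and> U \<subseteq> K_span F \<longrightarrow>
    \<mu> U \<le> card F \<and> (\<forall>U'. K_subspace U' \<and> U' \<subset> U \<longrightarrow> \<mu> U' < \<mu> U)"
    using K_span_rank[OF F(1) FA] by blast
  then show thesis using that[of \<mu> "card F"] sub deg0_ideal_K_subspace by blast
qed

lemma minimal_deg0_ideal:
  assumes "deg0_ideal U0" "Q U0"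
  obtains U where "deg0_ideal U" "Q U" "\<And>U'. deg0_ideal U' \<Longrightarrow> Q U' \<Longrightarrow> U' \<subseteq> U \<Longrightarrow> U' = U"
proof -
  obtain \<mu> :: "'a set \<Rightarrow> nat" and n :: nat where \<mu>:
    "\<And>U. deg0_ideal U \<Longrightarrow> \<mu> U \<le> n" "\<And>U U'. deg0_ideal U \<Longrightarrow> deg0_ideal U' \<Longrightarrow> U' \<subset> U \<Longrightarrow> \<mu> U' < \<mu> U"
    using deg0_ideal_rank by blast
  obtain U where U: "deg0_ideal U \<and> Q U" "\<And>U'. deg0_ideal U' \<and> Q U' \<Longrightarrow> \<mu> U \<le> \<mu> U'"
    using ex_has_least_nat[of "\<lambda>U. deg0_ideal U \<and> Q U" U0 \<mu>] assms by blast
  show thesis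
  proof (rule that[of U])
    fix U' assume "deg0_ideal U'" "Q U'" "U' \<subseteq> U"
    then show "U' = U" using U \<mu>(2)[of U U'] by fastforce
  qed (use U in auto)
qed

lemma maximal_deg0_ideal:
  assumes "deg0_ideal U0" "Q U0"
  obtains U where "deg0_ideal U" "Q U" "\<And>U'. deg0_ideal U' \<Longrightarrow> Q U' \<Longrightarrow> U \<subseteq> U' \<Longrightarrow> U' = U"
proof -
  obtain \<mu> :: "'a set \<Rightarrow> nat" and n :: nat where \<mu>: "\<And>U. deg0_ideal U \<Longrightarrow> \<mu> U \<le> n"
    "\<And>U U'. deg0_ideal U \<Longrightarrow> deg0_ideal U' \<Longrightarrow> U' \<subset> U \<Longrightarrow> \<mu> U' < \<mu> U"
    using deg0_ideal_rank by blast
  have "\<forall>U. deg0_ideal U \<and> Q U \<longrightarrow> \<mu> U < Suc n" using \<mu>(1) by (simp add: less_Suc_eq_le)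
  then obtain U where U: "deg0_ideal U \<and> Q U" "\<And>U'. deg0_ideal U' \<and> Q U' \<Longrightarrow> \<mu> U' \<le> \<mu> U"
    using ex_has_greatest_nat[of "\<lambda>U. deg0_ideal U \<and> Q U" U0 \<mu> "Suc n"] assms by blast
  show thesis
  proof (rule that[of U])
    fix U' assume "deg0_ideal U'" "Q U'" "U \<subseteq> U'"
    then show "U' = U" using U \<mu>(2)[of U' U] by fastforce
  qed (use U in auto)
qed

end

subsection \<open>The degree zero part of the graded Jacobson radical\<close>

text \<open>\<open>J0\<close> is a nilpotent two-sided ideal of A0, and \<open>J0_complement\<close>
  says that every left ideal of A0/J0 has a complement, which is semisimplicity of A0/J0 expressed
  in A0. The instances are \<open>rad0\<close> and, for semisimple A0, the zero ideal.\<close>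

locale deg0_radical = graded_algebra K A
  for K :: "('k, 'x) ring_scheme" and A :: "('k, 'a, nat) graded" +
  fixes J0 :: "'a set"
  assumes J0_ideal: "deg0_ideal J0"
    and J0_right: "\<lbrakk>e \<in> J0; r \<in> H 0\<rbrakk> \<Longrightarrow> e \<otimes>\<^bsub>A\<^esub> r \<in> J0"
    and J0_nilpotent: "\<exists>n. products A J0 n \<subseteq> {\<zero>\<^bsub>A\<^esub>}"
    and J0_complement: "\<lbrakk>deg0_ideal I; J0 \<subseteq> I\<rbrakk> \<Longrightarrow>
      \<exists>L. deg0_ideal L \<and> (\<forall>a\<in>H 0. \<exists>x\<in>I. \<exists>y\<in>L. a = x \<oplus>\<^bsub>A\<^esub> y) \<and> I \<inter> L \<subseteq> J0"

context graded_algebra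
begin

abbreviation "gr_ideal I \<equiv> graded_submodule A (graded_regular A) I"
abbreviation "rad \<equiv> graded_jacobson_radical A"
abbreviation "rad0 \<equiv> rad \<inter> H 0"

lemma gr_ideal_iff:
  "gr_ideal I \<longleftrightarrow> I \<subseteq> carrier A \<and> \<zero>\<^bsub>A\<^esub> \<in> I \<and> (\<forall>x\<in>I. \<forall>y\<in>I. x \<oplus>\<^bsub>A\<^esub> y \<in> I) \<and>
     (\<forall>a\<in>carrier A. \<forall>x\<in>I. a \<otimes>\<^bsub>A\<^esub> x \<in> I) \<and> (\<forall>x\<in>I. \<forall>j. cA j x \<in> I)"
  by (auto simp: reg.graded_submodule_iff reg.submodule_iff)

lemma gr_ideal_one: "gr_ideal I \<Longrightarrow> \<one>\<^bsub>A\<^esub> \<in> I \<Longrightarrow> I = carrier A"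
  unfolding gr_ideal_iff by (metis A.r_one subsetI subset_antisym)

lemma gr_ideal_deg0: "gr_ideal I \<Longrightarrow> deg0_ideal (I \<inter> H 0)"
  by (auto simp: gr_ideal_iff deg0_ideal_iff H_zero H_add H0_mult H0_carrier)

text \<open>This set is the sum of U and all elements of positive degree. It is a left ideal because
  \<open>cA 0\<close> is multiplicative.\<close>

lemma gr_ideal_extend:
  assumes "deg0_ideal U" shows "gr_ideal {a \<in> carrier A. cA 0 a \<in> U}"
proof -
  have "cA 0 (cA j x) \<in> U" if "x \<in> carrier A" "cA 0 x \<in> U" for x j
    using cA_same[OF cA_in[OF that(1), of j], of 0] that assms by (auto simp: deg0_ideal_iff)
  then show ?thesis
    using assms cA_in by (auto simp: gr_ideal_iff deg0_ideal_iff cA_add cA_mult_0 cA_zero)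
qed

text \<open>The right-hand side is a graded left ideal containing I, and it is proper because 1 has
  degree zero and is not in I; so maximality gives equality. In particular I contains all elements
  of positive degree.\<close>

lemma max_gr_ideal_eq:
  assumes "max_graded_left_ideal A I"
  shows "I = {a \<in> carrier A. cA 0 a \<in> I}"
proof -
  have I: "gr_ideal I" "I \<noteq> carrier A" "\<And>L. gr_ideal L \<Longrightarrow> I \<subseteq> L \<Longrightarrow> L = I \<or> L = carrier A"
    using assms by (auto simp: max_graded_left_ideal_def)
  let ?L = "{a \<in> carrier A. cA 0 a \<in> I \<inter> H 0}"
  have "gr_ideal ?L" by (rule gr_ideal_extend[OF gr_ideal_deg0[OF I(1)]])
  moreover have "I \<subseteq> ?L" using I(1) cA_in by (auto simp: gr_ideal_iff)
  moreover have "?L \<noteq> carrier A"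
  proof
    assume "?L = carrier A"
    then have "cA 0 \<one>\<^bsub>A\<^esub> \<in> I" using A.one_closed by blast
    then show False using I(2) gr_ideal_one[OF I(1)] cA_one by simp
  qed
  ultimately have "?L = I" using I(3) by auto
  moreover have "?L = {a \<in> carrier A. cA 0 a \<in> I}" using cA_in by auto
  ultimately show ?thesis by simp
qed

lemma rad_eq: "rad = {a \<in> carrier A. cA 0 a \<in> rad0}"
proof -
  have "a \<in> I \<longleftrightarrow> cA 0 a \<in> I" if "max_graded_left_ideal A I" "a \<in> carrier A" for I a
    using max_gr_ideal_eq[OF that(1)] that(2) by auto
  then show ?thesis using cA_in by (auto simp: graded_jacobson_radical_def)
qed

text \<open>The converse passage: a maximal left ideal of A0, enlarged by the elements of positive
  degree, is a maximal graded left ideal of A. Hence \<open>rad0\<close> is the Jacobson radical of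
  A0.\<close>

lemma max_extend:
  assumes U: "deg0_ideal U" "U \<noteq> H 0" "\<And>L. deg0_ideal L \<Longrightarrow> L \<noteq> H 0 \<Longrightarrow> U \<subseteq> L \<Longrightarrow> L = U"
  shows "max_graded_left_ideal A {a \<in> carrier A. cA 0 a \<in> U}" (is "max_graded_left_ideal A ?I")
  unfolding max_graded_left_ideal_def
proof (intro conjI allI impI; (elim conjE)?)
  show "gr_ideal ?I" by (rule gr_ideal_extend[OF U(1)])
  show "?I \<noteq> carrier A"
  proof
    assume "?I = carrier A"
    then have "cA 0 \<one>\<^bsub>A\<^esub> \<in> U" using A.one_closed by blast
    then show False using U(2) deg0_ideal_one[OF U(1)] cA_one by simp
  qed
  fix L assume L: "gr_ideal L" "?I \<subseteq> L"
  have UL: "U \<subseteq> L \<inter> H 0" using L U(1) cA0_same H0_carrier by (force simp: deg0_ideal_iff)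
  show "L = ?I \<or> L = carrier A"
  proof (cases "L \<inter> H 0 = H 0")
    case True
    then have "\<one>\<^bsub>A\<^esub> \<in> L" using one_H by auto
    then show ?thesis using gr_ideal_one[OF L(1)] by auto
  next
    case False
    then have "L \<inter> H 0 = U" using U(3)[OF gr_ideal_deg0[OF L(1)] _ UL] by auto
    then have "L \<subseteq> ?I" using L(1) cA_in by (auto simp: gr_ideal_iff)
    then show ?thesis using L(2) by auto
  qed
qed

lemma rad0_ideal: "deg0_ideal rad0"
proof -
  have "gr_ideal I" if "max_graded_left_ideal A I" for I using that by (simp add: max_graded_left_ideal_def)
  then show ?thesis
    by (auto simp: deg0_ideal_iff graded_jacobson_radical_def gr_ideal_iff H_zero H_add H0_mult H0_carrier)
qed

text \<open>If the left ideal generated by 1 - e were proper, a maximal left ideal of A0 above it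
  would contain e as well, hence 1.\<close>

lemma rad0_quasi_inverse:
  assumes e: "e \<in> rad0"
  obtains t where "t \<in> H 0" "t \<otimes>\<^bsub>A\<^esub> (\<one>\<^bsub>A\<^esub> \<ominus>\<^bsub>A\<^esub> e) = \<one>\<^bsub>A\<^esub>"
proof -
  let ?f = "\<one>\<^bsub>A\<^esub> \<ominus>\<^bsub>A\<^esub> e"
  define L where "L = (\<lambda>t. t \<otimes>\<^bsub>A\<^esub> ?f) ` H 0"
  have eH: "e \<in> H 0" "e \<in> carrier A" using e H0_carrier by auto
  have f: "?f \<in> H 0" using eH one_H deg0_ideal_minus[OF deg0_ideal_H0] by auto
  have fA: "?f \<in> carrier A" using f H0_carrier by auto
  have L: "deg0_ideal L" unfolding deg0_ideal_iff L_def
  proof (intro conjI ballI)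
    show "\<zero>\<^bsub>A\<^esub> \<in> (\<lambda>t. t \<otimes>\<^bsub>A\<^esub> ?f) ` H 0" using H_zero[of 0] A.l_null[OF fA] by (metis imageI)
    fix x assume "x \<in> (\<lambda>t. t \<otimes>\<^bsub>A\<^esub> ?f) ` H 0"
    then obtain t where t: "t \<in> H 0" "x = t \<otimes>\<^bsub>A\<^esub> ?f" by auto
    { fix y assume "y \<in> (\<lambda>t. t \<otimes>\<^bsub>A\<^esub> ?f) ` H 0"
      then obtain s where s: "s \<in> H 0" "y = s \<otimes>\<^bsub>A\<^esub> ?f" by auto
      have "x \<oplus>\<^bsub>A\<^esub> y = (t \<oplus>\<^bsub>A\<^esub> s) \<otimes>\<^bsub>A\<^esub> ?f" using s t fA H0_carrier by (simp add: A.l_distr)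
      then show "x \<oplus>\<^bsub>A\<^esub> y \<in> (\<lambda>t. t \<otimes>\<^bsub>A\<^esub> ?f) ` H 0" using H_add s t by blast }
    fix a assume a: "a \<in> H 0"
    have "a \<otimes>\<^bsub>A\<^esub> x = (a \<otimes>\<^bsub>A\<^esub> t) \<otimes>\<^bsub>A\<^esub> ?f" using a t fA H0_carrier by (simp add: A.m_assoc)
    then show "a \<otimes>\<^bsub>A\<^esub> x \<in> (\<lambda>t. t \<otimes>\<^bsub>A\<^esub> ?f) ` H 0" using H0_mult a t by blast
  qed (use f H0_mult in auto)
  have "L = H 0"
  proof (rule ccontr)
    assume "L \<noteq> H 0"
    then obtain U where U: "deg0_ideal U" "L \<subseteq> U \<and> U \<noteq> H 0"
      "\<And>U'. deg0_ideal U' \<Longrightarrow> L \<subseteq> U' \<and> U' \<noteq> H 0 \<Longrightarrow> U \<subseteq> U' \<Longrightarrow> U' = U"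
      using maximal_deg0_ideal[of L "\<lambda>U. L \<subseteq> U \<and> U \<noteq> H 0"] L by blast
    have "max_graded_left_ideal A {a \<in> carrier A. cA 0 a \<in> U}"
      by (rule max_extend) (use U in blast)+
    then have "cA 0 e \<in> U" using e by (auto simp: graded_jacobson_radical_def)
    then have "e \<in> U" using cA0_same eH by auto
    moreover have "?f \<in> L" using one_H fA A.l_one[OF fA] unfolding L_def by (metis imageI)
    then have "?f \<in> U" using U(2) by blast
    ultimately have "?f \<oplus>\<^bsub>A\<^esub> e \<in> U" using U(1) by (auto simp: deg0_ideal_iff)
    then have "\<one>\<^bsub>A\<^esub> \<in> U" using eH by (simp add: a_minus_def A.a_assoc A.l_neg)
    then show False using deg0_ideal_one U by blast
  qed
  then have "\<one>\<^bsub>A\<^esub> \<in> L" using one_H by simp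
  then show thesis using that unfolding L_def by auto
qed

text \<open>Since x is homogeneous, A x + I is a graded left ideal; it is strictly larger than I, so
  it contains 1. As x has degree zero, taking degree zero components of 1 = a x + m brings both
  coefficients into A0.\<close>

lemma max_gr_ideal_split:
  assumes I: "max_graded_left_ideal A I" and x: "x \<in> H 0" "x \<notin> I"
  obtains a m where "a \<in> H 0" "m \<in> I \<inter> H 0" "\<one>\<^bsub>A\<^esub> = a \<otimes>\<^bsub>A\<^esub> x \<oplus>\<^bsub>A\<^esub> m"
proof -
  have I': "gr_ideal I" "\<And>L. gr_ideal L \<Longrightarrow> I \<subseteq> L \<Longrightarrow> L = I \<or> L = carrier A"
    using I by (auto simp: max_graded_left_ideal_def)
  have xA: "x \<in> carrier A" using x H0_carrier by auto
  have IA: "i \<in> I \<Longrightarrow> i \<in> carrier A" for i using I' by (auto simp: gr_ideal_iff)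
  define L where "L = {a \<otimes>\<^bsub>A\<^esub> x \<oplus>\<^bsub>A\<^esub> m | a m. a \<in> carrier A \<and> m \<in> I}"
  let ?L = "{a \<otimes>\<^bsub>A\<^esub> x \<oplus>\<^bsub>A\<^esub> m | a m. a \<in> carrier A \<and> m \<in> I}"
  have "gr_ideal ?L" unfolding gr_ideal_iff
  proof (intro conjI ballI allI)
    show "?L \<subseteq> carrier A" using xA IA by auto
    have "\<zero>\<^bsub>A\<^esub> = \<zero>\<^bsub>A\<^esub> \<otimes>\<^bsub>A\<^esub> x \<oplus>\<^bsub>A\<^esub> \<zero>\<^bsub>A\<^esub>" using xA by simp
    then show "\<zero>\<^bsub>A\<^esub> \<in> ?L" using I'(1) unfolding gr_ideal_iff by blast
    fix y assume "y \<in> ?L"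
    then obtain a m where am: "y = a \<otimes>\<^bsub>A\<^esub> x \<oplus>\<^bsub>A\<^esub> m" "a \<in> carrier A" "m \<in> I" by auto
    { fix z assume "z \<in> ?L"
      then obtain b n where bn: "z = b \<otimes>\<^bsub>A\<^esub> x \<oplus>\<^bsub>A\<^esub> n" "b \<in> carrier A" "n \<in> I" by auto
      have "y \<oplus>\<^bsub>A\<^esub> z = (a \<oplus>\<^bsub>A\<^esub> b) \<otimes>\<^bsub>A\<^esub> x \<oplus>\<^bsub>A\<^esub> (m \<oplus>\<^bsub>A\<^esub> n)"
        using am bn xA IA by (simp add: A.l_distr A.a_ac)
      then show "y \<oplus>\<^bsub>A\<^esub> z \<in> ?L" using am bn I'(1) unfolding gr_ideal_iff by blast }
    { fix c assume c: "c \<in> carrier A"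
      have "c \<otimes>\<^bsub>A\<^esub> y = (c \<otimes>\<^bsub>A\<^esub> a) \<otimes>\<^bsub>A\<^esub> x \<oplus>\<^bsub>A\<^esub> c \<otimes>\<^bsub>A\<^esub> m"
        using am c xA IA by (simp add: A.r_distr A.m_assoc)
      then show "c \<otimes>\<^bsub>A\<^esub> y \<in> ?L" using am c I'(1) unfolding gr_ideal_iff by blast }
    fix j
    have "cA j y = cA j a \<otimes>\<^bsub>A\<^esub> x \<oplus>\<^bsub>A\<^esub> cA j m"
      using am IA xA component_smult[OF graded_module_regular, of a x 0 j] x by (simp add: cA_add)
    then show "cA j y \<in> ?L" using am cA_closed I'(1) unfolding gr_ideal_iff by blast
  qed
  then have gL: "L = I \<or> L = carrier A" if "I \<subseteq> L" using I'(2) that unfolding L_def by blast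
  have IL: "I \<subseteq> ?L"
  proof
    fix i assume i: "i \<in> I"
    then have "i = \<zero>\<^bsub>A\<^esub> \<otimes>\<^bsub>A\<^esub> x \<oplus>\<^bsub>A\<^esub> i" using xA IA by simp
    then show "i \<in> ?L" using i by blast
  qed
  have "x \<in> ?L"
  proof -
    have "x = \<one>\<^bsub>A\<^esub> \<otimes>\<^bsub>A\<^esub> x \<oplus>\<^bsub>A\<^esub> \<zero>\<^bsub>A\<^esub>" using xA by simp
    then show ?thesis using I'(1) unfolding gr_ideal_iff by blast
  qed
  then have "L = carrier A" using gL[folded L_def] IL[folded L_def] x unfolding L_def[symmetric] by blast
  then have "\<one>\<^bsub>A\<^esub> \<in> ?L" using A.one_closed unfolding L_def by (rule ssubst)
  then obtain a m where am: "\<one>\<^bsub>A\<^esub> = a \<otimes>\<^bsub>A\<^esub> x \<oplus>\<^bsub>A\<^esub> m" "a \<in> carrier A" "m \<in> I" by auto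
  have "\<one>\<^bsub>A\<^esub> = cA 0 a \<otimes>\<^bsub>A\<^esub> x \<oplus>\<^bsub>A\<^esub> cA 0 m"
  proof -
    have "cA 0 \<one>\<^bsub>A\<^esub> = cA 0 (a \<otimes>\<^bsub>A\<^esub> x \<oplus>\<^bsub>A\<^esub> m)" by (rule arg_cong[OF am(1), of "cA 0"])
    also have "\<dots> = cA 0 a \<otimes>\<^bsub>A\<^esub> x \<oplus>\<^bsub>A\<^esub> cA 0 m"
      using am(2) IA[OF am(3)] xA by (simp add: cA0_same[OF x(1)] cA_add cA_mult_0)
    finally show ?thesis unfolding cA_one .
  qed
  moreover have "cA 0 m \<in> I \<inter> H 0" using I'(1) am IA cA_in unfolding gr_ideal_iff by blast
  ultimately show thesis using that cA_in am by blast
qed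

text \<open>If e r were outside a maximal I, then 1 = a e r + m with m in I. Multiplying by r on the
  left gives (1 - r a e) r = r m in I. Since r a e lies in \<open>rad0\<close>, the factor 1 - r a e
  has a left inverse, so r and with it e r lie in I after all.\<close>

lemma rad0_right:
  assumes e: "e \<in> rad0" and r: "r \<in> H 0" shows "e \<otimes>\<^bsub>A\<^esub> r \<in> rad0"
proof -
  have eA: "e \<in> carrier A" "e \<in> H 0" and rA: "r \<in> carrier A" using e r H0_carrier by auto
  have er: "e \<otimes>\<^bsub>A\<^esub> r \<in> H 0" using e r H0_mult by auto
  have "e \<otimes>\<^bsub>A\<^esub> r \<in> I" if I: "max_graded_left_ideal A I" for I
  proof (rule ccontr)
    assume n: "e \<otimes>\<^bsub>A\<^esub> r \<notin> I"
    have gI: "gr_ideal I" using I by (auto simp: max_graded_left_ideal_def)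
    obtain a m where am: "a \<in> H 0" "m \<in> I \<inter> H 0" "\<one>\<^bsub>A\<^esub> = a \<otimes>\<^bsub>A\<^esub> (e \<otimes>\<^bsub>A\<^esub> r) \<oplus>\<^bsub>A\<^esub> m"
      using max_gr_ideal_split[OF I er n] by blast
    have aA: "a \<in> carrier A" "m \<in> carrier A" using am H0_carrier by auto
    have "r \<otimes>\<^bsub>A\<^esub> a \<otimes>\<^bsub>A\<^esub> e \<in> rad0" using rad0_ideal e H0_mult[OF r am(1)] by (auto simp: deg0_ideal_iff)
    then obtain t where t: "t \<in> H 0" "t \<otimes>\<^bsub>A\<^esub> (\<one>\<^bsub>A\<^esub> \<ominus>\<^bsub>A\<^esub> r \<otimes>\<^bsub>A\<^esub> a \<otimes>\<^bsub>A\<^esub> e) = \<one>\<^bsub>A\<^esub>"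
      using rad0_quasi_inverse by blast
    have tA: "t \<in> carrier A" using t H0_carrier by auto
    have "r = r \<otimes>\<^bsub>A\<^esub> (a \<otimes>\<^bsub>A\<^esub> (e \<otimes>\<^bsub>A\<^esub> r) \<oplus>\<^bsub>A\<^esub> m)" using am(3)[symmetric] rA by simp
    also have "\<dots> = (r \<otimes>\<^bsub>A\<^esub> a \<otimes>\<^bsub>A\<^esub> e) \<otimes>\<^bsub>A\<^esub> r \<oplus>\<^bsub>A\<^esub> r \<otimes>\<^bsub>A\<^esub> m"
      using aA eA rA by (simp add: A.r_distr A.m_assoc)
    finally have "r \<ominus>\<^bsub>A\<^esub> (r \<otimes>\<^bsub>A\<^esub> a \<otimes>\<^bsub>A\<^esub> e) \<otimes>\<^bsub>A\<^esub> r = r \<otimes>\<^bsub>A\<^esub> m"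
      using aA eA rA by (metis A.add.inv_solve_left A.add.m_comm A.m_closed a_minus_def A.a_inv_closed)
    then have "(\<one>\<^bsub>A\<^esub> \<ominus>\<^bsub>A\<^esub> r \<otimes>\<^bsub>A\<^esub> a \<otimes>\<^bsub>A\<^esub> e) \<otimes>\<^bsub>A\<^esub> r = r \<otimes>\<^bsub>A\<^esub> m"
      using aA eA rA by (simp add: a_minus_def A.l_distr A.l_minus)
    then have "t \<otimes>\<^bsub>A\<^esub> (r \<otimes>\<^bsub>A\<^esub> m) = t \<otimes>\<^bsub>A\<^esub> (\<one>\<^bsub>A\<^esub> \<ominus>\<^bsub>A\<^esub> r \<otimes>\<^bsub>A\<^esub> a \<otimes>\<^bsub>A\<^esub> e) \<otimes>\<^bsub>A\<^esub> r"
      using aA eA rA tA by (simp add: A.m_assoc)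
    also have "\<dots> = r" using t rA by simp
    finally have "r \<in> I" using gI am tA rA by (metis IntD1 gr_ideal_iff)
    then have "e \<otimes>\<^bsub>A\<^esub> r \<in> I" using gI eA by (auto simp: gr_ideal_iff)
    then show False using n by simp
  qed
  then show ?thesis using er H0_carrier by (auto simp: graded_jacobson_radical_def)
qed

text \<open>L is minimal among the left ideals with I + L = A0. If some x in both I and L were
  outside a maximal M, then 1 = a x + m, and every l in L is l a x + l m with l a x in I and l m in
  the intersection of L and M. That intersection would still supplement I, against
  minimality.\<close>

lemma rad0_complement:
  assumes I: "deg0_ideal I"
  shows "\<exists>L. deg0_ideal L \<and> (\<forall>a\<in>H 0. \<exists>x\<in>I. \<exists>y\<in>L. a = x \<oplus>\<^bsub>A\<^esub> y) \<and> I \<inter> L \<subseteq> rad0"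
proof -
  define Q where "Q L \<longleftrightarrow> (\<forall>a\<in>H 0. \<exists>x\<in>I. \<exists>y\<in>L. a = x \<oplus>\<^bsub>A\<^esub> y)" for L
  have IH: "x \<in> carrier A" "x \<in> H 0" if "x \<in> I" for x using that I H0_carrier by (auto simp: deg0_ideal_iff)
  have "Q (H 0)" unfolding Q_def
  proof
    fix a assume a: "a \<in> H 0"
    then have "a = \<zero>\<^bsub>A\<^esub> \<oplus>\<^bsub>A\<^esub> a" using H0_carrier by simp
    then show "\<exists>x\<in>I. \<exists>y\<in>H 0. a = x \<oplus>\<^bsub>A\<^esub> y" using a I unfolding deg0_ideal_iff by blast
  qed
  then obtain L where L: "deg0_ideal L" "Q L" "\<And>U. deg0_ideal U \<Longrightarrow> Q U \<Longrightarrow> U \<subseteq> L \<Longrightarrow> U = L"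
    using minimal_deg0_ideal[OF deg0_ideal_H0, of Q] by blast
  have LH: "x \<in> carrier A" "x \<in> H 0" if "x \<in> L" for x using that L(1) H0_carrier by (auto simp: deg0_ideal_iff)
  have "x \<in> rad0" if x: "x \<in> I" "x \<in> L" for x
  proof (rule ccontr)
    assume "x \<notin> rad0"
    then obtain M where M: "max_graded_left_ideal A M" "x \<notin> M"
      using IH[OF x(1)] by (auto simp: graded_jacobson_radical_def)
    have gM: "gr_ideal M" using M(1) by (auto simp: max_graded_left_ideal_def)
    obtain a m where am: "a \<in> H 0" "m \<in> M \<inter> H 0" "\<one>\<^bsub>A\<^esub> = a \<otimes>\<^bsub>A\<^esub> x \<oplus>\<^bsub>A\<^esub> m"
      using max_gr_ideal_split[OF M(1) IH(2)[OF x(1)] M(2)] by blast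
    have aA: "a \<in> carrier A" "m \<in> carrier A" "x \<in> carrier A" using am H0_carrier IH x by auto
    have ax: "a \<otimes>\<^bsub>A\<^esub> x \<in> I" "a \<otimes>\<^bsub>A\<^esub> x \<in> L" using I L(1) am x by (auto simp: deg0_ideal_iff)
    have "deg0_ideal (L \<inter> (M \<inter> H 0))" using L(1) gr_ideal_deg0[OF gM] by (auto simp: deg0_ideal_iff)
    moreover have "Q (L \<inter> (M \<inter> H 0))" unfolding Q_def
    proof
      fix b assume "b \<in> H 0"
      then obtain u l where ul: "u \<in> I" "l \<in> L" "b = u \<oplus>\<^bsub>A\<^esub> l" using L(2) by (auto simp: Q_def)
      have lA: "l \<in> carrier A" "l \<in> H 0" "u \<in> carrier A" using ul LH IH by auto
      have l: "l = l \<otimes>\<^bsub>A\<^esub> (a \<otimes>\<^bsub>A\<^esub> x) \<oplus>\<^bsub>A\<^esub> l \<otimes>\<^bsub>A\<^esub> m"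
        using am(3) lA aA by (metis A.m_closed A.r_distr A.r_one)
      have lax: "l \<otimes>\<^bsub>A\<^esub> (a \<otimes>\<^bsub>A\<^esub> x) \<in> I" "l \<otimes>\<^bsub>A\<^esub> (a \<otimes>\<^bsub>A\<^esub> x) \<in> L"
        using ax lA I L(1) by (auto simp: deg0_ideal_iff)
      have "l \<otimes>\<^bsub>A\<^esub> m = l \<ominus>\<^bsub>A\<^esub> l \<otimes>\<^bsub>A\<^esub> (a \<otimes>\<^bsub>A\<^esub> x)"
      proof -
        have "l \<otimes>\<^bsub>A\<^esub> (a \<otimes>\<^bsub>A\<^esub> x) \<oplus>\<^bsub>A\<^esub> l \<otimes>\<^bsub>A\<^esub> m \<ominus>\<^bsub>A\<^esub> l \<otimes>\<^bsub>A\<^esub> (a \<otimes>\<^bsub>A\<^esub> x) = l \<otimes>\<^bsub>A\<^esub> m"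
          using lA aA by (simp add: a_minus_def A.a_ac A.r_neg1 A.r_neg2 A.r_neg)
        then show ?thesis using l by simp
      qed
      then have "l \<otimes>\<^bsub>A\<^esub> m \<in> L" using deg0_ideal_minus[OF L(1) ul(2) lax(2)] by simp
      moreover have "l \<otimes>\<^bsub>A\<^esub> m \<in> M \<inter> H 0" using gM am lA H0_mult by (auto simp: gr_ideal_iff)
      moreover have "b = (u \<oplus>\<^bsub>A\<^esub> l \<otimes>\<^bsub>A\<^esub> (a \<otimes>\<^bsub>A\<^esub> x)) \<oplus>\<^bsub>A\<^esub> l \<otimes>\<^bsub>A\<^esub> m"
        using ul(3) l lA aA by (metis A.a_assoc A.m_closed)
      moreover have "u \<oplus>\<^bsub>A\<^esub> l \<otimes>\<^bsub>A\<^esub> (a \<otimes>\<^bsub>A\<^esub> x) \<in> I" using I ul lax by (auto simp: deg0_ideal_iff)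
      ultimately show "\<exists>x\<in>I. \<exists>y\<in>L \<inter> (M \<inter> H 0). b = x \<oplus>\<^bsub>A\<^esub> y" by blast
    qed
    ultimately have "L \<inter> (M \<inter> H 0) = L" using L(3) by blast
    then show False using x M by blast
  qed
  then show ?thesis using L(1,2) unfolding Q_def by (intro exI[of _ L]) blast
qed

lemma products_carrier: "E \<subseteq> carrier A \<Longrightarrow> products A E n \<subseteq> carrier A"
  by (induction n) auto

text \<open>\<open>la k\<close> consists of the a in A0 killed from the left by all k-fold products
  of \<open>rad0\<close>. This ascending chain becomes stationary at some k. If 1 is not in
  \<open>la k\<close>, take L minimal among the left ideals strictly above it: then
  \<open>rad0\<close> maps an x of L outside \<open>la k\<close> into \<open>la k\<close>, so x lies
  in \<open>la (Suc k)\<close>, which is \<open>la k\<close>.\<close>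

lemma rad0_nilpotent: "\<exists>n. products A rad0 n \<subseteq> {\<zero>\<^bsub>A\<^esub>}"
proof -
  have r0A: "rad0 \<subseteq> carrier A" using H0_carrier by auto
  note pA = subsetD[OF products_carrier[OF r0A]]
  define la where "la k = {a \<in> H 0. \<forall>p\<in>products A rad0 k. p \<otimes>\<^bsub>A\<^esub> a = \<zero>\<^bsub>A\<^esub>}" for k
  have la: "deg0_ideal (la k)" for k
  proof (cases k)
    case 0
    then have "la k = {\<zero>\<^bsub>A\<^esub>}" using H_zero H0_carrier by (auto simp: la_def)
    then show ?thesis using H_zero H0_carrier by (auto simp: deg0_ideal_iff)
  next
    case (Suc n)
    \<comment> \<open>Closure under left multiplication needs that \<open>rad0\<close> is a right
      ideal: the last factor e of p absorbs a.\<close>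
    have "p \<otimes>\<^bsub>A\<^esub> (a \<otimes>\<^bsub>A\<^esub> x) = \<zero>\<^bsub>A\<^esub>" if "a \<in> H 0" "x \<in> la k" and p: "p \<in> products A rad0 k" for p a x
    proof -
      obtain q e where q: "q \<in> products A rad0 n" "e \<in> rad0" "p = q \<otimes>\<^bsub>A\<^esub> e" 
        using p unfolding Suc products.simps by blast
      have "q \<otimes>\<^bsub>A\<^esub> (e \<otimes>\<^bsub>A\<^esub> a) \<in> products A rad0 k"
        using q(1) rad0_right[OF q(2) that(1)] unfolding Suc products.simps by blast
      then have "(q \<otimes>\<^bsub>A\<^esub> (e \<otimes>\<^bsub>A\<^esub> a)) \<otimes>\<^bsub>A\<^esub> x = \<zero>\<^bsub>A\<^esub>" using that by (auto simp: la_def)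
      then show ?thesis using q that pA[OF q(1)] r0A H0_carrier by (simp add: A.m_assoc la_def)
    qed
    then show ?thesis using pA
      by (auto simp: deg0_ideal_iff la_def H_zero H_add H0_mult H0_carrier A.r_distr)
  qed
  have laS: "a \<in> la (Suc k) \<longleftrightarrow> a \<in> H 0 \<and> (\<forall>e\<in>rad0. e \<otimes>\<^bsub>A\<^esub> a \<in> la k)" for a k
  proof -
    have "(\<forall>p\<in>products A rad0 (Suc k). p \<otimes>\<^bsub>A\<^esub> a = \<zero>\<^bsub>A\<^esub>) \<longleftrightarrow>
        (\<forall>e\<in>rad0. \<forall>p\<in>products A rad0 k. p \<otimes>\<^bsub>A\<^esub> (e \<otimes>\<^bsub>A\<^esub> a) = \<zero>\<^bsub>A\<^esub>)" if "a \<in> H 0"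
    proof -
      have "p \<otimes>\<^bsub>A\<^esub> e \<otimes>\<^bsub>A\<^esub> a = p \<otimes>\<^bsub>A\<^esub> (e \<otimes>\<^bsub>A\<^esub> a)"
        if "p \<in> products A rad0 k" "e \<in> rad0" for p e
        using that pA[of p k] r0A \<open>a \<in> H 0\<close> H0_carrier[of a] by (intro A.m_assoc) auto
      then show ?thesis unfolding products.simps by (auto 0 3; metis IntI)
    qed
    then show ?thesis using H0_mult by (auto simp: la_def)
  qed
  have mono: "la k \<subseteq> la (Suc k)" for k
    using la[of k] rad0_ideal unfolding laS deg0_ideal_iff by (auto simp: laS)
  obtain \<mu> :: "'a set \<Rightarrow> nat" and n :: nat where \<mu>: "\<And>U. deg0_ideal U \<Longrightarrow> \<mu> U \<le> n"
    "\<And>U U'. deg0_ideal U \<Longrightarrow> deg0_ideal U' \<Longrightarrow> U' \<subset> U \<Longrightarrow> \<mu> U' < \<mu> U"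
    using deg0_ideal_rank by blast
  have "\<exists>k. la (Suc k) = la k"
  proof (rule ccontr)
    assume "\<nexists>k. la (Suc k) = la k"
    then have "\<mu> (la k) < \<mu> (la (Suc k))" for k 
      using \<mu>(2)[OF la[of "Suc k"] la[of k]] mono[of k] by (metis psubsetI)
    then have "k \<le> \<mu> (la k)" for k by (induction k) (auto simp: Suc_le_eq intro: le_less_trans)
    then show False using \<mu>(1)[OF la, of "Suc n"] by (metis Suc_n_not_le_n le_trans)
  qed
  then obtain k where k: "la (Suc k) = la k" by blast
  have "\<one>\<^bsub>A\<^esub> \<in> la k"
  proof (rule ccontr)
    assume "\<one>\<^bsub>A\<^esub> \<notin> la k"
    then have "la k \<subset> H 0" using la[of k] one_H by (auto simp: deg0_ideal_iff)
    then obtain L where L: "deg0_ideal L" "la k \<subset> L" "\<And>U. deg0_ideal U \<Longrightarrow> la k \<subset> U \<Longrightarrow> U \<subseteq> L \<Longrightarrow> U = L"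
      using minimal_deg0_ideal[OF deg0_ideal_H0, of "\<lambda>L. la k \<subset> L"] by blast
    obtain x where x: "x \<in> L" "x \<notin> la k" using L(2) by auto
    have xH: "x \<in> H 0" "x \<in> carrier A" using x L(1) H0_carrier by (auto simp: deg0_ideal_iff)
    \<comment> \<open>Otherwise minimality of L makes \<open>la k\<close> + A0 e x equal to L, so x
      = m + r e x for some m in \<open>la k\<close>. The left inverse of 1 - r e then gives x = t m
      in \<open>la k\<close>.\<close>
    have "e \<otimes>\<^bsub>A\<^esub> x \<in> la k" if e: "e \<in> rad0" for e
    proof (rule ccontr)
      assume ex: "e \<otimes>\<^bsub>A\<^esub> x \<notin> la k"
      have eA: "e \<in> carrier A" "e \<in> H 0" using e r0A by auto
      have exL: "e \<otimes>\<^bsub>A\<^esub> x \<in> L" "e \<otimes>\<^bsub>A\<^esub> x \<in> H 0" using L(1) x eA by (auto simp: deg0_ideal_iff)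
      have laA: "m \<in> carrier A" "m \<in> H 0" if "m \<in> la k" for m using that H0_carrier by (auto simp: la_def)
      let ?U = "{m \<oplus>\<^bsub>A\<^esub> r \<otimes>\<^bsub>A\<^esub> (e \<otimes>\<^bsub>A\<^esub> x) | m r. m \<in> la k \<and> r \<in> H 0}"
      have "deg0_ideal ?U" unfolding deg0_ideal_iff
      proof (intro conjI ballI)
        show "?U \<subseteq> H 0" using laA exL H_add H0_mult by auto
        have "\<zero>\<^bsub>A\<^esub> = \<zero>\<^bsub>A\<^esub> \<oplus>\<^bsub>A\<^esub> \<zero>\<^bsub>A\<^esub> \<otimes>\<^bsub>A\<^esub> (e \<otimes>\<^bsub>A\<^esub> x)" using eA xH by simp
        then show "\<zero>\<^bsub>A\<^esub> \<in> ?U" using la[of k] H_zero unfolding deg0_ideal_iff by blast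
        fix y assume "y \<in> ?U"
        then obtain m r where mr: "y = m \<oplus>\<^bsub>A\<^esub> r \<otimes>\<^bsub>A\<^esub> (e \<otimes>\<^bsub>A\<^esub> x)" "m \<in> la k" "r \<in> H 0" by auto
        { fix z assume "z \<in> ?U"
          then obtain n s where ns: "z = n \<oplus>\<^bsub>A\<^esub> s \<otimes>\<^bsub>A\<^esub> (e \<otimes>\<^bsub>A\<^esub> x)" "n \<in> la k" "s \<in> H 0" by auto
          have "y \<oplus>\<^bsub>A\<^esub> z = (m \<oplus>\<^bsub>A\<^esub> n) \<oplus>\<^bsub>A\<^esub> (r \<oplus>\<^bsub>A\<^esub> s) \<otimes>\<^bsub>A\<^esub> (e \<otimes>\<^bsub>A\<^esub> x)"
            using mr ns laA H0_carrier eA xH by (simp add: A.l_distr A.a_ac)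
          then show "y \<oplus>\<^bsub>A\<^esub> z \<in> ?U" using mr ns la[of k] H_add unfolding deg0_ideal_iff by blast }
        fix a assume a: "a \<in> H 0"
        have "a \<otimes>\<^bsub>A\<^esub> y = (a \<otimes>\<^bsub>A\<^esub> m) \<oplus>\<^bsub>A\<^esub> (a \<otimes>\<^bsub>A\<^esub> r) \<otimes>\<^bsub>A\<^esub> (e \<otimes>\<^bsub>A\<^esub> x)"
          using mr a laA H0_carrier eA xH by (simp add: A.r_distr A.m_assoc)
        then show "a \<otimes>\<^bsub>A\<^esub> y \<in> ?U" using mr a la[of k] H0_mult unfolding deg0_ideal_iff by blast
      qed
      moreover have "la k \<subset> ?U"
      proof -
        have "m \<in> ?U" if "m \<in> la k" for m
        proof -
          have "m = m \<oplus>\<^bsub>A\<^esub> \<zero>\<^bsub>A\<^esub> \<otimes>\<^bsub>A\<^esub> (e \<otimes>\<^bsub>A\<^esub> x)" using eA xH laA that by simp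
          then show ?thesis using that H_zero by blast
        qed
        moreover have "e \<otimes>\<^bsub>A\<^esub> x \<in> ?U"
        proof -
          have "e \<otimes>\<^bsub>A\<^esub> x = \<zero>\<^bsub>A\<^esub> \<oplus>\<^bsub>A\<^esub> \<one>\<^bsub>A\<^esub> \<otimes>\<^bsub>A\<^esub> (e \<otimes>\<^bsub>A\<^esub> x)" using eA xH by simp
          then show ?thesis using la[of k] one_H unfolding deg0_ideal_iff by blast
        qed
        ultimately show ?thesis using ex by blast
      qed
      moreover have "?U \<subseteq> L"
      proof
        fix y assume "y \<in> ?U"
        then obtain m r where mr: "y = m \<oplus>\<^bsub>A\<^esub> r \<otimes>\<^bsub>A\<^esub> (e \<otimes>\<^bsub>A\<^esub> x)" "m \<in> la k" "r \<in> H 0" by auto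
        then have "m \<in> L" "r \<otimes>\<^bsub>A\<^esub> (e \<otimes>\<^bsub>A\<^esub> x) \<in> L" using L(1,2) exL(1) by (auto simp: deg0_ideal_iff)
        then show "y \<in> L" using L(1) mr(1) by (auto simp: deg0_ideal_iff)
      qed
      ultimately have "x \<in> ?U" using L(3) x(1) by blast
      then obtain m r where mr: "x = m \<oplus>\<^bsub>A\<^esub> r \<otimes>\<^bsub>A\<^esub> (e \<otimes>\<^bsub>A\<^esub> x)" "m \<in> la k" "r \<in> H 0" by auto
      have rA: "r \<in> carrier A" "m \<in> carrier A" using mr laA H0_carrier by auto
      have "r \<otimes>\<^bsub>A\<^esub> e \<in> rad0" using rad0_ideal e mr by (auto simp: deg0_ideal_iff)
      then obtain t where t: "t \<in> H 0" "t \<otimes>\<^bsub>A\<^esub> (\<one>\<^bsub>A\<^esub> \<ominus>\<^bsub>A\<^esub> r \<otimes>\<^bsub>A\<^esub> e) = \<one>\<^bsub>A\<^esub>"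
        using rad0_quasi_inverse by blast
      have tA: "t \<in> carrier A" using t H0_carrier by auto
      have "m = x \<ominus>\<^bsub>A\<^esub> r \<otimes>\<^bsub>A\<^esub> (e \<otimes>\<^bsub>A\<^esub> x)"
        using mr(1) rA eA xH by (metis A.add.inv_solve_right' A.m_closed a_minus_def)
      also have "\<dots> = (\<one>\<^bsub>A\<^esub> \<ominus>\<^bsub>A\<^esub> r \<otimes>\<^bsub>A\<^esub> e) \<otimes>\<^bsub>A\<^esub> x"
        using rA eA xH by (simp add: a_minus_def A.l_distr A.l_minus A.m_assoc)
      finally have "t \<otimes>\<^bsub>A\<^esub> m = (t \<otimes>\<^bsub>A\<^esub> (\<one>\<^bsub>A\<^esub> \<ominus>\<^bsub>A\<^esub> r \<otimes>\<^bsub>A\<^esub> e)) \<otimes>\<^bsub>A\<^esub> x"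
        using rA eA xH tA by (simp add: A.m_assoc)
      also have "\<dots> = x" using t xH by simp
      finally have "x \<in> la k" using la[of k] t mr(2) by (auto simp: deg0_ideal_iff)
      then show False using x by simp
    qed
    then have "x \<in> la (Suc k)" using laS xH by auto
    then show False using k x by simp
  qed
  then have "products A rad0 k \<subseteq> {\<zero>\<^bsub>A\<^esub>}" using pA by (force simp: la_def)
  then show ?thesis by blast
qed

lemma rad0_radical: "deg0_radical K A rad0"
  by unfold_locales (use rad0_ideal rad0_right rad0_nilpotent rad0_complement in auto)

text \<open>For the zero ideal the complement axiom is semisimplicity itself, read through the
  identification of left ideals of \<open>degree_zero_part A\<close> with subsets satisfying
  \<open>deg0_ideal\<close>.\<close>

lemma semisimple_radical:
  assumes "semisimple_ring (degree_zero_part A)"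
  shows "deg0_radical K A {\<zero>\<^bsub>A\<^esub>}"
proof
  let ?R = "degree_zero_part A"
  have R: "carrier ?R = H 0" "add ?R = add A" "zero ?R = zero A" "mult ?R = mult A" "one ?R = one A"
    by (auto simp: degree_zero_part_def H_0)
  show "deg0_ideal {\<zero>\<^bsub>A\<^esub>}" using H_zero H0_carrier by (auto simp: deg0_ideal_iff)
  show "e \<otimes>\<^bsub>A\<^esub> r \<in> {\<zero>\<^bsub>A\<^esub>}" if "e \<in> {\<zero>\<^bsub>A\<^esub>}" "r \<in> H 0" for e r using that H0_carrier by auto
  have "products A {\<zero>\<^bsub>A\<^esub>} 1 \<subseteq> {\<zero>\<^bsub>A\<^esub>}" by auto
  then show "\<exists>n. products A {\<zero>\<^bsub>A\<^esub>} n \<subseteq> {\<zero>\<^bsub>A\<^esub>}" by blast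
  have ag: "abelian_group ?R"
    by (rule abelian_group_restrict[OF A.abelian_group_axioms])
       (use R submodule.axioms(1)[OF homog_submodule[of 0]] in \<open>auto simp: additive_subgroup_def H_0\<close>)
  have mon: "monoid ?R"
    by (rule monoidI; unfold R) (simp_all add: H0_carrier H0_mult one_H A.m_assoc)
  interpret R: ring ?R
    by (rule ringI[OF ag mon]; unfold R) (simp_all add: H0_carrier A.l_distr A.r_distr)
  have lm: "left_module ?R (regular_module ?R)"
  proof -
    have "abelian_group (regular_module ?R)"
      by (rule abelian_group_restrict[OF ag]) (auto simp: regular_module_def additive_subgroup_iff[OF ag])
    then show ?thesis
      by (auto simp: left_module_def left_module_axioms_def R.ring_axioms regular_module_def R.l_distr R.r_distr R.m_assoc)
  qed
  have sub: "submodule I ?R (regular_module ?R) \<longleftrightarrow> deg0_ideal I" for I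
    unfolding left_module.submodule_iff[OF lm] deg0_ideal_iff by (auto simp: regular_module_def R)
  fix I assume "deg0_ideal I"
  then obtain L where L: "deg0_ideal L" "I \<inter> L = {\<zero>\<^bsub>A\<^esub>}" "I <+>\<^bsub>?R\<^esub> L = H 0"
    using assms sub unfolding semisimple_ring_def R by metis
  have "I <+>\<^bsub>?R\<^esub> L = {x \<oplus>\<^bsub>A\<^esub> y | x y. x \<in> I \<and> y \<in> L}" by (auto simp: set_add_def' R)
  then show "\<exists>L. deg0_ideal L \<and> (\<forall>a\<in>H 0. \<exists>x\<in>I. \<exists>y\<in>L. a = x \<oplus>\<^bsub>A\<^esub> y) \<and> I \<inter> L \<subseteq> {\<zero>\<^bsub>A\<^esub>}"
    using L by (intro exI[of _ L]) blast
qed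

end

subsection \<open>Free graded modules in coordinates\<close>

text \<open>The coordinates are part of the data, and generators are indexed by a set separate from
  the module. So the locale covers both a given basis, with \<open>e\<close> the identity, and
  modules built from coefficient functions. The map \<open>e\<close> need not be injective, as may
  happen over the zero ring.\<close>

locale free_module = graded_algebra K A + P: graded_module A P
  for K :: "('k, 'x) ring_scheme" and A :: "('k, 'a, nat) graded" and P :: "('a, 'p, int) graded" +
  fixes G :: "'g set" and deg :: "'g \<Rightarrow> int" and e :: "'g \<Rightarrow> 'p" and \<kappa> :: "'p \<Rightarrow> 'g \<Rightarrow> 'a"
  assumes coord_closed [simp]: "x \<in> carrier P \<Longrightarrow> \<kappa> x g \<in> carrier A"
    and coord_out: "x \<in> carrier P \<Longrightarrow> g \<notin> G \<Longrightarrow> \<kappa> x g = \<zero>\<^bsub>A\<^esub>"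
    and coord_fin: "x \<in> carrier P \<Longrightarrow> finite {g. \<kappa> x g \<noteq> \<zero>\<^bsub>A\<^esub>}"
    and coord_add: "\<lbrakk>x \<in> carrier P; y \<in> carrier P\<rbrakk> \<Longrightarrow> \<kappa> (x \<oplus>\<^bsub>P\<^esub> y) g = \<kappa> x g \<oplus>\<^bsub>A\<^esub> \<kappa> y g"
    and coord_smult: "\<lbrakk>a \<in> carrier A; x \<in> carrier P\<rbrakk> \<Longrightarrow> \<kappa> (a \<odot>\<^bsub>P\<^esub> x) g = a \<otimes>\<^bsub>A\<^esub> \<kappa> x g"
    and coord_sum: "x \<in> carrier P \<Longrightarrow> x = (\<Oplus>\<^bsub>P\<^esub>g\<in>{g. \<kappa> x g \<noteq> \<zero>\<^bsub>A\<^esub>}. \<kappa> x g \<odot>\<^bsub>P\<^esub> e g)"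
    and basis_homog: "g \<in> G \<Longrightarrow> e g \<in> homog P (deg g)"
    and coord_basis: "g \<in> G \<Longrightarrow> \<kappa> (e g) h = (if h = g then \<one>\<^bsub>A\<^esub> else \<zero>\<^bsub>A\<^esub>)"
begin

lemma basis_carrier: "g \<in> G \<Longrightarrow> e g \<in> carrier P"
  using basis_homog P.D_carrier by blast

lemma coord_zero: "\<kappa> \<zero>\<^bsub>P\<^esub> g = \<zero>\<^bsub>A\<^esub>"
  using coord_smult[of "\<zero>\<^bsub>A\<^esub>" "\<zero>\<^bsub>P\<^esub>" g] by (simp add: P.smult_r_null)

lemma coord_supp: "x \<in> carrier P \<Longrightarrow> \<kappa> x g \<noteq> \<zero>\<^bsub>A\<^esub> \<Longrightarrow> g \<in> G"
  using coord_out by blast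

lemma span_induct:
  assumes "x \<in> carrier P" "U \<subseteq> carrier P" "\<zero>\<^bsub>P\<^esub> \<in> U" "\<And>x y. x \<in> U \<Longrightarrow> y \<in> U \<Longrightarrow> x \<oplus>\<^bsub>P\<^esub> y \<in> U"
    "\<And>g. g \<in> G \<Longrightarrow> \<kappa> x g \<noteq> \<zero>\<^bsub>A\<^esub> \<Longrightarrow> \<kappa> x g \<odot>\<^bsub>P\<^esub> e g \<in> U"
  shows "x \<in> U"
proof -
  have "(\<Oplus>\<^bsub>P\<^esub>g\<in>{g. \<kappa> x g \<noteq> \<zero>\<^bsub>A\<^esub>}. \<kappa> x g \<odot>\<^bsub>P\<^esub> e g) \<in> U"
    by (rule P.M.finsum_in_subset) (use assms coord_supp in auto)
  then show ?thesis using coord_sum[OF assms(1)] by simp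
qed

text \<open>The disjunction is there because some generators do not lie in U although their
  multiples by the coefficients of x do; the choice may depend on g.\<close>

lemma submodule_gen:
  assumes "x \<in> carrier P" "submodule U A P"
    "\<And>g. g \<in> G \<Longrightarrow> \<kappa> x g \<noteq> \<zero>\<^bsub>A\<^esub> \<Longrightarrow> e g \<in> U \<or> \<kappa> x g \<odot>\<^bsub>P\<^esub> e g \<in> U"
  shows "x \<in> U"
proof (rule span_induct[OF assms(1)])
  show "\<kappa> x g \<odot>\<^bsub>P\<^esub> e g \<in> U" if "g \<in> G" "\<kappa> x g \<noteq> \<zero>\<^bsub>A\<^esub>" for g
    using assms(3)[OF that] assms(1,2) by (auto simp: P.submodule_iff)
qed (use assms(2) in \<open>auto simp: P.submodule_iff\<close>)

lemma coord_component:
  assumes "x \<in> carrier P"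
  shows "\<kappa> (component P j x) h = cA (j - deg h) (\<kappa> x h)"
proof -
  let ?U = "{x \<in> carrier P. \<forall>h. \<kappa> (component P j x) h = cA (j - deg h) (\<kappa> x h)}"
  have "x \<in> ?U"
  proof (rule span_induct[OF assms])
    fix g assume g: "g \<in> G"
    have "\<kappa> (component P j (\<kappa> x g \<odot>\<^bsub>P\<^esub> e g)) h = cA (j - deg h) (\<kappa> (\<kappa> x g \<odot>\<^bsub>P\<^esub> e g) h)" for h
      using g assms component_smult[OF P.graded_module_axioms _ basis_homog[OF g]]
      by (simp add: coord_smult basis_carrier coord_basis cA_zero)
    then show "\<kappa> x g \<odot>\<^bsub>P\<^esub> e g \<in> ?U" using assms g by (simp add: P.smult_closed basis_carrier)
  qed (auto simp: P.components_add coord_add cA_add coord_zero cA_zero)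
  then show ?thesis by simp
qed

lemma coord_homog: "x \<in> homog P j \<Longrightarrow> \<kappa> x g \<in> H (j - deg g)"
proof -
  assume x: "x \<in> homog P j"
  then have xc: "x \<in> carrier P" by (rule P.D_carrier)
  have "cA (j - deg g) (\<kappa> x g) = \<kappa> x g"
    using coord_component[OF xc, of j g, symmetric] P.components_same[OF x, of j] by simp
  then show ?thesis using cA_in[OF coord_closed[OF xc, of g], of "j - deg g"] by simp
qed

lemma homog_induct:
  assumes "x \<in> homog P j" "U \<subseteq> carrier P" "\<zero>\<^bsub>P\<^esub> \<in> U" "\<And>x y. x \<in> U \<Longrightarrow> y \<in> U \<Longrightarrow> x \<oplus>\<^bsub>P\<^esub> y \<in> U"
    "\<And>g a. g \<in> G \<Longrightarrow> a \<in> H (j - deg g) \<Longrightarrow> a \<odot>\<^bsub>P\<^esub> e g \<in> U"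
  shows "x \<in> U"
  by (rule span_induct) (use assms coord_homog P.D_carrier in auto)

definition lin_ext :: "('a, 'n, 'z) module_scheme \<Rightarrow> ('g \<Rightarrow> 'n) \<Rightarrow> 'p \<Rightarrow> 'n" where
  "lin_ext N v x = (\<Oplus>\<^bsub>N\<^esub>g\<in>{g. \<kappa> x g \<noteq> \<zero>\<^bsub>A\<^esub>}. \<kappa> x g \<odot>\<^bsub>N\<^esub> v g)"

lemma lin_ext:
  assumes "left_module A N" "\<And>g. g \<in> G \<Longrightarrow> v g \<in> carrier N"
  shows "lin_ext N v \<in> lin_maps A P N" "g \<in> G \<Longrightarrow> lin_ext N v (e g) = v g"
proof -
  interpret N: left_module A N by fact
  have sup: "lin_ext N v x = (\<Oplus>\<^bsub>N\<^esub>g\<in>F. \<kappa> x g \<odot>\<^bsub>N\<^esub> v g)"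
    if "x \<in> carrier P" "finite F" "F \<subseteq> G" "{g. \<kappa> x g \<noteq> \<zero>\<^bsub>A\<^esub>} \<subseteq> F" for x F
    unfolding lin_ext_def
    by (rule N.M.add.finprod_mono_neutral_cong_left)
       (use that assms(2) in \<open>auto simp: N.smult_l_null N.smult_closed subset_iff\<close>)
  have vc: "x \<in> carrier P \<Longrightarrow> g \<in> G \<Longrightarrow> \<kappa> x g \<odot>\<^bsub>N\<^esub> v g \<in> carrier N" for x g
    using assms(2) by (simp add: N.smult_closed)
  show "lin_ext N v \<in> lin_maps A P N" unfolding lin_maps_def
  proof (intro CollectI conjI ballI)
    show "lin_ext N v \<in> carrier P \<rightarrow> carrier N"
      unfolding lin_ext_def by (auto intro!: N.M.finsum_closed vc coord_supp)
    fix x assume x: "x \<in> carrier P"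
    { fix y assume y: "y \<in> carrier P"
      let ?F = "{g. \<kappa> x g \<noteq> \<zero>\<^bsub>A\<^esub>} \<union> {g. \<kappa> y g \<noteq> \<zero>\<^bsub>A\<^esub>}"
      have F: "finite ?F" "?F \<subseteq> G" using coord_fin coord_supp x y by auto
      have sub: "{g. \<kappa> (x \<oplus>\<^bsub>P\<^esub> y) g \<noteq> \<zero>\<^bsub>A\<^esub>} \<subseteq> ?F" using x y by (auto simp: coord_add)
      have "lin_ext N v (x \<oplus>\<^bsub>P\<^esub> y) = (\<Oplus>\<^bsub>N\<^esub>g\<in>?F. \<kappa> (x \<oplus>\<^bsub>P\<^esub> y) g \<odot>\<^bsub>N\<^esub> v g)"
        by (rule sup[OF _ F sub]) (use x y in auto)
      also have "\<dots> = (\<Oplus>\<^bsub>N\<^esub>g\<in>?F. \<kappa> x g \<odot>\<^bsub>N\<^esub> v g \<oplus>\<^bsub>N\<^esub> \<kappa> y g \<odot>\<^bsub>N\<^esub> v g)"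
        by (rule N.M.finsum_cong') (use x y F(2) assms(2) vc in \<open>auto simp: coord_add N.smult_l_distr subset_iff\<close>)
      also have "\<dots> = (\<Oplus>\<^bsub>N\<^esub>g\<in>?F. \<kappa> x g \<odot>\<^bsub>N\<^esub> v g) \<oplus>\<^bsub>N\<^esub> (\<Oplus>\<^bsub>N\<^esub>g\<in>?F. \<kappa> y g \<odot>\<^bsub>N\<^esub> v g)"
        by (rule N.M.finsum_addf) (use x y F(2) vc in auto)
      also have "\<dots> = lin_ext N v x \<oplus>\<^bsub>N\<^esub> lin_ext N v y"
        using sup[OF x F] sup[OF y F] by auto
      finally show "lin_ext N v (x \<oplus>\<^bsub>P\<^esub> y) = lin_ext N v x \<oplus>\<^bsub>N\<^esub> lin_ext N v y" . }
    fix a assume a: "a \<in> carrier A"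
    let ?F = "{g. \<kappa> x g \<noteq> \<zero>\<^bsub>A\<^esub>}"
    have F: "finite ?F" "?F \<subseteq> G" using coord_fin coord_supp x by auto
    have sub: "{g. \<kappa> (a \<odot>\<^bsub>P\<^esub> x) g \<noteq> \<zero>\<^bsub>A\<^esub>} \<subseteq> ?F" using x a by (auto simp: coord_smult)
    have "lin_ext N v (a \<odot>\<^bsub>P\<^esub> x) = (\<Oplus>\<^bsub>N\<^esub>g\<in>?F. \<kappa> (a \<odot>\<^bsub>P\<^esub> x) g \<odot>\<^bsub>N\<^esub> v g)"
      by (rule sup[OF _ F sub]) (use x a in \<open>auto simp: P.smult_closed\<close>)
    also have "\<dots> = (\<Oplus>\<^bsub>N\<^esub>g\<in>?F. a \<odot>\<^bsub>N\<^esub> (\<kappa> x g \<odot>\<^bsub>N\<^esub> v g))"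
      by (rule N.M.finsum_cong') (use x a F(2) assms(2) vc in \<open>auto simp: coord_smult N.smult_assoc N.smult_closed subset_iff\<close>)
    also have "\<dots> = a \<odot>\<^bsub>N\<^esub> lin_ext N v x"
      unfolding lin_ext_def by (rule N.smult_finsum[symmetric]) (use a x F(2) vc in auto)
    finally show "lin_ext N v (a \<odot>\<^bsub>P\<^esub> x) = a \<odot>\<^bsub>N\<^esub> lin_ext N v x" .
  qed
  show "lin_ext N v (e g) = v g" if g: "g \<in> G"
  proof -
    have "lin_ext N v (e g) = (\<Oplus>\<^bsub>N\<^esub>h\<in>{g}. \<kappa> (e g) h \<odot>\<^bsub>N\<^esub> v h)"
      by (rule sup) (use g coord_basis basis_carrier in auto)
    also have "\<dots> = v g" using g assms(2)[OF g] by (simp add: coord_basis N.smult_one)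
    finally show ?thesis .
  qed
qed

lemma lin_ext_gr_hom:
  assumes "graded_module A N" "\<And>g. g \<in> G \<Longrightarrow> v g \<in> homog N (deg g)"
  shows "lin_ext N v \<in> gr_hom A P N"
proof -
  interpret N: graded_module A N by fact
  have "lin_ext N v x \<in> homog N j" if "x \<in> homog P j" for j x
    unfolding lin_ext_def
  proof (rule N.M.finsum_in_subset)
    show "\<kappa> x g \<odot>\<^bsub>N\<^esub> v g \<in> homog N j" if "g \<in> {g. \<kappa> x g \<noteq> \<zero>\<^bsub>A\<^esub>}" for g
    proof -
      have "g \<in> G" using that coord_supp[OF P.D_carrier[OF \<open>x \<in> homog P j\<close>]] by simp
      then show ?thesis
        using H_smult[OF assms(1) coord_homog[OF \<open>x \<in> homog P j\<close>, of g] assms(2)[OF \<open>g \<in> G\<close>]] by simp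
    qed
  qed (use N.D_carrier N.D_zero N.D_add in auto)
  then show ?thesis unfolding gr_hom_iff
    using lin_ext(1)[OF N.left_module_axioms] assms(2) N.D_carrier by blast
qed

end

subsection \<open>Complements over the degree zero part\<close>

context deg0_radical
begin

lemma deg0_submoduleD:
  assumes "deg0_submodule A M j U"
  shows "x \<in> U \<Longrightarrow> x \<in> homog M j" "\<zero>\<^bsub>M\<^esub> \<in> U"
    "x \<in> U \<Longrightarrow> y \<in> U \<Longrightarrow> x \<oplus>\<^bsub>M\<^esub> y \<in> U" "a \<in> H 0 \<Longrightarrow> x \<in> U \<Longrightarrow> a \<odot>\<^bsub>M\<^esub> x \<in> U"
  using assms by (auto simp: deg0_submodule_def H_0)

lemma deg0_submoduleI:
  assumes "\<And>x. x \<in> U \<Longrightarrow> x \<in> homog M j" "\<zero>\<^bsub>M\<^esub> \<in> U"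
    "\<And>x y. x \<in> U \<Longrightarrow> y \<in> U \<Longrightarrow> x \<oplus>\<^bsub>M\<^esub> y \<in> U" "\<And>a x. a \<in> H 0 \<Longrightarrow> x \<in> U \<Longrightarrow> a \<odot>\<^bsub>M\<^esub> x \<in> U"
  shows "deg0_submodule A M j U"
  using assms by (auto simp: deg0_submodule_def H_0)

text \<open>By the hypothesis on \<open>J0\<close>, the quotient of M_j by N is a module over the
  semisimple ring A0/J0. It may have infinite dimension, so the complement W' is found by Zorn's
  lemma, as a maximal submodule meeting W inside N; the work is to show that W + W' is
  everything.\<close>

lemma deg0_complement:
  assumes M: "graded_module A M"
    and N: "deg0_submodule A M j N" and W: "deg0_submodule A M j W" "N \<subseteq> W"
    and J: "\<And>a x. a \<in> J0 \<Longrightarrow> x \<in> homog M j \<Longrightarrow> a \<odot>\<^bsub>M\<^esub> x \<in> N"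
  obtains W' where "deg0_submodule A M j W'" "N \<subseteq> W'" "W \<inter> W' \<subseteq> N"
    "\<And>x. x \<in> homog M j \<Longrightarrow> \<exists>w\<in>W. \<exists>w'\<in>W'. x = w \<oplus>\<^bsub>M\<^esub> w'"
proof -
  interpret M: graded_module A M by fact
  define \<U> where "\<U> = {U. deg0_submodule A M j U \<and> N \<subseteq> U \<and> W \<inter> U \<subseteq> N}"
  have "\<exists>W'\<in>\<U>. \<forall>U\<in>\<U>. W' \<subseteq> U \<longrightarrow> U = W'"
  proof (rule subset_Zorn_nonempty)
    show "\<U> \<noteq> {}" using N by (auto simp: \<U>_def)
    fix C assume C: "C \<noteq> {}" "subset.chain \<U> C"
    have CU: "deg0_submodule A M j c" "N \<subseteq> c" "W \<inter> c \<subseteq> N" if "c \<in> C" for c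
      using C that by (auto simp: subset.chain_def \<U>_def)
    obtain c where c: "c \<in> C" using C(1) by auto
    have "deg0_submodule A M j (\<Union>C)" unfolding deg0_submodule_def
    proof (intro conjI ballI)
      show "\<Union>C \<subseteq> homog M j" using CU(1) unfolding deg0_submodule_def by blast
      show "\<zero>\<^bsub>M\<^esub> \<in> \<Union>C" using CU(1) c unfolding deg0_submodule_def by blast
      show "a \<odot>\<^bsub>M\<^esub> x \<in> \<Union>C" if "a \<in> homog A 0" "x \<in> \<Union>C" for a x
        using that CU(1) unfolding deg0_submodule_def by blast
      fix x y assume xy: "x \<in> \<Union>C" "y \<in> \<Union>C"
      obtain c d where cd: "x \<in> c" "y \<in> d" "c \<in> C" "d \<in> C" using xy by blast
      have "c \<subseteq> d \<or> d \<subseteq> c" using C(2) cd(3,4) unfolding subset_chain_def by blast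
      then obtain b where b: "b \<in> C" "x \<in> b" "y \<in> b" using cd by blast
      then have "x \<oplus>\<^bsub>M\<^esub> y \<in> b" using CU(1)[OF b(1)] unfolding deg0_submodule_def by blast
      then show "x \<oplus>\<^bsub>M\<^esub> y \<in> \<Union>C" using b by blast
    qed
    moreover have "N \<subseteq> \<Union>C" "W \<inter> \<Union>C \<subseteq> N" using CU(2,3) c by blast+
    ultimately show "\<Union>C \<in> \<U>" unfolding \<U>_def by simp
  qed
  then obtain W' where W': "W' \<in> \<U>" and max: "\<And>U. U \<in> \<U> \<Longrightarrow> W' \<subseteq> U \<Longrightarrow> U = W'" by blast
  have W'': "deg0_submodule A M j W'" "N \<subseteq> W'" "W \<inter> W' \<subseteq> N" using W' by (auto simp: \<U>_def)
  note WD = deg0_submoduleD[OF W(1)] and UD = deg0_submoduleD[OF W''(1)]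
  have hc: "x \<in> carrier M" if "x \<in> homog M j" for x
    using that M.D_carrier by auto
  note c = hc[OF WD(1)] hc[OF UD(1)] H0_carrier
  define WW where "WW = {x. \<exists>w\<in>W. \<exists>w'\<in>W'. x = w \<oplus>\<^bsub>M\<^esub> w'}"
  have WWI: "x \<in> WW" if "w \<in> W" "w' \<in> W'" "x = w \<oplus>\<^bsub>M\<^esub> w'" for x w w'
    using that by (auto simp: WW_def)
  have WW: "deg0_submodule A M j WW"
  proof (rule deg0_submoduleI)
    show "\<zero>\<^bsub>M\<^esub> \<in> WW" by (rule WWI[OF WD(2) UD(2)]) simp
    fix x assume "x \<in> WW"
    then obtain w w' where w: "w \<in> W" "w' \<in> W'" "x = w \<oplus>\<^bsub>M\<^esub> w'" unfolding WW_def by blast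
    show "x \<in> homog M j" using M.D_add[OF WD(1)[OF w(1)] UD(1)[OF w(2)]] w(3) by simp
    { fix y assume "y \<in> WW"
      then obtain v v' where v: "v \<in> W" "v' \<in> W'" "y = v \<oplus>\<^bsub>M\<^esub> v'" unfolding WW_def by blast
      have "x \<oplus>\<^bsub>M\<^esub> y = (w \<oplus>\<^bsub>M\<^esub> v) \<oplus>\<^bsub>M\<^esub> (w' \<oplus>\<^bsub>M\<^esub> v')" using w v c by (simp add: M.M.a_ac)
      then show "x \<oplus>\<^bsub>M\<^esub> y \<in> WW" by (rule WWI[OF WD(3)[OF w(1) v(1)] UD(3)[OF w(2) v(2)]]) }
    fix a assume a: "a \<in> H 0"
    have "a \<odot>\<^bsub>M\<^esub> x = a \<odot>\<^bsub>M\<^esub> w \<oplus>\<^bsub>M\<^esub> a \<odot>\<^bsub>M\<^esub> w'" using a w c by (simp add: M.smult_r_distr)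
    then show "a \<odot>\<^bsub>M\<^esub> x \<in> WW" by (rule WWI[OF WD(4)[OF a w(1)] UD(4)[OF a w(2)]])
  qed
  note WWD = deg0_submoduleD[OF WW]
  have WWW: "W \<subseteq> WW"
  proof
    fix w assume w: "w \<in> W"
    show "w \<in> WW" by (rule WWI[OF w UD(2)]) (simp add: c(1)[OF w])
  qed
  have UWW: "W' \<subseteq> WW"
  proof
    fix w assume w: "w \<in> W'"
    show "w \<in> WW" by (rule WWI[OF WD(2) w]) (simp add: c(2)[OF w])
  qed
  have "y \<in> WW" if y: "y \<in> homog M j" for y
  proof -
    have yc: "y \<in> carrier M" using hc y by auto
    \<comment> \<open>The scalars that move y into W + W' form a left ideal containing
      \<open>J0\<close>. A complement L of it modulo \<open>J0\<close> splits 1 as a + f, and only f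
      y remains to be treated.\<close>
    define I where "I = {s \<in> H 0. s \<odot>\<^bsub>M\<^esub> y \<in> WW}"
    have I: "deg0_ideal I" unfolding deg0_ideal_iff
    proof (intro conjI ballI)
      show "\<zero>\<^bsub>A\<^esub> \<in> I" using yc WWD(2) H_zero by (simp add: I_def M.smult_l_null)
      show "s \<oplus>\<^bsub>A\<^esub> t \<in> I" if "s \<in> I" "t \<in> I" for s t
        using that yc WWD(3) H_add c(3) by (simp add: I_def M.smult_l_distr)
      show "a \<otimes>\<^bsub>A\<^esub> s \<in> I" if "a \<in> H 0" "s \<in> I" for a s
        using that yc WWD(4) H0_mult c(3) by (simp add: I_def M.smult_assoc)
    qed (auto simp: I_def)
    have "J0 \<subseteq> I" using J[OF _ y] J0_ideal W''(2) UWW by (auto simp: I_def deg0_ideal_iff)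
    then obtain L where L: "deg0_ideal L" "\<forall>a\<in>H 0. \<exists>x\<in>I. \<exists>y\<in>L. a = x \<oplus>\<^bsub>A\<^esub> y" "I \<inter> L \<subseteq> J0"
      using J0_complement[OF I] by blast
    obtain a f where af: "a \<in> I" "f \<in> L" "\<one>\<^bsub>A\<^esub> = a \<oplus>\<^bsub>A\<^esub> f" using L(2) one_H by blast
    have a: "a \<in> H 0" "a \<in> carrier A" using af(1) c(3) by (auto simp: I_def)
    have f: "f \<in> H 0" "f \<in> carrier A" using af(2) L(1) c(3) by (auto simp: deg0_ideal_iff)
    have fy: "f \<odot>\<^bsub>M\<^esub> y \<in> homog M j" using H_smult[OF M f(1) y] by simp
    have fyc: "f \<odot>\<^bsub>M\<^esub> y \<in> carrier M" by (rule hc[OF fy])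
    define Y where "Y = {x. \<exists>w\<in>W'. \<exists>s\<in>H 0. x = w \<oplus>\<^bsub>M\<^esub> s \<odot>\<^bsub>M\<^esub> (f \<odot>\<^bsub>M\<^esub> y)}"
    have YI: "x \<in> Y" if "w \<in> W'" "s \<in> H 0" "x = w \<oplus>\<^bsub>M\<^esub> s \<odot>\<^bsub>M\<^esub> (f \<odot>\<^bsub>M\<^esub> y)" for x w s
      using that by (auto simp: Y_def)
    have Ysub: "deg0_submodule A M j Y"
    proof (rule deg0_submoduleI)
      show "\<zero>\<^bsub>M\<^esub> \<in> Y" by (rule YI[OF UD(2) H_zero]) (simp add: M.smult_l_null fyc)
      fix x assume "x \<in> Y"
      then obtain w s where w: "w \<in> W'" "s \<in> H 0" "x = w \<oplus>\<^bsub>M\<^esub> s \<odot>\<^bsub>M\<^esub> (f \<odot>\<^bsub>M\<^esub> y)" unfolding Y_def by blast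
      show "x \<in> homog M j" using M.D_add[OF UD(1)[OF w(1)], of "s \<odot>\<^bsub>M\<^esub> (f \<odot>\<^bsub>M\<^esub> y)"] H_smult[OF M w(2) fy] w(3) by simp
      { fix z assume "z \<in> Y"
        then obtain v t where v: "v \<in> W'" "t \<in> H 0" "z = v \<oplus>\<^bsub>M\<^esub> t \<odot>\<^bsub>M\<^esub> (f \<odot>\<^bsub>M\<^esub> y)" unfolding Y_def by blast
        have "x \<oplus>\<^bsub>M\<^esub> z = (w \<oplus>\<^bsub>M\<^esub> v) \<oplus>\<^bsub>M\<^esub> (s \<oplus>\<^bsub>A\<^esub> t) \<odot>\<^bsub>M\<^esub> (f \<odot>\<^bsub>M\<^esub> y)"
          using w v c fyc by (simp add: M.M.a_ac M.smult_l_distr M.smult_closed)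
        then show "x \<oplus>\<^bsub>M\<^esub> z \<in> Y" by (rule YI[OF UD(3)[OF w(1) v(1)] H_add[OF w(2) v(2)]]) }
      fix b assume b: "b \<in> H 0"
      have "b \<odot>\<^bsub>M\<^esub> x = b \<odot>\<^bsub>M\<^esub> w \<oplus>\<^bsub>M\<^esub> (b \<otimes>\<^bsub>A\<^esub> s) \<odot>\<^bsub>M\<^esub> (f \<odot>\<^bsub>M\<^esub> y)"
        using b w c fyc by (simp add: M.smult_r_distr M.smult_assoc M.smult_closed)
      then show "b \<odot>\<^bsub>M\<^esub> x \<in> Y" by (rule YI[OF UD(4)[OF b w(1)] H0_mult[OF b w(2)]])
    qed
    have WY: "W' \<subseteq> Y"
    proof
      fix w assume w: "w \<in> W'"
      show "w \<in> Y" by (rule YI[OF w H_zero]) (simp add: M.smult_l_null fyc c(2)[OF w])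
    qed
    \<comment> \<open>For t = w + s f y in W, the term s f y lies in W + W'. So s f is in both I and
      L, hence in \<open>J0\<close>, and s f y is in N. Thus Y satisfies the condition defining W',
      and maximality puts f y into W'.\<close>
    have "W \<inter> Y \<subseteq> N"
    proof
      fix t assume t: "t \<in> W \<inter> Y"
      then obtain w s where w: "w \<in> W'" "s \<in> H 0" "t = w \<oplus>\<^bsub>M\<^esub> s \<odot>\<^bsub>M\<^esub> (f \<odot>\<^bsub>M\<^esub> y)" unfolding Y_def by blast
      have sA: "s \<in> carrier A" by (rule c(3)[OF w(2)])
      have sfc: "s \<odot>\<^bsub>M\<^esub> (f \<odot>\<^bsub>M\<^esub> y) \<in> carrier M" using sA fyc by (simp add: M.smult_closed)
      have "s \<odot>\<^bsub>M\<^esub> (f \<odot>\<^bsub>M\<^esub> y) = \<ominus>\<^bsub>M\<^esub> w \<oplus>\<^bsub>M\<^esub> t"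
        using w(3) c(2)[OF w(1)] sfc by (simp add: M.M.r_neg1)
      moreover have "\<ominus>\<^bsub>M\<^esub> w \<in> WW" "t \<in> WW"
        using deg0_neg[OF M W''(1) w(1)] t WWW UWW by auto
      ultimately have "s \<odot>\<^bsub>M\<^esub> (f \<odot>\<^bsub>M\<^esub> y) \<in> WW" using WWD(3) by simp
      then have "s \<otimes>\<^bsub>A\<^esub> f \<in> I" using w(2) sA f yc by (simp add: I_def H0_mult M.smult_assoc)
      moreover have "s \<otimes>\<^bsub>A\<^esub> f \<in> L" using L(1) w(2) af(2) by (simp add: deg0_ideal_iff)
      ultimately have "(s \<otimes>\<^bsub>A\<^esub> f) \<odot>\<^bsub>M\<^esub> y \<in> N" using J[OF _ y] L(3) by blast
      then have "s \<odot>\<^bsub>M\<^esub> (f \<odot>\<^bsub>M\<^esub> y) \<in> W'" using sA f yc W''(2) by (auto simp: M.smult_assoc)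
      then have "t \<in> W'" using UD(3)[OF w(1)] w(3) by simp
      then show "t \<in> N" using t W''(3) by auto
    qed
    then have "Y \<in> \<U>" using Ysub W''(2) WY by (auto simp: \<U>_def)
    then have "Y = W'" using max WY by blast
    moreover have "f \<odot>\<^bsub>M\<^esub> y \<in> Y" by (rule YI[OF UD(2) one_H]) (simp add: fyc M.smult_one)
    ultimately have 1: "f \<odot>\<^bsub>M\<^esub> y \<in> WW" using UWW by auto
    have 2: "a \<odot>\<^bsub>M\<^esub> y \<in> WW" using af by (simp add: I_def)
    have "(a \<oplus>\<^bsub>A\<^esub> f) \<odot>\<^bsub>M\<^esub> y = a \<odot>\<^bsub>M\<^esub> y \<oplus>\<^bsub>M\<^esub> f \<odot>\<^bsub>M\<^esub> y"
      using M.smult_l_distr a f yc by simp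
    then have "y = a \<odot>\<^bsub>M\<^esub> y \<oplus>\<^bsub>M\<^esub> f \<odot>\<^bsub>M\<^esub> y"
      unfolding af(3)[symmetric] using yc by (simp add: M.smult_one)
    then show ?thesis using WWD(3)[OF 2 1] by simp
  qed
  then show thesis using that[OF W''] unfolding WW_def by blast
qed

text \<open>\<open>products\<close> appends factors on the right; the argument with left
  annihilators in \<open>cycles_bound\<close> needs them on the left.\<close>

lemma products_cons: "a \<in> J0 \<Longrightarrow> p \<in> products A J0 n \<Longrightarrow> a \<otimes>\<^bsub>A\<^esub> p \<in> products A J0 (Suc n)"
proof (induction n arbitrary: p)
  case 0
  have aA: "a \<in> carrier A" using 0 J0_ideal H0_carrier by (auto simp: deg0_ideal_iff)
  have "a \<otimes>\<^bsub>A\<^esub> p = \<one>\<^bsub>A\<^esub> \<otimes>\<^bsub>A\<^esub> a" using 0 aA by simp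
  then show ?case using 0 by (auto intro!: exI[of _ "\<one>\<^bsub>A\<^esub>"] exI[of _ a])
next
  case (Suc n)
  have J0A: "J0 \<subseteq> carrier A" using J0_ideal H0_carrier by (auto simp: deg0_ideal_iff)
  obtain q b where q: "q \<in> products A J0 n" "b \<in> J0" "p = q \<otimes>\<^bsub>A\<^esub> b" using Suc.prems(2) by auto
  have "a \<otimes>\<^bsub>A\<^esub> p = (a \<otimes>\<^bsub>A\<^esub> q) \<otimes>\<^bsub>A\<^esub> b"
    using q J0A Suc.prems(1) products_carrier[OF J0A, of n] by (auto simp: A.m_assoc subset_iff)
  then show ?case using Suc.IH[OF Suc.prems(1) q(1)] q(2) products.simps(2)[of A J0 "Suc n"] by blast
qed

end

section \<open>Rules for differences in abelian groups\<close>

lemma (in abelian_group) minus_swap: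
  "\<lbrakk>x \<in> carrier G; a \<in> carrier G; b \<in> carrier G\<rbrakk> \<Longrightarrow> x \<ominus> a \<ominus> b = x \<ominus> b \<ominus> a"
  by (simp add: a_minus_def a_ac)

lemma (in abelian_group) minus_add_minus:
  "\<lbrakk>x \<in> carrier G; a \<in> carrier G; b \<in> carrier G\<rbrakk> \<Longrightarrow> (x \<ominus> a) \<oplus> (a \<ominus> b) = x \<ominus> b"
  by (simp add: a_minus_def a_ac r_neg2)

lemma (in abelian_group) minus_minus_cancel:
  "\<lbrakk>x \<in> carrier G; a \<in> carrier G\<rbrakk> \<Longrightarrow> x \<ominus> (x \<ominus> a) = a"
  by (simp add: a_minus_def minus_add r_neg2)

lemma (in abelian_group) minus_self: "x \<in> carrier G \<Longrightarrow> x \<ominus> x = \<zero>"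
  by (simp add: a_minus_def r_neg)

lemma (in abelian_group) minus_zero_right: "x \<in> carrier G \<Longrightarrow> x \<ominus> \<zero> = x"
  by (simp add: a_minus_def add.inv_one)

lemma (in abelian_group) minus_add_cancel: "\<lbrakk>x \<in> carrier G; a \<in> carrier G\<rbrakk> \<Longrightarrow> (x \<ominus> a) \<oplus> a = x"
  by (simp add: a_minus_def a_assoc l_neg)

lemma (in abelian_group) eq_add_of_minus: "\<lbrakk>x \<in> carrier G; a \<in> carrier G; x \<ominus> a = c\<rbrakk> \<Longrightarrow> x = c \<oplus> a"
  using minus_add_cancel by metis

subsection \<open>Complexes of free graded modules\<close>

locale free_complex = deg0_radical K A J0
  for K :: "('k, 'x) ring_scheme" and A :: "('k, 'a, nat) graded" and J0 +
  fixes P :: "('a, 'p) cochain" and G :: "int \<Rightarrow> 'g set" and deg :: "int \<Rightarrow> 'g \<Rightarrow> int"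
    and e :: "int \<Rightarrow> 'g \<Rightarrow> 'p" and \<kappa> :: "int \<Rightarrow> 'p \<Rightarrow> 'g \<Rightarrow> 'a" and n0 :: int
  assumes complex: "cochain_complex A P"
    and free: "free_module K A (obj P i) (G i) (deg i) (e i) (\<kappa> i)"
    and bounded: "i > n0 \<Longrightarrow> carrier (obj P i) = {\<zero>\<^bsub>obj P i\<^esub>}"
begin

sublocale F: free_module K A "obj P i" "G i" "deg i" "e i" "\<kappa> i" for i
  by (rule free)

abbreviation "C i \<equiv> carrier (obj P i)"
abbreviation "Hom i j \<equiv> gr_hom A (obj P i) (obj P j)"
abbreviation d where "d \<equiv> diff P"
abbreviation "hg i \<equiv> homog (obj P i)"

lemma graded_module_obj: "graded_module A (obj P i)" by (rule F.P.graded_module_axioms)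

lemma d_hom: "d i \<in> Hom i (i + 1)" and d_hom': "d (i - 1) \<in> Hom (i - 1) i"
  using complex spec[of "\<lambda>i. d i \<in> Hom i (i + 1)" "i - 1"] by (auto simp: cochain_complex_def)

lemma d_d: "x \<in> C i \<Longrightarrow> d (i + 1) (d i x) = \<zero>\<^bsub>obj P (i + 2)\<^esub>"
  using complex by (auto simp: cochain_complex_def)

lemma d_d': "x \<in> C (i - 1) \<Longrightarrow> d i (d (i - 1) x) = \<zero>\<^bsub>obj P (i + 1)\<^esub>"
  using d_d[of x "i - 1"] by (simp add: algebra_simps)

lemma hom_graded_map: "f \<in> Hom i j \<Longrightarrow> graded_map A (obj P i) (obj P j) f"
  by (intro graded_mapI graded_module_obj)

lemma hom_linear_map: "f \<in> Hom i j \<Longrightarrow> linear_map A (obj P i) (obj P j) f"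
  by (rule graded_map.axioms(1)[OF hom_graded_map])

lemmas hom_closed = linear_map.closed[OF hom_linear_map]
  and hom_add = linear_map.add[OF hom_linear_map]
  and hom_smult = linear_map.smult[OF hom_linear_map]
  and hom_zero = linear_map.zero[OF hom_linear_map]
  and hom_minus = linear_map.minus[OF hom_linear_map]
  and hom_homog = graded_map.homog[OF hom_graded_map]
  and hom_component = graded_map.component[OF hom_graded_map]
  and hom_vimage = linear_map.vimage_submodule[OF hom_linear_map]

lemmas d_closed = hom_closed[OF d_hom] and d_closed' = hom_closed[OF d_hom']
  and d_homog = hom_homog[OF d_hom] and d_homog' = hom_homog[OF d_hom']
  and hg_carrier = F.P.D_carrier and hg_minus = F.P.D_neg

lemma hg_diff: "x \<in> hg i j \<Longrightarrow> y \<in> hg i j \<Longrightarrow> x \<ominus>\<^bsub>obj P i\<^esub> y \<in> hg i j"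
  using F.P.D_add F.P.D_neg by (simp add: a_minus_def)

lemma hom_minus_hom: "f \<in> Hom i j \<Longrightarrow> g \<in> Hom i j \<Longrightarrow> (\<lambda>x. f x \<ominus>\<^bsub>obj P j\<^esub> g x) \<in> Hom i j"
  by (rule F.P.gr_hom_minus)

lemma zero_hom: "(\<lambda>x. \<zero>\<^bsub>obj P j\<^esub>) \<in> Hom i j"
  using F.P.D_zero by (auto simp: gr_hom_def F.P.smult_r_null)

lemma submodule_zero: "submodule {\<zero>\<^bsub>obj P i\<^esub>} A (obj P i)"
  by (auto simp: F.P.submodule_iff F.P.smult_r_null)

lemma submodule_subset: "submodule U A (obj P i) \<Longrightarrow> x \<in> U \<Longrightarrow> x \<in> C i"
  by (auto simp: F.P.submodule_iff)

subsubsection \<open>Contracting homotopies modulo submodules\<close>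

text \<open>The first condition says that 1 - ds - sd has values in L in degrees up to
  \<open>t i\<close>. The second is the hypothesis under which the step from i to i - 1 works. As d
  d = 0, it follows from the first if \<open>t (i - 1)\<close> is at most \<open>t i\<close>, and is
  an additional demand if the threshold rises as i decreases. With L zero this is a contraction in
  the given range, with L equal to \<open>N\<close> a contraction modulo the radical.\<close>

definition almost_contraction ::
  "(int \<Rightarrow> int) \<Rightarrow> (int \<Rightarrow> 'p set) \<Rightarrow> (int \<Rightarrow> 'p \<Rightarrow> 'p) \<Rightarrow> int \<Rightarrow> bool" where
  "almost_contraction t L s i \<longleftrightarrow> s i \<in> Hom i (i - 1) \<and>
     (\<forall>j\<le>t i. \<forall>x\<in>hg i j. x \<ominus>\<^bsub>obj P i\<^esub> d (i - 1) (s i x) \<ominus>\<^bsub>obj P i\<^esub> s (i + 1) (d i x) \<in> L i) \<and>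
     (\<forall>j\<le>t (i - 1). \<forall>x\<in>hg (i - 1) j. d (i - 1) x \<ominus>\<^bsub>obj P i\<^esub> d (i - 1) (s i (d (i - 1) x)) \<in> L i)"

text \<open>On a generator e of degree at most \<open>t i\<close>, the element e - s d e is a cycle
  modulo L by the second condition at i + 1, so \<open>h1\<close> supplies a y with e - s d e - d y
  in L, and s e is set to y. On the other generators s agrees with E, which takes care of boundaries
  one degree above the threshold.\<close>

lemma almost_contraction_step:
  assumes L: "\<And>i. submodule (L i) A (obj P i)"
    and s1: "almost_contraction t L s (i + 1)"
    and h1: "\<And>j v. \<lbrakk>j \<le> t i; v \<in> hg i j; d i v \<in> L (i + 1)\<rbrakk> \<Longrightarrow>
      \<exists>y\<in>hg (i - 1) j. v \<ominus>\<^bsub>obj P i\<^esub> d (i - 1) y \<in> L i"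
    and h2: "t (i - 1) \<le> t i \<or> (t (i - 1) = t i + 1 \<and>
      (\<forall>l>0. \<forall>a\<in>H l. \<forall>x\<in>C i. a \<odot>\<^bsub>obj P i\<^esub> x \<in> L i) \<and>
      (\<exists>E\<in>Hom i (i - 1). \<forall>x\<in>hg (i - 1) (t (i - 1)).
         d (i - 1) x \<ominus>\<^bsub>obj P i\<^esub> d (i - 1) (E (d (i - 1) x)) \<in> L i))"
  obtains r where "almost_contraction t L (s(i := r)) i"
proof -
  have s_hom: "s (i + 1) \<in> Hom (i + 1) i" using s1 by (simp add: almost_contraction_def)
  have s_dd: "d i x \<ominus>\<^bsub>obj P (i + 1)\<^esub> d i (s (i + 1) (d i x)) \<in> L (i + 1)" if "j \<le> t i" "x \<in> hg i j" for j x
    using s1 that by (simp add: almost_contraction_def)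
  \<comment> \<open>If \<open>t (i - 1)\<close> is at most \<open>t i\<close>, nothing is asked of E
    and the zero map serves.\<close>
  obtain E where E: "E \<in> Hom i (i - 1)"
    and E2: "\<not> t (i - 1) \<le> t i \<Longrightarrow> x \<in> hg (i - 1) (t (i - 1)) \<Longrightarrow>
         d (i - 1) x \<ominus>\<^bsub>obj P i\<^esub> d (i - 1) (E (d (i - 1) x)) \<in> L i" for x
    using h2 zero_hom by blast
  have sd_hom: "(\<lambda>x. s (i + 1) (d i x)) \<in> Hom i i" using gr_hom_comp[OF d_hom s_hom] .
  have "\<exists>y\<in>hg (i - 1) (deg i g). e i g \<ominus>\<^bsub>obj P i\<^esub> s (i + 1) (d i (e i g)) \<ominus>\<^bsub>obj P i\<^esub> d (i - 1) y \<in> L i"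
    if g: "g \<in> G i" "deg i g \<le> t i" for g
  proof (rule h1[OF g(2)])
    have eg: "e i g \<in> hg i (deg i g)" "e i g \<in> C i" using F.basis_homog F.basis_carrier g by auto
    show "e i g \<ominus>\<^bsub>obj P i\<^esub> s (i + 1) (d i (e i g)) \<in> hg i (deg i g)"
      using hg_diff eg hom_homog[OF sd_hom] by blast
    have "d i (e i g \<ominus>\<^bsub>obj P i\<^esub> s (i + 1) (d i (e i g))) =
        d i (e i g) \<ominus>\<^bsub>obj P (i + 1)\<^esub> d i (s (i + 1) (d i (e i g)))"
      using hom_minus[OF d_hom eg(2) hom_closed[OF sd_hom eg(2)]] .
    then show "d i (e i g \<ominus>\<^bsub>obj P i\<^esub> s (i + 1) (d i (e i g))) \<in> L (i + 1)"
      using s_dd[OF g(2) eg(1)] by simp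
  qed
  then obtain y where y: "\<And>g. g \<in> G i \<Longrightarrow> deg i g \<le> t i \<Longrightarrow> y g \<in> hg (i - 1) (deg i g)"
    "\<And>g. g \<in> G i \<Longrightarrow> deg i g \<le> t i \<Longrightarrow>
      e i g \<ominus>\<^bsub>obj P i\<^esub> s (i + 1) (d i (e i g)) \<ominus>\<^bsub>obj P i\<^esub> d (i - 1) (y g) \<in> L i"
    by metis
  define v where "v g = (if deg i g \<le> t i then y g else E (e i g))" for g
  have v: "v g \<in> hg (i - 1) (deg i g)" if "g \<in> G i" for g
    using y(1)[OF that] hom_homog[OF E F.basis_homog[OF that]] by (simp add: v_def)
  define r where "r = F.lin_ext i (obj P (i - 1)) v"
  have r: "r \<in> Hom i (i - 1)" unfolding r_def
    by (rule F.lin_ext_gr_hom[OF graded_module_obj v])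
  have re: "r (e i g) = v g" if "g \<in> G i" for g unfolding r_def
    by (rule F.lin_ext(2)[OF F.P.left_module_axioms _ that]) (use v hg_carrier in blast)
  have dr_hom: "(\<lambda>x. d (i - 1) (r x)) \<in> Hom i i" and dE_hom: "(\<lambda>x. d (i - 1) (E x)) \<in> Hom i i"
    using gr_hom_comp[OF r d_hom'] gr_hom_comp[OF E d_hom'] by auto
  have p1: "x \<ominus>\<^bsub>obj P i\<^esub> d (i - 1) (r x) \<ominus>\<^bsub>obj P i\<^esub> s (i + 1) (d i x) \<in> L i" if j: "j \<le> t i" "x \<in> hg i j" for j x
  proof -
    let ?\<theta> = "\<lambda>x. x \<ominus>\<^bsub>obj P i\<^esub> d (i - 1) (r x) \<ominus>\<^bsub>obj P i\<^esub> s (i + 1) (d i x)"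
    have \<theta>: "?\<theta> \<in> Hom i i" by (intro hom_minus_hom gr_hom_ident dr_hom sd_hom)
    have "x \<in> {x \<in> C i. ?\<theta> x \<in> L i}"
    proof (rule F.submodule_gen[OF hg_carrier[OF j(2)] hom_vimage[OF \<theta> L]])
      fix g assume g: "g \<in> G i" "\<kappa> i x g \<noteq> \<zero>\<^bsub>A\<^esub>"
      have "deg i g \<le> j" using F.coord_homog[OF j(2), of g] H_neg[of "j - deg i g"] g(2) by force
      then have le: "deg i g \<le> t i" using j(1) by simp
      have eg: "e i g \<in> C i" using F.basis_carrier g by auto
      have "?\<theta> (e i g) = e i g \<ominus>\<^bsub>obj P i\<^esub> s (i + 1) (d i (e i g)) \<ominus>\<^bsub>obj P i\<^esub> d (i - 1) (y g)"
        using F.P.M.minus_swap[OF eg hom_closed[OF dr_hom eg] hom_closed[OF sd_hom eg]] re[OF g(1)] le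
        by (simp add: v_def)
      then show "e i g \<in> {x \<in> C i. ?\<theta> x \<in> L i} \<or> \<kappa> i x g \<odot>\<^bsub>obj P i\<^esub> e i g \<in> {x \<in> C i. ?\<theta> x \<in> L i}"
        using y(2)[OF g(1) le] eg by simp
    qed
    then show ?thesis by simp
  qed
  have p2: "d (i - 1) x \<ominus>\<^bsub>obj P i\<^esub> d (i - 1) (r (d (i - 1) x)) \<in> L i" if j: "j \<le> t (i - 1)" "x \<in> hg (i - 1) j" for j x
  proof -
    let ?w = "d (i - 1) x"
    have xc: "x \<in> C (i - 1)" using j hg_carrier by auto
    have w: "?w \<in> hg i j" "?w \<in> C i" using d_homog'[OF j(2)] hg_carrier by auto
    have dw: "d i ?w = \<zero>\<^bsub>obj P (i + 1)\<^esub>" using d_d'[OF xc] .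
    show ?thesis
    proof (cases "j \<le> t i")
      case True
      have "?w \<ominus>\<^bsub>obj P i\<^esub> d (i - 1) (r ?w) \<ominus>\<^bsub>obj P i\<^esub> \<zero>\<^bsub>obj P i\<^esub> \<in> L i"
        using p1[OF True w(1)] dw hom_zero[OF s_hom] by simp
      moreover have "?w \<ominus>\<^bsub>obj P i\<^esub> d (i - 1) (r ?w) \<in> C i" using w hom_closed[OF dr_hom] by simp
      ultimately show ?thesis by (simp add: F.P.M.minus_zero_right)
    next
      case False
      then have j': "j = t i + 1" "t (i - 1) = t i + 1" "\<not> t (i - 1) \<le> t i" using h2 j by auto
      have pos: "a \<odot>\<^bsub>obj P i\<^esub> x \<in> L i" if "l > 0" "a \<in> H l" "x \<in> C i" for l a x
        using h2 that j'(3) by blast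
      let ?\<theta> = "\<lambda>x. d (i - 1) (E x) \<ominus>\<^bsub>obj P i\<^esub> d (i - 1) (r x)"
      have \<theta>: "?\<theta> \<in> Hom i i" by (intro hom_minus_hom dr_hom dE_hom)
      \<comment> \<open>In degree j = \<open>t i\<close> + 1 the maps d E and d r agree on the
        boundary w modulo L: on generators of degree j because r is defined by E there, and on those
        of lower degree because their coefficients in w have positive degree and carry everything
        into L. So E's property on boundaries passes to r.\<close>
      have "?w \<in> {x \<in> C i. ?\<theta> x \<in> L i}"
      proof (rule F.submodule_gen[OF w(2) hom_vimage[OF \<theta> L]])
        fix g assume g: "g \<in> G i" "\<kappa> i ?w g \<noteq> \<zero>\<^bsub>A\<^esub>"
        have eg: "e i g \<in> C i" using F.basis_carrier g by auto
        have \<kappa>H: "\<kappa> i ?w g \<in> H (j - deg i g)" using F.coord_homog[OF w(1)] .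
        have le: "deg i g \<le> j" using \<kappa>H H_neg[of "j - deg i g"] g(2) by force
        show "e i g \<in> {x \<in> C i. ?\<theta> x \<in> L i} \<or> \<kappa> i ?w g \<odot>\<^bsub>obj P i\<^esub> e i g \<in> {x \<in> C i. ?\<theta> x \<in> L i}"
        proof (cases "deg i g = j")
          case True
          then have "r (e i g) = E (e i g)" using re[OF g(1)] False by (simp add: v_def)
          then have "?\<theta> (e i g) = \<zero>\<^bsub>obj P i\<^esub>" using F.P.M.minus_self hom_closed[OF dE_hom eg] by simp
          then show ?thesis using eg L[of i] by (simp add: F.P.submodule_iff)
        next
          case False
          then have "?\<theta> (\<kappa> i ?w g \<odot>\<^bsub>obj P i\<^esub> e i g) \<in> L i"
            using hom_smult[OF \<theta> _ eg] pos[OF _ \<kappa>H hom_closed[OF \<theta> eg]] le w(2) by simp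
          then show ?thesis using w(2) eg by (simp add: F.P.smult_closed)
        qed
      qed
      then have "?\<theta> ?w \<in> L i" by simp
      then have "(?w \<ominus>\<^bsub>obj P i\<^esub> d (i - 1) (E ?w)) \<oplus>\<^bsub>obj P i\<^esub> ?\<theta> ?w \<in> L i"
        using E2[OF j'(3), of x] j' j(2) L[of i] by (simp add: F.P.submodule_iff)
      then show ?thesis
        using F.P.M.minus_add_minus[OF w(2) hom_closed[OF dE_hom w(2)] hom_closed[OF dr_hom w(2)]] by simp
    qed
  qed
  have "almost_contraction t L (s(i := r)) i"
    unfolding almost_contraction_def using r p1 p2 by simp
  then show thesis by (rule that)
qed

text \<open>Descending induction from above \<open>n0\<close>, where all terms are zero and s = 0
  works. Changing s at i - 1 leaves the conditions at i and above intact, since these involve only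
  \<open>s i'\<close> and \<open>s (i' + 1)\<close> for i' at least i. The floor \<open>i0\<close>
  keeps the number of nonzero terms involved finite, which later allows one bound for all low
  degrees.\<close>

lemma almost_contraction_exists:
  assumes L: "\<And>i. submodule (L i) A (obj P i)"
    and h1: "\<And>i j v. \<lbrakk>i \<ge> i0; j \<le> t i; v \<in> hg i j; d i v \<in> L (i + 1)\<rbrakk> \<Longrightarrow>
      \<exists>y\<in>hg (i - 1) j. v \<ominus>\<^bsub>obj P i\<^esub> d (i - 1) y \<in> L i"
    and h2: "\<And>i. i \<ge> i0 \<Longrightarrow> t (i - 1) \<le> t i \<or> (t (i - 1) = t i + 1 \<and>
      (\<forall>l>0. \<forall>a\<in>H l. \<forall>x\<in>C i. a \<odot>\<^bsub>obj P i\<^esub> x \<in> L i) \<and>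
      (\<exists>E\<in>Hom i (i - 1). \<forall>x\<in>hg (i - 1) (t (i - 1)).
         d (i - 1) x \<ominus>\<^bsub>obj P i\<^esub> d (i - 1) (E (d (i - 1) x)) \<in> L i))"
  obtains s where "\<And>i. i \<ge> i0 \<Longrightarrow> almost_contraction t L s i"
proof -
  define Q where "Q i \<longleftrightarrow> (\<exists>s. \<forall>i'\<ge>i. almost_contraction t L s i')" for i
  let ?k = "max i0 (n0 + 1)"
  have Qk: "Q ?k" unfolding Q_def
  proof (intro exI allI impI)
    fix i assume i: "?k \<le> i"
    have C: "C i = {\<zero>\<^bsub>obj P i\<^esub>}" using bounded i by simp
    let ?s = "\<lambda>i x. \<zero>\<^bsub>obj P (i - 1)\<^esub>"
    have in_L: "x \<in> L i" if "x \<in> C i" for x using that C L[of i] by (auto simp: F.P.submodule_iff)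
    show "almost_contraction t L ?s i" unfolding almost_contraction_def
      using zero_hom hg_carrier d_closed' by (auto intro!: in_L)
  qed
  have Qstep: "Q (i - 1)" if i: "i - 1 \<ge> i0" and Q: "Q i" for i
  proof -
    obtain s where s: "\<And>i'. i' \<ge> i \<Longrightarrow> almost_contraction t L s i'" using Q by (auto simp: Q_def)
    obtain r where r: "almost_contraction t L (s(i - 1 := r)) (i - 1)"
    proof (rule almost_contraction_step[OF L, where i="i - 1" and s=s and t=t])
      show "almost_contraction t L s (i - 1 + 1)" using s[of i] by simp
    qed (use h1[OF i] h2[OF i] in auto)
    have "almost_contraction t L (s(i - 1 := r)) i'" if "i' \<ge> i - 1" for i'
    proof (cases "i' = i - 1")
      case False
      then have "almost_contraction t L s i'" using s that by simp
      then show ?thesis using False that by (simp add: almost_contraction_def)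
    qed (use r in simp)
    then show ?thesis by (auto simp: Q_def)
  qed
  have "i \<ge> i0 \<longrightarrow> Q i" if "i \<le> ?k" for i
    using that by (induction i rule: int_le_induct) (use Qk Qstep in auto)
  then have "Q i0" by simp
  then show thesis using that by (auto simp: Q_def)
qed

subsubsection \<open>The submodule generated by the radical\<close>

text \<open>This is J P, where J is the two-sided ideal of elements of A whose degree zero component
  lies in \<open>J0\<close>.\<close>

definition N :: "int \<Rightarrow> 'p set" where
  "N i = {x \<in> C i. \<forall>g. cA 0 (\<kappa> i x g) \<in> J0}"

lemma J0_H: "a \<in> J0 \<Longrightarrow> a \<in> H 0" and J0_zero: "\<zero>\<^bsub>A\<^esub> \<in> J0"
  and J0_add: "a \<in> J0 \<Longrightarrow> b \<in> J0 \<Longrightarrow> a \<oplus>\<^bsub>A\<^esub> b \<in> J0" and J0_left: "r \<in> H 0 \<Longrightarrow> a \<in> J0 \<Longrightarrow> r \<otimes>\<^bsub>A\<^esub> a \<in> J0"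
  using J0_ideal by (auto simp: deg0_ideal_iff)

lemma N_submodule: "submodule (N i) A (obj P i)"
  unfolding F.P.submodule_iff N_def
  using J0_zero J0_add J0_left cA_in
  by (auto simp: F.coord_zero cA_zero F.coord_add cA_add F.coord_smult cA_mult_0 F.P.smult_closed)

lemma smult_N: "a \<in> carrier A \<Longrightarrow> cA 0 a \<in> J0 \<Longrightarrow> x \<in> C i \<Longrightarrow> a \<odot>\<^bsub>obj P i\<^esub> x \<in> N i"
  unfolding N_def using J0_right cA_in by (simp add: F.coord_smult cA_mult_0 F.P.smult_closed)

lemma smult_pos_N: "l > 0 \<Longrightarrow> a \<in> H l \<Longrightarrow> x \<in> C i \<Longrightarrow> a \<odot>\<^bsub>obj P i\<^esub> x \<in> N i"
  by (rule smult_N) (auto simp: H_carrier cA_same J0_zero)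

lemma N_hom:
  assumes f: "f \<in> Hom i j" and x: "x \<in> N i"
  shows "f x \<in> N j"
proof -
  have xc: "x \<in> C i" using x by (simp add: N_def)
  have "x \<in> {x \<in> C i. f x \<in> N j}"
  proof (rule F.submodule_gen[OF xc hom_vimage[OF f N_submodule]])
    fix g assume g: "g \<in> G i"
    have "f (\<kappa> i x g \<odot>\<^bsub>obj P i\<^esub> e i g) \<in> N j"
      using hom_smult[OF f _ F.basis_carrier[OF g]] smult_N[OF _ _ hom_closed[OF f F.basis_carrier[OF g]]] x xc
      by (simp add: N_def)
    then show "e i g \<in> {x \<in> C i. f x \<in> N j} \<or> \<kappa> i x g \<odot>\<^bsub>obj P i\<^esub> e i g \<in> {x \<in> C i. f x \<in> N j}"
      using xc F.basis_carrier[OF g] by (simp add: F.P.smult_closed)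
  qed
  then show ?thesis by simp
qed

text \<open>Modulo J P, an element of degree j involves only the generators of degree j: those of
  higher degree do not occur, and those of lower degree have coefficients of positive
  degree.\<close>

lemma top_induct:
  assumes x: "x \<in> hg i j" and U: "submodule U A (obj P i)" "N i \<subseteq> U"
    and gen: "\<And>g. g \<in> G i \<Longrightarrow> deg i g = j \<Longrightarrow> e i g \<in> U"
  shows "x \<in> U"
proof (rule F.submodule_gen[OF hg_carrier[OF x] U(1)])
  fix g assume g: "g \<in> G i" "\<kappa> i x g \<noteq> \<zero>\<^bsub>A\<^esub>"
  have \<kappa>H: "\<kappa> i x g \<in> H (j - deg i g)" using F.coord_homog[OF x] .
  have le: "deg i g \<le> j" using \<kappa>H H_neg[of "j - deg i g"] g(2) by force
  show "e i g \<in> U \<or> \<kappa> i x g \<odot>\<^bsub>obj P i\<^esub> e i g \<in> U"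
    using gen[OF g(1)] smult_pos_N[OF _ \<kappa>H F.basis_carrier[OF g(1)]] U(2) le by (cases "deg i g = j") auto
qed

text \<open>The degree j part of the preimage in P of the boundaries of P/JP.\<close>

definition W :: "int \<Rightarrow> int \<Rightarrow> 'p set" where
  "W i j = {x. \<exists>y\<in>hg (i - 1) j. \<exists>n\<in>N i \<inter> hg i j. x = d (i - 1) y \<oplus>\<^bsub>obj P i\<^esub> n}"

lemma N_homog_deg0: "deg0_submodule A (obj P i) j (N i \<inter> hg i j)"
  by (rule deg0_submoduleI)
     (use N_submodule[of i] F.P.D_add F.P.D_zero H_smult[OF graded_module_obj, of _ 0] H0_carrier in
       \<open>auto simp: F.P.submodule_iff\<close>)

lemma W_I: "y \<in> hg (i - 1) j \<Longrightarrow> n \<in> N i \<Longrightarrow> n \<in> hg i j \<Longrightarrow> x = d (i - 1) y \<oplus>\<^bsub>obj P i\<^esub> n \<Longrightarrow> x \<in> W i j"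
  by (auto simp: W_def)

lemma W_deg0: "deg0_submodule A (obj P i) j (W i j)"
proof (rule deg0_submoduleI)
  note ND = deg0_submoduleD[OF N_homog_deg0[of i j]]
  have z: "\<zero>\<^bsub>obj P i\<^esub> \<in> N i" "\<zero>\<^bsub>obj P i\<^esub> \<in> hg i j" using ND(2) by auto
  show "\<zero>\<^bsub>obj P i\<^esub> \<in> W i j"
    by (rule W_I[OF F.P.D_zero z]) (simp add: hom_zero[OF d_hom'])
  fix x assume "x \<in> W i j"
  then obtain y n where y: "y \<in> hg (i - 1) j" "n \<in> N i" "n \<in> hg i j" "x = d (i - 1) y \<oplus>\<^bsub>obj P i\<^esub> n"
    by (auto simp: W_def)
  note c = hg_carrier[OF y(1)] hg_carrier[OF y(3)]
  show "x \<in> hg i j" unfolding y(4) by (rule F.P.D_add[OF d_homog'[OF y(1)] y(3)])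
  { fix x' assume "x' \<in> W i j"
    then obtain y' n' where y': "y' \<in> hg (i - 1) j" "n' \<in> N i" "n' \<in> hg i j" "x' = d (i - 1) y' \<oplus>\<^bsub>obj P i\<^esub> n'"
      by (auto simp: W_def)
    note c' = hg_carrier[OF y'(1)] hg_carrier[OF y'(3)]
    have nn: "n \<oplus>\<^bsub>obj P i\<^esub> n' \<in> N i" "n \<oplus>\<^bsub>obj P i\<^esub> n' \<in> hg i j" using ND(3)[of n n'] y y' by auto
    have "x \<oplus>\<^bsub>obj P i\<^esub> x' = d (i - 1) (y \<oplus>\<^bsub>obj P (i - 1)\<^esub> y') \<oplus>\<^bsub>obj P i\<^esub> (n \<oplus>\<^bsub>obj P i\<^esub> n')"
      unfolding y(4) y'(4) using c c' d_closed' by (simp add: hom_add[OF d_hom'] F.P.M.a_ac)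
    then show "x \<oplus>\<^bsub>obj P i\<^esub> x' \<in> W i j" by (rule W_I[OF F.P.D_add[OF y(1) y'(1)] nn]) }
  fix a assume a: "a \<in> H 0"
  have an: "a \<odot>\<^bsub>obj P i\<^esub> n \<in> N i" "a \<odot>\<^bsub>obj P i\<^esub> n \<in> hg i j" using ND(4)[OF a, of n] y by auto
  have ay: "a \<odot>\<^bsub>obj P (i - 1)\<^esub> y \<in> hg (i - 1) j" using H_smult[OF graded_module_obj a y(1)] by simp
  have "a \<odot>\<^bsub>obj P i\<^esub> x = d (i - 1) (a \<odot>\<^bsub>obj P (i - 1)\<^esub> y) \<oplus>\<^bsub>obj P i\<^esub> a \<odot>\<^bsub>obj P i\<^esub> n"
    unfolding y(4) using c d_closed' H0_carrier[OF a] by (simp add: hom_smult[OF d_hom'] F.P.smult_r_distr)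
  then show "a \<odot>\<^bsub>obj P i\<^esub> x \<in> W i j" by (rule W_I[OF ay an])
qed

lemma N_sub_W: "N i \<inter> hg i j \<subseteq> W i j"
proof
  fix n assume n: "n \<in> N i \<inter> hg i j"
  show "n \<in> W i j"
    by (rule W_I[OF F.P.D_zero, of n]) (use n hg_carrier in \<open>auto simp: hom_zero[OF d_hom']\<close>)
qed

lemma d_in_W: "y \<in> hg (i - 1) j \<Longrightarrow> d (i - 1) y \<in> W i j"
  by (rule W_I[of y i j "\<zero>\<^bsub>obj P i\<^esub>"])
     (use deg0_submoduleD(2)[OF N_homog_deg0[of i j]] d_closed' hg_carrier in auto)

text \<open>Semisimplicity modulo the radical splits the boundaries off the top layer of \<open>P\<close>.\<close>

lemma boundary_projection:
  obtains \<pi> where "\<pi> \<in> Hom i i" "\<And>x. x \<in> hg i j \<Longrightarrow> x \<ominus>\<^bsub>obj P i\<^esub> \<pi> x \<in> W i j" "\<And>x. x \<in> W i j \<Longrightarrow> \<pi> x \<in> N i"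
proof -
  have JN: "a \<odot>\<^bsub>obj P i\<^esub> x \<in> N i \<inter> hg i j" if "a \<in> J0" "x \<in> hg i j" for a x
    using smult_N[of a x i] H_smult[OF graded_module_obj J0_H[OF that(1)] that(2)] that J0_H H0_carrier cA0_same hg_carrier
    by simp
  obtain W' where W': "deg0_submodule A (obj P i) j W'" "N i \<inter> hg i j \<subseteq> W'" "W i j \<inter> W' \<subseteq> N i \<inter> hg i j"
    "\<And>x. x \<in> hg i j \<Longrightarrow> \<exists>w\<in>W i j. \<exists>w'\<in>W'. x = w \<oplus>\<^bsub>obj P i\<^esub> w'"
    using deg0_complement[OF graded_module_obj N_homog_deg0 W_deg0 N_sub_W JN] by blast
  note WD = deg0_submoduleD[OF W_deg0[of i j]] and UD = deg0_submoduleD[OF W'(1)]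
  obtain w w' where ww: "\<And>x. x \<in> hg i j \<Longrightarrow> w x \<in> W i j" "\<And>x. x \<in> hg i j \<Longrightarrow> w' x \<in> W'"
    "\<And>x. x \<in> hg i j \<Longrightarrow> x = w x \<oplus>\<^bsub>obj P i\<^esub> w' x" using W'(4) by metis
  \<comment> \<open>The pieces selected by \<open>w\<close> and \<open>w'\<close> need not depend
    linearly on x. Only their values on generators of degree j are kept; \<pi> is the linear
    extension, and the decomposition is verified for it again.\<close>
  define v where "v g = (if deg i g = j then w' (e i g) else \<zero>\<^bsub>obj P i\<^esub>)" for g
  have v: "v g \<in> hg i (deg i g)" if "g \<in> G i" for g
    using ww(2)[of "e i g"] UD(1) F.basis_homog[OF that] F.P.D_zero by (auto simp: v_def)
  define \<pi> where "\<pi> = F.lin_ext i (obj P i) v"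
  have \<pi>: "\<pi> \<in> Hom i i" unfolding \<pi>_def by (rule F.lin_ext_gr_hom[OF graded_module_obj v])
  have \<pi>e: "\<pi> (e i g) = v g" if "g \<in> G i" for g unfolding \<pi>_def
    by (rule F.lin_ext(2)[OF F.P.left_module_axioms _ that]) (use v hg_carrier in blast)
  let ?U = "{x \<in> hg i j. \<pi> x \<in> W' \<and> x \<ominus>\<^bsub>obj P i\<^esub> \<pi> x \<in> W i j}"
  have U: "x \<in> ?U" if x: "x \<in> hg i j" for x
  proof (rule F.homog_induct[OF x])
    show "?U \<subseteq> C i" using hg_carrier by auto
    show "\<zero>\<^bsub>obj P i\<^esub> \<in> ?U"
      using UD(2) WD(2) F.P.D_zero by (simp add: hom_zero[OF \<pi>] F.P.M.minus_self)
    show "x \<oplus>\<^bsub>obj P i\<^esub> y \<in> ?U" if "x \<in> ?U" "y \<in> ?U" for x y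
    proof -
      have c: "x \<in> C i" "y \<in> C i" using that hg_carrier by auto
      have "(x \<oplus>\<^bsub>obj P i\<^esub> y) \<ominus>\<^bsub>obj P i\<^esub> \<pi> (x \<oplus>\<^bsub>obj P i\<^esub> y) = (x \<ominus>\<^bsub>obj P i\<^esub> \<pi> x) \<oplus>\<^bsub>obj P i\<^esub> (y \<ominus>\<^bsub>obj P i\<^esub> \<pi> y)"
        using c hom_closed[OF \<pi>] by (simp add: hom_add[OF \<pi>] a_minus_def F.P.M.minus_add F.P.M.a_ac)
      then show ?thesis using that c UD(3) WD(3) F.P.D_add by (simp add: hom_add[OF \<pi>])
    qed
    fix g a assume g: "g \<in> G i" and a: "a \<in> H (j - deg i g)"
    have aA: "a \<in> carrier A" using H_carrier[OF a] .
    have eg: "e i g \<in> hg i (deg i g)" "e i g \<in> C i" using F.basis_homog F.basis_carrier g by auto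
    have ae: "a \<odot>\<^bsub>obj P i\<^esub> e i g \<in> hg i j" using H_smult[OF graded_module_obj a eg(1)] by simp
    have \<pi>ae: "\<pi> (a \<odot>\<^bsub>obj P i\<^esub> e i g) = a \<odot>\<^bsub>obj P i\<^esub> v g" using hom_smult[OF \<pi> aA eg(2)] \<pi>e[OF g] by simp
    show "a \<odot>\<^bsub>obj P i\<^esub> e i g \<in> ?U"
    proof (cases "deg i g = j")
      case True
      then have ej: "e i g \<in> hg i j" and a0: "a \<in> H 0" using eg a by auto
      have vw: "v g = w' (e i g)" using True by (simp add: v_def)
      have c: "w (e i g) \<in> C i" "w' (e i g) \<in> C i" using WD(1)[OF ww(1)[OF ej]] UD(1)[OF ww(2)[OF ej]] hg_carrier by auto
      have "a \<odot>\<^bsub>obj P i\<^esub> e i g = a \<odot>\<^bsub>obj P i\<^esub> w (e i g) \<oplus>\<^bsub>obj P i\<^esub> a \<odot>\<^bsub>obj P i\<^esub> w' (e i g)"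
        using F.P.smult_r_distr[OF aA c] ww(3)[OF ej] by simp
      then have "a \<odot>\<^bsub>obj P i\<^esub> e i g \<ominus>\<^bsub>obj P i\<^esub> a \<odot>\<^bsub>obj P i\<^esub> w' (e i g) = a \<odot>\<^bsub>obj P i\<^esub> w (e i g)"
        using aA c by (simp add: a_minus_def F.P.M.a_assoc F.P.M.r_neg F.P.smult_closed)
      then show ?thesis using ae \<pi>ae vw UD(4)[OF a0 ww(2)[OF ej]] WD(4)[OF a0 ww(1)[OF ej]] by simp
    next
      case False
      then have "\<pi> (a \<odot>\<^bsub>obj P i\<^esub> e i g) = \<zero>\<^bsub>obj P i\<^esub>" using \<pi>ae aA by (simp add: v_def F.P.smult_r_null)
      moreover have "a \<odot>\<^bsub>obj P i\<^esub> e i g \<in> N i"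
      proof (cases "deg i g < j")
        case True then show ?thesis using smult_pos_N[OF _ a eg(2)] by simp
      next
        case False
        then have "a = \<zero>\<^bsub>A\<^esub>" using a H_neg[of "j - deg i g"] \<open>deg i g \<noteq> j\<close> by auto
        then show ?thesis using eg(2) N_submodule[of i] by (simp add: F.P.smult_l_null F.P.submodule_iff)
      qed
      ultimately show ?thesis using ae UD(2) N_sub_W[of i j] hg_carrier[OF ae] by (auto simp: F.P.M.minus_zero_right)
    qed
  qed
  \<comment> \<open>For x in \<open>W i j\<close> both x and x - \<pi> x lie in W, so \<pi> x lies
    in W and in W', whose intersection is contained in N.\<close>
  have "\<pi> x \<in> N i" if x: "x \<in> W i j" for x
  proof -
    have xh: "x \<in> hg i j" using WD(1)[OF x] .
    have "x \<ominus>\<^bsub>obj P i\<^esub> (x \<ominus>\<^bsub>obj P i\<^esub> \<pi> x) \<in> W i j"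
      using WD(3)[OF x deg0_neg[OF graded_module_obj W_deg0]] U[OF xh] by (simp add: a_minus_def[of _ x])
    then have "\<pi> x \<in> W i j" using F.P.M.minus_minus_cancel[OF hg_carrier[OF xh] hom_closed[OF \<pi> hg_carrier[OF xh]]] by simp
    then show ?thesis using U[OF xh] W'(3) by auto
  qed
  then show thesis using that \<pi> U by blast
qed

text \<open>A lift of boundaries modulo J P by a morphism of the full modules. On generators of
  degree j, 1 - \<pi> has values in W, and E picks preimages of the boundary part. On a boundary w
  the term \<pi> w already lies in J P, which leaves w - d E w there.\<close>

lemma boundary_splitting:
  obtains E where "E \<in> Hom i (i - 1)"
    "\<And>x. x \<in> hg (i - 1) j \<Longrightarrow> d (i - 1) x \<ominus>\<^bsub>obj P i\<^esub> d (i - 1) (E (d (i - 1) x)) \<in> N i"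
proof -
  obtain \<pi> where \<pi>: "\<pi> \<in> Hom i i" "\<And>x. x \<in> hg i j \<Longrightarrow> x \<ominus>\<^bsub>obj P i\<^esub> \<pi> x \<in> W i j" "\<And>x. x \<in> W i j \<Longrightarrow> \<pi> x \<in> N i"
    using boundary_projection by blast
  have "\<exists>y\<in>hg (i - 1) j. \<exists>n\<in>N i. x \<ominus>\<^bsub>obj P i\<^esub> \<pi> x = d (i - 1) y \<oplus>\<^bsub>obj P i\<^esub> n" if "x \<in> hg i j" for x
    using \<pi>(2)[OF that] by (auto simp: W_def)
  then obtain y n where yn: "\<And>x. x \<in> hg i j \<Longrightarrow> y x \<in> hg (i - 1) j" "\<And>x. x \<in> hg i j \<Longrightarrow> n x \<in> N i"
    "\<And>x. x \<in> hg i j \<Longrightarrow> x \<ominus>\<^bsub>obj P i\<^esub> \<pi> x = d (i - 1) (y x) \<oplus>\<^bsub>obj P i\<^esub> n x" by metis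
  define v where "v g = (if deg i g = j then y (e i g) else \<zero>\<^bsub>obj P (i - 1)\<^esub>)" for g
  have v: "v g \<in> hg (i - 1) (deg i g)" if "g \<in> G i" for g
    using yn(1)[of "e i g"] F.basis_homog[OF that] F.P.D_zero by (auto simp: v_def)
  define E where "E = F.lin_ext i (obj P (i - 1)) v"
  have E: "E \<in> Hom i (i - 1)" unfolding E_def by (rule F.lin_ext_gr_hom[OF graded_module_obj v])
  have Ee: "E (e i g) = v g" if "g \<in> G i" for g unfolding E_def
    by (rule F.lin_ext(2)[OF F.P.left_module_axioms _ that]) (use v hg_carrier in blast)
  have dE: "(\<lambda>x. d (i - 1) (E x)) \<in> Hom i i" using gr_hom_comp[OF E d_hom'] .
  let ?\<theta> = "\<lambda>x. x \<ominus>\<^bsub>obj P i\<^esub> \<pi> x \<ominus>\<^bsub>obj P i\<^esub> d (i - 1) (E x)"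
  have \<theta>: "?\<theta> \<in> Hom i i" by (intro hom_minus_hom gr_hom_ident \<pi>(1) dE)
  have \<theta>N: "?\<theta> x \<in> N i" if x: "x \<in> hg i j" for x
  proof -
    have "x \<in> {x \<in> C i. ?\<theta> x \<in> N i}"
    proof (rule top_induct[OF x hom_vimage[OF \<theta> N_submodule]])
      show "N i \<subseteq> {x \<in> C i. ?\<theta> x \<in> N i}" using N_hom[OF \<theta>] submodule_subset[OF N_submodule] by auto
      fix g assume g: "g \<in> G i" "deg i g = j"
      have ej: "e i g \<in> hg i j" "e i g \<in> C i" using F.basis_homog F.basis_carrier g by auto
      have dy: "d (i - 1) (y (e i g)) \<in> C i" by (rule d_closed'[OF hg_carrier[OF yn(1)[OF ej(1)]]])
      have nc: "n (e i g) \<in> C i" using submodule_subset[OF N_submodule] yn(2) ej by auto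
      have "?\<theta> (e i g) = n (e i g)"
        using yn(3)[OF ej(1)] Ee[OF g(1)] g(2) dy nc by (simp add: v_def a_minus_def F.P.M.a_ac F.P.M.r_neg2 F.P.M.r_neg)
      then show "e i g \<in> {x \<in> C i. ?\<theta> x \<in> N i}" using ej yn(2) by simp
    qed
    then show ?thesis by simp
  qed
  show thesis
  proof (rule that[OF E])
    fix x assume x: "x \<in> hg (i - 1) j"
    let ?w = "d (i - 1) x"
    have w: "?w \<in> hg i j" "?w \<in> C i" using d_homog'[OF x] hg_carrier[OF d_homog'[OF x]] by auto
    have "?\<theta> ?w \<oplus>\<^bsub>obj P i\<^esub> \<pi> ?w \<in> N i"
      using \<theta>N[OF w(1)] \<pi>(3)[OF d_in_W[OF x]] N_submodule[of i] by (simp add: F.P.submodule_iff)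
    moreover have "?\<theta> ?w \<oplus>\<^bsub>obj P i\<^esub> \<pi> ?w = ?w \<ominus>\<^bsub>obj P i\<^esub> d (i - 1) (E ?w)"
      using F.P.M.minus_swap[OF w(2) hom_closed[OF \<pi>(1) w(2)] hom_closed[OF dE w(2)]]
        F.P.M.minus_add_cancel[of "?w \<ominus>\<^bsub>obj P i\<^esub> d (i - 1) (E ?w)" i "\<pi> ?w"] w hom_closed[OF \<pi>(1) w(2)] hom_closed[OF dE w(2)]
      by simp
    ultimately show "?w \<ominus>\<^bsub>obj P i\<^esub> d (i - 1) (E ?w) \<in> N i" by simp
  qed
qed

end

definition homology_vanishes :: "('a, 'm) cochain \<Rightarrow> int \<Rightarrow> int \<Rightarrow> bool" where
  "homology_vanishes X i j \<longleftrightarrow> (\<forall>x\<in>homog (obj X i) j. diff X i x = \<zero>\<^bsub>obj X (i + 1)\<^esub> \<longrightarrow>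
     (\<exists>y\<in>homog (obj X (i - 1)) j. diff X (i - 1) y = x))"

context free_complex
begin

subsubsection \<open>The degree filtration\<close>

text \<open>\<open>homology_vanishes X i j\<close> says that \<open>H\<^sup>i(X)\<^sub>j = 0\<close>, and \<open>top_acyclic i j\<close> that \<open>H\<^sup>i(P/JP)\<^sub>j = 0\<close>, where \<open>J\<close>
  consists of the elements whose degree zero component lies in \<open>J0\<close>.\<close>

abbreviation "acyclic_at \<equiv> homology_vanishes P"

definition top_acyclic :: "int \<Rightarrow> int \<Rightarrow> bool" where
  "top_acyclic i j \<longleftrightarrow> (\<forall>v\<in>hg i j. d i v \<in> N (i + 1) \<longrightarrow>
     (\<exists>y\<in>hg (i - 1) j. v \<ominus>\<^bsub>obj P i\<^esub> d (i - 1) y \<in> N i))"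

definition Fil :: "int \<Rightarrow> int \<Rightarrow> 'p set" where
  "Fil i m = {x \<in> C i. \<forall>g. deg i g > m \<longrightarrow> \<kappa> i x g = \<zero>\<^bsub>A\<^esub>}"

lemma Fil_carrier: "x \<in> Fil i m \<Longrightarrow> x \<in> C i" by (simp add: Fil_def)

lemma Fil_submodule: "submodule (Fil i m) A (obj P i)"
  unfolding F.P.submodule_iff Fil_def
  by (auto simp: F.coord_zero F.coord_add F.coord_smult F.P.smult_closed)

lemma homog_Fil: "x \<in> hg i j \<Longrightarrow> j \<le> m \<Longrightarrow> x \<in> Fil i m"
proof -
  assume x: "x \<in> hg i j" and "j \<le> m"
  then have "\<kappa> i x g = \<zero>\<^bsub>A\<^esub>" if "deg i g > m" for g
    using F.coord_homog[OF x, of g] H_neg[of "j - deg i g"] that by simp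
  then show ?thesis using hg_carrier[OF x] by (simp add: Fil_def)
qed

lemma Fil_mono: "x \<in> Fil i m \<Longrightarrow> m \<le> m' \<Longrightarrow> x \<in> Fil i m'"
  by (simp add: Fil_def)

text \<open>A generator of degree at most m goes to an element of degree at most m, and such an
  element involves no generator of degree above m.\<close>

lemma Fil_hom:
  assumes f: "f \<in> Hom i j" and x: "x \<in> Fil i m"
  shows "f x \<in> Fil j m"
proof -
  have "x \<in> {x \<in> C i. f x \<in> Fil j m}"
  proof (rule F.submodule_gen[OF Fil_carrier[OF x] hom_vimage[OF f Fil_submodule]])
    fix g assume g: "g \<in> G i" "\<kappa> i x g \<noteq> \<zero>\<^bsub>A\<^esub>"
    then have "deg i g \<le> m" using x by (force simp: Fil_def)
    then have "f (e i g) \<in> Fil j m" using homog_Fil hom_homog[OF f F.basis_homog[OF g(1)]] by blast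
    then show "e i g \<in> {x \<in> C i. f x \<in> Fil j m} \<or> \<kappa> i x g \<odot>\<^bsub>obj P i\<^esub> e i g \<in> {x \<in> C i. f x \<in> Fil j m}"
      using F.basis_carrier[OF g(1)] by simp
  qed
  then show ?thesis by simp
qed

lemma Fil_component: "x \<in> Fil i m \<Longrightarrow> component (obj P i) j x \<in> Fil i m"
  by (simp add: Fil_def F.coord_component cA_zero)

text \<open>Between \<open>i0\<close> and \<open>n0\<close> there are finitely many cohomological
  degrees, and above \<open>n0\<close> the complex is zero; so the individual bounds have a common
  one.\<close>

lemma bounded_acyclicity:
  assumes "\<And>i. \<exists>l0. \<forall>l<l0. acyclic_at i l"
  shows "\<exists>m0. \<forall>i\<ge>i0. \<forall>l\<le>m0. acyclic_at i l"
proof -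
  obtain l0 where l0: "\<And>i l. l < l0 i \<Longrightarrow> acyclic_at i l" using assms by metis
  \<comment> \<open>Inserting 0 keeps the set nonempty when \<open>n0\<close> is below
    \<open>i0\<close>, and subtracting 1 turns the weak inequality for l into the strict one of the
    hypothesis.\<close>
  define m0 where "m0 = Min (insert 0 (l0 ` {i0..n0})) - 1"
  have "acyclic_at i l" if "i \<ge> i0" "l \<le> m0" for i l
  proof (cases "i \<le> n0")
    case True
    then have "Min (insert 0 (l0 ` {i0..n0})) \<le> l0 i" using that by (intro Min_le) auto
    then have "l < l0 i" using that(2) unfolding m0_def by linarith
    then show ?thesis by (rule l0)
  next
    case False
    then have "x = \<zero>\<^bsub>obj P i\<^esub>" if "x \<in> hg i l" for x using bounded[of i] hg_carrier[OF that] by auto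
    then show ?thesis unfolding homology_vanishes_def
      by (intro ballI impI bexI[of _ "\<zero>\<^bsub>obj P (i - 1)\<^esub>"])
         (simp_all add: hom_zero[OF d_hom'] F.P.D_zero)
  qed
  then show ?thesis by blast
qed

text \<open>Elements of \<open>Fil i m\<close> may have components of degree above m, about which
  the hypothesis says nothing. But a contraction that is exact on the generators of degree at most m
  is, by linearity, exact on all that they generate. It exists with L zero and a constant
  threshold.\<close>

lemma low_cycles_bound:
  assumes ac: "\<And>i l. i \<ge> i0 \<Longrightarrow> l \<le> m \<Longrightarrow> acyclic_at i l"
    and i: "i \<ge> i0" and z: "z \<in> Fil i m" "d i z = \<zero>\<^bsub>obj P (i + 1)\<^esub>"
  obtains q where "q \<in> Fil (i - 1) m" "d (i - 1) q = z"
proof -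
  let ?L = "\<lambda>i. {\<zero>\<^bsub>obj P i\<^esub>}"
  obtain s where s: "\<And>i. i \<ge> i0 \<Longrightarrow> almost_contraction (\<lambda>_. m) ?L s i"
  proof (rule almost_contraction_exists[of ?L i0 "\<lambda>_. m"])
    show "\<exists>y\<in>hg (i - 1) j. v \<ominus>\<^bsub>obj P i\<^esub> d (i - 1) y \<in> ?L i"
      if "i \<ge> i0" "j \<le> m" "v \<in> hg i j" "d i v \<in> ?L (i + 1)" for i j v
      using ac[OF that(1,2)] that(3,4) hg_carrier[OF that(3)] unfolding homology_vanishes_def
      by (metis F.P.M.minus_self singletonD singletonI)
  qed (use submodule_zero in auto)
  have s_hom: "s i \<in> Hom i (i - 1)" "s (i + 1) \<in> Hom (i + 1) i"
    using s[of i] s[of "i + 1"] i by (auto simp: almost_contraction_def)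
  let ?\<theta> = "\<lambda>x. x \<ominus>\<^bsub>obj P i\<^esub> d (i - 1) (s i x) \<ominus>\<^bsub>obj P i\<^esub> s (i + 1) (d i x)"
  have ds: "(\<lambda>x. d (i - 1) (s i x)) \<in> Hom i i" and sd: "(\<lambda>x. s (i + 1) (d i x)) \<in> Hom i i"
    using gr_hom_comp[OF s_hom(1) d_hom'] gr_hom_comp[OF d_hom s_hom(2)] by auto
  have \<theta>: "?\<theta> \<in> Hom i i" by (intro hom_minus_hom gr_hom_ident ds sd)
  have zc: "z \<in> C i" using z Fil_carrier by auto
  have "z \<in> {x \<in> C i. ?\<theta> x \<in> ?L i}"
  proof (rule F.submodule_gen[OF zc hom_vimage[OF \<theta> submodule_zero]])
    fix g assume g: "g \<in> G i" "\<kappa> i z g \<noteq> \<zero>\<^bsub>A\<^esub>"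
    then have "deg i g \<le> m" using z by (force simp: Fil_def)
    then have "?\<theta> (e i g) \<in> ?L i" using s[OF i] F.basis_homog[OF g(1)] unfolding almost_contraction_def by blast
    then show "e i g \<in> {x \<in> C i. ?\<theta> x \<in> ?L i} \<or> \<kappa> i z g \<odot>\<^bsub>obj P i\<^esub> e i g \<in> {x \<in> C i. ?\<theta> x \<in> ?L i}"
      using F.basis_carrier[OF g(1)] by simp
  qed
  then have "z \<ominus>\<^bsub>obj P i\<^esub> d (i - 1) (s i z) \<ominus>\<^bsub>obj P i\<^esub> \<zero>\<^bsub>obj P i\<^esub> = \<zero>\<^bsub>obj P i\<^esub>"
    using z(2) hom_zero[OF s_hom(2)] by simp
  then have "z \<ominus>\<^bsub>obj P i\<^esub> d (i - 1) (s i z) = \<zero>\<^bsub>obj P i\<^esub>"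
    using zc hom_closed[OF ds zc] by (simp add: F.P.M.minus_zero_right)
  then have "d (i - 1) (s i z) = z"
    using F.P.M.eq_add_of_minus[OF zc hom_closed[OF ds zc]] hom_closed[OF ds zc] by simp
  then show thesis using that Fil_hom[OF s_hom(1) z(1)] by blast
qed

text \<open>The homotopy \<open>u = 1 - ds - sd\<close> moves the coefficients of the top layer of \<open>Fil i m\<close> one step up in the
  filtration by annihilators of powers of \<open>J0\<close>, so finitely many applications push a cycle into \<open>Fil i (m - 1)\<close>.\<close>

lemma cycles_bound:
  assumes ac: "\<And>i l. i \<ge> i0 \<Longrightarrow> l \<le> m0 \<Longrightarrow> acyclic_at i l"
    and top: "\<And>i j. i \<ge> i0 \<Longrightarrow> i + j < D \<Longrightarrow> top_acyclic i j"
    and i: "i \<ge> i0" and z: "z \<in> Fil i m" "d i z = \<zero>\<^bsub>obj P (i + 1)\<^esub>" "i + m < D"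
  shows "\<exists>q\<in>Fil (i - 1) m. d (i - 1) q = z"
proof -
  \<comment> \<open>The largest j with i + j < D. It rises by one when i drops by one, so the
    alternative with the map E applies throughout, and E comes from
    \<open>boundary_splitting\<close>.\<close>
  define t where "t i = D - 1 - i" for i :: int
  obtain s where s: "\<And>i. i \<ge> i0 \<Longrightarrow> almost_contraction t N s i"
  proof (rule almost_contraction_exists[of N i0 t])
    show "\<exists>y\<in>hg (i - 1) j. v \<ominus>\<^bsub>obj P i\<^esub> d (i - 1) y \<in> N i"
      if "i \<ge> i0" "j \<le> t i" "v \<in> hg i j" "d i v \<in> N (i + 1)" for i j v
      using top[of i j] that by (auto simp: t_def top_acyclic_def)
    show "t (i - 1) \<le> t i \<or> (t (i - 1) = t i + 1 \<and>
      (\<forall>l>0. \<forall>a\<in>H l. \<forall>x\<in>C i. a \<odot>\<^bsub>obj P i\<^esub> x \<in> N i) \<and>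
      (\<exists>E\<in>Hom i (i - 1). \<forall>x\<in>hg (i - 1) (t (i - 1)).
         d (i - 1) x \<ominus>\<^bsub>obj P i\<^esub> d (i - 1) (E (d (i - 1) x)) \<in> N i))" for i
    proof -
      obtain E where "E \<in> Hom i (i - 1)"
        "\<And>x. x \<in> hg (i - 1) (t (i - 1)) \<Longrightarrow> d (i - 1) x \<ominus>\<^bsub>obj P i\<^esub> d (i - 1) (E (d (i - 1) x)) \<in> N i"
        using boundary_splitting by blast
      then show ?thesis using smult_pos_N by (auto simp: t_def)
    qed
  qed (use N_submodule in auto)
  have s_hom: "s i \<in> Hom i (i - 1)" "s (i + 1) \<in> Hom (i + 1) i"
    using s[of i] s[of "i + 1"] i by (auto simp: almost_contraction_def)
  let ?u = "\<lambda>x. x \<ominus>\<^bsub>obj P i\<^esub> d (i - 1) (s i x) \<ominus>\<^bsub>obj P i\<^esub> s (i + 1) (d i x)"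
  have ds: "(\<lambda>x. d (i - 1) (s i x)) \<in> Hom i i" and sd: "(\<lambda>x. s (i + 1) (d i x)) \<in> Hom i i"
    using gr_hom_comp[OF s_hom(1) d_hom'] gr_hom_comp[OF d_hom s_hom(2)] by auto
  have u: "?u \<in> Hom i i" by (intro hom_minus_hom gr_hom_ident ds sd)
  have uN: "?u x \<in> N i" if "x \<in> hg i j" "j \<le> t i" for x j
    using s[OF i] that unfolding almost_contraction_def by blast
  obtain n where n: "products A J0 n \<subseteq> {\<zero>\<^bsub>A\<^esub>}" using J0_nilpotent by blast
  \<comment> \<open>Left annihilators of J0^(n - k). \<open>ann 0\<close> is all of A as J0^n = 0,
    and \<open>ann n\<close> is zero as the empty product is 1.\<close>
  define ann where "ann k = {a \<in> carrier A. \<forall>p\<in>products A J0 (n - k). a \<otimes>\<^bsub>A\<^esub> p = \<zero>\<^bsub>A\<^esub>}" for k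
  have J0A: "J0 \<subseteq> carrier A" using J0_H H0_carrier by blast
  note pA = subsetD[OF products_carrier[OF J0A]]
  have ann0: "ann 0 = carrier A" using n by (auto simp: ann_def)
  have annn: "ann n = {\<zero>\<^bsub>A\<^esub>}" by (auto simp: ann_def)
  have ann_J0: "a \<otimes>\<^bsub>A\<^esub> b \<in> ann (Suc k)" if "a \<in> ann k" "b \<in> J0" "k < n" for a b k
  proof -
    have "a \<otimes>\<^bsub>A\<^esub> b \<otimes>\<^bsub>A\<^esub> p = \<zero>\<^bsub>A\<^esub>" if p: "p \<in> products A J0 (n - Suc k)" for p
    proof -
      have "b \<otimes>\<^bsub>A\<^esub> p \<in> products A J0 (n - k)"
        using products_cons[OF \<open>b \<in> J0\<close> p] \<open>k < n\<close> by (simp add: Suc_diff_Suc del: products.simps)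
      then show ?thesis using \<open>a \<in> ann k\<close> \<open>b \<in> J0\<close> J0A pA[OF p] by (auto simp: ann_def A.m_assoc)
    qed
    then show ?thesis using that J0A by (auto simp: ann_def)
  qed
  \<comment> \<open>Layers between \<open>Fil i m\<close>, which is \<open>FF m 0\<close>, and
    \<open>Fil i (m - 1)\<close>, which is \<open>FF m n\<close>.\<close>
  define FF where "FF m k = {x \<in> Fil i m. \<forall>g. deg i g = m \<longrightarrow> \<kappa> i x g \<in> ann k}" for m k
  have FF_sub: "submodule (FF m k) A (obj P i)" for m k
    using Fil_submodule[of i m] pA unfolding F.P.submodule_iff FF_def ann_def
    by (auto simp: F.coord_zero F.coord_add F.coord_smult A.l_distr A.m_assoc Fil_carrier subset_iff)
  have uFF: "?u x \<in> FF m (Suc k)" if x: "x \<in> FF m k" and k: "k < n" and m: "m \<le> t i" for x m k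
  proof -
    have xF: "x \<in> Fil i m" and xc: "x \<in> C i" using x Fil_carrier by (auto simp: FF_def)
    have "x \<in> {x \<in> C i. ?u x \<in> FF m (Suc k)}"
    proof (rule F.submodule_gen[OF xc hom_vimage[OF u FF_sub]])
      fix g assume g: "g \<in> G i" "\<kappa> i x g \<noteq> \<zero>\<^bsub>A\<^esub>"
      have le: "deg i g \<le> m" using xF g(2) by (force simp: Fil_def)
      have eg: "e i g \<in> hg i (deg i g)" "e i g \<in> C i" using F.basis_homog F.basis_carrier g by auto
      let ?w = "?u (e i g)"
      have w: "?w \<in> hg i (deg i g)" "?w \<in> C i" using hom_homog[OF u eg(1)] hg_carrier by auto
      have \<kappa>w: "\<kappa> i ?w h \<in> H (deg i g - deg i h)" for h by (rule F.coord_homog[OF w(1)])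
      \<comment> \<open>For h of degree m, a generator g of lower degree contributes nothing,
        because the coefficient of u (e g) at h would have negative degree. If g has degree m, that
        coefficient has degree zero and lies in \<open>J0\<close>, because u maps e g into
        N.\<close>
      have "\<kappa> i x g \<otimes>\<^bsub>A\<^esub> \<kappa> i ?w h \<in> ann (Suc k)" if h: "deg i h = m" for h
      proof (cases "deg i g = m")
        case True
        then have "\<kappa> i ?w h \<in> H 0" using \<kappa>w[of h] h by simp
        moreover have "cA 0 (\<kappa> i ?w h) \<in> J0" using uN[OF eg(1)] le m by (simp add: N_def)
        ultimately have "\<kappa> i ?w h \<in> J0" by (simp add: cA0_same)
        moreover have "\<kappa> i x g \<in> ann k" using x True by (simp add: FF_def)
        ultimately show ?thesis using ann_J0 k by blast
      next
        case False
        then have "\<kappa> i ?w h = \<zero>\<^bsub>A\<^esub>" using \<kappa>w[of h] h le H_neg[of "deg i g - deg i h"] by auto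
        then show ?thesis using xc pA by (auto simp: ann_def)
      qed
      then have "\<kappa> i x g \<odot>\<^bsub>obj P i\<^esub> ?w \<in> FF m (Suc k)"
        using w homog_Fil[OF w(1) le] Fil_submodule[of i m] xc
        by (simp add: FF_def F.P.submodule_iff F.coord_smult)
      then have "?u (\<kappa> i x g \<odot>\<^bsub>obj P i\<^esub> e i g) \<in> FF m (Suc k)" using hom_smult[OF u _ eg(2)] xc by simp
      then show "e i g \<in> {x \<in> C i. ?u x \<in> FF m (Suc k)} \<or>
          \<kappa> i x g \<odot>\<^bsub>obj P i\<^esub> e i g \<in> {x \<in> C i. ?u x \<in> FF m (Suc k)}"
        using xc eg by (simp add: F.P.smult_closed)
    qed
    then show ?thesis by simp
  qed
  have low: "\<exists>q\<in>Fil (i - 1) m. d (i - 1) q = z" if "m \<le> m0" "z \<in> Fil i m" "d i z = \<zero>\<^bsub>obj P (i + 1)\<^esub>" for m z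
  proof -
    have "\<And>i l. i \<ge> i0 \<Longrightarrow> l \<le> m \<Longrightarrow> acyclic_at i l" using ac that(1) by simp
    from low_cycles_bound[OF this i that(2,3)] show ?thesis by blast
  qed
  \<comment> \<open>\<open>k\<close> is the number of applications of u that remain until the layer
    \<open>FF m n\<close> is reached.\<close>
  have descend: "\<exists>q\<in>Fil (i - 1) m. d (i - 1) q = z"
    if m: "m \<le> t i" and IH: "\<And>z. z \<in> Fil i (m - 1) \<Longrightarrow> d i z = \<zero>\<^bsub>obj P (i + 1)\<^esub> \<Longrightarrow> \<exists>q\<in>Fil (i - 1) (m - 1). d (i - 1) q = z"
      and k: "k \<le> n" and z: "z \<in> FF m (n - k)" "d i z = \<zero>\<^bsub>obj P (i + 1)\<^esub>" for m k z
    using k z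
  proof (induction k arbitrary: z)
    case 0
    have "\<kappa> i z g = \<zero>\<^bsub>A\<^esub>" if "deg i g > m - 1" for g
      using that 0 annn by (cases "deg i g = m") (auto simp: FF_def Fil_def)
    then have "z \<in> Fil i (m - 1)" using 0 by (simp add: FF_def Fil_def)
    then obtain q where q: "q \<in> Fil (i - 1) (m - 1)" "d (i - 1) q = z" using IH 0(3) by blast
    have "q \<in> Fil (i - 1) m" by (rule Fil_mono[OF q(1)]) simp
    then show ?case using q(2) by blast
  next
    case (Suc k)
    have zc: "z \<in> C i" and zF: "z \<in> Fil i m" using Suc.prems Fil_carrier by (auto simp: FF_def)
    have dsz: "d (i - 1) (s i z) \<in> C i" using hom_closed[OF ds zc] .
    \<comment> \<open>On a cycle, u z = z - d s z is again a cycle and differs from z by the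
      boundary of an element of \<open>Fil (i - 1) m\<close>. So a primitive of u z in the
      filtration yields one of z.\<close>
    have uz: "?u z = z \<ominus>\<^bsub>obj P i\<^esub> d (i - 1) (s i z)"
      using Suc.prems(3) hom_zero[OF s_hom(2)] zc dsz by (simp add: F.P.M.minus_zero_right)
    have "?u z \<in> FF m (n - k)"
      using uFF[OF Suc.prems(2) _ m] Suc.prems(1) by (simp add: Suc_diff_Suc)
    moreover have "d i (?u z) = \<zero>\<^bsub>obj P (i + 1)\<^esub>"
      unfolding uz using hom_minus[OF d_hom zc dsz] Suc.prems(3) d_d'[OF hom_closed[OF s_hom(1) zc]]
      by (simp add: F.P.M.minus_self)
    ultimately obtain q where q: "q \<in> Fil (i - 1) m" "d (i - 1) q = ?u z" using Suc.IH Suc.prems(1) by force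
    have sz: "s i z \<in> Fil (i - 1) m" by (rule Fil_hom[OF s_hom(1) zF])
    have "d (i - 1) (q \<oplus>\<^bsub>obj P (i - 1)\<^esub> s i z) = ?u z \<oplus>\<^bsub>obj P i\<^esub> d (i - 1) (s i z)"
      using hom_add[OF d_hom' Fil_carrier[OF q(1)] Fil_carrier[OF sz]] q(2) by simp
    also have "\<dots> = z" unfolding uz using F.P.M.minus_add_cancel[OF zc dsz] .
    finally show ?case using q(1) sz Fil_submodule[of "i - 1" m] by (auto simp: F.P.submodule_iff)
  qed
  \<comment> \<open>Ascending induction on m from \<open>m0\<close>; at and below \<open>m0\<close>
    the contraction of \<open>low_cycles_bound\<close> gives the result.\<close>
  have "m \<le> t i \<longrightarrow> (\<forall>z\<in>Fil i m. d i z = \<zero>\<^bsub>obj P (i + 1)\<^esub> \<longrightarrow> (\<exists>q\<in>Fil (i - 1) m. d (i - 1) q = z))" if "m \<ge> m0" for m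
    using that
  proof (induction m rule: int_ge_induct)
    case base
    then show ?case using low by blast
  next
    case (step m)
    show ?case
    proof (intro impI ballI)
      fix z assume *: "m + 1 \<le> t i" "z \<in> Fil i (m + 1)" "d i z = \<zero>\<^bsub>obj P (i + 1)\<^esub>"
      show "\<exists>q\<in>Fil (i - 1) (m + 1). d (i - 1) q = z"
      proof (rule descend[OF *(1) _ order.refl _ *(3)])
        show "z \<in> FF (m + 1) (n - n)" using *(2) Fil_carrier by (simp add: FF_def ann0)
      qed (use step.IH * in auto)
    qed
  qed
  then show ?thesis using low[of m z] z by (cases "m \<ge> m0") (auto simp: t_def)
qed

text \<open>A cycle of degree j lies in \<open>Fil i j\<close>. The primitive obtained there need
  not be homogeneous, but its component of degree j is still a primitive.\<close>

lemma acyclic_of_top_acyclic: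
  assumes low: "\<And>i. \<exists>l0. \<forall>l<l0. acyclic_at i l"
    and top: "\<And>i j. i + j < D \<Longrightarrow> top_acyclic i j" and ij: "i + j < D"
  shows "acyclic_at i j"
  unfolding homology_vanishes_def
proof (intro ballI impI)
  fix z assume z: "z \<in> hg i j" "d i z = \<zero>\<^bsub>obj P (i + 1)\<^esub>"
  obtain m0 where m0: "\<And>i' l. i' \<ge> i \<Longrightarrow> l \<le> m0 \<Longrightarrow> acyclic_at i' l" using bounded_acyclicity[OF low] by blast
  obtain q where q: "q \<in> Fil (i - 1) j" "d (i - 1) q = z"
    using cycles_bound[OF m0 top order.refl homog_Fil[OF z(1) order.refl] z(2) ij] by blast
  have qc: "q \<in> C (i - 1)" using q Fil_carrier by auto
  have "d (i - 1) (component (obj P (i - 1)) j q) = component (obj P i) j z"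
    using hom_component[OF d_hom' qc, of j] q(2) by simp
  also have "\<dots> = z" using F.P.components_same[OF z(1), of j] by simp
  finally show "\<exists>y\<in>hg (i - 1) j. d (i - 1) y = z" using F.P.components_spec(1)[OF qc] by blast
qed

text \<open>For v of degree j with d v in N, the cycle d v lies in
  \<open>Fil (i + 1) (j - 1)\<close>. Since (i + 1) + (j - 1) = i + j < D, and top acyclicity is
  known above i, \<open>cycles_bound\<close> gives q in \<open>Fil i (j - 1)\<close> with d q = d v,
  which may be taken of degree j. Acyclicity makes v - q a boundary, and q lies in N.\<close>

lemma top_acyclic_of_acyclic:
  assumes J0: "J0 = {\<zero>\<^bsub>A\<^esub>}"
    and low: "\<And>i. \<exists>l0. \<forall>l<l0. acyclic_at i l"
    and ac: "\<And>i j. i + j < D \<Longrightarrow> acyclic_at i j" and ij: "i + j < D"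
  shows "top_acyclic i j"
proof -
  have N0: "x \<in> N i \<longleftrightarrow> x \<in> Fil i (j - 1)" if x: "x \<in> hg i j" for x i j
  proof
    assume xN: "x \<in> N i"
    have "\<kappa> i x g = \<zero>\<^bsub>A\<^esub>" if "deg i g > j - 1" for g
    proof (cases "deg i g = j")
      case True
      then have "\<kappa> i x g \<in> H 0" using F.coord_homog[OF x, of g] by simp
      moreover have "cA 0 (\<kappa> i x g) \<in> J0" using xN by (simp add: N_def)
      ultimately show ?thesis using J0 by (simp add: cA0_same)
    next
      case False
      then show ?thesis using that F.coord_homog[OF x, of g] H_neg[of "j - deg i g"] by auto
    qed
    then show "x \<in> Fil i (j - 1)" using hg_carrier[OF x] by (simp add: Fil_def)
  next
    assume xF: "x \<in> Fil i (j - 1)"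
    have "cA 0 (\<kappa> i x g) \<in> J0" for g
    proof (cases "deg i g \<le> j - 1")
      case True
      then show ?thesis using cA_same[OF F.coord_homog[OF x, of g], of 0] J0_zero by simp
    next
      case False
      then show ?thesis using xF J0_zero by (simp add: Fil_def cA_zero)
    qed
    then show "x \<in> N i" using hg_carrier[OF x] by (simp add: N_def)
  qed
  have descend: "top_acyclic i j" if top: "\<And>i' j. i' > i \<Longrightarrow> i' + j < D \<Longrightarrow> top_acyclic i' j" and ij: "i + j < D" for i j
    unfolding top_acyclic_def
  proof (intro ballI impI)
    fix v assume v: "v \<in> hg i j" "d i v \<in> N (i + 1)"
    have vc: "v \<in> C i" using v hg_carrier by auto
    obtain m0 where m0: "\<And>i' l. i' \<ge> i + 1 \<Longrightarrow> l \<le> m0 \<Longrightarrow> acyclic_at i' l" using bounded_acyclicity[OF low] by blast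
    have dv: "d i v \<in> hg (i + 1) j" by (rule d_homog[OF v(1)])
    have "\<exists>q\<in>Fil (i + 1 - 1) (j - 1). d (i + 1 - 1) q = d i v"
    proof (rule cycles_bound[where ?i0.0="i + 1" and ?m0.0=m0 and D=D])
      show "d i v \<in> Fil (i + 1) (j - 1)" using N0[OF dv] v(2) by simp
      show "d (i + 1) (d i v) = \<zero>\<^bsub>obj P (i + 1 + 1)\<^esub>" using d_d[OF vc] by (simp add: algebra_simps)
    qed (use m0 top ij in auto)
    then obtain q where q: "q \<in> Fil i (j - 1)" "d i q = d i v" by auto
    have qc: "q \<in> C i" using q Fil_carrier by auto
    define q' where "q' = component (obj P i) j q"
    have q': "q' \<in> hg i j" "q' \<in> Fil i (j - 1)"
      unfolding q'_def using F.P.components_spec(1)[OF qc] Fil_component[OF q(1)] by auto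
    have q'c: "q' \<in> C i" using q'(1) hg_carrier by auto
    have "d i q' = component (obj P (i + 1)) j (d i q)" unfolding q'_def by (rule hom_component[OF d_hom qc, symmetric])
    then have "d i q' = d i v" using q(2) F.P.components_same[OF dv, of j] by simp
    then have "d i (v \<ominus>\<^bsub>obj P i\<^esub> q') = \<zero>\<^bsub>obj P (i + 1)\<^esub>"
      using hom_minus[OF d_hom vc q'c] d_closed[OF vc] by (simp add: F.P.M.minus_self)
    then obtain y where y: "y \<in> hg (i - 1) j" "d (i - 1) y = v \<ominus>\<^bsub>obj P i\<^esub> q'"
      using ac[OF ij] hg_diff[OF v(1) q'(1)] unfolding homology_vanishes_def by blast
    have "v \<ominus>\<^bsub>obj P i\<^esub> d (i - 1) y = q'" unfolding y(2) by (rule F.P.M.minus_minus_cancel[OF vc q'c])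
    then show "\<exists>y\<in>hg (i - 1) j. v \<ominus>\<^bsub>obj P i\<^esub> d (i - 1) y \<in> N i" using y(1) N0[OF q'(1)] q'(2) by auto
  qed
  have above: "top_acyclic i j" if "i > n0" for i j
  proof -
    have "v = \<zero>\<^bsub>obj P i\<^esub>" if "v \<in> hg i j" for v using bounded[OF \<open>i > n0\<close>] hg_carrier[OF that] by auto
    moreover have "\<zero>\<^bsub>obj P i\<^esub> \<ominus>\<^bsub>obj P i\<^esub> d (i - 1) \<zero>\<^bsub>obj P (i - 1)\<^esub> \<in> N i"
      using N_submodule[of i] hom_zero[OF d_hom'[of i]] by (simp add: F.P.M.minus_self F.P.submodule_iff)
    ultimately show ?thesis using F.P.D_zero unfolding top_acyclic_def by blast
  qed
  have below: "\<forall>i'\<ge>i. \<forall>j. i' + j < D \<longrightarrow> top_acyclic i' j" if "i \<le> n0 + 1" for i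
    using that
  proof (induction i rule: int_le_induct)
    case base
    then show ?case using above by auto
  next
    case (step i)
    have "top_acyclic (i - 1) j" if "i - 1 + j < D" for j
      by (rule descend) (use step.IH that in auto)
    then have "top_acyclic i' j" if "i' \<ge> i - 1" "i' + j < D" for i' j
      using step.IH that by (cases "i' = i - 1") auto
    then show ?case by blast
  qed
  show ?thesis
  proof (cases "i \<le> n0 + 1")
    case True
    show ?thesis by (rule below[OF True, rule_format, OF order.refl ij])
  next
    case False
    then show ?thesis using above by simp
  qed
qed

end

subsection \<open>Quotient modules\<close>

lemma graded_quot_simps [simp]:
  "carrier (graded_quot M N) = a_rcosets\<^bsub>M\<^esub> N" "zero (graded_quot M N) = N" "add (graded_quot M N) = set_add M"
  "smult (graded_quot M N) = (\<lambda>a C. \<Union>x\<in>C. N +>\<^bsub>M\<^esub> (a \<odot>\<^bsub>M\<^esub> x))"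
  "homog (graded_quot M N) j = (\<lambda>x. N +>\<^bsub>M\<^esub> x) ` homog M j"
  by (auto simp: graded_quot_def)

lemma (in abelian_group) rcos_eq_iff:
  assumes "additive_subgroup N G" "x \<in> carrier G" "y \<in> carrier G"
  shows "N +> x = N +> y \<longleftrightarrow> x \<ominus> y \<in> N"
proof -
  have N: "subgroup N (add_monoid G)" "N \<subseteq> carrier G"
    using additive_subgroup.a_subgroup[OF assms(1)] additive_subgroup.a_subset[OF assms(1)] by auto
  show ?thesis
  proof
    assume "N +> x = N +> y"
    then have "N +> (x \<oplus> \<ominus> y) = N" by (rule a_coset_add_inv2) (use assms N in auto)
    then show "x \<ominus> y \<in> N" using a_coset_join1[OF _ _ N(1)] assms by (simp add: a_minus_def)
  next
    assume "x \<ominus> y \<in> N"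
    then have "N +> (x \<oplus> \<ominus> y) = N" using a_coset_join2[OF _ N(1)] assms by (simp add: a_minus_def)
    then show "N +> x = N +> y" by (rule a_coset_add_inv1) (use assms N in auto)
  qed
qed

lemma (in abelian_group) rcos_self_iff:
  assumes "additive_subgroup N G" "x \<in> carrier G"
  shows "N +> x = N \<longleftrightarrow> x \<in> N"
  using rcos_eq_iff[OF assms, of \<zero>] additive_subgroup.a_subset[OF assms(1)] assms(2) minus_zero_right by simp

lemma left_module_quot:
  fixes M :: "('a, 'm, int) graded"
  assumes "left_module A M" "submodule N A M"
  shows "left_module A (graded_quot M N)"
    and "\<And>x y. x \<in> carrier M \<Longrightarrow> y \<in> carrier M \<Longrightarrow> (N +>\<^bsub>M\<^esub> x) \<oplus>\<^bsub>graded_quot M N\<^esub> (N +>\<^bsub>M\<^esub> y) = N +>\<^bsub>M\<^esub> (x \<oplus>\<^bsub>M\<^esub> y)"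
    and "\<And>a x. a \<in> carrier A \<Longrightarrow> x \<in> carrier M \<Longrightarrow> a \<odot>\<^bsub>graded_quot M N\<^esub> (N +>\<^bsub>M\<^esub> x) = N +>\<^bsub>M\<^esub> (a \<odot>\<^bsub>M\<^esub> x)"
    and "\<And>x. x \<in> carrier M \<Longrightarrow> \<ominus>\<^bsub>graded_quot M N\<^esub> (N +>\<^bsub>M\<^esub> x) = N +>\<^bsub>M\<^esub> (\<ominus>\<^bsub>M\<^esub> x)"
proof -
  interpret left_module A M by fact
  have sub: "additive_subgroup N M" using submodule_additive[OF assms(2)] .
  interpret N: abelian_subgroup N M by (rule abelian_subgroupI3[OF sub M.abelian_group_axioms])
  let ?Q = "graded_quot M N"
  have NM: "N \<subseteq> carrier M" using N.a_subset .
  have carr: "C \<in> carrier ?Q \<longleftrightarrow> (\<exists>x\<in>carrier M. C = N +>\<^bsub>M\<^esub> x)" for C by (auto simp: A_RCOSETS_def')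
  show add: "(N +>\<^bsub>M\<^esub> x) \<oplus>\<^bsub>?Q\<^esub> (N +>\<^bsub>M\<^esub> y) = N +>\<^bsub>M\<^esub> (x \<oplus>\<^bsub>M\<^esub> y)" if "x \<in> carrier M" "y \<in> carrier M" for x y
    using N.a_rcos_sum that by simp
  have zero: "\<zero>\<^bsub>?Q\<^esub> = N +>\<^bsub>M\<^esub> \<zero>\<^bsub>M\<^esub>" using NM by simp
  show sm: "a \<odot>\<^bsub>?Q\<^esub> (N +>\<^bsub>M\<^esub> x) = N +>\<^bsub>M\<^esub> (a \<odot>\<^bsub>M\<^esub> x)" if a: "a \<in> carrier A" and x: "x \<in> carrier M" for a x
  proof -
    \<comment> \<open>The scalar multiple of a coset is defined as a union over its elements; all
      members of this union are the same coset.\<close>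
    have "N +>\<^bsub>M\<^esub> (a \<odot>\<^bsub>M\<^esub> y) = N +>\<^bsub>M\<^esub> (a \<odot>\<^bsub>M\<^esub> x)" if y: "y \<in> N +>\<^bsub>M\<^esub> x" for y
    proof -
      obtain n where n: "n \<in> N" "y = n \<oplus>\<^bsub>M\<^esub> x" using y by (auto simp: a_r_coset_def')
      have nc: "n \<in> carrier M" using n NM by auto
      have "a \<odot>\<^bsub>M\<^esub> y \<ominus>\<^bsub>M\<^esub> a \<odot>\<^bsub>M\<^esub> x = a \<odot>\<^bsub>M\<^esub> n"
        using n(2) nc x a by (simp add: smult_r_distr smult_closed a_minus_def M.a_assoc M.r_neg)
      also have "\<dots> \<in> N" using assms(2) n a by (auto simp: submodule_iff)
      finally show ?thesis using M.rcos_eq_iff[OF sub] n(2) nc x a by (simp add: smult_closed)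
    qed
    then have "a \<odot>\<^bsub>?Q\<^esub> (N +>\<^bsub>M\<^esub> x) = (\<Union>y\<in>N +>\<^bsub>M\<^esub> x. N +>\<^bsub>M\<^esub> (a \<odot>\<^bsub>M\<^esub> x))"
      unfolding graded_quot_simps by (intro SUP_cong refl) blast
    moreover have "N +>\<^bsub>M\<^esub> x \<noteq> {}" using N.a_rcos_self[OF x] by blast
    ultimately show ?thesis by (simp only: UN_constant if_False)
  qed
  have ag: "abelian_group ?Q"
  proof (rule abelian_groupI)
    fix X assume "X \<in> carrier ?Q"
    then obtain x where x: "x \<in> carrier M" "X = N +>\<^bsub>M\<^esub> x" using carr by auto
    show "\<zero>\<^bsub>?Q\<^esub> \<oplus>\<^bsub>?Q\<^esub> X = X" unfolding zero x(2) using add[OF M.zero_closed x(1)] x(1) by simp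
    have "(N +>\<^bsub>M\<^esub> (\<ominus>\<^bsub>M\<^esub> x)) \<oplus>\<^bsub>?Q\<^esub> X = \<zero>\<^bsub>?Q\<^esub>"
      unfolding zero x(2) using add[of "\<ominus>\<^bsub>M\<^esub> x" x] x(1) by (simp add: M.l_neg)
    moreover have "N +>\<^bsub>M\<^esub> (\<ominus>\<^bsub>M\<^esub> x) \<in> carrier ?Q" using carr x(1) by blast
    ultimately show "\<exists>Y\<in>carrier ?Q. Y \<oplus>\<^bsub>?Q\<^esub> X = \<zero>\<^bsub>?Q\<^esub>" by blast
    fix Y assume "Y \<in> carrier ?Q"
    then obtain y where y: "y \<in> carrier M" "Y = N +>\<^bsub>M\<^esub> y" using carr by auto
    show "X \<oplus>\<^bsub>?Q\<^esub> Y \<in> carrier ?Q" unfolding x(2) y(2) add[OF x(1) y(1)] carr using x(1) y(1) by blast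
    show "X \<oplus>\<^bsub>?Q\<^esub> Y = Y \<oplus>\<^bsub>?Q\<^esub> X"
      unfolding x(2) y(2) add[OF x(1) y(1)] add[OF y(1) x(1)] using x(1) y(1) by (simp add: M.a_comm)
    fix Z assume "Z \<in> carrier ?Q"
    then obtain z where z: "z \<in> carrier M" "Z = N +>\<^bsub>M\<^esub> z" using carr by auto
    show "X \<oplus>\<^bsub>?Q\<^esub> Y \<oplus>\<^bsub>?Q\<^esub> Z = X \<oplus>\<^bsub>?Q\<^esub> (Y \<oplus>\<^bsub>?Q\<^esub> Z)"
      unfolding x(2) y(2) z(2) using x(1) y(1) z(1) add by (simp del: graded_quot_simps add: M.a_assoc)
  next
    show "\<zero>\<^bsub>?Q\<^esub> \<in> carrier ?Q" unfolding zero carr by blast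
  qed
  interpret Q: abelian_group ?Q by (rule ag)
  show "\<ominus>\<^bsub>?Q\<^esub> (N +>\<^bsub>M\<^esub> x) = N +>\<^bsub>M\<^esub> (\<ominus>\<^bsub>M\<^esub> x)" if x: "x \<in> carrier M" for x
  proof (rule Q.minus_equality)
    show "(N +>\<^bsub>M\<^esub> (\<ominus>\<^bsub>M\<^esub> x)) \<oplus>\<^bsub>?Q\<^esub> (N +>\<^bsub>M\<^esub> x) = \<zero>\<^bsub>?Q\<^esub>"
      unfolding zero using add[of "\<ominus>\<^bsub>M\<^esub> x" x] x by (simp add: M.l_neg)
  qed (use carr x in blast)+
  show "left_module A ?Q" unfolding left_module_def left_module_axioms_def
  proof (intro conjI allI impI R.ring_axioms ag)
    fix a X assume a: "a \<in> carrier A" and "X \<in> carrier ?Q"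
    then obtain x where x: "x \<in> carrier M" "X = N +>\<^bsub>M\<^esub> x" using carr by auto
    show "a \<odot>\<^bsub>?Q\<^esub> X \<in> carrier ?Q" unfolding x(2) sm[OF a x(1)] carr using a x(1) smult_closed by blast
    { fix b assume b: "b \<in> carrier A"
      show "(a \<oplus>\<^bsub>A\<^esub> b) \<odot>\<^bsub>?Q\<^esub> X = a \<odot>\<^bsub>?Q\<^esub> X \<oplus>\<^bsub>?Q\<^esub> b \<odot>\<^bsub>?Q\<^esub> X"
        unfolding x(2) using a b x(1) sm add by (simp del: graded_quot_simps add: smult_l_distr smult_closed)
      show "(a \<otimes>\<^bsub>A\<^esub> b) \<odot>\<^bsub>?Q\<^esub> X = a \<odot>\<^bsub>?Q\<^esub> (b \<odot>\<^bsub>?Q\<^esub> X)"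
        unfolding x(2) using a b x(1) sm by (simp del: graded_quot_simps add: smult_assoc smult_closed) }
    fix Y assume "Y \<in> carrier ?Q"
    then obtain y where y: "y \<in> carrier M" "Y = N +>\<^bsub>M\<^esub> y" using carr by auto
    show "a \<odot>\<^bsub>?Q\<^esub> (X \<oplus>\<^bsub>?Q\<^esub> Y) = a \<odot>\<^bsub>?Q\<^esub> X \<oplus>\<^bsub>?Q\<^esub> a \<odot>\<^bsub>?Q\<^esub> Y"
      unfolding x(2) y(2) using a x(1) y(1) sm add by (simp del: graded_quot_simps add: smult_r_distr smult_closed)
  next
    fix X assume "X \<in> carrier ?Q"
    then obtain x where x: "x \<in> carrier M" "X = N +>\<^bsub>M\<^esub> x" using carr by auto
    show "\<one>\<^bsub>A\<^esub> \<odot>\<^bsub>?Q\<^esub> X = X" unfolding x(2) using x(1) sm by (simp del: graded_quot_simps add: smult_one)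
  qed
qed

lemma shift_simps [simp]:
  "carrier (shift M j) = carrier M" "zero (shift M j) = zero M" "add (shift M j) = add M" "smult (shift M j) = smult M"
  "homog (shift M j) m = homog M (m + j)"
  by (auto simp: shift_def)

lemma gr_hom_shift_iff:
  "f \<in> gr_hom A M (shift N k) \<longleftrightarrow> f \<in> lin_maps A M N \<and> (\<forall>j. \<forall>x\<in>homog M j. f x \<in> homog N (j + k))"
  by (simp add: gr_hom_def lin_maps_def)

subsection \<open>The semisimple quotient \<open>S = A/J\<close>\<close>

context graded_algebra
begin

abbreviation "S \<equiv> graded_top A"
abbreviation cls :: "'a \<Rightarrow> 'a set" where "cls a \<equiv> rad +>\<^bsub>graded_regular A\<^esub> a"

lemma rad_gr_ideal: "gr_ideal rad"
  using gr_ideal_extend[OF rad0_ideal] rad_eq by simp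

lemma rad_submodule: "submodule rad A (graded_regular A)"
  using rad_gr_ideal by (simp add: graded_submodule_def)

lemma S_eq: "S = graded_quot (graded_regular A) rad"
  by (simp add: graded_top_def)

lemma S_left_module: "left_module A S"
  unfolding S_eq by (rule left_module_quot(1)[OF left_module_regular rad_submodule])

sublocale S: left_module A S by (rule S_left_module)

lemmas cls_add = left_module_quot(2)[OF left_module_regular rad_submodule, folded S_eq, simplified]
  and cls_smult = left_module_quot(3)[OF left_module_regular rad_submodule, folded S_eq, simplified]
  and cls_neg = left_module_quot(4)[OF left_module_regular rad_submodule, folded S_eq, simplified]

lemma S_zero: "\<zero>\<^bsub>S\<^esub> = rad" by (simp add: S_eq)

lemma S_carrier: "X \<in> carrier S \<longleftrightarrow> (\<exists>x\<in>carrier A. X = cls x)"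
  by (auto simp: S_eq A_RCOSETS_def')

lemma S_homog: "X \<in> homog S j \<longleftrightarrow> (\<exists>x\<in>H j. X = cls x)"
  by (auto simp: S_eq)

lemma cls_zero_iff: "x \<in> carrier A \<Longrightarrow> cls x = \<zero>\<^bsub>S\<^esub> \<longleftrightarrow> cA 0 x \<in> rad0"
  using reg.M.rcos_self_iff[OF reg.submodule_additive[OF rad_submodule], of x] rad_eq cA_in S_zero by auto

lemma S_homog_zero: "\<zero>\<^bsub>S\<^esub> \<in> homog S j"
proof -
  have "cls \<zero>\<^bsub>A\<^esub> = \<zero>\<^bsub>S\<^esub>" using rad0_ideal by (subst cls_zero_iff) (auto simp: cA_zero deg0_ideal_iff)
  then show ?thesis unfolding S_homog using H_zero by metis
qed

lemma S_homog_add: "X \<in> homog S j \<Longrightarrow> Y \<in> homog S j \<Longrightarrow> X \<oplus>\<^bsub>S\<^esub> Y \<in> homog S j"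
proof -
  assume "X \<in> homog S j" "Y \<in> homog S j"
  then obtain x y where "x \<in> H j" "y \<in> H j" "X = cls x" "Y = cls y" unfolding S_homog by blast
  then show ?thesis unfolding S_homog
    by (intro bexI[of _ "x \<oplus>\<^bsub>A\<^esub> y"]) (simp_all add: cls_add H_add H_carrier)
qed

lemma S_homog_neg: "X \<in> homog S j \<Longrightarrow> \<ominus>\<^bsub>S\<^esub> X \<in> homog S j"
proof -
  assume "X \<in> homog S j"
  then obtain x where "x \<in> H j" "X = cls x" unfolding S_homog by blast
  then show ?thesis unfolding S_homog
    by (intro bexI[of _ "\<ominus>\<^bsub>A\<^esub> x"]) (simp_all add: cls_neg H_minus H_carrier)
qed

text \<open>J contains every element of nonzero degree, so S is concentrated in degree zero.\<close>

lemma S_homog_nonzero: 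
  assumes "X \<in> homog S j" "j \<noteq> 0" shows "X = \<zero>\<^bsub>S\<^esub>"
proof -
  obtain x where x: "x \<in> H j" "X = cls x" using assms S_homog by auto
  have "cA 0 x \<in> rad0" using cA_same[OF x(1), of 0] assms(2) rad0_ideal by (simp add: deg0_ideal_iff)
  then show ?thesis using cls_zero_iff[OF H_carrier[OF x(1)]] x(2) by simp
qed

lemma cls_lin: "cls \<in> lin_maps A (graded_regular A) S"
  unfolding lin_maps_def using S_carrier by (auto simp: cls_add cls_smult)

text \<open>\<open>ext_vanishes P i j\<close> says that \<open>H\<^sup>-\<^sup>i(Hom(P, S))\<^sub>-\<^sub>j = 0\<close>.\<close>

definition ext_vanishes :: "('a, 'p) cochain \<Rightarrow> int \<Rightarrow> int \<Rightarrow> bool" where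
  "ext_vanishes P i j \<longleftrightarrow> (\<forall>\<phi>\<in>gr_hom A (obj P i) (shift S (- j)).
     (\<forall>x\<in>carrier (obj P (i - 1)). \<phi> (diff P (i - 1) x) = \<zero>\<^bsub>S\<^esub>) \<longrightarrow>
     (\<exists>\<psi>\<in>gr_hom A (obj P (i + 1)) (shift S (- j)). \<forall>x\<in>carrier (obj P i). \<phi> x = \<psi> (diff P i x)))"

text \<open>As S is concentrated in degree zero, both maps vanish on all homogeneous parts of M
  other than that of degree -k.\<close>

lemma gr_hom_S_eqI:
  assumes M: "graded_module A M" and f: "f \<in> gr_hom A M (shift S k)" and g: "g \<in> gr_hom A M (shift S k)"
    and eq: "\<And>x. x \<in> homog M (- k) \<Longrightarrow> f x = g x" and x: "x \<in> carrier M"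
  shows "f x = g x"
proof -
  interpret M: graded_module A M by fact
  show ?thesis using x
  proof (rule M.direct_sum_induct)
  show "f x = g x" if x: "x \<in> homog M j" for x j
  proof (cases "j + k = 0")
    case True
    then have "j = - k" by simp
    then show ?thesis using eq x by simp
  next
    case False
    have "f x \<in> homog S (j + k)" "g x \<in> homog S (j + k)" using f g x by (simp_all add: gr_hom_shift_iff)
    then have "f x = \<zero>\<^bsub>S\<^esub>" "g x = \<zero>\<^bsub>S\<^esub>" by (simp_all add: S_homog_nonzero[OF _ False])
    then show ?thesis by simp
  qed
  show "f (x \<oplus>\<^bsub>M\<^esub> y) = g (x \<oplus>\<^bsub>M\<^esub> y)" if "x \<in> carrier M" "y \<in> carrier M" "f x = g x" "f y = g y" for x y
    using that f g by (simp add: gr_hom_shift_iff lin_maps_def)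
  qed
qed

lemma gr_hom_S_add: "f \<in> gr_hom A M (shift S k) \<Longrightarrow> g \<in> gr_hom A M (shift S k) \<Longrightarrow> (\<lambda>x. f x \<oplus>\<^bsub>S\<^esub> g x) \<in> gr_hom A M (shift S k)"
  using S.lin_maps_add[of f M g] S_homog_add by (simp add: gr_hom_shift_iff)

lemma gr_hom_S_neg: "f \<in> gr_hom A M (shift S k) \<Longrightarrow> (\<lambda>x. \<ominus>\<^bsub>S\<^esub> f x) \<in> gr_hom A M (shift S k)"
  using S.lin_maps_neg[of f M] S_homog_neg by (simp add: gr_hom_shift_iff)

lemma gr_hom_S_zero: "left_module A M \<Longrightarrow> (\<lambda>x. \<zero>\<^bsub>S\<^esub>) \<in> gr_hom A M (shift S k)"
  using S_homog_zero by (auto simp: gr_hom_shift_iff lin_maps_def S.smult_r_null)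

lemma graded_Hom_carrierI:
  "finite F \<Longrightarrow> \<forall>j\<in>F. g j \<in> gr_hom A M (shift N j) \<Longrightarrow>
    (\<lambda>x\<in>carrier M. \<Oplus>\<^bsub>N\<^esub>j\<in>F. g j x) \<in> carrier (graded_Hom A M N)"
  unfolding graded_Hom_def by (simp, rule exI[of _ F], rule exI[of _ g], simp)

lemma graded_Hom_add:
  assumes M: "left_module A M" and f: "f \<in> carrier (graded_Hom A M S)" and \<psi>: "\<psi> \<in> gr_hom A M (shift S k)"
  shows "(\<lambda>x\<in>carrier M. f x \<oplus>\<^bsub>S\<^esub> \<psi> x) \<in> carrier (graded_Hom A M S)"
proof -
  obtain F g where F: "finite F" "\<And>j. j \<in> F \<Longrightarrow> g j \<in> gr_hom A M (shift S j)"
    and fg: "f = (\<lambda>x\<in>carrier M. \<Oplus>\<^bsub>S\<^esub>j\<in>F. g j x)"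
    using f by (auto simp: graded_Hom_def)
  \<comment> \<open>\<open>k\<close> may already occur in \<open>F\<close>, so both summands are
    written over the same index set, filled up with zero maps.\<close>
  define F' where "F' = insert k F"
  define g1 where "g1 j = (if j \<in> F then g j else (\<lambda>x. \<zero>\<^bsub>S\<^esub>))" for j
  define g2 where "g2 j = (if k = j then \<psi> else (\<lambda>x. \<zero>\<^bsub>S\<^esub>))" for j
  have g1: "g1 j \<in> gr_hom A M (shift S j)" and g2: "g2 j \<in> gr_hom A M (shift S j)" for j
    using F(2) \<psi> gr_hom_S_zero[OF M] by (auto simp: g1_def g2_def)
  have cl: "h x \<in> carrier S" if "h \<in> gr_hom A M (shift S j)" "x \<in> carrier M" for h j x
    using that by (auto simp: gr_hom_shift_iff lin_maps_def)
  have "(\<lambda>x\<in>carrier M. f x \<oplus>\<^bsub>S\<^esub> \<psi> x) = (\<lambda>x\<in>carrier M. \<Oplus>\<^bsub>S\<^esub>j\<in>F'. g1 j x \<oplus>\<^bsub>S\<^esub> g2 j x)"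
  proof (rule restrict_ext)
    fix x assume x: "x \<in> carrier M"
    have "(\<Oplus>\<^bsub>S\<^esub>j\<in>F'. g1 j x \<oplus>\<^bsub>S\<^esub> g2 j x) = (\<Oplus>\<^bsub>S\<^esub>j\<in>F'. g1 j x) \<oplus>\<^bsub>S\<^esub> (\<Oplus>\<^bsub>S\<^esub>j\<in>F'. g2 j x)"
      by (rule S.M.finsum_addf) (use cl[OF g1 x] cl[OF g2 x] in auto)
    moreover have "(\<Oplus>\<^bsub>S\<^esub>j\<in>F. g j x) = (\<Oplus>\<^bsub>S\<^esub>j\<in>F'. g1 j x)"
      by (rule S.M.add.finprod_mono_neutral_cong_left) (use F cl[OF g1 x] in \<open>auto simp: F'_def g1_def\<close>)
    moreover have "(\<Oplus>\<^bsub>S\<^esub>j\<in>F'. g2 j x) = (\<Oplus>\<^bsub>S\<^esub>j\<in>F'. if k = j then \<psi> x else \<zero>\<^bsub>S\<^esub>)"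
      by (rule S.M.finsum_cong') (use cl[OF \<psi> x] in \<open>auto simp: g2_def\<close>)
    moreover have "\<dots> = \<psi> x"
      using S.M.finsum_singleton[of k F' "\<lambda>_. \<psi> x"] F(1) cl[OF \<psi> x] by (simp add: F'_def)
    ultimately show "f x \<oplus>\<^bsub>S\<^esub> \<psi> x = (\<Oplus>\<^bsub>S\<^esub>j\<in>F'. g1 j x \<oplus>\<^bsub>S\<^esub> g2 j x)" using x by (simp add: fg)
  qed
  moreover have "finite F'" using F(1) by (simp add: F'_def)
  moreover have "\<forall>j\<in>F'. (\<lambda>x. g1 j x \<oplus>\<^bsub>S\<^esub> g2 j x) \<in> gr_hom A M (shift S j)" using gr_hom_S_add g1 g2 by blast
  ultimately show ?thesis using graded_Hom_carrierI[of F' "\<lambda>j x. g1 j x \<oplus>\<^bsub>S\<^esub> g2 j x" M S] by simp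
qed

lemma graded_Hom_zero: "(\<lambda>x\<in>carrier M. \<zero>\<^bsub>S\<^esub>) \<in> carrier (graded_Hom A M S)"
  using graded_Hom_carrierI[of "{}" _ M S] by simp

text \<open>On the part of M of degree -k, a map to S(j) with j different from k vanishes. The lemma
  replaces an arbitrary primitive in the Hom complex by a homogeneous one.\<close>

lemma graded_Hom_component:
  assumes M: "graded_module A M" and f: "f \<in> carrier (graded_Hom A M S)"
  obtains \<psi> where "\<psi> \<in> gr_hom A M (shift S k)" "\<And>x. x \<in> homog M (- k) \<Longrightarrow> f x = \<psi> x"
proof -
  interpret M: graded_module A M by fact
  obtain F g where F: "finite F" "\<And>j. j \<in> F \<Longrightarrow> g j \<in> gr_hom A M (shift S j)"
    and fg: "f = (\<lambda>x\<in>carrier M. \<Oplus>\<^bsub>S\<^esub>j\<in>F. g j x)"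
    using f by (auto simp: graded_Hom_def)
  define \<psi> where "\<psi> = (if k \<in> F then g k else (\<lambda>x. \<zero>\<^bsub>S\<^esub>))"
  have \<psi>: "\<psi> \<in> gr_hom A M (shift S k)" using F(2) gr_hom_S_zero[OF M.left_module_axioms] by (simp add: \<psi>_def)
  have "f x = \<psi> x" if x: "x \<in> homog M (- k)" for x
  proof -
    have xc: "x \<in> carrier M" using M.D_carrier x by auto
    have cl: "\<psi> x \<in> carrier S" using \<psi> xc by (auto simp: gr_hom_shift_iff lin_maps_def)
    have gj: "g j x = (if k = j then \<psi> x else \<zero>\<^bsub>S\<^esub>)" if j: "j \<in> F" for j
    proof (cases "k = j")
      case False
      have "g j x \<in> homog S (- k + j)" using F(2)[OF j] x unfolding gr_hom_shift_iff by blast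
      then show ?thesis using S_homog_nonzero[of "g j x" "- k + j"] False by simp
    qed (use j \<psi>_def in auto)
    have "f x = (\<Oplus>\<^bsub>S\<^esub>j\<in>F. g j x)" using fg xc by simp
    also have "\<dots> = (\<Oplus>\<^bsub>S\<^esub>j\<in>F. if k = j then \<psi> x else \<zero>\<^bsub>S\<^esub>)"
      by (rule S.M.finsum_cong') (use gj cl in auto)
    also have "\<dots> = \<psi> x"
    proof (cases "k \<in> F")
      case True
      then show ?thesis using S.M.finsum_singleton[of k F "\<lambda>_. \<psi> x"] F(1) cl by simp
    next
      case False
      then have "(\<Oplus>\<^bsub>S\<^esub>j\<in>F. if k = j then \<psi> x else \<zero>\<^bsub>S\<^esub>) = (\<Oplus>\<^bsub>S\<^esub>j\<in>F. \<zero>\<^bsub>S\<^esub>)"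
        by (intro S.M.finsum_cong') auto
      then show ?thesis using False by (simp add: \<psi>_def)
    qed
    finally show ?thesis .
  qed
  then show thesis using that \<psi> by blast
qed

text \<open>With i = -n, a homogeneous element of bidegree (n, k) is a morphism from P^i to S(k). It
  is a cocycle if it kills the boundaries in P^i, and a coboundary if it factors through d, up to a
  sign. The rest of the proof deals with cosets, signs and the extensionality of the functions
  involved.\<close>

lemma Hom_cohomology_zero_iff:
  fixes P :: "('a, 'p) cochain"
  assumes P: "cochain_complex A P"
  shows "homog (cohomology (Hom_complex A P S) n) k = {\<zero>\<^bsub>cohomology (Hom_complex A P S) n\<^esub>} \<longleftrightarrow>
    ext_vanishes P (- n) (- k)"
proof -
  let ?X = "Hom_complex A P S"
  have ob: "obj ?X n = graded_Hom A (obj P (- n)) S" for n by (simp add: Hom_complex_def)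
  define i where "i = - n"
  have gm: "graded_module A (obj P i)" for i using P by (simp add: cochain_complex_def)
  note lm = graded_module.axioms(1)[OF gm]
  have dh: "diff P i \<in> gr_hom A (obj P i) (obj P (i + 1))" for i using P by (simp add: cochain_complex_def)
  have dh': "diff P (i - 1) \<in> gr_hom A (obj P (i - 1)) (obj P i)" for i using dh[of "i - 1"] by simp
  \<comment> \<open>The sign of the differential; it is an additive involution of S preserving
    degrees, so it can be moved from the coboundary to the primitive.\<close>
  define sg where "sg n y = (if even (n::int) then \<ominus>\<^bsub>S\<^esub> y else y)" for n y
  have sg: "y \<in> carrier S \<Longrightarrow> sg n y \<in> carrier S" "y \<in> carrier S \<Longrightarrow> sg n (sg n y) = y"
    "y \<in> carrier S \<Longrightarrow> z \<in> carrier S \<Longrightarrow> sg n (y \<oplus>\<^bsub>S\<^esub> z) = sg n y \<oplus>\<^bsub>S\<^esub> sg n z"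
    "y \<in> carrier S \<Longrightarrow> sg n y = \<zero>\<^bsub>S\<^esub> \<longleftrightarrow> y = \<zero>\<^bsub>S\<^esub>" for n y z
    by (auto simp: sg_def S.M.minus_add)
  have sgh: "(\<lambda>x. sg n (f x)) \<in> gr_hom A M (shift S k)" if "f \<in> gr_hom A M (shift S k)" for f M k n
    using that gr_hom_S_neg[OF that] by (cases "even n") (simp_all add: sg_def)
  have diff0: "diff ?X m f = (\<lambda>x\<in>carrier (obj P (- (m + 1))). sg m (f (diff P (- (m + 1)) x)))" for m f
    by (simp only: Hom_complex_def cochain.simps sg_def Let_def)
  have idx: "- (n + 1) = i - 1" "- (n - 1 + 1) = i" by (auto simp: i_def)
  note diff1 = diff0[of n, unfolded idx] and diff2 = diff0[of "n - 1", unfolded idx]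
  have ob1: "obj ?X (n - 1) = graded_Hom A (obj P (i + 1)) S" unfolding ob i_def by simp
  have grc: "f x \<in> carrier S" if "f \<in> gr_hom A M (shift S k)" "x \<in> carrier M" for f M k x
    using that by (auto simp: gr_hom_shift_iff lin_maps_def)
  have grd: "diff P i x \<in> carrier (obj P (i + 1))" if "x \<in> carrier (obj P i)" for x i
    using that dh[of i] by (auto simp: gr_hom_def)
  have ghc: "f x \<in> carrier S" if f: "f \<in> carrier (graded_Hom A M S)" and x: "x \<in> carrier M" for f and M :: "('a, 'p, int) graded" and x
  proof -
    obtain F g where g: "\<And>j. j \<in> F \<Longrightarrow> g j \<in> gr_hom A M (shift S j)" "f = (\<lambda>x\<in>carrier M. \<Oplus>\<^bsub>S\<^esub>j\<in>F. g j x)"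
      using f by (auto simp: graded_Hom_def)
    have "g j x \<in> carrier S" if "j \<in> F" for j by (rule grc[OF g(1)[OF that] x])
    then show ?thesis using x g(2) by (auto intro!: S.M.finsum_closed)
  qed
  let ?B = "coboundaries ?X n"
  let ?Hk = "gr_hom A (obj P i) (shift S k) \<inter> extensional (carrier (obj P i))"
  have zero_add: "(\<lambda>x\<in>carrier (obj P i). (\<lambda>x\<in>carrier (obj P i). \<zero>\<^bsub>S\<^esub>) x \<oplus>\<^bsub>S\<^esub> f x) = f" if f: "f \<in> ?Hk" for f
  proof (rule extensionalityI[of _ "carrier (obj P i)"])
    fix x assume x: "x \<in> carrier (obj P i)"
    have "f x \<in> carrier S" by (rule grc[OF _ x]) (use f in blast)
    then show "(\<lambda>x\<in>carrier (obj P i). (\<lambda>x\<in>carrier (obj P i). \<zero>\<^bsub>S\<^esub>) x \<oplus>\<^bsub>S\<^esub> f x) x = f x" using x by simp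
  qed (use f in simp_all)
  interpret Pi: graded_module A "obj P i" by (rule gm)
  have restr: "restrict \<phi> (carrier (obj P i)) \<in> ?Hk" if "\<phi> \<in> gr_hom A (obj P i) (shift S k)" for \<phi>
    using that Pi.D_carrier by (auto simp: gr_hom_shift_iff lin_maps_def Pi.smult_closed)
  have hom_sub: "f \<in> carrier (obj ?X n)" if f: "f \<in> ?Hk" for f
  proof -
    have "(\<lambda>x\<in>carrier (obj P i). (\<lambda>x\<in>carrier (obj P i). \<zero>\<^bsub>S\<^esub>) x \<oplus>\<^bsub>S\<^esub> f x) \<in> carrier (graded_Hom A (obj P i) S)"
      using graded_Hom_add[OF lm graded_Hom_zero] f by blast
    then show ?thesis unfolding zero_add[OF f] by (simp add: ob i_def)
  qed
  define Z where "Z = {f \<in> ?Hk. \<forall>x\<in>carrier (obj P (i - 1)). f (diff P (i - 1) x) = \<zero>\<^bsub>S\<^esub>}"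
  have Z: "homog (obj ?X n) k \<inter> cocycles ?X n = Z"
  proof -
    have "homog (obj ?X n) k = ?Hk" by (simp add: ob graded_Hom_def i_def)
    moreover have "f \<in> cocycles ?X n \<longleftrightarrow> (\<forall>x\<in>carrier (obj P (i - 1)). f (diff P (i - 1) x) = \<zero>\<^bsub>S\<^esub>)" if f: "f \<in> ?Hk" for f
    proof -
      have "\<zero>\<^bsub>obj ?X (n + 1)\<^esub> = (\<lambda>x\<in>carrier (obj P (i - 1)). \<zero>\<^bsub>S\<^esub>)"
        unfolding ob by (simp add: graded_Hom_def i_def)
      moreover have "f (diff P (i - 1) x) \<in> carrier S" if x: "x \<in> carrier (obj P (i - 1))" for x
        by (rule grc[of f "obj P i" k]) (use grd[OF x] f in simp_all)
      ultimately show ?thesis using hom_sub[OF f] sg(4)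
        unfolding cocycles_def diff1 by (auto simp: fun_eq_iff restrict_def)
    qed
    ultimately show ?thesis by (auto simp: Z_def)
  qed
  have coset: "a_r_coset (graded_sub (obj ?X n) (cocycles ?X n)) ?B f = {(\<lambda>x\<in>carrier (obj P i). h x \<oplus>\<^bsub>S\<^esub> f x) | h. h \<in> ?B}" for f
    by (auto simp: a_r_coset_def' graded_sub_def ob graded_Hom_def i_def)
  have homog_eq: "homog (cohomology ?X n) k = (\<lambda>f. {(\<lambda>x\<in>carrier (obj P i). h x \<oplus>\<^bsub>S\<^esub> f x) | h. h \<in> ?B}) ` Z"
    unfolding cohomology_def graded_quot_simps coset[symmetric] Z[symmetric] by (simp add: graded_sub_def)
  have zero: "\<zero>\<^bsub>cohomology ?X n\<^esub> = ?B" by (simp add: cohomology_def)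
  have B: "h \<in> ?B \<longleftrightarrow> (\<exists>g\<in>carrier (graded_Hom A (obj P (i + 1)) S). h = (\<lambda>x\<in>carrier (obj P i). sg (n - 1) (g (diff P i x))))" for h
    unfolding coboundaries_def ob1 using diff2 by (auto simp: image_iff)
  have Bc: "h x \<in> carrier S" if "h \<in> ?B" "x \<in> carrier (obj P i)" for h x
    using that ghc grd sg(1) unfolding B by auto
  have B_add: "(\<lambda>x\<in>carrier (obj P i). h x \<oplus>\<^bsub>S\<^esub> \<psi> (diff P i x)) \<in> ?B"
    if h: "h \<in> ?B" and \<psi>: "\<psi> \<in> gr_hom A (obj P (i + 1)) (shift S k)" for h \<psi>
  proof -
    obtain g where g: "g \<in> carrier (graded_Hom A (obj P (i + 1)) S)" "h = (\<lambda>x\<in>carrier (obj P i). sg (n - 1) (g (diff P i x)))"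
      using h B by auto
    let ?g = "\<lambda>x\<in>carrier (obj P (i + 1)). g x \<oplus>\<^bsub>S\<^esub> sg (n - 1) (\<psi> x)"
    have "?g \<in> carrier (graded_Hom A (obj P (i + 1)) S)" by (rule graded_Hom_add[OF lm g(1) sgh[OF \<psi>]])
    moreover have "(\<lambda>x\<in>carrier (obj P i). h x \<oplus>\<^bsub>S\<^esub> \<psi> (diff P i x)) = (\<lambda>x\<in>carrier (obj P i). sg (n - 1) (?g (diff P i x)))"
      unfolding g(2) by (rule restrict_ext) (use sg ghc[OF g(1)] grc[OF \<psi>] grd in simp)
    ultimately show ?thesis unfolding B by blast
  qed
  have zB: "(\<lambda>x\<in>carrier (obj P i). \<zero>\<^bsub>S\<^esub>) \<in> ?B"
  proof -
    have "(\<lambda>x\<in>carrier (obj P i). \<zero>\<^bsub>S\<^esub>) = (\<lambda>x\<in>carrier (obj P i). sg (n - 1) ((\<lambda>x\<in>carrier (obj P (i + 1)). \<zero>\<^bsub>S\<^esub>) (diff P i x)))"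
      by (rule restrict_ext) (use grd sg(4)[OF S.M.zero_closed] in simp)
    then show ?thesis unfolding B using graded_Hom_zero by blast
  qed
  have Zne: "Z \<noteq> {}"
  proof -
    have "restrict (\<lambda>x. \<zero>\<^bsub>S\<^esub>) (carrier (obj P i)) \<in> ?Hk" by (rule restr[OF gr_hom_S_zero[OF lm]])
    then have "restrict (\<lambda>x. \<zero>\<^bsub>S\<^esub>) (carrier (obj P i)) \<in> Z" unfolding Z_def using grd[of _ "i - 1"] by simp
    then show ?thesis by blast
  qed
  have key: "{(\<lambda>x\<in>carrier (obj P i). h x \<oplus>\<^bsub>S\<^esub> f x) | h. h \<in> ?B} = ?B \<longleftrightarrow>
      (\<exists>\<psi>\<in>gr_hom A (obj P (i + 1)) (shift S k). \<forall>x\<in>carrier (obj P i). f x = \<psi> (diff P i x))" (is "?L = _ \<longleftrightarrow> ?R")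
    if f: "f \<in> Z" for f
  proof
    have fk: "f \<in> gr_hom A (obj P i) (shift S k)" "f \<in> extensional (carrier (obj P i))" using f by (auto simp: Z_def)
    assume L: "?L = ?B"
    have "(\<lambda>x\<in>carrier (obj P i). (\<lambda>x\<in>carrier (obj P i). \<zero>\<^bsub>S\<^esub>) x \<oplus>\<^bsub>S\<^esub> f x) \<in> ?B" using L zB by blast
    then have "f \<in> ?B" using zero_add[of f] fk by simp
    then obtain g where g: "g \<in> carrier (graded_Hom A (obj P (i + 1)) S)" "f = (\<lambda>x\<in>carrier (obj P i). sg (n - 1) (g (diff P i x)))"
      using B by auto
    \<comment> \<open>The primitive g is a finite sum of maps of various degrees. Its part of degree
      k suffices, because f and the composite need only be compared on elements of degree
      -k.\<close>
    obtain \<psi> where \<psi>: "\<psi> \<in> gr_hom A (obj P (i + 1)) (shift S k)" "\<And>x. x \<in> homog (obj P (i + 1)) (- k) \<Longrightarrow> g x = \<psi> x"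
      using graded_Hom_component[OF gm g(1)] by blast
    have "f x = sg (n - 1) (\<psi> (diff P i x))" if "x \<in> carrier (obj P i)" for x
    proof (rule gr_hom_S_eqI[OF gm fk(1) _ _ that])
      show "(\<lambda>x. sg (n - 1) (\<psi> (diff P i x))) \<in> gr_hom A (obj P i) (shift S k)"
        using gr_hom_comp[OF dh sgh[OF \<psi>(1)]] .
      fix x assume x: "x \<in> homog (obj P i) (- k)"
      have "x \<in> carrier (obj P i)" using x Pi.D_carrier by blast
      moreover have "diff P i x \<in> homog (obj P (i + 1)) (- k)" using dh x by (auto simp: gr_hom_def)
      ultimately show "f x = sg (n - 1) (\<psi> (diff P i x))" unfolding g(2) using \<psi>(2) by simp
    qed
    then show ?R by (intro bexI[OF _ sgh[OF \<psi>(1), of "n - 1"]] ballI)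
  next
    assume ?R
    then obtain \<psi> where \<psi>: "\<psi> \<in> gr_hom A (obj P (i + 1)) (shift S k)" "\<And>x. x \<in> carrier (obj P i) \<Longrightarrow> f x = \<psi> (diff P i x)" by blast
    show "?L = ?B"
    proof (intro equalityI subsetI)
      fix h' assume "h' \<in> ?L"
      then obtain h where h: "h \<in> ?B" "h' = (\<lambda>x\<in>carrier (obj P i). h x \<oplus>\<^bsub>S\<^esub> f x)" by auto
      have "h' = (\<lambda>x\<in>carrier (obj P i). h x \<oplus>\<^bsub>S\<^esub> \<psi> (diff P i x))" unfolding h(2) by (rule restrict_ext) (simp add: \<psi>(2))
      then show "h' \<in> ?B" using B_add[OF h(1) \<psi>(1)] by simp
    next
      fix h assume h: "h \<in> ?B"
      have hx: "h \<in> extensional (carrier (obj P i))" using h unfolding B by auto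
      let ?h = "\<lambda>x\<in>carrier (obj P i). h x \<oplus>\<^bsub>S\<^esub> \<ominus>\<^bsub>S\<^esub> \<psi> (diff P i x)"
      have "?h \<in> ?B" by (rule B_add[OF h gr_hom_S_neg[OF \<psi>(1)]])
      moreover have "h = (\<lambda>x\<in>carrier (obj P i). ?h x \<oplus>\<^bsub>S\<^esub> f x)"
        by (rule extensionalityI[OF hx]) (use \<psi>(2) Bc[OF h] grc[OF \<psi>(1)] grd in \<open>auto simp: S.M.a_assoc S.M.l_neg\<close>)
      ultimately show "h \<in> ?L" by blast
    qed
  qed
  have img: "g ` Z = {b} \<longleftrightarrow> (\<forall>f\<in>Z. g f = b)" for g :: "('p \<Rightarrow> 'a set) \<Rightarrow> ('p \<Rightarrow> 'a set) set" and b
    using Zne by blast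
  have "homog (cohomology ?X n) k = {\<zero>\<^bsub>cohomology ?X n\<^esub>} \<longleftrightarrow>
    (\<forall>f\<in>Z. \<exists>\<psi>\<in>gr_hom A (obj P (i + 1)) (shift S k). \<forall>x\<in>carrier (obj P i). f x = \<psi> (diff P i x))"
    unfolding homog_eq zero img by (intro ball_cong refl key)
  also have "\<dots> \<longleftrightarrow> ext_vanishes P i (- k)"
  proof
    assume *: "\<forall>f\<in>Z. \<exists>\<psi>\<in>gr_hom A (obj P (i + 1)) (shift S k). \<forall>x\<in>carrier (obj P i). f x = \<psi> (diff P i x)"
    show "ext_vanishes P i (- k)" unfolding ext_vanishes_def
    proof (intro ballI impI)
      fix \<phi> assume \<phi>: "\<phi> \<in> gr_hom A (obj P i) (shift S (- (- k)))"
        "\<forall>x\<in>carrier (obj P (i - 1)). \<phi> (diff P (i - 1) x) = \<zero>\<^bsub>S\<^esub>"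
      have "restrict \<phi> (carrier (obj P i)) \<in> ?Hk" using restr \<phi>(1) by simp
      then have "restrict \<phi> (carrier (obj P i)) \<in> Z" unfolding Z_def using \<phi>(2) grd[of _ "i - 1"] by simp
      then show "\<exists>\<psi>\<in>gr_hom A (obj P (i + 1)) (shift S (- (- k))). \<forall>x\<in>carrier (obj P i). \<phi> x = \<psi> (diff P i x)"
        using * by fastforce
    qed
  next
    assume "ext_vanishes P i (- k)"
    then show "\<forall>f\<in>Z. \<exists>\<psi>\<in>gr_hom A (obj P (i + 1)) (shift S k). \<forall>x\<in>carrier (obj P i). f x = \<psi> (diff P i x)"
      by (auto simp: ext_vanishes_def Z_def)
  qed
  finally show ?thesis by (simp add: i_def)
qed

end

section \<open>Comparison of maps to S with the cohomology of P/JP\<close>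

text \<open>S is a quotient of A by a left ideal; that J annihilates it from the left rests on
  \<open>rad0_right\<close>.\<close>

lemma (in graded_algebra) rad_smult_S:
  assumes "a \<in> carrier A" "cA 0 a \<in> rad0" "X \<in> carrier S"
  shows "a \<odot>\<^bsub>S\<^esub> X = \<zero>\<^bsub>S\<^esub>"
proof -
  obtain x where x: "x \<in> carrier A" "X = cls x" using assms S_carrier by auto
  have "cA 0 (a \<otimes>\<^bsub>A\<^esub> x) \<in> rad0" using rad0_right[OF assms(2)] assms(1) x(1) cA_in by (simp add: cA_mult_0)
  then show ?thesis unfolding x(2) cls_smult[OF assms(1) x(1)] using cls_zero_iff assms(1) x(1) by simp
qed

context free_complex
begin

lemma S_linear_map: "\<psi> \<in> gr_hom A (obj P i) (shift S k) \<Longrightarrow> linear_map A (obj P i) S \<psi>"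
  by (simp add: linear_map_def linear_map_axioms_def gr_hom_shift_iff S.left_module_axioms F.P.left_module_axioms)

text \<open>Since J annihilates S, a map from P to S factors through P/JP.\<close>

lemma N_kernel:
  assumes J0: "J0 \<subseteq> rad0" and \<psi>: "\<psi> \<in> gr_hom A (obj P i) (shift S k)" and w: "w \<in> N i"
  shows "\<psi> w = \<zero>\<^bsub>S\<^esub>"
proof -
  interpret L: linear_map A "obj P i" S \<psi> by (rule S_linear_map[OF \<psi>])
  have "submodule {\<zero>\<^bsub>S\<^esub>} A S" by (auto simp: S.submodule_iff S.smult_r_null)
  note sub = L.vimage_submodule[OF this]
  have wc: "w \<in> C i" using w by (simp add: N_def)
  have "w \<in> {x \<in> C i. \<psi> x \<in> {\<zero>\<^bsub>S\<^esub>}}"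
  proof (rule F.submodule_gen[OF wc sub])
    fix g assume g: "g \<in> G i"
    note eg = F.basis_carrier[OF g]
    have "cA 0 (\<kappa> i w g) \<in> rad0" using w J0 by (auto simp: N_def)
    then have "\<psi> (\<kappa> i w g \<odot>\<^bsub>obj P i\<^esub> e i g) = \<zero>\<^bsub>S\<^esub>"
      using L.smult[OF F.coord_closed[OF wc] eg] rad_smult_S[OF F.coord_closed[OF wc] _ L.closed[OF eg]] by simp
    then show "e i g \<in> {x \<in> C i. \<psi> x \<in> {\<zero>\<^bsub>S\<^esub>}} \<or> \<kappa> i w g \<odot>\<^bsub>obj P i\<^esub> e i g \<in> {x \<in> C i. \<psi> x \<in> {\<zero>\<^bsub>S\<^esub>}}"
      using F.P.smult_closed[OF F.coord_closed[OF wc] eg] by simp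
  qed
  then show ?thesis by simp
qed

text \<open>For a generator g of degree j, the test map \<phi> is the class in S of the g-th
  coordinate of \<pi>. It kills boundaries because \<pi> carries W into N, so it factors through d,
  and d v in N forces \<phi> v = 0. As g varies, all coordinates of \<pi> v lie in J, so v agrees
  modulo N with v - \<pi> v, which is a boundary up to N.\<close>

lemma top_acyclic_of_ext_vanishes:
  assumes J0: "J0 = rad0" and ext: "ext_vanishes P i j"
  shows "top_acyclic i j"
  unfolding top_acyclic_def
proof (intro ballI impI)
  fix v assume v: "v \<in> hg i j" "d i v \<in> N (i + 1)"
  have vc: "v \<in> C i" using v hg_carrier by auto
  obtain \<pi> where \<pi>: "\<pi> \<in> Hom i i" "\<And>x. x \<in> hg i j \<Longrightarrow> x \<ominus>\<^bsub>obj P i\<^esub> \<pi> x \<in> W i j" "\<And>x. x \<in> W i j \<Longrightarrow> \<pi> x \<in> N i"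
    using boundary_projection by blast
  have \<pi>v: "\<pi> v \<in> hg i j" "\<pi> v \<in> C i" using hom_homog[OF \<pi>(1) v(1)] hom_closed[OF \<pi>(1) vc] by auto
  have "cA 0 (\<kappa> i (\<pi> v) g) \<in> rad0" for g
  proof (cases "deg i g = j")
    case False
    have "cA 0 (\<kappa> i (\<pi> v) g) = \<zero>\<^bsub>A\<^esub>"
      using cA_same[OF F.coord_homog[OF \<pi>v(1), of g], of 0] False by simp
    then show ?thesis using J0_zero J0 by simp
  next
    case True
    define \<phi> where "\<phi> x = cls (\<kappa> i (\<pi> x) g)" for x
    have "(\<lambda>x. \<kappa> i x g) \<in> lin_maps A (obj P i) (graded_regular A)"
      by (auto simp: lin_maps_def F.coord_add F.coord_smult)
    then have "\<phi> \<in> lin_maps A (obj P i) S" unfolding \<phi>_def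
      using lin_maps_comp[OF lin_maps_comp[of \<pi> A "obj P i" "obj P i"] cls_lin] \<pi>(1) by (simp add: gr_hom_iff)
    moreover have "\<phi> x \<in> homog S (l + - j)" if x: "x \<in> hg i l" for x l
      unfolding \<phi>_def S_homog using F.coord_homog[OF hom_homog[OF \<pi>(1) x], of g] True by auto
    ultimately have \<phi>: "\<phi> \<in> gr_hom A (obj P i) (shift S (- j))" by (simp add: gr_hom_shift_iff)
    have "\<phi> (d (i - 1) x) = \<zero>\<^bsub>S\<^esub>" if "x \<in> C (i - 1)" for x
    proof (rule gr_hom_S_eqI[OF graded_module_obj gr_hom_comp[OF d_hom' \<phi>] gr_hom_S_zero[OF F.P.left_module_axioms] _ that])
      fix x assume "x \<in> hg (i - 1) (- (- j))"
      then have x: "x \<in> hg (i - 1) j" by simp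
      have n: "\<pi> (d (i - 1) x) \<in> N i" by (rule \<pi>(3)[OF d_in_W[OF x]])
      then have "cA 0 (\<kappa> i (\<pi> (d (i - 1) x)) g) \<in> rad0" unfolding N_def using J0 by blast
      then show "\<phi> (d (i - 1) x) = \<zero>\<^bsub>S\<^esub>" unfolding \<phi>_def
        using cls_zero_iff[OF F.coord_closed[OF submodule_subset[OF N_submodule n], of g]] by simp
    qed
    then have "\<forall>x\<in>C (i - 1). \<phi> (d (i - 1) x) = \<zero>\<^bsub>S\<^esub>" by simp
    from bspec[OF ext[unfolded ext_vanishes_def] \<phi>, THEN mp, OF this]
    obtain \<psi> where \<psi>: "\<psi> \<in> gr_hom A (obj P (i + 1)) (shift S (- j))" "\<And>x. x \<in> C i \<Longrightarrow> \<phi> x = \<psi> (d i x)"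
      by (elim bexE) simp
    have "\<phi> v = \<zero>\<^bsub>S\<^esub>" using \<psi>(2)[OF vc] N_kernel[OF _ \<psi>(1) v(2)] J0 by simp
    then show ?thesis unfolding \<phi>_def using cls_zero_iff[OF F.coord_closed[OF \<pi>v(2), of g]] by simp
  qed
  then have "cA 0 (\<kappa> i (\<pi> v) g) \<in> J0" for g using J0 by blast
  then have \<pi>N: "\<pi> v \<in> N i" using \<pi>v(2) by (simp add: N_def)
  obtain y n where y: "y \<in> hg (i - 1) j" "n \<in> N i" "v \<ominus>\<^bsub>obj P i\<^esub> \<pi> v = d (i - 1) y \<oplus>\<^bsub>obj P i\<^esub> n"
    using \<pi>(2)[OF v(1)] by (auto simp: W_def)
  have c: "d (i - 1) y \<in> C i" "n \<in> C i"
    using d_closed'[OF hg_carrier[OF y(1)]] submodule_subset[OF N_submodule y(2)] by auto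
  have "v = (d (i - 1) y \<oplus>\<^bsub>obj P i\<^esub> n) \<oplus>\<^bsub>obj P i\<^esub> \<pi> v" by (rule F.P.M.eq_add_of_minus[OF vc \<pi>v(2) y(3)])
  from arg_cong[OF this, of "\<lambda>u. u \<ominus>\<^bsub>obj P i\<^esub> d (i - 1) y"]
  have "v \<ominus>\<^bsub>obj P i\<^esub> d (i - 1) y = ((d (i - 1) y \<oplus>\<^bsub>obj P i\<^esub> n) \<oplus>\<^bsub>obj P i\<^esub> \<pi> v) \<ominus>\<^bsub>obj P i\<^esub> d (i - 1) y" .
  also have "\<dots> = n \<oplus>\<^bsub>obj P i\<^esub> \<pi> v"
    using c \<pi>v(2) by (simp add: a_minus_def F.P.M.a_ac F.P.M.r_neg2 F.P.M.r_neg)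
  finally have "v \<ominus>\<^bsub>obj P i\<^esub> d (i - 1) y = n \<oplus>\<^bsub>obj P i\<^esub> \<pi> v" .
  moreover have "n \<oplus>\<^bsub>obj P i\<^esub> \<pi> v \<in> N i" using N_submodule[of i] y(2) \<pi>N by (simp add: F.P.submodule_iff)
  ultimately show "\<exists>y\<in>hg (i - 1) j. v \<ominus>\<^bsub>obj P i\<^esub> d (i - 1) y \<in> N i"
    using y(1) by (intro bexI[of _ y]) simp_all
qed

text \<open>The factorization is \<phi> after E, where E splits the boundaries of P^(i+1) in degree
  j. For x of degree j, the element x - E d x is a cycle modulo N, hence a boundary up to N, and
  \<phi> kills boundaries as well as N.\<close>

lemma ext_vanishes_of_top_acyclic:
  assumes J0: "J0 \<subseteq> rad0" and top: "top_acyclic i j"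
  shows "ext_vanishes P i j"
  unfolding ext_vanishes_def
proof (intro ballI impI)
  fix \<phi> assume \<phi>: "\<phi> \<in> gr_hom A (obj P i) (shift S (- j))" "\<forall>x\<in>C (i - 1). \<phi> (d (i - 1) x) = \<zero>\<^bsub>S\<^esub>"
  interpret L: linear_map A "obj P i" S \<phi> by (rule S_linear_map[OF \<phi>(1)])
  obtain E where "E \<in> Hom (i + 1) (i + 1 - 1)" "\<And>x. x \<in> hg (i + 1 - 1) j \<Longrightarrow>
      d (i + 1 - 1) x \<ominus>\<^bsub>obj P (i + 1)\<^esub> d (i + 1 - 1) (E (d (i + 1 - 1) x)) \<in> N (i + 1)"
    using boundary_splitting by blast
  then have E: "E \<in> Hom (i + 1) i" "\<And>x. x \<in> hg i j \<Longrightarrow> d i x \<ominus>\<^bsub>obj P (i + 1)\<^esub> d i (E (d i x)) \<in> N (i + 1)" by auto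
  have Ed: "(\<lambda>x. E (d i x)) \<in> Hom i i" using gr_hom_comp[OF d_hom E(1)] .
  have \<psi>: "(\<lambda>x. \<phi> (E x)) \<in> gr_hom A (obj P (i + 1)) (shift S (- j))" using gr_hom_comp[OF E(1) \<phi>(1)] .
  have "\<phi> x = \<phi> (E (d i x))" if "x \<in> C i" for x
  proof (rule gr_hom_S_eqI[OF graded_module_obj \<phi>(1) gr_hom_comp[OF Ed \<phi>(1)] _ that])
    fix x assume "x \<in> hg i (- (- j))"
    then have x: "x \<in> hg i j" "x \<in> C i" using hg_carrier by auto
    let ?v = "x \<ominus>\<^bsub>obj P i\<^esub> E (d i x)"
    have Ex: "E (d i x) \<in> hg i j" "E (d i x) \<in> C i" using hom_homog[OF Ed x(1)] hom_closed[OF Ed x(2)] by auto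
    have v: "?v \<in> hg i j" "?v \<in> C i" using hg_diff[OF x(1) Ex(1)] hg_carrier by auto
    have "d i ?v \<in> N (i + 1)" using hom_minus[OF d_hom x(2) Ex(2)] E(2)[OF x(1)] by simp
    then obtain y where y: "y \<in> hg (i - 1) j" "?v \<ominus>\<^bsub>obj P i\<^esub> d (i - 1) y \<in> N i"
      using top v(1) unfolding top_acyclic_def by blast
    have dy: "d (i - 1) y \<in> C i" "\<phi> (d (i - 1) y) = \<zero>\<^bsub>S\<^esub>" using d_closed' \<phi>(2) hg_carrier[OF y(1)] by auto
    have "\<phi> ?v \<ominus>\<^bsub>S\<^esub> \<zero>\<^bsub>S\<^esub> = \<zero>\<^bsub>S\<^esub>"
      using N_kernel[OF J0 \<phi>(1) y(2)] L.minus[OF v(2) dy(1)] dy(2) by simp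
    then have "\<phi> ?v = \<zero>\<^bsub>S\<^esub>" using S.M.minus_zero_right L.closed[OF v(2)] by simp
    then have "\<phi> x \<ominus>\<^bsub>S\<^esub> \<phi> (E (d i x)) = \<zero>\<^bsub>S\<^esub>" using L.minus[OF x(2) Ex(2)] by simp
    then show "\<phi> x = \<phi> (E (d i x))"
      using S.M.eq_add_of_minus[OF L.closed[OF x(2)] L.closed[OF Ex(2)]] L.closed[OF Ex(2)] by simp
  qed
  then show "\<exists>\<psi>\<in>gr_hom A (obj P (i + 1)) (shift S (- j)). \<forall>x\<in>C i. \<phi> x = \<psi> (d i x)"
    by (intro bexI[OF _ \<psi>]) simp
qed

end

subsection \<open>Cohomology of complexes of graded modules\<close>

locale gr_complex = graded_algebra K A
  for K :: "('k, 'x) ring_scheme" and A :: "('k, 'a, nat) graded" +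
  fixes X :: "('a, 'm) cochain"
  assumes complex: "cochain_complex A X"
begin

abbreviation "Z \<equiv> cocycles X"
abbreviation "B \<equiv> coboundaries X"
abbreviation "Hq \<equiv> cohomology X"

lemma obj_graded: "graded_module A (obj X i)"
  using complex by (simp add: cochain_complex_def)

sublocale O: graded_module A "obj X i" for i by (rule obj_graded)

lemma diff_hom: "diff X i \<in> gr_hom A (obj X i) (obj X (i + 1))"
  using complex by (simp add: cochain_complex_def)

lemma diff_hom': "diff X (i - 1) \<in> gr_hom A (obj X (i - 1)) (obj X i)"
  using diff_hom[of "i - 1"] by simp

lemma diff_map: "graded_map A (obj X i) (obj X (i + 1)) (diff X i)"
  and diff_map': "graded_map A (obj X (i - 1)) (obj X i) (diff X (i - 1))"
  by (auto intro!: graded_mapI obj_graded diff_hom diff_hom')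

lemmas diff_linear = graded_map.axioms(1)[OF diff_map] and diff_linear' = graded_map.axioms(1)[OF diff_map']

lemma diff_diff': "x \<in> carrier (obj X (i - 1)) \<Longrightarrow> diff X i (diff X (i - 1) x) = \<zero>\<^bsub>obj X (i + 1)\<^esub>"
proof -
  assume x: "x \<in> carrier (obj X (i - 1))"
  have "\<forall>j. \<forall>x\<in>carrier (obj X j). diff X (j + 1) (diff X j x) = \<zero>\<^bsub>obj X (j + 2)\<^esub>"
    using complex by (simp add: cochain_complex_def)
  from this[rule_format, OF x] show ?thesis by (simp add: algebra_simps)
qed

lemma Z_carrier: "x \<in> Z i \<Longrightarrow> x \<in> carrier (obj X i)" by (simp add: cocycles_def)

lemma Z_submodule: "submodule (Z i) A (obj X i)"
proof -
  have "submodule {\<zero>\<^bsub>obj X (i + 1)\<^esub>} A (obj X (i + 1))" by (auto simp: O.submodule_iff O.smult_r_null)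
  from linear_map.vimage_submodule[OF diff_linear this] show ?thesis by (simp add: cocycles_def)
qed

lemma Z_component: "x \<in> Z i \<Longrightarrow> component (obj X i) j x \<in> Z i"
proof -
  assume x: "x \<in> Z i"
  then have xc: "x \<in> carrier (obj X i)" by (rule Z_carrier)
  have "diff X i (component (obj X i) j x) = component (obj X (i + 1)) j (diff X i x)"
    by (rule graded_map.component[OF diff_map xc, symmetric])
  then show ?thesis using x xc by (simp add: cocycles_def)
qed

lemma B_iff: "x \<in> B i \<longleftrightarrow> (\<exists>y\<in>carrier (obj X (i - 1)). x = diff X (i - 1) y)"
  by (auto simp: coboundaries_def)

lemma B_submodule: "submodule (B i) A (obj X i)"
  unfolding O.submodule_iff
proof (intro conjI ballI)
  note l = linear_map.closed[OF diff_linear'] linear_map.add[OF diff_linear'] linear_map.smult[OF diff_linear']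
    linear_map.zero[OF diff_linear']
  show "B i \<subseteq> carrier (obj X i)" using l(1) by (auto simp: B_iff)
  show "\<zero>\<^bsub>obj X i\<^esub> \<in> B i" unfolding B_iff by (rule bexI[of _ "\<zero>\<^bsub>obj X (i - 1)\<^esub>"]) (simp_all add: l(4))
  fix x assume "x \<in> B i"
  then obtain x' where x: "x' \<in> carrier (obj X (i - 1))" "x = diff X (i - 1) x'" unfolding B_iff by blast
  { fix y assume "y \<in> B i"
    then obtain y' where y: "y' \<in> carrier (obj X (i - 1))" "y = diff X (i - 1) y'" unfolding B_iff by blast
    show "x \<oplus>\<^bsub>obj X i\<^esub> y \<in> B i" unfolding B_iff x(2) y(2)
      by (rule bexI[of _ "x' \<oplus>\<^bsub>obj X (i - 1)\<^esub> y'"]) (simp_all add: l(2) x(1) y(1)) }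
  fix a assume a: "a \<in> carrier A"
  show "a \<odot>\<^bsub>obj X i\<^esub> x \<in> B i" unfolding B_iff x(2)
    by (rule bexI[of _ "a \<odot>\<^bsub>obj X (i - 1)\<^esub> x'"]) (simp_all add: l(3) x(1) a O.smult_closed)
qed

lemma B_Z: "x \<in> B i \<Longrightarrow> x \<in> Z i"
  using diff_diff' linear_map.closed[OF diff_linear'] by (auto simp: B_iff cocycles_def)

lemma B_homog: "x \<in> B i \<Longrightarrow> component (obj X i) j x = z \<Longrightarrow> \<exists>y\<in>homog (obj X (i - 1)) j. diff X (i - 1) y = z"
proof -
  assume x: "x \<in> B i" and z: "component (obj X i) j x = z"
  obtain y where y: "y \<in> carrier (obj X (i - 1))" "x = diff X (i - 1) y" using x unfolding B_iff by blast
  show ?thesis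
    by (rule bexI[of _ "component (obj X (i - 1)) j y"])
       (use graded_map.component[OF diff_map' y(1), of j] z y O.components_spec(1) in simp_all)
qed

lemmas B_additive = O.submodule_additive[OF B_submodule]
lemmas rcos_eq = O.M.rcos_eq_iff[OF B_additive] and rcos_self = O.M.rcos_self_iff[OF B_additive]

lemma Hq_zero: "\<zero>\<^bsub>Hq i\<^esub> = B i" by (simp add: cohomology_def)

lemma Hq_carrier: "c \<in> carrier (Hq i) \<longleftrightarrow> (\<exists>x\<in>Z i. c = B i +>\<^bsub>obj X i\<^esub> x)"
  by (auto simp: cohomology_def A_RCOSETS_def' graded_sub_def a_r_coset_def')

lemma Hq_homog: "homog (Hq i) j = (\<lambda>x. B i +>\<^bsub>obj X i\<^esub> x) ` (homog (obj X i) j \<inter> Z i)"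
  by (simp add: cohomology_def graded_sub_def a_r_coset_def')

lemma Hq_module: "left_module A (Hq i)"
  and Hq_add: "x \<in> Z i \<Longrightarrow> y \<in> Z i \<Longrightarrow> (B i +>\<^bsub>obj X i\<^esub> x) \<oplus>\<^bsub>Hq i\<^esub> (B i +>\<^bsub>obj X i\<^esub> y) = B i +>\<^bsub>obj X i\<^esub> (x \<oplus>\<^bsub>obj X i\<^esub> y)"
  and Hq_smult: "a \<in> carrier A \<Longrightarrow> x \<in> Z i \<Longrightarrow> a \<odot>\<^bsub>Hq i\<^esub> (B i +>\<^bsub>obj X i\<^esub> x) = B i +>\<^bsub>obj X i\<^esub> (a \<odot>\<^bsub>obj X i\<^esub> x)"
proof -
  let ?Z = "graded_sub (obj X i) (Z i)"
  have Zs: "carrier ?Z = Z i" "add ?Z = add (obj X i)" "zero ?Z = zero (obj X i)" "smult ?Z = smult (obj X i)"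
    by (auto simp: graded_sub_def)
  have sub: "Z i \<subseteq> carrier (obj X i)" "\<And>a x. a \<in> carrier A \<Longrightarrow> x \<in> Z i \<Longrightarrow> a \<odot>\<^bsub>obj X i\<^esub> x \<in> Z i"
    using Z_submodule[of i] by (auto simp: O.submodule_iff)
  have "abelian_group ?Z"
    by (rule abelian_group_restrict[OF O.M.abelian_group_axioms]) (use Zs O.submodule_additive[OF Z_submodule] in auto)
  then have lm: "left_module A ?Z"
    unfolding left_module_def left_module_axioms_def Zs
    using A.ring_axioms sub
    by (auto simp: O.smult_l_distr O.smult_r_distr O.smult_assoc O.smult_one subset_iff)
  have Bsub: "submodule (B i) A ?Z"
    using B_submodule[of i] B_Z unfolding left_module.submodule_iff[OF lm] O.submodule_iff Zs by auto
  have cs: "N +>\<^bsub>?Z\<^esub> x = N +>\<^bsub>obj X i\<^esub> x" for N x by (simp add: a_r_coset_def' graded_sub_def)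
  note q = left_module_quot[OF lm Bsub, folded cohomology_def]
  show "left_module A (Hq i)" by (rule q(1))
  show "x \<in> Z i \<Longrightarrow> y \<in> Z i \<Longrightarrow> (B i +>\<^bsub>obj X i\<^esub> x) \<oplus>\<^bsub>Hq i\<^esub> (B i +>\<^bsub>obj X i\<^esub> y) = B i +>\<^bsub>obj X i\<^esub> (x \<oplus>\<^bsub>obj X i\<^esub> y)"
    using q(2)[of x y] by (simp only: Zs cs)
  show "a \<in> carrier A \<Longrightarrow> x \<in> Z i \<Longrightarrow> a \<odot>\<^bsub>Hq i\<^esub> (B i +>\<^bsub>obj X i\<^esub> x) = B i +>\<^bsub>obj X i\<^esub> (a \<odot>\<^bsub>obj X i\<^esub> x)"
    using q(3)[of a x] by (simp only: Zs cs)
qed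

lemma homology_vanishes_iff: "homog (Hq i) j = {\<zero>\<^bsub>Hq i\<^esub>} \<longleftrightarrow> homology_vanishes X i j"
proof -
  have Z0: "\<zero>\<^bsub>obj X i\<^esub> \<in> homog (obj X i) j \<inter> Z i"
    using O.D_zero Z_submodule[of i] by (simp add: O.submodule_iff)
  have img: "f ` Y = {b} \<longleftrightarrow> (\<forall>x\<in>Y. f x = b)" if "Y \<noteq> {}" for f :: "'m \<Rightarrow> 'm set" and Y b
    using that by blast
  have "homog (Hq i) j = {\<zero>\<^bsub>Hq i\<^esub>} \<longleftrightarrow> (\<forall>x\<in>homog (obj X i) j \<inter> Z i. B i +>\<^bsub>obj X i\<^esub> x = B i)"
    unfolding Hq_homog Hq_zero by (rule img) (use Z0 in blast)
  also have "\<dots> \<longleftrightarrow> (\<forall>x\<in>homog (obj X i) j \<inter> Z i. x \<in> B i)"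
    using rcos_self Z_carrier by (intro ball_cong) auto
  also have "\<dots> \<longleftrightarrow> (\<forall>x\<in>homog (obj X i) j \<inter> Z i. \<exists>y\<in>homog (obj X (i - 1)) j. diff X (i - 1) y = x)"
  proof (intro ball_cong refl iffI)
    fix x assume x: "x \<in> homog (obj X i) j \<inter> Z i"
    show "\<exists>y\<in>homog (obj X (i - 1)) j. diff X (i - 1) y = x" if "x \<in> B i"
      by (rule B_homog[OF that]) (use x O.components_same[of x i j j] in simp)
    show "x \<in> B i" if "\<exists>y\<in>homog (obj X (i - 1)) j. diff X (i - 1) y = x"
      unfolding B_iff using that O.D_carrier by blast
  qed
  also have "\<dots> \<longleftrightarrow> homology_vanishes X i j"
    unfolding homology_vanishes_def cocycles_def using O.D_carrier by blast
  finally show ?thesis .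
qed

text \<open>Let l0 bound from below the degrees occurring in cocycle representatives of finitely
  many generators. As A has no negative degrees, every class has a representative y living in
  degrees at least l0. A cocycle x of degree l < l0 differs from such a y by a boundary, and the
  degree l component of x - y is x.\<close>

lemma fg_bounded:
  assumes fg: "finitely_generated A (Hq i)"
  shows "\<exists>l0. \<forall>l<l0. homology_vanishes X i l"
proof -
  interpret Q: left_module A "Hq i" by (rule Hq_module)
  obtain F where F: "finite F" "F \<subseteq> carrier (Hq i)"
    "\<And>x. x \<in> carrier (Hq i) \<Longrightarrow> \<exists>c\<in>F \<rightarrow> carrier A. x = (\<Oplus>\<^bsub>Hq i\<^esub>b\<in>F. c b \<odot>\<^bsub>Hq i\<^esub> b)"
    using fg unfolding finitely_generated_def by auto
  have "\<forall>c\<in>F. \<exists>x\<in>Z i. c = B i +>\<^bsub>obj X i\<^esub> x" using F(2) Hq_carrier by blast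
  then obtain z where z: "\<And>c. c \<in> F \<Longrightarrow> z c \<in> Z i" "\<And>c. c \<in> F \<Longrightarrow> c = B i +>\<^bsub>obj X i\<^esub> z c" by metis
  define D where "D = (\<Union>c\<in>F. {l. component (obj X i) l (z c) \<noteq> \<zero>\<^bsub>obj X i\<^esub>})"
  have "finite D" unfolding D_def using F(1) O.components_spec(2) Z_carrier z(1) by blast
  define l0 where "l0 = Min (insert 0 D)"
  have l0: "l0 \<le> l" if "l \<in> D" for l unfolding l0_def using that \<open>finite D\<close> by simp
  \<comment> \<open>The elements without components below l0. They form a submodule, since
    homogeneous scalars only raise degrees.\<close>
  define hi where "hi = {x \<in> carrier (obj X i). \<forall>l<l0. component (obj X i) l x = \<zero>\<^bsub>obj X i\<^esub>}"
  have zhi: "z c \<in> hi" if "c \<in> F" for c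
    unfolding hi_def using that z(1) Z_carrier l0 unfolding D_def by fastforce
  have hi_smult: "a \<odot>\<^bsub>obj X i\<^esub> x \<in> hi" if a: "a \<in> carrier A" and x: "x \<in> hi" for a x
    using a[folded graded_regular_simps(1)]
  proof (rule reg.direct_sum_induct)
    have xc: "x \<in> carrier (obj X i)" using x by (simp add: hi_def)
    show "a \<odot>\<^bsub>obj X i\<^esub> x \<in> hi" if a: "a \<in> H k" for k a
    proof -
      have aA: "a \<in> carrier A" using H_carrier[OF a] .
      have "component (obj X i) l (a \<odot>\<^bsub>obj X i\<^esub> x) = \<zero>\<^bsub>obj X i\<^esub>" if l: "l < l0" for l
      proof (cases "k < 0")
        case True
        then show ?thesis using a H_neg[of k] xc by (simp add: O.smult_l_null)
      next
        case False
        have "component (obj X i) ((l - k) + k) (a \<odot>\<^bsub>obj X i\<^esub> x) = a \<odot>\<^bsub>obj X i\<^esub> component (obj X i) (l - k) x"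
          by (rule components_hom[where h="\<lambda>i. i + k" and f="\<lambda>x. a \<odot>\<^bsub>obj X i\<^esub> x"])
             (use aA xc H_smult[OF obj_graded a] in \<open>auto simp: O.direct_sum_axioms O.smult_closed O.smult_r_distr add.commute\<close>)
        moreover have "component (obj X i) (l - k) x = \<zero>\<^bsub>obj X i\<^esub>" using x l False by (simp add: hi_def)
        ultimately show ?thesis using aA by (simp add: O.smult_r_null)
      qed
      then show ?thesis using aA xc by (simp add: hi_def O.smult_closed)
    qed
    show "(a \<oplus>\<^bsub>graded_regular A\<^esub> b) \<odot>\<^bsub>obj X i\<^esub> x \<in> hi"
      if "a \<in> carrier (graded_regular A)" "b \<in> carrier (graded_regular A)" "a \<odot>\<^bsub>obj X i\<^esub> x \<in> hi" "b \<odot>\<^bsub>obj X i\<^esub> x \<in> hi" for a b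
      using that xc by (simp add: hi_def O.smult_l_distr O.components_add)
  qed
  define U where "U = {c. \<exists>x\<in>Z i \<inter> hi. c = B i +>\<^bsub>obj X i\<^esub> x}"
  have Zs: "\<zero>\<^bsub>obj X i\<^esub> \<in> Z i" "\<And>x y. x \<in> Z i \<Longrightarrow> y \<in> Z i \<Longrightarrow> x \<oplus>\<^bsub>obj X i\<^esub> y \<in> Z i"
    "\<And>a x. a \<in> carrier A \<Longrightarrow> x \<in> Z i \<Longrightarrow> a \<odot>\<^bsub>obj X i\<^esub> x \<in> Z i"
    using Z_submodule[of i] by (auto simp: O.submodule_iff)
  have U: "submodule U A (Hq i)" unfolding Q.submodule_iff
  proof (intro conjI ballI)
    show "U \<subseteq> carrier (Hq i)" unfolding U_def using Hq_carrier by blast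
    have "B i = B i +>\<^bsub>obj X i\<^esub> \<zero>\<^bsub>obj X i\<^esub>"
      using rcos_self[of "\<zero>\<^bsub>obj X i\<^esub>" i] B_submodule[of i] by (simp add: O.submodule_iff)
    then show "\<zero>\<^bsub>Hq i\<^esub> \<in> U" unfolding U_def Hq_zero using Zs(1) by (auto simp: hi_def)
    fix c assume "c \<in> U"
    then obtain x where x: "x \<in> Z i" "x \<in> hi" "c = B i +>\<^bsub>obj X i\<^esub> x" unfolding U_def by blast
    { fix c' assume "c' \<in> U"
      then obtain y where y: "y \<in> Z i" "y \<in> hi" "c' = B i +>\<^bsub>obj X i\<^esub> y" unfolding U_def by blast
      have "x \<oplus>\<^bsub>obj X i\<^esub> y \<in> hi" using x(2) y(2) by (simp add: hi_def O.components_add)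
      then show "c \<oplus>\<^bsub>Hq i\<^esub> c' \<in> U" unfolding U_def x(3) y(3) Hq_add[OF x(1) y(1)] using Zs(2) x(1) y(1) by blast }
    fix a assume a: "a \<in> carrier A"
    show "a \<odot>\<^bsub>Hq i\<^esub> c \<in> U" unfolding U_def x(3) Hq_smult[OF a x(1)] using Zs(3) x(1,2) a hi_smult by blast
  qed
  have FU: "F \<subseteq> U" unfolding U_def using z zhi by blast
  have "homology_vanishes X i l" if l: "l < l0" for l
    unfolding homology_vanishes_def
  proof (intro ballI impI)
    fix x assume x: "x \<in> homog (obj X i) l" "diff X i x = \<zero>\<^bsub>obj X (i + 1)\<^esub>"
    have xZ: "x \<in> Z i" and xc: "x \<in> carrier (obj X i)" using x O.D_carrier by (auto simp: cocycles_def)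
    obtain c where c: "c \<in> F \<rightarrow> carrier A" "B i +>\<^bsub>obj X i\<^esub> x = (\<Oplus>\<^bsub>Hq i\<^esub>b\<in>F. c b \<odot>\<^bsub>Hq i\<^esub> b)"
      using F(3) Hq_carrier xZ by blast
    have "(\<Oplus>\<^bsub>Hq i\<^esub>b\<in>F. c b \<odot>\<^bsub>Hq i\<^esub> b) \<in> U"
    proof (rule Q.submodule_finsum[OF U])
      show "c b \<odot>\<^bsub>Hq i\<^esub> b \<in> U" if "b \<in> F" for b
        using U FU that c(1) unfolding Q.submodule_iff by blast
    qed
    then obtain y where y: "y \<in> Z i" "y \<in> hi" "B i +>\<^bsub>obj X i\<^esub> x = B i +>\<^bsub>obj X i\<^esub> y"
      unfolding U_def c(2)[symmetric] by blast
    have yc: "y \<in> carrier (obj X i)" using y Z_carrier by auto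
    have "x \<ominus>\<^bsub>obj X i\<^esub> y \<in> B i" using rcos_eq[OF xc yc] y(3) by simp
    then show "\<exists>w\<in>homog (obj X (i - 1)) l. diff X (i - 1) w = x"
    proof (rule B_homog)
      have "component (obj X i) l (x \<ominus>\<^bsub>obj X i\<^esub> y) = component (obj X i) l x \<ominus>\<^bsub>obj X i\<^esub> component (obj X i) l y"
        using xc yc by (simp add: a_minus_def O.components_add O.components_neg)
      then show "component (obj X i) l (x \<ominus>\<^bsub>obj X i\<^esub> y) = x"
        using O.components_same[OF x(1), of l] y(2) l xc by (simp add: hi_def O.M.minus_zero_right)
    qed
  qed
  then show ?thesis by blast
qed

end

locale gr_complex_map = P: gr_complex K A P + X: gr_complex K A X
  for K :: "('k, 'x) ring_scheme" and A :: "('k, 'a, nat) graded"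
    and P :: "('a, 'p) cochain" and X :: "('a, 'm) cochain" +
  fixes q :: "int \<Rightarrow> 'p \<Rightarrow> 'm"
  assumes cochain_map: "cochain_map A P X q"
begin

lemma q_diff: "x \<in> carrier (obj P i) \<Longrightarrow> q (i + 1) (diff P i x) = diff X i (q i x)"
  using cochain_map by (simp add: cochain_map_def)

lemma q_diff': "x \<in> carrier (obj P (i - 1)) \<Longrightarrow> q i (diff P (i - 1) x) = diff X (i - 1) (q (i - 1) x)"
  using q_diff[of x "i - 1"] by simp

lemma q_graded_map: "graded_map A (obj P i) (obj X i) (q i)"
  using cochain_map by (intro graded_mapI P.obj_graded X.obj_graded) (simp add: cochain_map_def)

sublocale q: graded_map A "obj P k" "obj X k" "q k" for k
  by (rule q_graded_map)

lemma q_Z: "x \<in> P.Z i \<Longrightarrow> q i x \<in> X.Z i"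
  using q_diff[of x i] q.closed[of x i] q.zero by (simp add: cocycles_def)

lemma q_B: "x \<in> P.B i \<Longrightarrow> q i x \<in> X.B i"
  using q_diff' q.closed unfolding P.B_iff X.B_iff by blast

lemma cohomology_map_coset:
  assumes p: "p \<in> P.Z i"
  shows "cohomology_map P X q i (P.B i +>\<^bsub>obj P i\<^esub> p) = X.B i +>\<^bsub>obj X i\<^esub> q i p"
proof -
  have pc: "p \<in> carrier (obj P i)" using p P.Z_carrier by auto
  have "X.B i +>\<^bsub>obj X i\<^esub> q i x = X.B i +>\<^bsub>obj X i\<^esub> q i p" if x: "x \<in> P.B i +>\<^bsub>obj P i\<^esub> p" for x
  proof -
    obtain b where b: "b \<in> P.B i" "x = b \<oplus>\<^bsub>obj P i\<^esub> p" using x by (auto simp: a_r_coset_def')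
    have bc: "b \<in> carrier (obj P i)" using b P.B_Z P.Z_carrier by auto
    have xc: "x \<in> carrier (obj P i)" using b bc pc by simp
    have "q i x \<ominus>\<^bsub>obj X i\<^esub> q i p = q i b"
      unfolding b(2) using bc pc q.closed by (simp add: q.add a_minus_def X.O.M.a_assoc X.O.M.r_neg)
    then show ?thesis using X.rcos_eq[OF q.closed[OF xc] q.closed[OF pc]] q_B[OF b(1)] by simp
  qed
  then have "cohomology_map P X q i (P.B i +>\<^bsub>obj P i\<^esub> p) = (\<Union>x\<in>P.B i +>\<^bsub>obj P i\<^esub> p. X.B i +>\<^bsub>obj X i\<^esub> q i p)"
    unfolding cohomology_map_def by (intro SUP_cong refl) blast
  moreover have "P.B i +>\<^bsub>obj P i\<^esub> p \<noteq> {}"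
    using P.B_submodule[of i] by (auto simp: a_r_coset_def' P.O.submodule_iff)
  ultimately show ?thesis by (simp only: UN_constant if_False)
qed

text \<open>\<open>quasi_iso\<close> demands bijectivity on the full cohomology modules, without
  reference to degrees. Since q and the differentials preserve degrees, passing to the degree j
  components of representatives and primitives recovers the statement in a single degree.\<close>

lemma quasi_iso_homology_vanishes:
  assumes q: "quasi_iso A P X q"
  shows "homology_vanishes P i j \<longleftrightarrow> homology_vanishes X i j"
proof -
  have bij: "bij_betw (cohomology_map P X q i) (carrier (P.Hq i)) (carrier (X.Hq i))" for i using q by (simp add: quasi_iso_def)
  show ?thesis
  proof
    assume van: "homology_vanishes P i j"
    show "homology_vanishes X i j" unfolding homology_vanishes_def
    proof (intro ballI impI)
      fix x assume x: "x \<in> homog (obj X i) j" "diff X i x = \<zero>\<^bsub>obj X (i + 1)\<^esub>"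
      have xc: "x \<in> carrier (obj X i)" using x X.O.D_carrier by auto
      have "X.B i +>\<^bsub>obj X i\<^esub> x \<in> carrier (X.Hq i)" using X.Hq_carrier x xc by (auto simp: cocycles_def)
      then have "X.B i +>\<^bsub>obj X i\<^esub> x \<in> cohomology_map P X q i ` carrier (P.Hq i)"
        unfolding bij_betw_imp_surj_on[OF bij] .
      then obtain c where c: "c \<in> carrier (P.Hq i)" "cohomology_map P X q i c = X.B i +>\<^bsub>obj X i\<^esub> x"
        by (elim imageE) simp
      obtain p where p: "p \<in> P.Z i" "c = P.B i +>\<^bsub>obj P i\<^esub> p" using c(1) P.Hq_carrier by blast
      have pc: "p \<in> carrier (obj P i)" using p P.Z_carrier by auto
      let ?p = "component (obj P i) j p"
      have pj: "?p \<in> homog (obj P i) j" "?p \<in> P.Z i" using P.O.components_spec(1)[OF pc] P.Z_component[OF p(1)] by auto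
      obtain y where y: "y \<in> homog (obj P (i - 1)) j" "diff P (i - 1) y = ?p"
        using van pj unfolding homology_vanishes_def cocycles_def by blast
      have yc: "y \<in> carrier (obj P (i - 1))" using y P.O.D_carrier by auto
      have eq: "X.B i +>\<^bsub>obj X i\<^esub> x = X.B i +>\<^bsub>obj X i\<^esub> q i p" using c(2) cohomology_map_coset[OF p(1)] p(2) by simp
      have "x \<ominus>\<^bsub>obj X i\<^esub> q i p \<in> X.B i" using X.rcos_eq[OF xc q.closed[OF pc]] eq by simp
      then obtain w where w: "w \<in> homog (obj X (i - 1)) j" "diff X (i - 1) w = component (obj X i) j (x \<ominus>\<^bsub>obj X i\<^esub> q i p)"
        using X.B_homog by blast
      have wc: "w \<in> carrier (obj X (i - 1))" using w X.O.D_carrier by auto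
      have qp: "component (obj X i) j (q i p) = diff X (i - 1) (q (i - 1) y)"
        using q.component[OF pc] y(2) q_diff'[OF yc] by simp
      have qyc: "q (i - 1) y \<in> homog (obj X (i - 1)) j" "q (i - 1) y \<in> carrier (obj X (i - 1))"
        using q.homog[OF y(1)] q.closed[OF yc] by auto
      have "diff X (i - 1) w = x \<ominus>\<^bsub>obj X i\<^esub> diff X (i - 1) (q (i - 1) y)"
        unfolding w(2) qp[symmetric] using xc q.closed[OF pc] X.O.components_same[OF x(1), of j]
        by (simp add: a_minus_def X.O.components_add X.O.components_neg)
      then have "x = diff X (i - 1) w \<oplus>\<^bsub>obj X i\<^esub> diff X (i - 1) (q (i - 1) y)"
        using X.O.M.eq_add_of_minus[OF xc linear_map.closed[OF X.diff_linear' qyc(2)]] by simp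
      also have "\<dots> = diff X (i - 1) (w \<oplus>\<^bsub>obj X (i - 1)\<^esub> q (i - 1) y)"
        using linear_map.add[OF X.diff_linear' wc qyc(2)] by simp
      finally show "\<exists>y\<in>homog (obj X (i - 1)) j. diff X (i - 1) y = x"
        using X.O.D_add[OF w(1) qyc(1)] by (intro bexI) simp_all
    qed
  next
    assume van: "homology_vanishes X i j"
    show "homology_vanishes P i j" unfolding homology_vanishes_def
    proof (intro ballI impI)
      fix p assume p: "p \<in> homog (obj P i) j" "diff P i p = \<zero>\<^bsub>obj P (i + 1)\<^esub>"
      have pc: "p \<in> carrier (obj P i)" using p P.O.D_carrier by auto
      then have pZ: "p \<in> P.Z i" using p by (simp add: cocycles_def)
      have "diff X i (q i p) = \<zero>\<^bsub>obj X (i + 1)\<^esub>" using q_Z[OF pZ] by (simp add: cocycles_def)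
      then obtain y where y: "y \<in> homog (obj X (i - 1)) j" "diff X (i - 1) y = q i p"
        using van q.homog[OF p(1)] unfolding homology_vanishes_def by blast
      have qpB: "q i p \<in> X.B i" unfolding X.B_iff by (rule bexI[of _ y]) (use y X.O.D_carrier in simp_all)
      have 1: "cohomology_map P X q i (P.B i +>\<^bsub>obj P i\<^esub> p) = X.B i"
        unfolding cohomology_map_coset[OF pZ] using X.rcos_self[OF q.closed[OF pc]] qpB by simp
      have 2: "cohomology_map P X q i (P.B i +>\<^bsub>obj P i\<^esub> \<zero>\<^bsub>obj P i\<^esub>) = X.B i"
      proof -
        have "\<zero>\<^bsub>obj P i\<^esub> \<in> P.Z i" "\<zero>\<^bsub>obj X i\<^esub> \<in> X.B i"
          using P.Z_submodule[of i] X.B_submodule[of i] by (auto simp: P.O.submodule_iff X.O.submodule_iff)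
        then show ?thesis using cohomology_map_coset[of "\<zero>\<^bsub>obj P i\<^esub>" i] q.zero[of i] X.rcos_self[of "\<zero>\<^bsub>obj X i\<^esub>" i] by simp
      qed
      have 3: "P.B i +>\<^bsub>obj P i\<^esub> p \<in> carrier (P.Hq i)" "P.B i +>\<^bsub>obj P i\<^esub> \<zero>\<^bsub>obj P i\<^esub> \<in> carrier (P.Hq i)"
        unfolding P.Hq_carrier using pZ P.Z_submodule[of i] unfolding P.O.submodule_iff by blast+
      have "P.B i +>\<^bsub>obj P i\<^esub> p = P.B i +>\<^bsub>obj P i\<^esub> \<zero>\<^bsub>obj P i\<^esub>"
        by (rule inj_onD[OF bij_betw_imp_inj_on[OF bij] _ 3]) (simp only: 1 2)
      then have "p \<ominus>\<^bsub>obj P i\<^esub> \<zero>\<^bsub>obj P i\<^esub> \<in> P.B i" using P.rcos_eq[OF pc P.O.M.zero_closed] by simp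
      then have "p \<in> P.B i" using pc by (simp add: P.O.M.minus_zero_right)
      then show "\<exists>y\<in>homog (obj P (i - 1)) j. diff P (i - 1) y = p"
        by (rule P.B_homog) (use P.O.components_same[OF p(1), of j] in simp)
    qed
  qed
qed

end

subsection \<open>Coding finitely supported functions by lists\<close>

text \<open>The length \<open>prod_encode (n, length w)\<close> of \<open>pad n w\<close> records both \<open>n\<close> and the length of \<open>w\<close>.\<close>

definition pad :: "nat \<Rightarrow> 'b list \<Rightarrow> 'b list" where
  "pad n w = w @ replicate (prod_encode (n, length w) - length w) undefined"

lemma pad_inject: "pad n w = pad n' w' \<longleftrightarrow> n = n' \<and> w = w'"
proof -
  have len: "length (pad n w) = prod_encode (n, length w)" for n and w :: "'b list"
    using le_prod_encode_2[of "length w" n] by (simp add: pad_def)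
  have "n = n' \<and> w = w'" if eq: "pad n w = pad n' w'"
  proof -
    have "prod_encode (n, length w) = prod_encode (n', length w')" using len[of n w] len[of n' w'] eq by simp
    then have n: "n = n'" "length w = length w'" by auto
    then show ?thesis using eq by (simp add: pad_def)
  qed
  then show ?thesis by auto
qed

text \<open>The type of letters may have a single element, so no letter can serve as a separator.
  All numerical data, here the lengths of the blocks, go into the length of the padded list.\<close>

definition concat_code :: "'b list list \<Rightarrow> 'b list" where
  "concat_code ws = pad (list_encode (map length ws)) (concat ws)"

lemma concat_code_inject: "concat_code ws = concat_code ws' \<Longrightarrow> ws = ws'"
proof -
  assume "concat_code ws = concat_code ws'"
  then have *: "map length ws = map length ws'" "concat ws = concat ws'" by (auto simp: concat_code_def pad_inject list_encode_eq)
  have len: "length ws = length ws'" using arg_cong[OF *(1), of length] by simp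
  have "length (ws ! i) = length (ws' ! i)" if "i < length ws" for i
    using arg_cong[OF *(1), of "\<lambda>l. l ! i"] that len by simp
  then have "\<forall>(x, y)\<in>set (zip ws ws'). length x = length y" by (auto simp: set_zip)
  then show ?thesis using *(2) len by (simp add: concat_injective)
qed

text \<open>The terms of \<open>chosen_resolution\<close> consist of lists over \<open>'a \<times> 'm\<close>, and so must the free modules below, whose
  generators are triples of a degree, an element of \<open>X\<close> and an element of the next term of the resolution.\<close>

lemma coding_exists:
  fixes z :: 'a
  shows "\<exists>\<iota> :: (int \<times> 'm \<times> ('a \<times> 'm) list \<Rightarrow> 'a) \<Rightarrow> ('a \<times> 'm) list. inj_on \<iota> {c. finite {g. c g \<noteq> z}}"
proof -
  \<comment> \<open>The degree j is held by the padding length, the coefficient and the element of X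
    by the first letter, and the element of the next term by the remaining letters.\<close>
  define en :: "'a \<times> int \<times> 'm \<times> ('a \<times> 'm) list \<Rightarrow> ('a \<times> 'm) list" where
    "en = (\<lambda>(a, j, m, t). pad (int_encode j) ((a, m) # t))"
  have en: "inj en" by (auto simp: inj_def en_def pad_inject int_encode_eq)
  define graph where "graph c = {(c g, g) | g. c g \<noteq> z}" for c :: "int \<times> 'm \<times> ('a \<times> 'm) list \<Rightarrow> 'a"
  have graph_inj: "c = c'" if "graph c = graph c'" for c c'
  proof
    fix g
    have iff: "(a, g) \<in> graph d \<longleftrightarrow> a = d g \<and> d g \<noteq> z" for a d
      unfolding graph_def by blast
    have "(a = c g \<and> c g \<noteq> z) \<longleftrightarrow> (a = c' g \<and> c' g \<noteq> z)" for a
      using iff[of a c] iff[of a c'] unfolding that by blast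
    then show "c g = c' g" by metis
  qed
  \<comment> \<open>Any enumeration of the finite graph will do: equal codes give equal lists, hence
    equal graphs.\<close>
  define L where "L c = (SOME l. set l = graph c)" for c
  define \<iota> where "\<iota> c = concat_code (map en (L c))" for c
  have "c = c'" if c: "finite {g. c g \<noteq> z}" "finite {g. c' g \<noteq> z}" and eq: "\<iota> c = \<iota> c'" for c c'
  proof -
    have fin: "finite (graph c)" if "finite {g. c g \<noteq> z}" for c
    proof -
      have "graph c = (\<lambda>g. (c g, g)) ` {g. c g \<noteq> z}" by (auto simp: graph_def)
      then show ?thesis using that by simp
    qed
    have set: "set (L c) = graph c" if "finite {g. c g \<noteq> z}" for c
      unfolding L_def using someI_ex[OF finite_list[OF fin[OF that]]] .
    have "map en (L c) = map en (L c')" using concat_code_inject eq unfolding \<iota>_def .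
    then have "L c = L c'" unfolding inj_map_eq_map[OF en] .
    then have "graph c = graph c'" using set[OF c(1)] set[OF c(2)] by simp
    then show ?thesis by (rule graph_inj)
  qed
  then show ?thesis by (auto simp: inj_on_def)
qed

subsection \<open>Free modules on a given set of generators\<close>

text \<open>The free module of finitely supported coefficient functions, transported along an
  injection \<open>\<iota>\<close> into a prescribed type. Its inverse \<open>\<delta>\<close>
  serves as the coordinate map, and identities are checked after applying
  \<open>\<delta>\<close>.\<close>

locale free_construction = graded_algebra K A
  for K :: "('k, 'x) ring_scheme" and A :: "('k, 'a, nat) graded" +
  fixes \<iota> :: "('g \<Rightarrow> 'a) \<Rightarrow> 'p" and deg :: "'g \<Rightarrow> int"
  assumes \<iota>_inj: "inj_on \<iota> {c. finite {g. c g \<noteq> \<zero>\<^bsub>A\<^esub>}}"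
begin

definition \<delta> :: "'p \<Rightarrow> 'g \<Rightarrow> 'a" where
  "\<delta> = inv_into {c. finite {g. c g \<noteq> \<zero>\<^bsub>A\<^esub>}} \<iota>"

definition coeffs :: "'g set \<Rightarrow> ('g \<Rightarrow> 'a) set" where
  "coeffs G = {c. (\<forall>g. c g \<in> carrier A) \<and> (\<forall>g. g \<notin> G \<longrightarrow> c g = \<zero>\<^bsub>A\<^esub>) \<and> finite {g. c g \<noteq> \<zero>\<^bsub>A\<^esub>}}"

definition free_graded :: "'g set \<Rightarrow> ('a, 'p, int) graded" where
  "free_graded G = \<lparr>carrier = \<iota> ` coeffs G, mult = undefined, one = undefined, zero = \<iota> (\<lambda>_. \<zero>\<^bsub>A\<^esub>),
     add = (\<lambda>s t. \<iota> (\<lambda>g. \<delta> s g \<oplus>\<^bsub>A\<^esub> \<delta> t g)), smult = (\<lambda>a s. \<iota> (\<lambda>g. a \<otimes>\<^bsub>A\<^esub> \<delta> s g)),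
     homog = (\<lambda>j. \<iota> ` {c \<in> coeffs G. \<forall>g. c g \<in> H (j - deg g)})\<rparr>"

definition gen :: "'g \<Rightarrow> 'p" where
  "gen g = \<iota> (\<lambda>h. if h = g then \<one>\<^bsub>A\<^esub> else \<zero>\<^bsub>A\<^esub>)"

lemma free_simps: "carrier (free_graded G) = \<iota> ` coeffs G" "zero (free_graded G) = \<iota> (\<lambda>_. \<zero>\<^bsub>A\<^esub>)"
  "add (free_graded G) = (\<lambda>s t. \<iota> (\<lambda>g. \<delta> s g \<oplus>\<^bsub>A\<^esub> \<delta> t g))" "smult (free_graded G) = (\<lambda>a s. \<iota> (\<lambda>g. a \<otimes>\<^bsub>A\<^esub> \<delta> s g))"
  "homog (free_graded G) j = \<iota> ` {c \<in> coeffs G. \<forall>g. c g \<in> H (j - deg g)}"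
  by (auto simp: free_graded_def)

lemma \<delta>_\<iota>: "c \<in> coeffs G \<Longrightarrow> \<delta> (\<iota> c) = c"
  unfolding \<delta>_def by (rule inv_into_f_f[OF \<iota>_inj]) (simp add: coeffs_def)

lemma coeffs_zero: "(\<lambda>_. \<zero>\<^bsub>A\<^esub>) \<in> coeffs G" by (simp add: coeffs_def)

lemma coeffs_add: "c \<in> coeffs G \<Longrightarrow> c' \<in> coeffs G \<Longrightarrow> (\<lambda>g. c g \<oplus>\<^bsub>A\<^esub> c' g) \<in> coeffs G"
proof -
  assume c: "c \<in> coeffs G" "c' \<in> coeffs G"
  have "{g. c g \<oplus>\<^bsub>A\<^esub> c' g \<noteq> \<zero>\<^bsub>A\<^esub>} \<subseteq> {g. c g \<noteq> \<zero>\<^bsub>A\<^esub>} \<union> {g. c' g \<noteq> \<zero>\<^bsub>A\<^esub>}" using c by (auto simp: coeffs_def)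
  then have "finite {g. c g \<oplus>\<^bsub>A\<^esub> c' g \<noteq> \<zero>\<^bsub>A\<^esub>}"
    by (rule finite_subset) (use c in \<open>simp add: coeffs_def\<close>)
  then show ?thesis using c by (simp add: coeffs_def)
qed

lemma coeffs_map:
  assumes c: "c \<in> coeffs G" and f: "\<And>g a. a \<in> carrier A \<Longrightarrow> f g a \<in> carrier A" "\<And>g. f g \<zero>\<^bsub>A\<^esub> = \<zero>\<^bsub>A\<^esub>"
  shows "(\<lambda>g. f g (c g)) \<in> coeffs G"
proof -
  have "{g. f g (c g) \<noteq> \<zero>\<^bsub>A\<^esub>} \<subseteq> {g. c g \<noteq> \<zero>\<^bsub>A\<^esub>}" by (auto simp: f(2))
  then have "finite {g. f g (c g) \<noteq> \<zero>\<^bsub>A\<^esub>}"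
    by (rule finite_subset) (use c in \<open>simp add: coeffs_def\<close>)
  then show ?thesis using c f by (simp add: coeffs_def)
qed

lemma coeffs_smult: "a \<in> carrier A \<Longrightarrow> c \<in> coeffs G \<Longrightarrow> (\<lambda>g. a \<otimes>\<^bsub>A\<^esub> c g) \<in> coeffs G"
  by (rule coeffs_map) auto

lemma coeffs_neg: "c \<in> coeffs G \<Longrightarrow> (\<lambda>g. \<ominus>\<^bsub>A\<^esub> c g) \<in> coeffs G"
  by (rule coeffs_map) auto

lemma coeffs_carrier: "c \<in> coeffs G \<Longrightarrow> c g \<in> carrier A" by (simp add: coeffs_def)

lemma \<delta>_coeffs: "s \<in> carrier (free_graded G) \<Longrightarrow> \<delta> s \<in> coeffs G"
  using \<delta>_\<iota> by (auto simp: free_simps)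

lemma \<iota>_\<delta>: "s \<in> carrier (free_graded G) \<Longrightarrow> \<iota> (\<delta> s) = s"
  using \<delta>_\<iota> by (auto simp: free_simps)

lemma free_eqI: "s \<in> carrier (free_graded G) \<Longrightarrow> t \<in> carrier (free_graded G) \<Longrightarrow> \<delta> s = \<delta> t \<Longrightarrow> s = t"
  using \<iota>_\<delta> by metis

lemma \<delta>_add: "s \<in> carrier (free_graded G) \<Longrightarrow> t \<in> carrier (free_graded G) \<Longrightarrow>
    \<delta> (s \<oplus>\<^bsub>free_graded G\<^esub> t) = (\<lambda>g. \<delta> s g \<oplus>\<^bsub>A\<^esub> \<delta> t g)"
  using \<delta>_\<iota>[OF coeffs_add[OF \<delta>_coeffs \<delta>_coeffs]] by (simp add: free_simps(3))

lemma \<delta>_smult: "a \<in> carrier A \<Longrightarrow> s \<in> carrier (free_graded G) \<Longrightarrow>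
    \<delta> (a \<odot>\<^bsub>free_graded G\<^esub> s) = (\<lambda>g. a \<otimes>\<^bsub>A\<^esub> \<delta> s g)"
  using \<delta>_\<iota>[OF coeffs_smult[OF _ \<delta>_coeffs]] by (simp add: free_simps(4))

lemma \<delta>_zero: "\<delta> \<zero>\<^bsub>free_graded G\<^esub> = (\<lambda>_. \<zero>\<^bsub>A\<^esub>)"
  using \<delta>_\<iota>[OF coeffs_zero] by (simp add: free_simps(2))

lemma \<iota>_closed: "c \<in> coeffs G \<Longrightarrow> \<iota> c \<in> carrier (free_graded G)"
  by (simp add: free_simps)

lemma free_add_closed: "s \<in> carrier (free_graded G) \<Longrightarrow> t \<in> carrier (free_graded G) \<Longrightarrow> s \<oplus>\<^bsub>free_graded G\<^esub> t \<in> carrier (free_graded G)"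
  using \<iota>_closed[OF coeffs_add[OF \<delta>_coeffs \<delta>_coeffs]] by (simp add: free_simps(3))

lemma free_smult_closed: "a \<in> carrier A \<Longrightarrow> s \<in> carrier (free_graded G) \<Longrightarrow> a \<odot>\<^bsub>free_graded G\<^esub> s \<in> carrier (free_graded G)"
  using \<iota>_closed[OF coeffs_smult[OF _ \<delta>_coeffs]] by (simp add: free_simps(4))

lemma free_zero_closed: "\<zero>\<^bsub>free_graded G\<^esub> \<in> carrier (free_graded G)"
  using \<iota>_closed[OF coeffs_zero] by (simp add: free_simps(2))

lemma \<delta>_carrier: "s \<in> carrier (free_graded G) \<Longrightarrow> \<delta> s g \<in> carrier A"
  using coeffs_carrier[OF \<delta>_coeffs] .

lemma free_left_module: "left_module A (free_graded G)"
proof -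
  have "abelian_group (free_graded G)"
  proof (rule abelian_groupI)
    fix s t u assume s: "s \<in> carrier (free_graded G)" and t: "t \<in> carrier (free_graded G)" and u: "u \<in> carrier (free_graded G)"
    show "s \<oplus>\<^bsub>free_graded G\<^esub> t \<oplus>\<^bsub>free_graded G\<^esub> u = s \<oplus>\<^bsub>free_graded G\<^esub> (t \<oplus>\<^bsub>free_graded G\<^esub> u)"
      by (rule free_eqI[where G=G]) (simp_all add: s t u free_add_closed \<delta>_add \<delta>_carrier[OF s] \<delta>_carrier[OF t] \<delta>_carrier[OF u] A.a_assoc)
  next
    fix s t assume s: "s \<in> carrier (free_graded G)" and t: "t \<in> carrier (free_graded G)"
    show "s \<oplus>\<^bsub>free_graded G\<^esub> t = t \<oplus>\<^bsub>free_graded G\<^esub> s"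
      by (rule free_eqI[where G=G]) (simp_all add: s t free_add_closed \<delta>_add \<delta>_carrier[OF s] \<delta>_carrier[OF t] A.a_comm)
  next
    fix s assume s: "s \<in> carrier (free_graded G)"
    show "\<zero>\<^bsub>free_graded G\<^esub> \<oplus>\<^bsub>free_graded G\<^esub> s = s"
      by (rule free_eqI[where G=G]) (simp_all add: s free_add_closed free_zero_closed \<delta>_add \<delta>_zero \<delta>_carrier[OF s])
    let ?t = "\<iota> (\<lambda>g. \<ominus>\<^bsub>A\<^esub> \<delta> s g)"
    have t: "?t \<in> carrier (free_graded G)" "\<delta> ?t = (\<lambda>g. \<ominus>\<^bsub>A\<^esub> \<delta> s g)"
      using \<iota>_closed[OF coeffs_neg[OF \<delta>_coeffs[OF s]]] \<delta>_\<iota>[OF coeffs_neg[OF \<delta>_coeffs[OF s]]] by auto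
    have "?t \<oplus>\<^bsub>free_graded G\<^esub> s = \<zero>\<^bsub>free_graded G\<^esub>"
      by (rule free_eqI[where G=G]) (simp_all add: s t free_add_closed free_zero_closed \<delta>_add \<delta>_zero \<delta>_carrier[OF s] A.l_neg)
    then show "\<exists>t\<in>carrier (free_graded G). t \<oplus>\<^bsub>free_graded G\<^esub> s = \<zero>\<^bsub>free_graded G\<^esub>" using t(1) by blast
  qed (simp_all add: free_add_closed free_zero_closed)
  moreover have "left_module_axioms A (free_graded G)"
  proof (rule left_module_axioms.intro)
    fix a b s t assume a: "a \<in> carrier A" and b: "b \<in> carrier A" and s: "s \<in> carrier (free_graded G)"
    show "(a \<oplus>\<^bsub>A\<^esub> b) \<odot>\<^bsub>free_graded G\<^esub> s = a \<odot>\<^bsub>free_graded G\<^esub> s \<oplus>\<^bsub>free_graded G\<^esub> b \<odot>\<^bsub>free_graded G\<^esub> s"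
      by (rule free_eqI[where G=G]) (simp_all add: a b s free_add_closed free_smult_closed \<delta>_add \<delta>_smult \<delta>_carrier[OF s] A.l_distr)
    show "(a \<otimes>\<^bsub>A\<^esub> b) \<odot>\<^bsub>free_graded G\<^esub> s = a \<odot>\<^bsub>free_graded G\<^esub> (b \<odot>\<^bsub>free_graded G\<^esub> s)"
      by (rule free_eqI[where G=G]) (simp_all add: a b s free_smult_closed \<delta>_smult \<delta>_carrier[OF s] A.m_assoc)
  next
    fix a s t assume a: "a \<in> carrier A" and s: "s \<in> carrier (free_graded G)" and t: "t \<in> carrier (free_graded G)"
    show "a \<odot>\<^bsub>free_graded G\<^esub> (s \<oplus>\<^bsub>free_graded G\<^esub> t) = a \<odot>\<^bsub>free_graded G\<^esub> s \<oplus>\<^bsub>free_graded G\<^esub> a \<odot>\<^bsub>free_graded G\<^esub> t"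
      by (rule free_eqI[where G=G]) (simp_all add: a s t free_add_closed free_smult_closed \<delta>_add \<delta>_smult \<delta>_carrier[OF s] \<delta>_carrier[OF t] A.r_distr)
  next
    fix s assume s: "s \<in> carrier (free_graded G)"
    show "\<one>\<^bsub>A\<^esub> \<odot>\<^bsub>free_graded G\<^esub> s = s"
      by (rule free_eqI[where G=G]) (simp_all add: s free_smult_closed \<delta>_smult \<delta>_carrier[OF s])
  qed (simp add: free_smult_closed)
  ultimately show ?thesis by (simp add: left_module_def A.ring_axioms)
qed

lemma \<delta>_finsum:
  assumes "f \<in> F \<rightarrow> carrier (free_graded G)"
  shows "\<delta> (finsum (free_graded G) f F) g = (\<Oplus>\<^bsub>A\<^esub>i\<in>F. \<delta> (f i) g)"
proof (rule finsum_additive_map[where f="\<lambda>s. \<delta> s g"])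
  interpret M: left_module A "free_graded G" by (rule free_left_module)
  show "abelian_monoid (free_graded G)" by (rule M.M.abelian_monoid_axioms)
qed (use assms A.abelian_monoid_axioms \<delta>_carrier \<delta>_zero \<delta>_add in auto)

lemma free_homog: "s \<in> homog (free_graded G) j \<longleftrightarrow> s \<in> carrier (free_graded G) \<and> (\<forall>g. \<delta> s g \<in> H (j - deg g))"
proof
  assume "s \<in> homog (free_graded G) j"
  then show "s \<in> carrier (free_graded G) \<and> (\<forall>g. \<delta> s g \<in> H (j - deg g))" using \<delta>_\<iota> by (auto simp: free_simps)
next
  assume s: "s \<in> carrier (free_graded G) \<and> (\<forall>g. \<delta> s g \<in> H (j - deg g))"
  then have "\<iota> (\<delta> s) \<in> homog (free_graded G) j" unfolding free_simps(5) using \<delta>_coeffs by blast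
  then show "s \<in> homog (free_graded G) j" using \<iota>_\<delta>[of s G] s by simp
qed

lemma free_graded_module: "graded_module A (free_graded G)"
proof -
  interpret M: left_module A "free_graded G" by (rule free_left_module)
  let ?p = "\<lambda>j s. \<iota> (\<lambda>g. cA (j - deg g) (\<delta> s g))"
  have p: "?p j s \<in> carrier (free_graded G)" "\<delta> (?p j s) = (\<lambda>g. cA (j - deg g) (\<delta> s g))"
    if "s \<in> carrier (free_graded G)" for j s
  proof -
    have "(\<lambda>g. cA (j - deg g) (\<delta> s g)) \<in> coeffs G"
      by (rule coeffs_map[OF \<delta>_coeffs[OF that]]) (auto simp: cA_zero)
    then show "?p j s \<in> carrier (free_graded G)" "\<delta> (?p j s) = (\<lambda>g. cA (j - deg g) (\<delta> s g))"
      using \<iota>_closed \<delta>_\<iota> by blast+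
  qed
  have "direct_sum (free_graded G) (homog (free_graded G))"
  proof (rule direct_sumI(1)[where p="?p"])
    show "additive_subgroup (homog (free_graded G) j) (free_graded G)" for j
    proof -
      have neg: "\<ominus>\<^bsub>free_graded G\<^esub> s \<in> homog (free_graded G) j" if "s \<in> homog (free_graded G) j" for s
      proof -
        have s: "s \<in> carrier (free_graded G)" using that free_homog by auto
        have "\<ominus>\<^bsub>free_graded G\<^esub> s = (\<ominus>\<^bsub>A\<^esub> \<one>\<^bsub>A\<^esub>) \<odot>\<^bsub>free_graded G\<^esub> s"
          using s by (simp add: M.smult_l_minus M.smult_one)
        then show ?thesis using that H_minus \<delta>_carrier[OF s]
          unfolding free_homog by (simp add: \<delta>_smult free_smult_closed A.l_minus)
      qed
      show ?thesis unfolding additive_subgroup_iff[OF M.M.abelian_group_axioms]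
        using neg H_zero H_add by (auto simp: free_homog free_add_closed free_zero_closed \<delta>_add \<delta>_zero)
    qed
    show "?p j s \<in> homog (free_graded G) j" if "s \<in> carrier (free_graded G)" for j s
      unfolding free_homog using p[OF that] cA_in \<delta>_carrier[OF that] by simp
    show "?p j (s \<oplus>\<^bsub>free_graded G\<^esub> t) = ?p j s \<oplus>\<^bsub>free_graded G\<^esub> ?p j t"
      if s: "s \<in> carrier (free_graded G)" and t: "t \<in> carrier (free_graded G)" for j s t
    proof (rule free_eqI[where G=G])
      note st = free_add_closed[OF s t]
      show "?p j (s \<oplus>\<^bsub>free_graded G\<^esub> t) \<in> carrier (free_graded G)" by (rule p(1)[OF st])
      show "?p j s \<oplus>\<^bsub>free_graded G\<^esub> ?p j t \<in> carrier (free_graded G)" by (rule free_add_closed[OF p(1)[OF s] p(1)[OF t]])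
      show "\<delta> (?p j (s \<oplus>\<^bsub>free_graded G\<^esub> t)) = \<delta> (?p j s \<oplus>\<^bsub>free_graded G\<^esub> ?p j t)"
      proof -
        have "\<delta> (?p j (s \<oplus>\<^bsub>free_graded G\<^esub> t)) = (\<lambda>g. cA (j - deg g) (\<delta> (s \<oplus>\<^bsub>free_graded G\<^esub> t) g))"
          by (rule p(2)[OF st])
        also have "\<dots> = (\<lambda>g. cA (j - deg g) (\<delta> s g) \<oplus>\<^bsub>A\<^esub> cA (j - deg g) (\<delta> t g))"
          unfolding \<delta>_add[OF s t] using cA_add \<delta>_carrier[OF s] \<delta>_carrier[OF t] by simp
        also have "\<dots> = (\<lambda>g. \<delta> (?p j s) g \<oplus>\<^bsub>A\<^esub> \<delta> (?p j t) g)" unfolding p(2)[OF s] p(2)[OF t] ..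
        also have "\<dots> = \<delta> (?p j s \<oplus>\<^bsub>free_graded G\<^esub> ?p j t)" by (rule \<delta>_add[OF p(1)[OF s] p(1)[OF t], symmetric])
        finally show ?thesis .
      qed
    qed
    show "?p i s = (if i = j then s else \<zero>\<^bsub>free_graded G\<^esub>)" if s: "s \<in> homog (free_graded G) j" for i j s
    proof (rule free_eqI[where G=G])
      have sc: "s \<in> carrier (free_graded G)" using s free_homog by auto
      show "?p i s \<in> carrier (free_graded G)" using p(1)[OF sc] .
      show "(if i = j then s else \<zero>\<^bsub>free_graded G\<^esub>) \<in> carrier (free_graded G)" using sc free_zero_closed by simp
      have "cA (i - deg g) (\<delta> s g) = (if i = j then \<delta> s g else \<zero>\<^bsub>A\<^esub>)" for g
        using cA_same[of "\<delta> s g" "j - deg g" "i - deg g"] s unfolding free_homog by simp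
      then show "\<delta> (?p i s) = \<delta> (if i = j then s else \<zero>\<^bsub>free_graded G\<^esub>)"
        unfolding p(2)[OF sc] by (cases "i = j") (simp_all add: \<delta>_zero)
    qed
    fix s assume s: "s \<in> carrier (free_graded G)"
    let ?J = "{j. ?p j s \<noteq> \<zero>\<^bsub>free_graded G\<^esub>}"
    have J: "j \<in> ?J \<longleftrightarrow> (\<exists>g. cA (j - deg g) (\<delta> s g) \<noteq> \<zero>\<^bsub>A\<^esub>)" for j
    proof -
      have "?p j s = \<zero>\<^bsub>free_graded G\<^esub> \<longleftrightarrow> \<delta> (?p j s) = \<delta> \<zero>\<^bsub>free_graded G\<^esub>"
        by (rule iffI[OF arg_cong free_eqI[OF p(1)[OF s] free_zero_closed]])
      then show ?thesis unfolding p(2)[OF s] \<delta>_zero by (auto simp: fun_eq_iff)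
    qed
    \<comment> \<open>Finitely many coordinates are nonzero, and each has finitely many components,
      which the degrees of the generators shift.\<close>
    have "?J \<subseteq> (\<Union>g\<in>{g. \<delta> s g \<noteq> \<zero>\<^bsub>A\<^esub>}. (\<lambda>l. l + deg g) ` {l. cA l (\<delta> s g) \<noteq> \<zero>\<^bsub>A\<^esub>})"
    proof
      fix j assume "j \<in> ?J"
      then obtain g where g: "cA (j - deg g) (\<delta> s g) \<noteq> \<zero>\<^bsub>A\<^esub>" using J by auto
      then have "\<delta> s g \<noteq> \<zero>\<^bsub>A\<^esub>" by (auto simp: cA_zero)
      then show "j \<in> (\<Union>g\<in>{g. \<delta> s g \<noteq> \<zero>\<^bsub>A\<^esub>}. (\<lambda>l. l + deg g) ` {l. cA l (\<delta> s g) \<noteq> \<zero>\<^bsub>A\<^esub>})"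
        using g by (intro UN_I[of g] image_eqI[of _ _ "j - deg g"]) simp_all
    qed
    moreover have "finite {g. \<delta> s g \<noteq> \<zero>\<^bsub>A\<^esub>}" using \<delta>_coeffs[OF s] by (simp add: coeffs_def)
    moreover have "finite {l. cA l (\<delta> s g) \<noteq> \<zero>\<^bsub>A\<^esub>}" for g
      using reg.components_spec(2)[of "\<delta> s g"] \<delta>_carrier[OF s] by simp
    ultimately show finJ: "finite ?J" by (meson finite_UN finite_imageI finite_subset)
    show "s = (\<Oplus>\<^bsub>free_graded G\<^esub>j\<in>?J. ?p j s)"
    proof (rule free_eqI[OF s])
      show "(\<Oplus>\<^bsub>free_graded G\<^esub>j\<in>?J. ?p j s) \<in> carrier (free_graded G)"
        using p(1)[OF s] by (intro M.M.finsum_closed) auto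
      show "\<delta> s = \<delta> (\<Oplus>\<^bsub>free_graded G\<^esub>j\<in>?J. ?p j s)"
      proof
        fix g
        let ?h = "\<lambda>j. j - deg g"
        have "\<delta> (\<Oplus>\<^bsub>free_graded G\<^esub>j\<in>?J. ?p j s) g = (\<Oplus>\<^bsub>A\<^esub>j\<in>?J. cA (?h j) (\<delta> s g))"
          by (subst \<delta>_finsum) (use p[OF s] in auto)
        also have "\<dots> = (\<Oplus>\<^bsub>A\<^esub>l\<in>?h ` ?J. cA l (\<delta> s g))"
          by (rule A.add.finprod_reindex[symmetric]) (use \<delta>_carrier[OF s] in \<open>auto simp: inj_on_def\<close>)
        also have "\<dots> = \<delta> s g"
        proof -
          have sub: "{l. cA l (\<delta> s g) \<noteq> \<zero>\<^bsub>A\<^esub>} \<subseteq> ?h ` ?J"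
          proof
            fix l assume "l \<in> {l. cA l (\<delta> s g) \<noteq> \<zero>\<^bsub>A\<^esub>}"
            then have "l + deg g \<in> ?J" unfolding J by (intro exI[of _ g]) simp
            then show "l \<in> ?h ` ?J" by (rule image_eqI[rotated]) simp
          qed
          show ?thesis using reg.components_sum[of "\<delta> s g" "?h ` ?J"] finJ sub \<delta>_carrier[OF s] by simp
        qed
        finally show "\<delta> s g = \<delta> (\<Oplus>\<^bsub>free_graded G\<^esub>j\<in>?J. ?p j s) g" by simp
      qed
    qed
  qed (rule M.M.abelian_group_axioms)
  moreover have "a \<odot>\<^bsub>free_graded G\<^esub> s \<in> homog (free_graded G) (int i + j)"
    if "a \<in> homog A i" "s \<in> homog (free_graded G) j" for a s i j
  proof -
    have a: "a \<in> H (int i)" using that H_nat by simp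
    have s: "s \<in> carrier (free_graded G)" "\<And>g. \<delta> s g \<in> H (j - deg g)" using that free_homog by auto
    have "a \<otimes>\<^bsub>A\<^esub> \<delta> s g \<in> H (int i + j - deg g)" for g using H_mult[OF a s(2)[of g]] by (simp add: algebra_simps)
    then show ?thesis unfolding free_homog using free_smult_closed \<delta>_smult s(1) H_carrier[OF a] by simp
  qed
  ultimately show ?thesis
    by (auto simp: graded_module_def graded_module_axioms_def M.left_module_axioms direct_sum.direct_sum)
qed

lemma gen_closed: "g \<in> G \<Longrightarrow> gen g \<in> carrier (free_graded G)"
  and \<delta>_gen: "g \<in> G \<Longrightarrow> \<delta> (gen g) = (\<lambda>h. if h = g then \<one>\<^bsub>A\<^esub> else \<zero>\<^bsub>A\<^esub>)"
proof -
  have "(\<lambda>h. if h = g then \<one>\<^bsub>A\<^esub> else \<zero>\<^bsub>A\<^esub>) \<in> coeffs G" if "g \<in> G"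
  proof -
    have "{h. (if h = g then \<one>\<^bsub>A\<^esub> else \<zero>\<^bsub>A\<^esub>) \<noteq> \<zero>\<^bsub>A\<^esub>} \<subseteq> {g}" by auto
    then have "finite {h. (if h = g then \<one>\<^bsub>A\<^esub> else \<zero>\<^bsub>A\<^esub>) \<noteq> \<zero>\<^bsub>A\<^esub>}" by (rule finite_subset) simp
    then show ?thesis using that by (simp add: coeffs_def)
  qed
  then show "g \<in> G \<Longrightarrow> gen g \<in> carrier (free_graded G)" "g \<in> G \<Longrightarrow> \<delta> (gen g) = (\<lambda>h. if h = g then \<one>\<^bsub>A\<^esub> else \<zero>\<^bsub>A\<^esub>)"
    unfolding gen_def using \<iota>_closed \<delta>_\<iota> by auto
qed

lemma free_module_free_graded: "free_module K A (free_graded G) G deg gen \<delta>"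
proof -
  interpret M: graded_module A "free_graded G" by (rule free_graded_module)
  show ?thesis
  proof (intro free_module.intro free_module_axioms.intro graded_algebra_axioms free_graded_module)
    show "gen g \<in> homog (free_graded G) (deg g)" if "g \<in> G" for g
      unfolding free_homog using gen_closed[OF that] \<delta>_gen[OF that] one_H H_zero by simp
    show "s = (\<Oplus>\<^bsub>free_graded G\<^esub>g\<in>{g. \<delta> s g \<noteq> \<zero>\<^bsub>A\<^esub>}. \<delta> s g \<odot>\<^bsub>free_graded G\<^esub> gen g)"
      if s: "s \<in> carrier (free_graded G)" for s
    proof (rule free_eqI[OF s])
      let ?F = "{g. \<delta> s g \<noteq> \<zero>\<^bsub>A\<^esub>}"
      have F: "g \<in> G" if "g \<in> ?F" for g using \<delta>_coeffs[OF s] that by (auto simp: coeffs_def)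
      have fin: "finite ?F" using \<delta>_coeffs[OF s] by (simp add: coeffs_def)
      have c: "\<delta> s g \<odot>\<^bsub>free_graded G\<^esub> gen g \<in> carrier (free_graded G)" if "g \<in> ?F" for g
        using free_smult_closed[OF \<delta>_carrier[OF s] gen_closed[OF F[OF that]]] .
      show "(\<Oplus>\<^bsub>free_graded G\<^esub>g\<in>?F. \<delta> s g \<odot>\<^bsub>free_graded G\<^esub> gen g) \<in> carrier (free_graded G)"
        using c by (intro M.M.finsum_closed) auto
      show "\<delta> s = \<delta> (\<Oplus>\<^bsub>free_graded G\<^esub>g\<in>?F. \<delta> s g \<odot>\<^bsub>free_graded G\<^esub> gen g)"
      proof
        fix h
        have "\<delta> (\<Oplus>\<^bsub>free_graded G\<^esub>g\<in>?F. \<delta> s g \<odot>\<^bsub>free_graded G\<^esub> gen g) h = (\<Oplus>\<^bsub>A\<^esub>g\<in>?F. \<delta> (\<delta> s g \<odot>\<^bsub>free_graded G\<^esub> gen g) h)"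
          by (rule \<delta>_finsum) (use c in auto)
        also have "\<dots> = (\<Oplus>\<^bsub>A\<^esub>g\<in>?F. if h = g then \<delta> s g else \<zero>\<^bsub>A\<^esub>)"
          by (rule A.finsum_cong') (use \<delta>_smult[OF \<delta>_carrier[OF s] gen_closed] \<delta>_gen F \<delta>_carrier[OF s] in auto)
        also have "\<dots> = \<delta> s h"
        proof (cases "h \<in> ?F")
          case True
          then show ?thesis using A.finsum_singleton[of h ?F "\<delta> s"] fin \<delta>_carrier[OF s] by auto
        next
          case False
          then have "(\<Oplus>\<^bsub>A\<^esub>g\<in>?F. if h = g then \<delta> s g else \<zero>\<^bsub>A\<^esub>) = (\<Oplus>\<^bsub>A\<^esub>g\<in>?F. \<zero>\<^bsub>A\<^esub>)"
            by (intro A.finsum_cong') auto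
          then show ?thesis using False by simp
        qed
        finally show "\<delta> s h = \<delta> (\<Oplus>\<^bsub>free_graded G\<^esub>g\<in>?F. \<delta> s g \<odot>\<^bsub>free_graded G\<^esub> gen g) h" by simp
      qed
    qed
    fix s assume s: "s \<in> carrier (free_graded G)"
    show "\<delta> s g \<in> carrier A" for g by (rule \<delta>_carrier[OF s])
    show "\<delta> s g = \<zero>\<^bsub>A\<^esub>" if "g \<notin> G" for g using \<delta>_coeffs[OF s] that by (simp add: coeffs_def)
    show "finite {g. \<delta> s g \<noteq> \<zero>\<^bsub>A\<^esub>}" using \<delta>_coeffs[OF s] by (simp add: coeffs_def)
    show "\<delta> (s \<oplus>\<^bsub>free_graded G\<^esub> t) g = \<delta> s g \<oplus>\<^bsub>A\<^esub> \<delta> t g" if t: "t \<in> carrier (free_graded G)" for t g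
      unfolding \<delta>_add[OF s t] ..
    show "\<delta> (a \<odot>\<^bsub>free_graded G\<^esub> s) g = a \<otimes>\<^bsub>A\<^esub> \<delta> s g" if a: "a \<in> carrier A" for a g
      unfolding \<delta>_smult[OF a s] ..
  next
    show "\<delta> (gen g) h = (if h = g then \<one>\<^bsub>A\<^esub> else \<zero>\<^bsub>A\<^esub>)" if "g \<in> G" for g h
      unfolding \<delta>_gen[OF that] ..
  qed
qed

end

section \<open>Freeness by coordinates and freeness by a homogeneous basis\<close>

context free_module
begin

lemma coord_finsum:
  assumes "f \<in> F \<rightarrow> carrier P"
  shows "\<kappa> (finsum P f F) g = (\<Oplus>\<^bsub>A\<^esub>i\<in>F. \<kappa> (f i) g)"
  by (rule finsum_additive_map[where f="\<lambda>x. \<kappa> x g"])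
     (use assms in \<open>auto simp: P.M.abelian_monoid_axioms A.abelian_monoid_axioms coord_zero coord_add\<close>)

lemma graded_free: "graded_free A P"
  unfolding graded_free_def
proof (intro conjI P.graded_module_axioms exI[of _ "e ` G"] ballI)
  show "e ` G \<subseteq> (\<Union>j. homog P j)" using basis_homog by blast
  fix x assume x: "x \<in> carrier P"
  let ?Q = "\<lambda>c. (\<forall>b\<in>e ` G. c b \<in> carrier A) \<and> (\<forall>b. b \<notin> e ` G \<longrightarrow> c b = \<zero>\<^bsub>A\<^esub>) \<and> finite {b. c b \<noteq> \<zero>\<^bsub>A\<^esub>} \<and>
    x = (\<Oplus>\<^bsub>P\<^esub>b\<in>{b. c b \<noteq> \<zero>\<^bsub>A\<^esub>}. c b \<odot>\<^bsub>P\<^esub> b)"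
  show "\<exists>!c. ?Q c"
  proof (cases "\<one>\<^bsub>A\<^esub> = \<zero>\<^bsub>A\<^esub>")
    \<comment> \<open>Over the zero ring \<open>e\<close> may identify different generators; there
      every module is zero, and the only coefficient function is zero.\<close>
    case True
    then have A0: "carrier A = {\<zero>\<^bsub>A\<^esub>}" using A.carrier_one_zero by simp
    have "x = \<zero>\<^bsub>P\<^esub>" using P.smult_one[OF x] P.smult_l_null[OF x] True by simp
    show ?thesis
    proof (rule ex1I[of _ "\<lambda>_. \<zero>\<^bsub>A\<^esub>"])
      show "?Q (\<lambda>_. \<zero>\<^bsub>A\<^esub>)" using \<open>x = \<zero>\<^bsub>P\<^esub>\<close> by simp
      fix c assume c: "?Q c"
      show "c = (\<lambda>_. \<zero>\<^bsub>A\<^esub>)"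
      proof
        fix b show "c b = \<zero>\<^bsub>A\<^esub>" using c A0 by (cases "b \<in> e ` G") auto
      qed
    qed
  next
    case False
    have inj: "inj_on e G"
    proof
      fix g h assume gh: "g \<in> G" "h \<in> G" "e g = e h"
      then show "g = h" using coord_basis[of g g] coord_basis[of h g] False by (auto split: if_splits)
    qed
    define c where "c b = (if b \<in> e ` G then \<kappa> x (inv_into G e b) else \<zero>\<^bsub>A\<^esub>)" for b
    have ce: "c (e g) = \<kappa> x g" if "g \<in> G" for g using inj that by (simp add: c_def)
    have supp: "{b. c b \<noteq> \<zero>\<^bsub>A\<^esub>} = e ` {g. \<kappa> x g \<noteq> \<zero>\<^bsub>A\<^esub>}"
    proof
      show "{b. c b \<noteq> \<zero>\<^bsub>A\<^esub>} \<subseteq> e ` {g. \<kappa> x g \<noteq> \<zero>\<^bsub>A\<^esub>}"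
      proof
        fix b assume b: "b \<in> {b. c b \<noteq> \<zero>\<^bsub>A\<^esub>}"
        then obtain g where "g \<in> G" "b = e g" by (auto simp: c_def split: if_splits)
        then show "b \<in> e ` {g. \<kappa> x g \<noteq> \<zero>\<^bsub>A\<^esub>}" using b ce by auto
      qed
      show "e ` {g. \<kappa> x g \<noteq> \<zero>\<^bsub>A\<^esub>} \<subseteq> {b. c b \<noteq> \<zero>\<^bsub>A\<^esub>}" using ce coord_supp[OF x] by auto
    qed
    have sG: "{g. \<kappa> x g \<noteq> \<zero>\<^bsub>A\<^esub>} \<subseteq> G" using coord_supp[OF x] by auto
    have "?Q c"
    proof (intro conjI ballI allI impI)
      show "finite {b. c b \<noteq> \<zero>\<^bsub>A\<^esub>}" unfolding supp using coord_fin[OF x] by simp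
      have "(\<Oplus>\<^bsub>P\<^esub>b\<in>{b. c b \<noteq> \<zero>\<^bsub>A\<^esub>}. c b \<odot>\<^bsub>P\<^esub> b) = (\<Oplus>\<^bsub>P\<^esub>g\<in>{g. \<kappa> x g \<noteq> \<zero>\<^bsub>A\<^esub>}. c (e g) \<odot>\<^bsub>P\<^esub> e g)"
        unfolding supp using sG x
        by (intro P.M.add.finprod_reindex inj_on_subset[OF inj]) (auto simp: ce P.smult_closed basis_carrier subset_iff)
      also have "\<dots> = (\<Oplus>\<^bsub>P\<^esub>g\<in>{g. \<kappa> x g \<noteq> \<zero>\<^bsub>A\<^esub>}. \<kappa> x g \<odot>\<^bsub>P\<^esub> e g)"
        by (rule P.M.finsum_cong') (use sG x in \<open>auto simp: ce P.smult_closed basis_carrier subset_iff\<close>)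
      finally show "x = (\<Oplus>\<^bsub>P\<^esub>b\<in>{b. c b \<noteq> \<zero>\<^bsub>A\<^esub>}. c b \<odot>\<^bsub>P\<^esub> b)" using coord_sum[OF x] by simp
    qed (use x in \<open>auto simp: c_def\<close>)
    moreover have "c' = c" if c': "?Q c'" for c'
    proof
      fix b
      let ?F = "{b. c' b \<noteq> \<zero>\<^bsub>A\<^esub>}"
      have FB: "\<exists>g\<in>G. b = e g" if "b \<in> ?F" for b using c' that by blast
      have c'A: "c' b \<in> carrier A" for b using c' by (cases "b \<in> e ` G") auto
      show "c' b = c b"
      proof (cases "b \<in> e ` G")
        case True
        then obtain g where g: "g \<in> G" "b = e g" by auto
        have cl: "c' b \<odot>\<^bsub>P\<^esub> b \<in> carrier P" if "b \<in> ?F" for b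
          using FB[OF that] c'A basis_carrier P.smult_closed by auto
        have "\<kappa> x g = \<kappa> (\<Oplus>\<^bsub>P\<^esub>b\<in>?F. c' b \<odot>\<^bsub>P\<^esub> b) g" using c' by simp
        also have "\<dots> = (\<Oplus>\<^bsub>A\<^esub>b'\<in>?F. \<kappa> (c' b' \<odot>\<^bsub>P\<^esub> b') g)" by (rule coord_finsum) (use cl in auto)
        also have "\<dots> = (\<Oplus>\<^bsub>A\<^esub>b'\<in>?F. if b = b' then c' b' else \<zero>\<^bsub>A\<^esub>)"
        proof (rule A.finsum_cong')
          fix b' assume "b' \<in> ?F"
          then obtain h where h: "h \<in> G" "b' = e h" using FB by auto
          have "b = b' \<longleftrightarrow> g = h" using inj g h by (auto simp: inj_on_def)
          then show "\<kappa> (c' b' \<odot>\<^bsub>P\<^esub> b') g = (if b = b' then c' b' else \<zero>\<^bsub>A\<^esub>)"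
            using h c'A by (simp add: coord_smult basis_carrier coord_basis)
        qed (use c'A in auto)
        also have "\<dots> = c' b"
        proof (cases "b \<in> ?F")
          case True
          then show ?thesis using A.finsum_singleton[of b ?F c'] c' c'A by auto
        next
          case False
          then have "(\<Oplus>\<^bsub>A\<^esub>b'\<in>?F. if b = b' then c' b' else \<zero>\<^bsub>A\<^esub>) = (\<Oplus>\<^bsub>A\<^esub>b'\<in>?F. \<zero>\<^bsub>A\<^esub>)"
            by (intro A.finsum_cong') auto
          then show ?thesis using False by simp
        qed
        finally show ?thesis using ce g by simp
      next
        case False
        then show ?thesis using c' by (simp add: c_def)
      qed
    qed
    ultimately show ?thesis by (rule ex1I)
  qed
qed

end

text \<open>The coordinates are the coefficients of the unique expansion in the basis. Uniqueness
  also makes them linear: the sum of two expansions is an expansion of the sum, and similarly for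
  multiples.\<close>

lemma (in graded_algebra) graded_free_coordinates:
  assumes "graded_free A P"
  shows "\<exists>B deg \<kappa>. free_module K A P B deg (\<lambda>b. b) \<kappa>"
proof -
  obtain B where gm: "graded_module A P" and B: "B \<subseteq> (\<Union>j. homog P j)"
    and ex: "\<And>x. x \<in> carrier P \<Longrightarrow> \<exists>!c. (\<forall>b\<in>B. c b \<in> carrier A) \<and> (\<forall>b. b \<notin> B \<longrightarrow> c b = \<zero>\<^bsub>A\<^esub>) \<and>
           finite {b. c b \<noteq> \<zero>\<^bsub>A\<^esub>} \<and> x = (\<Oplus>\<^bsub>P\<^esub>b\<in>{b. c b \<noteq> \<zero>\<^bsub>A\<^esub>}. c b \<odot>\<^bsub>P\<^esub> b)"
    using assms unfolding graded_free_def by auto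
  interpret P: graded_module A P by (rule gm)
  define Q where "Q x c \<longleftrightarrow> (\<forall>b\<in>B. c b \<in> carrier A) \<and> (\<forall>b. b \<notin> B \<longrightarrow> c b = \<zero>\<^bsub>A\<^esub>) \<and>
           finite {b. c b \<noteq> \<zero>\<^bsub>A\<^esub>} \<and> x = (\<Oplus>\<^bsub>P\<^esub>b\<in>{b. c b \<noteq> \<zero>\<^bsub>A\<^esub>}. c b \<odot>\<^bsub>P\<^esub> b)" for x c
  define \<kappa> where "\<kappa> x = (THE c. Q x c)" for x
  have Q: "Q x (\<kappa> x)" if "x \<in> carrier P" for x
    unfolding \<kappa>_def using theI'[OF ex[OF that]] unfolding Q_def .
  have Q_unique: "\<kappa> x = c" if "x \<in> carrier P" "Q x c" for x c
    using ex[OF that(1)] Q[OF that(1)] that(2) unfolding Q_def by blast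
  have Bc: "b \<in> carrier P" if "b \<in> B" for b using B that P.D_carrier by blast
  have \<kappa>A: "\<kappa> x b \<in> carrier A" if "x \<in> carrier P" for x b
    using Q[OF that] unfolding Q_def by (cases "b \<in> B") auto
  have \<kappa>out: "\<kappa> x b = \<zero>\<^bsub>A\<^esub>" if "x \<in> carrier P" "b \<notin> B" for x b
    using Q[OF that(1)] that(2) unfolding Q_def by blast
  have \<kappa>fin: "finite {b. \<kappa> x b \<noteq> \<zero>\<^bsub>A\<^esub>}" if "x \<in> carrier P" for x using Q[OF that] unfolding Q_def by blast
  have \<kappa>sum: "x = (\<Oplus>\<^bsub>P\<^esub>b\<in>{b. \<kappa> x b \<noteq> \<zero>\<^bsub>A\<^esub>}. \<kappa> x b \<odot>\<^bsub>P\<^esub> b)" if "x \<in> carrier P" for x using Q[OF that] unfolding Q_def by blast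
  have mono: "(\<Oplus>\<^bsub>P\<^esub>b\<in>{b. c b \<noteq> \<zero>\<^bsub>A\<^esub>}. c b \<odot>\<^bsub>P\<^esub> b) = (\<Oplus>\<^bsub>P\<^esub>b\<in>F. c b \<odot>\<^bsub>P\<^esub> b)"
    if "finite F" "F \<subseteq> B" "{b. c b \<noteq> \<zero>\<^bsub>A\<^esub>} \<subseteq> F" "\<And>b. b \<in> F \<Longrightarrow> c b \<in> carrier A" for F c
    by (rule P.M.add.finprod_mono_neutral_cong_left)
       (use that Bc in \<open>auto simp: P.smult_l_null P.smult_closed subset_iff\<close>)
  have unique: "\<kappa> x b = (if b \<in> F then c b else \<zero>\<^bsub>A\<^esub>)"
    if F: "finite F" "F \<subseteq> B" "\<And>b. b \<in> F \<Longrightarrow> c b \<in> carrier A" and x: "x = (\<Oplus>\<^bsub>P\<^esub>b\<in>F. c b \<odot>\<^bsub>P\<^esub> b)" for x F c b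
  proof -
    let ?c = "\<lambda>b. if b \<in> F then c b else \<zero>\<^bsub>A\<^esub>"
    have cl: "c b \<odot>\<^bsub>P\<^esub> b \<in> carrier P" if "b \<in> F" for b using that F Bc P.smult_closed by blast
    have xc: "x \<in> carrier P" unfolding x using cl by (intro P.M.finsum_closed) auto
    have sub: "{b. ?c b \<noteq> \<zero>\<^bsub>A\<^esub>} \<subseteq> F" by auto
    have "(\<Oplus>\<^bsub>P\<^esub>b\<in>F. ?c b \<odot>\<^bsub>P\<^esub> b) = (\<Oplus>\<^bsub>P\<^esub>b\<in>F. c b \<odot>\<^bsub>P\<^esub> b)"
      by (rule P.M.finsum_cong') (use cl in auto)
    then have "x = (\<Oplus>\<^bsub>P\<^esub>b\<in>{b. ?c b \<noteq> \<zero>\<^bsub>A\<^esub>}. ?c b \<odot>\<^bsub>P\<^esub> b)"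
      using mono[OF F(1,2) sub] F(3) x by simp
    then have "Q x ?c" unfolding Q_def using F finite_subset[OF sub F(1)] by auto
    then show ?thesis using Q_unique[OF xc] by simp
  qed
  have fold: "x = (\<Oplus>\<^bsub>P\<^esub>b\<in>F. \<kappa> x b \<odot>\<^bsub>P\<^esub> b)" if "x \<in> carrier P" "finite F" "F \<subseteq> B" "{b. \<kappa> x b \<noteq> \<zero>\<^bsub>A\<^esub>} \<subseteq> F" for x F
    using \<kappa>sum[OF that(1)] mono[OF that(2,3,4)] \<kappa>A[OF that(1)] by simp
  have sB: "{b. \<kappa> x b \<noteq> \<zero>\<^bsub>A\<^esub>} \<subseteq> B" if "x \<in> carrier P" for x using \<kappa>out[OF that] by auto
  define deg where "deg b = (SOME j. b \<in> homog P j)" for b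
  have "free_module K A P B deg (\<lambda>b. b) \<kappa>"
  proof (intro free_module.intro free_module_axioms.intro graded_algebra_axioms gm)
    show "b \<in> homog P (deg b)" if "b \<in> B" for b
      unfolding deg_def by (rule someI_ex) (use B that in blast)
    show "\<kappa> b b' = (if b' = b then \<one>\<^bsub>A\<^esub> else \<zero>\<^bsub>A\<^esub>)" if b: "b \<in> B" for b b'
      using unique[of "{b}" "\<lambda>_. \<one>\<^bsub>A\<^esub>" b b'] b Bc[OF b] by (simp add: P.smult_one)
    fix x b assume x: "x \<in> carrier P"
    let ?Fx = "{b. \<kappa> x b \<noteq> \<zero>\<^bsub>A\<^esub>}"
    { fix y assume y: "y \<in> carrier P"
      let ?F = "?Fx \<union> {b. \<kappa> y b \<noteq> \<zero>\<^bsub>A\<^esub>}"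
      have F: "finite ?F" "?F \<subseteq> B" using \<kappa>fin sB x y by auto
      have cl: "z \<in> carrier P \<Longrightarrow> b \<in> ?F \<Longrightarrow> \<kappa> z b \<odot>\<^bsub>P\<^esub> b \<in> carrier P" for z b
        using F(2) \<kappa>A Bc P.smult_closed by blast
      have "x \<oplus>\<^bsub>P\<^esub> y = (\<Oplus>\<^bsub>P\<^esub>b\<in>?F. \<kappa> x b \<odot>\<^bsub>P\<^esub> b) \<oplus>\<^bsub>P\<^esub> (\<Oplus>\<^bsub>P\<^esub>b\<in>?F. \<kappa> y b \<odot>\<^bsub>P\<^esub> b)"
        using fold[OF x F] fold[OF y F] by auto
      also have "\<dots> = (\<Oplus>\<^bsub>P\<^esub>b\<in>?F. \<kappa> x b \<odot>\<^bsub>P\<^esub> b \<oplus>\<^bsub>P\<^esub> \<kappa> y b \<odot>\<^bsub>P\<^esub> b)"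
        by (rule P.M.finsum_addf[symmetric]) (use cl x y in auto)
      also have "\<dots> = (\<Oplus>\<^bsub>P\<^esub>b\<in>?F. (\<kappa> x b \<oplus>\<^bsub>A\<^esub> \<kappa> y b) \<odot>\<^bsub>P\<^esub> b)"
        by (rule P.M.finsum_cong') (use \<kappa>A[OF x] \<kappa>A[OF y] F(2) Bc in \<open>auto simp: P.smult_l_distr P.smult_closed subset_iff\<close>)
      finally have "\<kappa> (x \<oplus>\<^bsub>P\<^esub> y) b = (if b \<in> ?F then \<kappa> x b \<oplus>\<^bsub>A\<^esub> \<kappa> y b else \<zero>\<^bsub>A\<^esub>)"
        by (intro unique[OF F]) (use \<kappa>A x y in auto)
      then show "\<kappa> (x \<oplus>\<^bsub>P\<^esub> y) b = \<kappa> x b \<oplus>\<^bsub>A\<^esub> \<kappa> y b" by auto }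
    fix a assume a: "a \<in> carrier A"
    have F: "finite ?Fx" "?Fx \<subseteq> B" using \<kappa>fin sB x by auto
    have "a \<odot>\<^bsub>P\<^esub> x = a \<odot>\<^bsub>P\<^esub> (\<Oplus>\<^bsub>P\<^esub>b\<in>?Fx. \<kappa> x b \<odot>\<^bsub>P\<^esub> b)" using \<kappa>sum[OF x] by simp
    also have "\<dots> = (\<Oplus>\<^bsub>P\<^esub>b\<in>?Fx. a \<odot>\<^bsub>P\<^esub> (\<kappa> x b \<odot>\<^bsub>P\<^esub> b))"
      by (rule P.smult_finsum[OF a]) (use \<kappa>A[OF x] F(2) Bc P.smult_closed in blast)
    also have "\<dots> = (\<Oplus>\<^bsub>P\<^esub>b\<in>?Fx. (a \<otimes>\<^bsub>A\<^esub> \<kappa> x b) \<odot>\<^bsub>P\<^esub> b)"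
      by (rule P.M.finsum_cong') (use a \<kappa>A[OF x] F(2) Bc in \<open>auto simp: P.smult_assoc P.smult_closed subset_iff\<close>)
    finally have "\<kappa> (a \<odot>\<^bsub>P\<^esub> x) b = (if b \<in> ?Fx then a \<otimes>\<^bsub>A\<^esub> \<kappa> x b else \<zero>\<^bsub>A\<^esub>)"
      by (intro unique[OF F]) (use \<kappa>A x a in auto)
    then show "\<kappa> (a \<odot>\<^bsub>P\<^esub> x) b = a \<otimes>\<^bsub>A\<^esub> \<kappa> x b" using a by auto
  qed (use \<kappa>A \<kappa>out \<kappa>fin \<kappa>sum in auto)
  then show ?thesis by blast
qed

lemma (in free_module) gr_hom_eqI:
  assumes N: "graded_module A N" and f: "f \<in> gr_hom A P N" "f' \<in> gr_hom A P N"
    and eq: "\<And>g. g \<in> G \<Longrightarrow> f (e g) = f' (e g)" and x: "x \<in> carrier P"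
  shows "f x = f' x"
proof -
  interpret F: graded_map A P N f by (rule graded_mapI[OF P.graded_module_axioms N f(1)])
  interpret F': graded_map A P N f' by (rule graded_mapI[OF P.graded_module_axioms N f(2)])
  have "x \<in> {x \<in> carrier P. f x = f' x}"
  proof (rule submodule_gen[OF x])
    show "submodule {x \<in> carrier P. f x = f' x} A P"
      unfolding P.submodule_iff
      by (auto simp: F.add F'.add F.smult F'.smult F.zero F'.zero P.smult_closed)
    fix g assume "g \<in> G"
    then show "e g \<in> {x \<in> carrier P. f x = f' x} \<or> \<kappa> x g \<odot>\<^bsub>P\<^esub> e g \<in> {x \<in> carrier P. f x = f' x}"
      using eq basis_carrier by simp
  qed
  then show ?thesis by simp
qed

text \<open>Surjectivity is required on cocycles themselves and not only up to coboundaries, which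
  is the form in which the construction of the resolution provides it.\<close>

lemma (in gr_complex_map) quasi_isoI:
  assumes onto: "\<And>i x. x \<in> X.Z i \<Longrightarrow> \<exists>p\<in>P.Z i. q i p = x"
    and exact: "\<And>i p. p \<in> P.Z i \<Longrightarrow> q i p \<in> X.B i \<Longrightarrow> p \<in> P.B i"
  shows "quasi_iso A P X q"
  unfolding quasi_iso_def
proof (intro conjI allI cochain_map)
  fix i
  show "bij_betw (cohomology_map P X q i) (carrier (P.Hq i)) (carrier (X.Hq i))"
  proof (rule bij_betw_imageI)
    show "inj_on (cohomology_map P X q i) (carrier (P.Hq i))"
    proof
      fix c c' assume cc: "c \<in> carrier (P.Hq i)" "c' \<in> carrier (P.Hq i)"
        and eq: "cohomology_map P X q i c = cohomology_map P X q i c'"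
      obtain p where p: "p \<in> P.Z i" "c = P.B i +>\<^bsub>obj P i\<^esub> p" using cc(1) P.Hq_carrier by blast
      obtain p' where p': "p' \<in> P.Z i" "c' = P.B i +>\<^bsub>obj P i\<^esub> p'" using cc(2) P.Hq_carrier by blast
      note pc = P.Z_carrier[OF p(1)] P.Z_carrier[OF p'(1)]
      have "X.B i +>\<^bsub>obj X i\<^esub> q i p = X.B i +>\<^bsub>obj X i\<^esub> q i p'"
        using eq unfolding p(2) p'(2) cohomology_map_coset[OF p(1)] cohomology_map_coset[OF p'(1)] .
      then have "q i p \<ominus>\<^bsub>obj X i\<^esub> q i p' \<in> X.B i" unfolding X.rcos_eq[OF q.closed[OF pc(1)] q.closed[OF pc(2)]] .
      then have "q i (p \<ominus>\<^bsub>obj P i\<^esub> p') \<in> X.B i" unfolding q.minus[OF pc] .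
      then have "p \<ominus>\<^bsub>obj P i\<^esub> p' \<in> P.B i"
        by (rule exact[OF P.O.submodule_minus[OF P.Z_submodule p(1) p'(1)]])
      then show "c = c'" unfolding p(2) p'(2) P.rcos_eq[OF pc] .
    qed
    show "cohomology_map P X q i ` carrier (P.Hq i) = carrier (X.Hq i)"
    proof (intro subset_antisym subsetI)
      fix c assume "c \<in> cohomology_map P X q i ` carrier (P.Hq i)"
      then obtain c' where c': "c' \<in> carrier (P.Hq i)" "c = cohomology_map P X q i c'" by (elim imageE)
      then obtain p where p: "p \<in> P.Z i" "c' = P.B i +>\<^bsub>obj P i\<^esub> p" unfolding P.Hq_carrier by blast
      show "c \<in> carrier (X.Hq i)"
        unfolding X.Hq_carrier c'(2) p(2) cohomology_map_coset[OF p(1)] using q_Z[OF p(1)] by blast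
    next
      fix c assume "c \<in> carrier (X.Hq i)"
      then obtain x where x: "x \<in> X.Z i" "c = X.B i +>\<^bsub>obj X i\<^esub> x" unfolding X.Hq_carrier by blast
      obtain p where p: "p \<in> P.Z i" "q i p = x" using onto[OF x(1)] by blast
      show "c \<in> cohomology_map P X q i ` carrier (P.Hq i)"
      proof (rule image_eqI)
        show "c = cohomology_map P X q i (P.B i +>\<^bsub>obj P i\<^esub> p)"
          unfolding cohomology_map_coset[OF p(1)] p(2) x(2) ..
        show "P.B i +>\<^bsub>obj P i\<^esub> p \<in> carrier (P.Hq i)" unfolding P.Hq_carrier using p(1) by blast
      qed
    qed
  qed
qed

subsection \<open>Existence of free resolutions\<close>

locale resolution_construction = gr_complex K A X + free_construction K A \<iota> fst
  for K :: "('k, 'x) ring_scheme" and A :: "('k, 'a, nat) graded" and X :: "('a, 'm) cochain"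
    and \<iota> :: "(int \<times> 'm \<times> 'p \<Rightarrow> 'a) \<Rightarrow> 'p" +
  fixes n0 :: int
  assumes bounded: "i > n0 \<Longrightarrow> carrier (obj X i) = {\<zero>\<^bsub>obj X i\<^esub>}"
begin

text \<open>A generator carries its images as entries of the triple, so the maps require no
  knowledge of the source; the argument \<open>G\<close> generates the target.\<close>

definition dmap :: "(int \<times> 'm \<times> 'p) set \<Rightarrow> 'p \<Rightarrow> 'p" where
  "dmap G = free_module.lin_ext A \<delta> (free_graded G) (\<lambda>g. snd (snd g))"

definition fmap :: "int \<Rightarrow> 'p \<Rightarrow> 'm" where
  "fmap i = free_module.lin_ext A \<delta> (obj X i) (\<lambda>g. fst (snd g))"

text \<open>A generator \<open>(j, x, z)\<close> of degree \<open>j\<close> maps to \<open>x\<close> in \<open>X\<close> and has differential \<open>z\<close>.  The generators with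
  \<open>z = 0\<close> hit every cocycle of \<open>X\<close>, and the others kill every cocycle that becomes a coboundary in \<open>X\<close>.\<close>

definition gens :: "int \<Rightarrow> (int \<times> 'm \<times> 'p) set \<Rightarrow> (int \<times> 'm \<times> 'p) set \<Rightarrow> (int \<times> 'm \<times> 'p) set" where
  "gens i G' G'' = {(j, x, z) | j x z. x \<in> homog (obj X i) j \<and> z \<in> homog (free_graded G') j \<and>
     dmap G'' z = \<zero>\<^bsub>free_graded G''\<^esub> \<and> fmap (i + 1) z = diff X i x}"

text \<open>Descending recursion on \<open>i\<close>: the components of \<open>gens_pair k\<close> generate the terms in degrees \<open>n0 + 1 - k\<close>
  and \<open>n0 + 2 - k\<close>.\<close>

primrec gens_pair :: "nat \<Rightarrow> (int \<times> 'm \<times> 'p) set \<times> (int \<times> 'm \<times> 'p) set" where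
  "gens_pair 0 = ({}, {})" |
  "gens_pair (Suc k) = (gens (n0 - int k) (fst (gens_pair k)) (snd (gens_pair k)), fst (gens_pair k))"

text \<open>For i above \<open>n0\<close> the truncation by \<open>nat\<close> selects the start of
  the recursion, the empty set of generators.\<close>

definition Gset :: "int \<Rightarrow> (int \<times> 'm \<times> 'p) set" where
  "Gset i = fst (gens_pair (nat (n0 + 1 - i)))"

definition res :: "('a, 'p) cochain" where
  "res = \<lparr>obj = (\<lambda>i. free_graded (Gset i)), diff = (\<lambda>i. dmap (Gset (i + 1)))\<rparr>"

lemma Gset_above: "i > n0 \<Longrightarrow> Gset i = {}" by (simp add: Gset_def)

lemma Gset_rec: "i \<le> n0 \<Longrightarrow> Gset i = gens i (Gset (i + 1)) (Gset (i + 2))"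
proof -
  assume i: "i \<le> n0"
  define k where "k = nat (n0 - i)"
  have k: "nat (n0 + 1 - i) = Suc k" "nat (n0 + 1 - (i + 1)) = k" "n0 - int k = i" using i by (auto simp: k_def)
  have "snd (gens_pair k) = Gset (i + 2)"
  proof (cases k)
    case 0
    then have "nat (n0 + 1 - (i + 2)) = 0" using k(3) by simp
    then show ?thesis by (simp only: Gset_def 0 gens_pair.simps fst_conv snd_conv)
  next
    case (Suc k')
    then have "nat (n0 + 1 - (i + 2)) = k'" using k(3) by simp
    then show ?thesis by (simp only: Gset_def Suc gens_pair.simps fst_conv snd_conv)
  qed
  then show ?thesis by (simp only: Gset_def k gens_pair.simps fst_conv snd_conv)
qed

lemma Gset_iff: "(j, x, z) \<in> Gset i \<longleftrightarrow> i \<le> n0 \<and> x \<in> homog (obj X i) j \<and> z \<in> homog (obj res (i + 1)) j \<and>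
    diff res (i + 1) z = \<zero>\<^bsub>obj res (i + 2)\<^esub> \<and> fmap (i + 1) z = diff X i x"
proof (cases "i \<le> n0")
  case True
  then show ?thesis unfolding Gset_rec[OF True] by (simp add: gens_def res_def add.commute[of 2 i])
qed (simp add: Gset_above)

lemma res_free: "free_module K A (obj res i) (Gset i) fst gen \<delta>"
  unfolding res_def by (simp add: free_module_free_graded)

lemma res_graded: "graded_module A (obj res i)"
  unfolding res_def by (simp add: free_graded_module)

lemma GsetD: "g \<in> Gset i \<Longrightarrow> fst (snd g) \<in> homog (obj X i) (fst g)" "g \<in> Gset i \<Longrightarrow> snd (snd g) \<in> homog (obj res (i + 1)) (fst g)"
  "g \<in> Gset i \<Longrightarrow> diff res (i + 1) (snd (snd g)) = \<zero>\<^bsub>obj res (i + 2)\<^esub>" "g \<in> Gset i \<Longrightarrow> fmap (i + 1) (snd (snd g)) = diff X i (fst (snd g))"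
  using Gset_iff[of "fst g" "fst (snd g)" "snd (snd g)" i] by auto

lemma diff_res: "diff res i = free_module.lin_ext A \<delta> (obj res (i + 1)) (\<lambda>g. snd (snd g))"
  by (simp add: res_def dmap_def)

lemma diff_res_hom: "diff res i \<in> gr_hom A (obj res i) (obj res (i + 1))"
  unfolding diff_res by (rule free_module.lin_ext_gr_hom[OF res_free res_graded GsetD(2)])

lemma fmap_hom: "fmap i \<in> gr_hom A (obj res i) (obj X i)"
  unfolding fmap_def by (rule free_module.lin_ext_gr_hom[OF res_free obj_graded GsetD(1)])

lemma diff_res_gen: "g \<in> Gset i \<Longrightarrow> diff res i (gen g) = snd (snd g)"
proof -
  assume g: "g \<in> Gset i"
  interpret R: graded_module A "obj res (i + 1)" by (rule res_graded)
  show ?thesis unfolding diff_res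
    by (rule free_module.lin_ext(2)[OF res_free R.left_module_axioms R.D_carrier[OF GsetD(2)] g])
qed

lemma fmap_gen: "g \<in> Gset i \<Longrightarrow> fmap i (gen g) = fst (snd g)"
  unfolding fmap_def
  by (rule free_module.lin_ext(2)[OF res_free graded_module.axioms(1)[OF obj_graded] O.D_carrier[OF GsetD(1)]])

lemma gr_hom_zero: "graded_module A M \<Longrightarrow> graded_module A N \<Longrightarrow> (\<lambda>_. \<zero>\<^bsub>N\<^esub>) \<in> gr_hom A M N"
proof -
  assume "graded_module A N"
  then interpret N: graded_module A N .
  show ?thesis by (auto simp: gr_hom_def N.smult_r_null N.D_zero)
qed

text \<open>Both d d and zero are morphisms, so they need only be compared on generators, where the
  third entry of the triple is a cocycle by the choice of \<open>gens\<close>.\<close>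

lemma res_complex: "cochain_complex A res"
  unfolding cochain_complex_def
proof (intro conjI allI ballI)
  fix i x assume x: "x \<in> carrier (obj res i)"
  have i2: "i + 1 + 1 = i + (2::int)" by simp
  show "diff res (i + 1) (diff res i x) = \<zero>\<^bsub>obj res (i + 2)\<^esub>"
  proof (rule free_module.gr_hom_eqI[OF res_free res_graded _ _ _ x])
    show "(\<lambda>x. diff res (i + 1) (diff res i x)) \<in> gr_hom A (obj res i) (obj res (i + 2))"
      using gr_hom_comp[OF diff_res_hom[of i] diff_res_hom[of "i + 1"]] unfolding i2 .
    show "(\<lambda>_. \<zero>\<^bsub>obj res (i + 2)\<^esub>) \<in> gr_hom A (obj res i) (obj res (i + 2))"
      by (rule gr_hom_zero[OF res_graded res_graded])
  qed (simp add: diff_res_gen GsetD(3))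
qed (rule res_graded diff_res_hom)+

lemma fmap_map: "cochain_map A res X fmap"
  unfolding cochain_map_def
proof (intro conjI allI ballI)
  fix i x assume x: "x \<in> carrier (obj res i)"
  show "fmap (i + 1) (diff res i x) = diff X i (fmap i x)"
    by (rule free_module.gr_hom_eqI[OF res_free obj_graded
          gr_hom_comp[OF diff_res_hom fmap_hom] gr_hom_comp[OF fmap_hom diff_hom] _ x])
       (simp add: diff_res_gen fmap_gen GsetD(4))
qed (rule fmap_hom)

lemma res_bounded: "i > n0 \<Longrightarrow> carrier (obj res i) = {\<zero>\<^bsub>obj res i\<^esub>}"
proof -
  assume "i > n0"
  moreover have "coeffs {} = {\<lambda>_. \<zero>\<^bsub>A\<^esub>}" by (auto simp: coeffs_def)
  ultimately show ?thesis by (simp add: res_def free_simps Gset_above)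
qed

sublocale f: gr_complex_map K A res X fmap
  by (intro gr_complex_map.intro gr_complex_map_axioms.intro gr_complex.intro gr_complex_axioms.intro
      graded_algebra_axioms res_complex complex fmap_map)

lemma fmap_onto:
  assumes x: "x \<in> Z i"
  shows "\<exists>p\<in>f.P.Z i. fmap i p = x"
proof -
  have hom: "\<exists>p\<in>f.P.Z i. fmap i p = y" if y: "y \<in> homog (obj X i) j" "y \<in> Z i" for j y
  proof (cases "i \<le> n0")
    case True
    let ?g = "(j, y, \<zero>\<^bsub>obj res (i + 1)\<^esub>)"
    have "diff res (i + 1) \<zero>\<^bsub>obj res (i + 1)\<^esub> = \<zero>\<^bsub>obj res (i + 2)\<^esub>"
      using linear_map.zero[OF f.P.diff_linear[of "i + 1"]] by (simp add: add.assoc)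
    then have g: "?g \<in> Gset i"
      unfolding Gset_iff using True y f.P.O.D_zero f.q.zero by (simp add: cocycles_def)
    have "gen ?g \<in> carrier (obj res i)" using gen_closed[OF g] by (simp add: res_def)
    then have "gen ?g \<in> f.P.Z i" using diff_res_gen[OF g] by (simp add: cocycles_def)
    then show ?thesis using fmap_gen[OF g] by (intro bexI) simp_all
  next
    case False
    then have "y = \<zero>\<^bsub>obj X i\<^esub>" using bounded Z_carrier[OF y(2)] by auto
    then show ?thesis using f.P.Z_submodule[of i] f.q.zero f.P.O.submodule_iff by blast
  qed
  have xc: "x \<in> carrier (obj X i)" using Z_carrier[OF x] .
  have Zs: "\<zero>\<^bsub>obj res i\<^esub> \<in> f.P.Z i" "\<And>p p'. p \<in> f.P.Z i \<Longrightarrow> p' \<in> f.P.Z i \<Longrightarrow> p \<oplus>\<^bsub>obj res i\<^esub> p' \<in> f.P.Z i"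
    using f.P.Z_submodule[of i] unfolding f.P.O.submodule_iff by blast+
  define U where "U = fmap i ` f.P.Z i"
  have "(\<Oplus>\<^bsub>obj X i\<^esub>j\<in>{j. component (obj X i) j x \<noteq> \<zero>\<^bsub>obj X i\<^esub>}. component (obj X i) j x) \<in> U"
  proof (rule O.M.finsum_in_subset)
    show "U \<subseteq> carrier (obj X i)" unfolding U_def using f.P.Z_carrier f.q.closed by blast
    show "\<zero>\<^bsub>obj X i\<^esub> \<in> U" unfolding U_def using Zs(1) f.q.zero[of i, symmetric] by (rule image_eqI[rotated])
    fix u v assume "u \<in> U" "v \<in> U"
    then obtain p p' where p: "p \<in> f.P.Z i" "p' \<in> f.P.Z i" "u = fmap i p" "v = fmap i p'" unfolding U_def by blast
    have "u \<oplus>\<^bsub>obj X i\<^esub> v = fmap i (p \<oplus>\<^bsub>obj res i\<^esub> p')"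
      unfolding p(3,4) by (rule f.q.add[OF f.P.Z_carrier[OF p(1)] f.P.Z_carrier[OF p(2)], symmetric])
    then show "u \<oplus>\<^bsub>obj X i\<^esub> v \<in> U" unfolding U_def using Zs(2)[OF p(1,2)] by (rule image_eqI)
  next
    fix j
    show "component (obj X i) j x \<in> U"
    proof -
      obtain p where "p \<in> f.P.Z i" "fmap i p = component (obj X i) j x"
        using hom[OF O.components_spec(1)[OF xc] Z_component[OF x, of j]] by (elim bexE)
      then show ?thesis unfolding U_def by (metis imageI)
    qed
  qed
  then have "x \<in> U" unfolding O.components_spec(3)[OF xc, symmetric] .
  then show ?thesis unfolding U_def by blast
qed

text \<open>Generators carry homogeneous data, so each component of p is treated separately and the
  results are summed.\<close>

lemma fmap_exact:
  assumes p: "p \<in> f.P.Z i" and B: "fmap i p \<in> B i"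
  shows "p \<in> f.P.B i"
proof (cases "i - 1 \<le> n0")
  case True
  have pc: "p \<in> carrier (obj res i)" using f.P.Z_carrier[OF p] .
  have "component (obj res i) j p \<in> f.P.B i" for j
  proof -
    let ?p = "component (obj res i) j p"
    obtain w where w: "w \<in> homog (obj X (i - 1)) j" "diff X (i - 1) w = fmap i ?p"
      using B_homog[OF B f.q.component[OF pc]] by blast
    have pZ: "diff res i ?p = \<zero>\<^bsub>obj res (i + 1)\<^esub>" using f.P.Z_component[OF p] by (simp add: cocycles_def)
    have g: "(j, w, ?p) \<in> Gset (i - 1)"
      unfolding Gset_iff using True w pZ f.P.O.components_spec(1)[OF pc] by (simp add: add.commute[of 1 i])
    have "diff res (i - 1) (gen (j, w, ?p)) = ?p" using diff_res_gen[OF g] by simp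
    moreover have "gen (j, w, ?p) \<in> carrier (obj res (i - 1))" using gen_closed[OF g] by (simp add: res_def)
    ultimately show ?thesis unfolding f.P.B_iff by (intro bexI) simp_all
  qed
  then have "(\<Oplus>\<^bsub>obj res i\<^esub>j\<in>{j. component (obj res i) j p \<noteq> \<zero>\<^bsub>obj res i\<^esub>}. component (obj res i) j p) \<in> f.P.B i"
    by (intro f.P.O.submodule_finsum[OF f.P.B_submodule])
  then show ?thesis unfolding f.P.O.components_spec(3)[OF pc, symmetric] .
next
  case False
  then have "p = \<zero>\<^bsub>obj res i\<^esub>" using res_bounded[of i] f.P.Z_carrier[OF p] by auto
  then show ?thesis using f.P.B_submodule[of i] f.P.O.submodule_iff by blast
qed

lemma res_resolution: "free_resolution A X res"
  unfolding free_resolution_def Dminus_Gr_def right_bounded_def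
  using res_complex res_bounded free_module.graded_free[OF res_free] f.quasi_isoI[OF fmap_onto fmap_exact] by blast

end

text \<open>The choice ranges over complexes whose terms live in lists over pairs. So the existence
  of a resolution is needed in exactly this type, which the injection of
  \<open>coding_exists\<close> makes possible.\<close>

lemma (in graded_algebra) chosen_resolution:
  fixes X :: "('a, 'm) cochain"
  assumes "X \<in> Dminus_Gr A"
  shows "free_resolution A X (chosen_resolution A X)"
proof -
  obtain n0 where n0: "\<And>i. i > n0 \<Longrightarrow> carrier (obj X i) = {\<zero>\<^bsub>obj X i\<^esub>}"
    using assms by (auto simp: Dminus_Gr_def right_bounded_def)
  obtain \<iota> :: "(int \<times> 'm \<times> ('a \<times> 'm) list \<Rightarrow> 'a) \<Rightarrow> ('a \<times> 'm) list"
    where \<iota>: "inj_on \<iota> {c. finite {g. c g \<noteq> \<zero>\<^bsub>A\<^esub>}}" using coding_exists[of "\<zero>\<^bsub>A\<^esub>"] by (elim exE)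
  interpret resolution_construction K A X \<iota> n0
    by (intro resolution_construction.intro gr_complex.intro gr_complex_axioms.intro free_construction.intro
        free_construction_axioms.intro resolution_construction_axioms.intro graded_algebra_axioms \<iota>)
       (use assms n0 in \<open>auto simp: Dminus_Gr_def\<close>)
  show ?thesis unfolding chosen_resolution_def by (rule someI[of "free_resolution A X", OF res_resolution])
qed

subsection \<open>Regularity and degrees of the cohomology\<close>

text \<open>V and W stand for nonvanishing of the cohomology of X and of Ext, the latter in opposite
  bidegrees. The order argument is carried out in the extended reals, so empty and unbounded index
  sets require no case distinction.\<close>

lemma uminus_Inf_le_Sup:
  fixes V W :: "int \<Rightarrow> int \<Rightarrow> bool"
  assumes "\<And>i j. V i j \<Longrightarrow> \<exists>i' j'. W i' j' \<and> i' + j' \<le> i + j"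
  shows "- Inf {ereal (of_int (i + j)) | i j. V i j} \<le> Sup {ereal (of_int (n + k)) | n k. W (- n) (- k)}"
    (is "- ?I \<le> ?S")
proof -
  have "- ?S \<le> ?I"
  proof (rule Inf_greatest)
    fix x assume "x \<in> {ereal (of_int (i + j)) | i j. V i j}"
    then obtain i j where x: "x = ereal (of_int (i + j))" "V i j" by blast
    obtain i' j' where w: "W i' j'" "i' + j' \<le> i + j" using assms[OF x(2)] by blast
    have "ereal (of_int (- i' + - j')) \<le> ?S"
      by (intro Sup_upper CollectI exI conjI) (rule refl, use w(1) in simp)
    then have "- ?S \<le> - ereal (of_int (- i' + - j'))" by (simp only: ereal_minus_le_minus)
    also have "\<dots> \<le> x" using w(2) x(1) by simp
    finally show "- ?S \<le> x" .
  qed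
  then show ?thesis by (simp only: ereal_uminus_le_reorder)
qed

lemma Sup_le_uminus_Inf:
  fixes V W :: "int \<Rightarrow> int \<Rightarrow> bool"
  assumes "\<And>i j. W i j \<Longrightarrow> \<exists>i' j'. V i' j' \<and> i' + j' \<le> i + j"
  shows "Sup {ereal (of_int (n + k)) | n k. W (- n) (- k)} \<le> - Inf {ereal (of_int (i + j)) | i j. V i j}"
    (is "?S \<le> - ?I")
proof (rule Sup_least)
  fix x assume "x \<in> {ereal (of_int (n + k)) | n k. W (- n) (- k)}"
  then obtain n k where x: "x = ereal (of_int (n + k))" "W (- n) (- k)" by blast
  obtain i j where v: "V i j" "i + j \<le> - n + - k" using assms[OF x(2)] by blast
  have "?I \<le> ereal (of_int (i + j))" by (rule Inf_lower) (use v(1) in blast)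
  also have "\<dots> \<le> ereal (of_int (- n + - k))" using v(2) by simp
  also have "\<dots> = - x" by (simp add: x(1))
  finally have "- (- x) \<le> - ?I" by (simp only: ereal_minus_le_minus)
  then show "x \<le> - ?I" by simp
qed

context graded_algebra
begin

lemma resolution_homology_vanishes:
  assumes X: "X \<in> Dminus_Gr A" and P: "free_resolution A X P"
  shows "homology_vanishes P i j \<longleftrightarrow> homology_vanishes X i j"
proof -
  obtain q where q: "quasi_iso A P X q" using P by (auto simp: free_resolution_def)
  interpret gr_complex_map K A P X q
    by (intro gr_complex_map.intro gr_complex.intro gr_complex_axioms.intro gr_complex_map_axioms.intro graded_algebra_axioms)
       (use X P q in \<open>auto simp: Dminus_Gr_def free_resolution_def quasi_iso_def\<close>)
  show ?thesis by (rule quasi_iso_homology_vanishes[OF q])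
qed

lemma resolution_free_complex:
  assumes J0: "deg0_radical K A J0" and P: "free_resolution A X P"
  shows "\<exists>G deg \<kappa> n0. free_complex K A J0 P G deg (\<lambda>_ b. b) \<kappa> n0"
proof -
  have "\<forall>i. \<exists>B deg \<kappa>. free_module K A (obj P i) B deg (\<lambda>b. b) \<kappa>"
    using P unfolding free_resolution_def by (intro allI graded_free_coordinates) blast
  then obtain G deg \<kappa> where "\<And>i. free_module K A (obj P i) (G i) (deg i) (\<lambda>b. b) (\<kappa> i)" by metis
  moreover obtain n0 where "\<And>i. i > n0 \<Longrightarrow> carrier (obj P i) = {\<zero>\<^bsub>obj P i\<^esub>}"
    using P by (auto simp: free_resolution_def Dminus_Gr_def right_bounded_def)
  ultimately have "free_complex K A J0 P G deg (\<lambda>_ b. b) \<kappa> n0"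
    using P J0 by (auto simp: free_complex_def free_complex_axioms_def free_resolution_def Dminus_Gr_def)
  then show ?thesis by blast
qed

lemma Dminus_gr_bounded_below:
  assumes "X \<in> Dminus_gr A"
  shows "\<exists>l0. \<forall>l<l0. homology_vanishes X i l"
proof -
  interpret gr_complex K A X
    by (intro gr_complex.intro gr_complex_axioms.intro graded_algebra_axioms)
       (use assms in \<open>simp add: Dminus_gr_def Dminus_Gr_def\<close>)
  show ?thesis using assms by (intro fg_bounded) (simp add: Dminus_gr_def)
qed

lemma homology_vanishes_of_ext_vanishes:
  assumes X: "X \<in> Dminus_gr A" and P: "free_resolution A X P"
    and ext: "\<And>i j. i + j < D \<Longrightarrow> ext_vanishes P i j" and ij: "i + j < D"
  shows "homology_vanishes X i j"
proof -
  have X': "X \<in> Dminus_Gr A" using X by (simp add: Dminus_gr_def)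
  note iff = resolution_homology_vanishes[OF X' P]
  obtain G deg \<kappa> n0 where "free_complex K A rad0 P G deg (\<lambda>_ b. b) \<kappa> n0"
    using resolution_free_complex[OF rad0_radical P] by blast
  then interpret free_complex K A rad0 P G deg "\<lambda>_ b. b" \<kappa> n0 .
  have "homology_vanishes P i j"
    by (rule acyclic_of_top_acyclic[OF _ top_acyclic_of_ext_vanishes[OF refl ext] ij])
       (use Dminus_gr_bounded_below[OF X] iff in auto)
  then show ?thesis using iff by simp
qed

text \<open>The homotopies are taken with \<open>J0\<close> zero, while the target of the maps is
  A/J. The two are compatible because zero is contained in \<open>rad0\<close>, so maps to S still
  kill the smaller submodule \<open>N\<close>.\<close>

lemma ext_vanishes_of_homology_vanishes:
  assumes ss: "semisimple_ring (degree_zero_part A)" and X: "X \<in> Dminus_gr A" and P: "free_resolution A X P"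
    and van: "\<And>i j. i + j < D \<Longrightarrow> homology_vanishes X i j" and ij: "i + j < D"
  shows "ext_vanishes P i j"
proof -
  have X': "X \<in> Dminus_Gr A" using X by (simp add: Dminus_gr_def)
  note iff = resolution_homology_vanishes[OF X' P]
  obtain G deg \<kappa> n0 where "free_complex K A {\<zero>\<^bsub>A\<^esub>} P G deg (\<lambda>_ b. b) \<kappa> n0"
    using resolution_free_complex[OF semisimple_radical[OF ss] P] by blast
  then interpret free_complex K A "{\<zero>\<^bsub>A\<^esub>}" P G deg "\<lambda>_ b. b" \<kappa> n0 .
  have "top_acyclic i j"
    by (rule top_acyclic_of_acyclic[OF refl _ _ ij]) (use Dminus_gr_bounded_below[OF X] van iff in auto)
  moreover have "{\<zero>\<^bsub>A\<^esub>} \<subseteq> rad0" using rad0_ideal by (simp add: deg0_ideal_iff)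
  ultimately show ?thesis by (intro ext_vanishes_of_top_acyclic)
qed

lemma inf_deg_eq:
  assumes "cochain_complex A X"
  shows "inf_deg X = Inf {ereal (of_int (i + j)) | i j. \<not> homology_vanishes X i j}"
proof -
  interpret gr_complex K A X by (intro gr_complex.intro gr_complex_axioms.intro graded_algebra_axioms assms)
  show ?thesis unfolding inf_deg_def homology_vanishes_iff ..
qed

lemma extreg_eq:
  assumes "cochain_complex A (chosen_resolution A X)"
  shows "extreg A X = Sup {ereal (of_int (n + k)) | n k. \<not> ext_vanishes (chosen_resolution A X) (- n) (- k)}"
  unfolding extreg_def sup_deg_def RHom_def Hom_cohomology_zero_iff[OF assms] ..

lemma inf_deg_le_extreg:
  assumes X: "X \<in> Dminus_gr A"
  shows "- inf_deg X \<le> extreg A X"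
proof -
  let ?P = "chosen_resolution A X"
  have P: "free_resolution A X ?P" using X by (intro chosen_resolution) (simp add: Dminus_gr_def)
  have c: "cochain_complex A X" "cochain_complex A ?P"
    using X P by (auto simp: Dminus_gr_def Dminus_Gr_def free_resolution_def)
  show ?thesis unfolding inf_deg_eq[OF c(1)] extreg_eq[OF c(2)]
  proof (rule uminus_Inf_le_Sup)
    fix i j assume "\<not> homology_vanishes X i j"
    \<comment> \<open>With D = i + j + 1 the contrapositive yields a nonvanishing Ext in total
      degree at most i + j.\<close>
    then show "\<exists>i' j'. \<not> ext_vanishes ?P i' j' \<and> i' + j' \<le> i + j"
      using homology_vanishes_of_ext_vanishes[OF X P, of "i + j + 1" i j] by force
  qed
qed

lemma extreg_le_inf_deg:
  assumes ss: "semisimple_ring (degree_zero_part A)" and X: "X \<in> Dminus_gr A"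
  shows "extreg A X \<le> - inf_deg X"
proof -
  let ?P = "chosen_resolution A X"
  have P: "free_resolution A X ?P" using X by (intro chosen_resolution) (simp add: Dminus_gr_def)
  have c: "cochain_complex A X" "cochain_complex A ?P"
    using X P by (auto simp: Dminus_gr_def Dminus_Gr_def free_resolution_def)
  show ?thesis unfolding inf_deg_eq[OF c(1)] extreg_eq[OF c(2)]
  proof (rule Sup_le_uminus_Inf)
    fix i j assume "\<not> ext_vanishes ?P i j"
    then show "\<exists>i' j'. \<not> homology_vanishes X i' j' \<and> i' + j' \<le> i + j"
      using ext_vanishes_of_homology_vanishes[OF ss X P, of "i + j + 1" i j] by force
  qed
qed

end

theorem theorem1p2:
  fixes K :: "('k, 'x) ring_scheme" and A :: "('k, 'a, nat) graded"
  assumes "noetherian_graded_algebra K A"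
  shows "(\<forall>X :: ('a, 'm) cochain. X \<in> Dminus_gr A \<and> \<not> D_iso A X zero_complex \<longrightarrow>
            - inf_deg X \<le> extreg A X) \<and>
         (semisimple_ring (degree_zero_part A) \<longrightarrow>
            (\<forall>X :: ('a, 'm) cochain. X \<in> Dminus_gr A \<and> \<not> D_iso A X zero_complex \<longrightarrow>
               - inf_deg X = extreg A X))"
proof -
  interpret graded_algebra K A using assms by (simp add: noetherian_graded_algebra_def)
  show ?thesis using inf_deg_le_extreg extreg_le_inf_deg by (blast intro: order_antisym)
qed

end
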